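(* Let $1<p\le 5$ and let $\phi$ be the (global) solution of the defocusing semilinear wave equation $-\partial_t^2\phi+\Delta\phi=|\phi|^{p-1}\phi$ on $\mathbb{R}^{1+2}$ with initial data $\phi(0,x)=\phi_0(x)$, $\partial_t\phi(0,x)=\phi_1(x)$ satisfying $\mathcal{E}_{0,2}<\infty$. Then there is a constant $C$ depending only on $p$ such that $$\int_{\mathbb{R}^2}|\phi(t,x)|^{p+1}\,dx\le C\,\mathcal{E}_{0,2}\,(1+t)^{-\frac{p-1}{2}}\qquad\forall\, t\ge 0 .$$ Moreover, if $1+\sqrt{8}<p<5$, the solution scatters to linear solutions in the critical Sobolev space and in the energy space: there exist pairs $\phi_0^{\pm}\in \dot H^{s_p}(\mathbb{R}^2)\cap\dot H^1(\mathbb{R}^2)$, $\phi_1^{\pm}\in\dot H^{s_p-1}(\mathbb{R}^2)\cap L^2(\mathbb{R}^2)$ such that $$\lim_{t\to\pm\infty}\big\|(\phi(t,\cdot),\partial_t\phi(t,\cdot))-\mathbf{L}(t)(\phi_0^{\pm},\phi_1^{\pm})\big\|_{\dot H^s\times\dot H^{s-1}}=0\quad\text{for all } s_p\le s\le 1 .$$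
   Context: Solutions are real-valued; initial data are assumed sufficiently regular and decaying at spatial infinity. For $k\ge0$ and $0\le\gamma\le2$ the weighted data norm is $$\mathcal{E}_{k,\gamma}=\sum_{l\le k}\int_{\mathbb{R}^2}(1+|x|)^{\gamma+2l}\big(|\nabla^{l+1}\phi_0|^2+|\nabla^l\phi_1|^2\big)+(1+|x|)^{\gamma}|\phi_0|^{p+1}\,dx .$$ The critical Sobolev exponent is $s_p=\frac{p-3}{p-1}$. $\mathbf{L}(t)$ denotes the linear wave propagator on $\mathbb{R}^{1+2}$: $\mathbf{L}(t)(f_0,f_1)=(u(t,\cdot),\partial_tu(t,\cdot))$ where $u$ solves $-\partial_t^2u+\Delta u=0$, $u(0)=f_0$, $\partial_tu(0)=f_1$. *)

theory Defs
  imports "HOL-Analysis.Analysis"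
begin

fun Ck :: "nat \<Rightarrow> ('a::euclidean_space \<Rightarrow> real) \<Rightarrow> bool" where
  "Ck 0 f = continuous_on UNIV f"
| "Ck (Suc k) f = (\<exists>D. (\<forall>x. (f has_derivative (\<lambda>h. \<Sum>b\<in>Basis. (h \<bullet> b) * D b x)) (at x))
                        \<and> (\<forall>b\<in>Basis. Ck k (D b)))"

definition smooth_fun :: "('a::euclidean_space \<Rightarrow> real) \<Rightarrow> bool" where
  "smooth_fun f \<longleftrightarrow> (\<forall>k. Ck k f)"

definition test_fun :: "(real^2 \<Rightarrow> real) \<Rightarrow> bool" where
  "test_fun g \<longleftrightarrow> smooth_fun g \<and> bounded {x. g x \<noteq> 0}"

definition pdir :: "('a::real_normed_vector \<Rightarrow> real) \<Rightarrow> 'a \<Rightarrow> 'a \<Rightarrow> real" where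
  "pdir f v z = deriv (\<lambda>h. f (z + h *\<^sub>R v)) 0"

definition dt :: "(real \<Rightarrow> real^2 \<Rightarrow> real) \<Rightarrow> real \<Rightarrow> real^2 \<Rightarrow> real" where
  "dt \<phi> t x = deriv (\<lambda>s. \<phi> s x) t"

definition grad_sq :: "(real^2 \<Rightarrow> real) \<Rightarrow> real^2 \<Rightarrow> real" where
  "grad_sq f x = (\<Sum>i\<in>UNIV. (pdir f (axis i 1) x)^2)"

definition nlw_solution :: "real \<Rightarrow> (real^2 \<Rightarrow> real) \<Rightarrow> (real^2 \<Rightarrow> real) \<Rightarrow> (real \<Rightarrow> real^2 \<Rightarrow> real) \<Rightarrow> bool" where
  "nlw_solution p \<phi>0 \<phi>1 \<phi> \<longleftrightarrow>
     (let \<Phi> = (\<lambda>z::real \<times> (real^2). \<phi> (fst z) (snd z)) in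
       Ck 2 \<Phi> \<and>
       (\<forall>z. - pdir (pdir \<Phi> (1, 0)) (1, 0) z
              + (\<Sum>i\<in>UNIV. pdir (pdir \<Phi> (0, axis i 1)) (0, axis i 1) z)
            = \<bar>\<Phi> z\<bar> powr (p - 1) * \<Phi> z)) \<and>
     (\<forall>x. \<phi> 0 x = \<phi>0 x) \<and> (\<forall>x. dt \<phi> 0 x = \<phi>1 x)"

definition E02 :: "real \<Rightarrow> (real^2 \<Rightarrow> real) \<Rightarrow> (real^2 \<Rightarrow> real) \<Rightarrow> ennreal" where
  "E02 p \<phi>0 \<phi>1 = (\<integral>\<^sup>+ x. ennreal ((1 + norm x) powr 2 * (grad_sq \<phi>0 x + (\<phi>1 x)^2)
                                  + (1 + norm x) powr 2 * \<bar>\<phi>0 x\<bar> powr (p + 1)) \<partial>lborel)"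

definition s_crit :: "real \<Rightarrow> real" where
  "s_crit p = (p - 3) / (p - 1)"

text \<open>Fourier transform (absolutely convergent; used only on test functions).\<close>
definition ft :: "(real^2 \<Rightarrow> real) \<Rightarrow> real^2 \<Rightarrow> complex" where
  "ft g \<xi> = (\<integral> x. cis (- (\<xi> \<bullet> x)) * complex_of_real (g x) \<partial>lborel)"

definition fmult :: "(real^2 \<Rightarrow> real) \<Rightarrow> (real^2 \<Rightarrow> real) \<Rightarrow> real^2 \<Rightarrow> real" where
  "fmult m g x = Re (complex_of_real (1 / (2 * pi)^2) *
                     (\<integral> \<xi>. cis (\<xi> \<bullet> x) * complex_of_real (m \<xi>) * ft g \<xi> \<partial>lborel))"

text \<open>cos(t|D|), sin(t|D|)/|D| and -|D| sin(t|D|) = \<partial>_t cos(t|D|).\<close>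
definition Cw :: "real \<Rightarrow> (real^2 \<Rightarrow> real) \<Rightarrow> real^2 \<Rightarrow> real" where
  "Cw t = fmult (\<lambda>\<xi>. cos (t * norm \<xi>))"
definition Sw :: "real \<Rightarrow> (real^2 \<Rightarrow> real) \<Rightarrow> real^2 \<Rightarrow> real" where
  "Sw t = fmult (\<lambda>\<xi>. sin (t * norm \<xi>) / norm \<xi>)"
definition Dw :: "real \<Rightarrow> (real^2 \<Rightarrow> real) \<Rightarrow> real^2 \<Rightarrow> real" where
  "Dw t = fmult (\<lambda>\<xi>. - norm \<xi> * sin (t * norm \<xi>))"

definition Nsq :: "real \<Rightarrow> (real^2 \<Rightarrow> real) \<Rightarrow> ennreal" where
  "Nsq \<sigma> g = (\<integral>\<^sup>+ \<xi>. ennreal (norm \<xi> powr (2 * \<sigma>) * (cmod (ft g \<xi>))^2) \<partial>lborel)"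

text \<open>Squared \<dot>H^s norm of a distribution given as a linear functional on test functions,
  defined by duality with \<dot>H^{-s} (equal to the usual norm up to a fixed constant factor).\<close>
definition hdot_sq :: "real \<Rightarrow> ((real^2 \<Rightarrow> real) \<Rightarrow> real) \<Rightarrow> ennreal" where
  "hdot_sq s \<Lambda> = (SUP g \<in> {g. test_fun g \<and> 0 < Nsq (-s) g \<and> Nsq (-s) g < \<infinity>}.
                      ennreal ((\<Lambda> g)^2) / Nsq (-s) g)"

definition pairing :: "(real^2 \<Rightarrow> real) \<Rightarrow> (real^2 \<Rightarrow> real) \<Rightarrow> real" where
  "pairing f g = (\<integral> x. f x * g x \<partial>lborel)"

definition loc_integrable :: "(real^2 \<Rightarrow> real) \<Rightarrow> bool" where
  "loc_integrable f \<longleftrightarrow> f \<in> borel_measurable lborel \<and>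
     (\<forall>K. compact K \<longrightarrow> set_integrable lborel K f)"

text \<open>Squared \<dot>H^s \<times> \<dot>H^{s-1} distance between (\<phi>(t),\<partial>_t\<phi>(t)) and L(t)(f0,f1),
  where L(t) is realised via its (self-adjoint) Fourier multipliers acting on test functions.\<close>
definition scat_dist :: "real \<Rightarrow> (real \<Rightarrow> real^2 \<Rightarrow> real) \<Rightarrow> (real^2 \<Rightarrow> real) \<Rightarrow> (real^2 \<Rightarrow> real) \<Rightarrow> real \<Rightarrow> ennreal" where
  "scat_dist s \<phi> f0 f1 t =
     hdot_sq s (\<lambda>g. pairing (\<phi> t) g - pairing f0 (Cw t g) - pairing f1 (Sw t g))
   + hdot_sq (s - 1) (\<lambda>g. pairing (dt \<phi> t) g - pairing f0 (Dw t g) - pairing f1 (Cw t g))"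

definition scat_data :: "real \<Rightarrow> (real^2 \<Rightarrow> real) \<Rightarrow> (real^2 \<Rightarrow> real) \<Rightarrow> bool" where
  "scat_data p f0 f1 \<longleftrightarrow> loc_integrable f0 \<and> loc_integrable f1 \<and>
     hdot_sq (s_crit p) (pairing f0) < \<infinity> \<and> hdot_sq 1 (pairing f0) < \<infinity> \<and>
     hdot_sq (s_crit p - 1) (pairing f1) < \<infinity> \<and> integrable lborel (\<lambda>x. (f1 x)^2)"

end

(* Along a null direction the current of the conformal field has a divergence of one sign up to
   (5 - p) U V; multiplying by a tuned weight in U = 1 + t - s x and adding a copy of the energy
   absorbs it, and the two directions s = 1 and s = -1 together give the decay of the potential.
   The same quantities bound the scaling and boost derivatives, so a Gagliardo inequality in polar
   coordinates yields |N|_r <= K (1 + t)^(-1-eps) for 2 (p-1)/(p+1) <= r <= 2 exactly when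
   p > 1 + sqrt 8. By Duhamel, pairing the solution with free waves therefore converges at a rate
   controlled by the dual Sobolev norm of the test function; Riesz representation turns the limit
   functional into the scattering data, and time reversal treats t -> -infinity. *)
theory Submission imports Defs "HOL-Probability.Probability" "HOL-Real_Asymp.Real_Asymp" begin

subsection \<open>Currents and backward light cones\<close>

text \<open>The solution is \<open>C^2\<close> with no decay at infinity, so no energy identity can
  be integrated over the plane directly. The identities are cut off first, mostly along backward
  cones, where causality of the flux gives the boundary term a sign, and Fatou's lemma removes the
  cutoff. The null currents contain \<open>u\<close> undifferentiated, which \<open>E02\<close> does
  not control directly; a Hardy inequality that uses only \<open>L^(p+1)\<close> integrability at
  infinity supplies it. The exponent dual to \<open>s_crit p\<close> is
  \<open>2 / (2 - s_crit p) = 2 (p - 1) / (p + 1)\<close>, and there the norm of the nonlinearity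
  must be integrable in time: this is the origin of \<open>1 + sqrt 8\<close>. The other end
  \<open>r = 2\<close> needs an \<open>L^(2p)\<close> bound, obtained by absorption. Norms and
  propagators are tested against test functions, but a propagated test function is not visibly a
  test function again. Hence the class \<open>adm\<close>: continuous, compactly supported, with
  rapidly decaying transform. Finite propagation speed keeps it stable, and a weighted
  \<open>L^2\<close> bound on it makes the limit functionals functions rather than mere
  distributions.\<close>

abbreviation (input) nn_lborel (binder "NN" 10) where "nn_lborel f \<equiv> nn_integral lborel f"
abbreviation (input) integral_lborel (binder "LL" 10) where "integral_lborel f \<equiv> integral\<^sup>L lborel f"
abbreviation (input) at_pair (infixl "$$" 999) where "f $$ z \<equiv> f (fst z) (snd z)"
abbreviation (input) abs_brackets ("<|_|>") where "<|x|> \<equiv> abs x"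
abbreviation (input) seq_tendsto ("_ ----> _" [60, 60] 60) where "X ----> L \<equiv> (X \<longlongrightarrow> L) sequentially"
abbreviation (input) "EE \<equiv> ennreal"
abbreviation (input) "ind \<equiv> indicator"
abbreviation (input) "CO \<equiv> continuous_on"
abbreviation (input) has_real_deriv :: "(real => real) => real => real filter => bool" (infix "hrd" 50) where "(f hrd D) F \<equiv> (f has_field_derivative D) F"
abbreviation (input) "BB \<equiv> borel_measurable borel"
abbreviation (input) "cr \<equiv> complex_of_real"

text \<open>Fatou's lemma in the form that removes the cutoffs: bounds for truncated integrals pass
  to the pointwise limit.\<close>

lemma nn_integral_le_of_tendsto:
 fixes f :: "nat => 'a => ennreal"
 assumes "!!n. f n \<in> borel_measurable M" "!!x. x \<in> space M ==> (%n. f n x) ----> g x"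
  and "eventually (%n. (\<integral>\<^sup>+x. f n x \<partial>M) <= B n) sequentially" "B ----> C"
 shows "(\<integral>\<^sup>+x. g x \<partial>M) <= C"
proof -
 have "(\<integral>\<^sup>+x. g x \<partial>M) = (\<integral>\<^sup>+x. liminf (%n. f n x) \<partial>M)"
  by (rule nn_integral_cong) (metis assms(2) lim_imp_Liminf sequentially_bot)
 also have "... <= liminf (%n. \<integral>\<^sup>+x. f n x \<partial>M)"
  by (rule nn_integral_liminf) (use assms(1) in auto)
 also have "... <= liminf B" by (rule Liminf_mono) (use assms(3) in auto)
 also have "... = C" using assms(4) by (simp add: lim_imp_Liminf)
 finally show ?thesis .
qed

definition cont3 :: "(real => real => real => real) => bool" where
 "cont3 f \<longleftrightarrow> CO UNIV (%z. f (fst z) (fst (snd z)) (snd (snd z)))"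

lemma cont3_comp:
 assumes "cont3 f" "CO S a" "CO S b" "CO S c"
 shows "CO S (%z. f (a z) (b z) (c z))"
proof -
 have "CO S (%z. (a z, b z, c z))" by (intro continuous_intros assms)
 from continuous_on_compose2[OF assms(1)[unfolded cont3_def] this] show ?thesis by simp
qed

text \<open>A density \<open>e\<close> with flux \<open>(q1, q2)\<close> and space-time divergence
  \<open>b\<close>. Only the three derivatives entering the divergence are required, with joint
  continuity; they stay behind the existential so that later only \<open>b\<close> has to be
  tracked.\<close>

definition is_current where
 "is_current e q1 q2 b \<longleftrightarrow> (\<exists>et q1x q2y.
  (\<forall>t x y. ((%s. e s x y) hrd et t x y) (at t)) &
  (\<forall>t x y. ((%s. q1 t s y) hrd q1x t x y) (at x)) &
  (\<forall>t x y. ((%s. q2 t x s) hrd q2y t x y) (at y)) &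
  cont3 e & cont3 q1 & cont3 q2 & cont3 et & cont3 q1x & cont3 q2y &
  (\<forall>t x y. et t x y + q1x t x y + q2y t x y = b t x y))"

lemma is_currentI:
 assumes "!!t x y. ((%s. e s x y) hrd et t x y) (at t)"
  "!!t x y. ((%s. q1 t s y) hrd q1x t x y) (at x)"
  "!!t x y. ((%s. q2 t x s) hrd q2y t x y) (at y)"
  "cont3 e" "cont3 q1" "cont3 q2" "cont3 et" "cont3 q1x" "cont3 q2y"
  "!!t x y. et t x y + q1x t x y + q2y t x y = b t x y"
 shows "is_current e q1 q2 b"
 unfolding is_current_def
 by (rule exI[of _ et], rule exI[of _ q1x], rule exI[of _ q2y]) (use assms in blast)

lemma is_current_cont: "is_current e q1 q2 b ==> cont3 e & cont3 q1 & cont3 q2 & cont3 b"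
proof -
 assume "is_current e q1 q2 b"
 then obtain et q1x q2y where *: "cont3 e" "cont3 q1" "cont3 q2" "cont3 et" "cont3 q1x" "cont3 q2y"
  "!!t x y. et t x y + q1x t x y + q2y t x y = b t x y"
  unfolding is_current_def by blast
 have "cont3 (%t x y. et t x y + q1x t x y + q2y t x y)"
  using *(4-6) unfolding cont3_def by (intro continuous_intros)
 then show ?thesis using * by simp
qed

lemma is_current_add:
 assumes "is_current e q1 q2 b" "is_current e' q1' q2' b'"
 shows "is_current (%t x y. e t x y + e' t x y) (%t x y. q1 t x y + q1' t x y)
  (%t x y. q2 t x y + q2' t x y) (%t x y. b t x y + b' t x y)"
proof -
 obtain et q1x q2y where a:
  "!!t x y. ((%s. e s x y) hrd et t x y) (at t)"
  "!!t x y. ((%s. q1 t s y) hrd q1x t x y) (at x)"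
  "!!t x y. ((%s. q2 t x s) hrd q2y t x y) (at y)"
  "cont3 e" "cont3 q1" "cont3 q2" "cont3 et" "cont3 q1x" "cont3 q2y"
  "!!t x y. b t x y = et t x y + q1x t x y + q2y t x y"
  using assms(1) unfolding is_current_def by metis
 obtain et' q1x' q2y' where b:
  "!!t x y. ((%s. e' s x y) hrd et' t x y) (at t)"
  "!!t x y. ((%s. q1' t s y) hrd q1x' t x y) (at x)"
  "!!t x y. ((%s. q2' t x s) hrd q2y' t x y) (at y)"
  "cont3 e'" "cont3 q1'" "cont3 q2'" "cont3 et'" "cont3 q1x'" "cont3 q2y'"
  "!!t x y. b' t x y = et' t x y + q1x' t x y + q2y' t x y"
  using assms(2) unfolding is_current_def by metis
 show ?thesis
  by (rule is_currentI[of _ "%t x y. et t x y + et' t x y" _ "%t x y. q1x t x y + q1x' t x y"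
     _ "%t x y. q2y t x y + q2y' t x y"])
   (use a b in \<open>auto intro!: derivative_intros simp: cont3_def intro!: continuous_on_add\<close>)
qed

text \<open>The product rule for divergences. It serves the cone cutoffs, the null weight
  \<open>wt\<close> and the cutoff transported by the scaling field alike.\<close>

lemma is_current_mult:
 assumes "is_current e q1 q2 b"
  and "!!t x y. ((%s. c s x y) hrd ct t x y) (at t)"
  "!!t x y. ((%s. c t s y) hrd cx t x y) (at x)"
  "!!t x y. ((%s. c t x s) hrd cy t x y) (at y)"
  "cont3 c" "cont3 ct" "cont3 cx" "cont3 cy"
 shows "is_current (%t x y. c t x y * e t x y) (%t x y. c t x y * q1 t x y)
  (%t x y. c t x y * q2 t x y)
  (%t x y. c t x y * b t x y + (ct t x y * e t x y + cx t x y * q1 t x y + cy t x y * q2 t x y))"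
proof -
 obtain et q1x q2y where a:
  "!!t x y. ((%s. e s x y) hrd et t x y) (at t)"
  "!!t x y. ((%s. q1 t s y) hrd q1x t x y) (at x)"
  "!!t x y. ((%s. q2 t x s) hrd q2y t x y) (at y)"
  "cont3 e" "cont3 q1" "cont3 q2" "cont3 et" "cont3 q1x" "cont3 q2y"
  "!!t x y. b t x y = et t x y + q1x t x y + q2y t x y"
  using assms(1) unfolding is_current_def by metis
 note c = assms(2-)
 show ?thesis
 proof (rule is_currentI)
  fix t x y
  show "((%s. c s x y * e s x y) hrd ct t x y * e t x y + et t x y * c t x y) (at t)"
   by (rule DERIV_mult[OF c(1) a(1)])
  show "((%s. c t s y * q1 t s y) hrd cx t x y * q1 t x y + q1x t x y * c t x y) (at x)"
   by (rule DERIV_mult[OF c(2) a(2)])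
  show "((%s. c t x s * q2 t x s) hrd cy t x y * q2 t x y + q2y t x y * c t x y) (at y)"
   by (rule DERIV_mult[OF c(3) a(3)])
  show "ct t x y * e t x y + et t x y * c t x y + (cx t x y * q1 t x y + q1x t x y * c t x y) +
   (cy t x y * q2 t x y + q2y t x y * c t x y) =
   c t x y * b t x y + (ct t x y * e t x y + cx t x y * q1 t x y + cy t x y * q2 t x y)"
   unfolding a(10) by (simp add: algebra_simps)
 qed (use a(4-9) c(4-7) in \<open>simp_all add: cont3_def continuous_on_mult continuous_on_add\<close>)
qed

abbreviation sq_box :: "real => (real \<times> real) set" where
 "sq_box R \<equiv> cbox (-R, -R) (R, R)"

lemma in_sq_box: "z \<in> sq_box R \<longleftrightarrow> <|fst z|> <= R & <|snd z|> <= R"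
 by (cases z) (auto simp: cbox_Pair_eq abs_le_iff)

lemma integral_dx_zero:
 fixes q qx :: "real => real => real"
 assumes "!!x y. ((%s. q s y) hrd qx x y) (at x)"
  "CO UNIV (%z. qx $$ z)" "!!y. q (-R) y = 0" "!!y. q R y = 0" "0 <= R"
 shows "integral (sq_box R) (%z. qx $$ z) = 0"
proof -
 have c: "CO (cbox (-R,-R) (R,R)) (%(x,y). qx x y)"
  using continuous_on_subset[OF assms(2)] by (auto simp: case_prod_beta')
 have "integral (sq_box R) (%z. qx $$ z) =
   integral (cbox (-R) R) (%x. integral (cbox (-R) R) (%y. qx x y))"
  using integral_prod_continuous[OF c] by (simp add: case_prod_beta')
 also have "... = integral (cbox (-R) R) (%y. integral (cbox (-R) R) (%x. qx x y))"
  by (rule integral_swap_continuous[OF c])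
 also have "... = integral (cbox (-R) R) (%y. 0)"
 proof (rule integral_cong)
  fix y
  have "((%x. qx x y) has_integral (q R y - q (-R) y)) {-R..R}"
   by (rule fundamental_theorem_of_calculus)
    (use assms in \<open>auto simp: has_real_derivative_iff_has_vector_derivative[symmetric]
      intro: has_field_derivative_at_within\<close>)
  then show "integral (cbox (-R) R) (%x. qx x y) = 0"
   using assms by (auto simp: integral_unique)
 qed
 finally show ?thesis by simp
qed

lemma integral_dy_zero:
 fixes q qy :: "real => real => real"
 assumes "!!x y. ((%s. q x s) hrd qy x y) (at y)"
  "CO UNIV (%z. qy $$ z)" "!!x. q x (-R) = 0" "!!x. q x R = 0" "0 <= R"
 shows "integral (sq_box R) (%z. qy $$ z) = 0"
proof -
 have c: "CO (cbox (-R,-R) (R,R)) (%(x,y). qy x y)"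
  using continuous_on_subset[OF assms(2)] by (auto simp: case_prod_beta')
 have "integral (sq_box R) (%z. qy $$ z) =
   integral (cbox (-R) R) (%x. integral (cbox (-R) R) (%y. qy x y))"
  using integral_prod_continuous[OF c] by (simp add: case_prod_beta')
 also have "... = integral (cbox (-R) R) (%y. 0)"
 proof (rule integral_cong)
  fix x
  have "((%y. qy x y) has_integral (q x R - q x (-R))) {-R..R}"
   by (rule fundamental_theorem_of_calculus)
    (use assms in \<open>auto simp: has_real_derivative_iff_has_vector_derivative[symmetric]
      intro: has_field_derivative_at_within\<close>)
  then show "integral (cbox (-R) R) (%y. qy x y) = 0"
   using assms by (auto simp: integral_unique)
 qed
 finally show ?thesis by simp
qed

lemma cont3_mult: "cont3 f ==> cont3 g ==> cont3 (%t x y. f t x y * g t x y)"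
 unfolding cont3_def by (rule continuous_on_mult)

lemma cont3_slice: "cont3 f ==> CO S (%z. f t $$ z)"
 by (erule cont3_comp) (intro continuous_intros)+

text \<open>The flux vanishes on the faces of a fixed box, so its spatial divergence integrates to
  zero and the Leibniz rule leaves only \<open>b\<close>.\<close>

lemma current_integral_deriv:
 assumes cur: "is_current e q1 q2 b" and R: "0 <= R"
  and supp: "!!t x y. t \<in> I ==> R <= <|x|> | R <= <|y|> ==> q1 t x y = 0 & q2 t x y = 0"
  and I: "convex I" "t \<in> I"
 shows "((%t. integral (sq_box R) (%z. e t $$ z)) hrd
     integral (sq_box R) (%z. b t $$ z)) (at t within I)"
proof -
 obtain et q1x q2y where a:
  "!!t x y. ((%s. e s x y) hrd et t x y) (at t)"
  "!!t x y. ((%s. q1 t s y) hrd q1x t x y) (at x)"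
  "!!t x y. ((%s. q2 t x s) hrd q2y t x y) (at y)"
  "cont3 e" "cont3 q1" "cont3 q2" "cont3 et" "cont3 q1x" "cont3 q2y"
  "!!t x y. b t x y = et t x y + q1x t x y + q2y t x y"
  using cur unfolding is_current_def by metis
 have 1: "((%t. integral (sq_box R) (%z. e t $$ z)) hrd
     integral (sq_box R) (%z. et t $$ z)) (at t within I)"
 proof (rule leibniz_rule_field_derivative)
  show "CO (I \<times> sq_box R) (%(x, t). et x $$ t)"
   unfolding case_prod_beta' by (rule cont3_comp[OF a(7)]) (intro continuous_intros)+
 qed (use I a in \<open>auto intro!: integrable_continuous cont3_slice intro: has_field_derivative_at_within\<close>)
 have 2: "integral (sq_box R) (%z. q1x t $$ z) = 0"
  by (rule integral_dx_zero[of "q1 t"]) (use a R supp[OF I(2)] in \<open>auto intro!: cont3_slice\<close>)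
 have 3: "integral (sq_box R) (%z. q2y t $$ z) = 0"
  by (rule integral_dy_zero[of "q2 t"]) (use a R supp[OF I(2)] in \<open>auto intro!: cont3_slice\<close>)
 have i: "(%z. f t $$ z) integrable_on sq_box R" if "cont3 f" for f
  by (rule integrable_continuous, rule cont3_slice[OF that])
 have "integral (sq_box R) (%z. b t $$ z) =
   integral (sq_box R) (%z. et t $$ z)"
  unfolding a(10) using i[OF a(7)] i[OF a(8)] i[OF a(9)] 2 3
  by (simp add: integral_add integrable_add)
 then show ?thesis using 1 by simp
qed

lemma integral_sq_box_lborel:
 fixes f :: "real \<times> real => 'a::euclidean_space"
 assumes "CO (sq_box R) f" "!!z. z \<notin> sq_box R ==> f z = 0"
 shows "integrable lborel f" "integral\<^sup>L lborel f = integral (sq_box R) f"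
proof -
 have *: "(%z. ind (sq_box R) z *\<^sub>R f z) = f"
  using assms(2) by (auto simp: indicator_def)
 have "set_integrable lborel (sq_box R) f"
  unfolding set_integrable_def by (rule borel_integrable_compact[OF _ assms(1)]) auto
 then show "integrable lborel f" "integral\<^sup>L lborel f = integral (sq_box R) f"
  using set_borel_integral_eq_integral(2)[of "sq_box R" f] *
  by (auto simp: set_integrable_def set_lebesgue_integral_def)
qed

section \<open>Cutoffs along smoothed backward cones\<close>

definition psq :: "real => real" where "psq s = (max 0 s)^2"

lemma psq_deriv: "(psq hrd 2 * max 0 s) (at s)"
proof (cases s "0::real" rule: linorder_cases)
 case less
 have "((%_. 0) hrd 2 * max 0 s) (at s)" using less by (auto simp: max_def)
 then show ?thesis
  by (rule has_field_derivative_transform_within_open[of _ _ _ "{..<0}"])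
   (use less in \<open>auto simp: psq_def max_def\<close>)
next
 case greater
 have "((%s. s^2) hrd 2 * max 0 s) (at s)" using greater
  by (auto intro!: derivative_eq_intros simp: max_def)
 then show ?thesis
  by (rule has_field_derivative_transform_within_open[of _ _ _ "{0<..}"])
   (use greater in \<open>auto simp: psq_def max_def\<close>)
next
 case equal
 have l: "((%h::real. max 0 h) \<longlongrightarrow> 0) (at 0)"
  using continuous_max[of "at 0" "%_. 0::real" "%h. h"] by (auto simp: continuous_at)
 have "((%h. psq h / h) \<longlongrightarrow> 0) (at 0)"
  by (rule tendsto_cong[THEN iffD1, OF _ l])
   (auto simp: eventually_at_filter psq_def max_def power2_eq_square)
 then show ?thesis using equal by (simp add: DERIV_def psq_def)
qed

lemmas psq_deriv_chain[derivative_intros] = DERIV_chain2[OF psq_deriv]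

lemma continuous_on_psq[continuous_intros]: "CO S f ==> CO S (%x. psq (f x))"
 unfolding psq_def by (intro continuous_intros)

text \<open>A smoothed distance to the origin: for \<open>0 < d\<close> it is differentiable at the
  origin too, and its gradient has length at most 1, so cones built from it shrink no slower than
  light cones.\<close>

definition jap :: "real => real => real => real" where "jap d x y = sqrt (d^2 + x^2 + y^2)"

lemma jap_pos: "0 < d ==> 0 < jap d x y"
 unfolding jap_def by (auto intro!: add_pos_nonneg)

lemma jap_deriv:
 assumes "0 < d"
 shows "((%s. jap d (s - a) y) hrd (x - a) / jap d (x - a) y) (at x)"
  "((%s. jap d x' (s - b)) hrd (y' - b) / jap d x' (y' - b)) (at y')"
proof -
 have *: "0 < d^2 + a^2 + b^2" for a b using assms by (auto intro!: add_pos_nonneg)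
 show "((%s. jap d (s - a) y) hrd (x - a) / jap d (x - a) y) (at x)"
  unfolding jap_def using *[of "x - a" y] by (auto intro!: derivative_eq_intros simp: field_simps)
 show "((%s. jap d x' (s - b)) hrd (y' - b) / jap d x' (y' - b)) (at y')"
  unfolding jap_def using *[of x' "y' - b"] by (auto intro!: derivative_eq_intros simp: field_simps)
qed

lemma jap_grad_le: "0 < d ==> (x / jap d x y)^2 + (y / jap d x y)^2 <= 1"
 using jap_pos[of d x y] by (simp add: power_divide jap_def add_nonneg_nonneg divide_simps)

text \<open>Supported in a smoothed backward cone about \<open>(a, b)\<close>. The squared positive
  part is used because its derivative is still continuous.\<close>

definition cone_cut :: "real => real => real => real => real => real => real => real" where
 "cone_cut d a b R t x y = psq (R - t - jap d (x - a) (y - b))"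

lemma cone_cut_zero: "0 < d ==> 0 <= t ==> <|a|> + <|b|> + <|R|> <= <|x|> | <|a|> + <|b|> + <|R|> <= <|y|> ==> cone_cut d a b R t x y = 0"
proof -
 assume *: "0 < d" "0 <= t" "<|a|> + <|b|> + <|R|> <= <|x|> | <|a|> + <|b|> + <|R|> <= <|y|>"
 have "<|x - a|> <= jap d (x - a) (y - b)" "<|y - b|> <= jap d (x - a) (y - b)"
  unfolding jap_def by (auto intro!: real_le_rsqrt)
 then show ?thesis using * unfolding cone_cut_def psq_def by auto
qed

text \<open>Cutting off along backward cones only decreases the divergence of a causal current.\<close>
lemma current_cone_cut:
 assumes cur: "is_current e q1 q2 b" and d: "0 < d"
  and causal: "!!t x y v w. v^2 + w^2 <= 1 ==> v * q1 t x y + w * q2 t x y <= e t x y"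
 shows "\<exists>b'. is_current (%t x y. cone_cut d a c R t x y * e t x y) (%t x y. cone_cut d a c R t x y * q1 t x y)
  (%t x y. cone_cut d a c R t x y * q2 t x y) b' & (\<forall>t x y. b' t x y <= cone_cut d a c R t x y * b t x y)"
proof -
 define m where "m = (%t x y. 2 * max 0 (R - t - jap d (x - a) (y - c)))"
 define X where "X = (%(t::real) x y. (x - a) / jap d (x - a) (y - c))"
 define Y where "Y = (%(t::real) x y. (y - c) / jap d (x - a) (y - c))"
 have j: "jap d u v ~= 0" for u v using jap_pos[OF d, of u v] by simp
 have cj: "CO UNIV (%z. jap d (fst (snd z) - a) (snd (snd z) - c))"
  unfolding jap_def by (intro continuous_intros)
 let ?b = "(%t x y. cone_cut d a c R t x y * b t x y + (- m t x y * e t x y + - m t x y * X t x y * q1 t x y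
   + - m t x y * Y t x y * q2 t x y))"
 have "is_current (%t x y. cone_cut d a c R t x y * e t x y) (%t x y. cone_cut d a c R t x y * q1 t x y)
  (%t x y. cone_cut d a c R t x y * q2 t x y) ?b"
 proof (rule is_current_mult[OF cur])
  fix t x y
  show "((%s. cone_cut d a c R s x y) hrd - m t x y) (at t)"
   unfolding cone_cut_def m_def by (auto intro!: derivative_eq_intros)
  show "((%s. cone_cut d a c R t s y) hrd - m t x y * X t x y) (at x)"
   unfolding cone_cut_def m_def X_def by (auto intro!: derivative_eq_intros jap_deriv d)
  show "((%s. cone_cut d a c R t x s) hrd - m t x y * Y t x y) (at y)"
   unfolding cone_cut_def m_def Y_def by (auto intro!: derivative_eq_intros jap_deriv d)
 qed (auto simp: cont3_def cone_cut_def m_def X_def Y_def j intro!: continuous_intros cj)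
 moreover have "?b t x y <= cone_cut d a c R t x y * b t x y" for t x y
 proof -
  \<comment> \<open>The derivative of the cutoff is \<open>- m\<close> times
    \<open>(1, X, Y)\<close> with \<open>(X, Y)\<close> in the unit disc, so \<open>causal\<close>
    at \<open>(- X, - Y)\<close> gives the extra divergence its sign.\<close>
  have "(- X t x y)^2 + (- Y t x y)^2 <= 1" using jap_grad_le[OF d] unfolding X_def Y_def by simp
  from causal[OF this, of t x y] have "0 <= m t x y * (e t x y + X t x y * q1 t x y + Y t x y * q2 t x y)"
   unfolding m_def by (intro mult_nonneg_nonneg) auto
  then show ?thesis by (simp add: algebra_simps)
 qed
 ultimately show ?thesis by blast
qed

lemma DERIV_le_mono_diff:
 fixes F G :: "real => real"
 assumes "a <= c" "!!t. t \<in> {a..c} ==> (F hrd f t) (at t within {a..c})"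
  "!!t. t \<in> {a..c} ==> (G hrd g t) (at t within {a..c})"
  "!!t. t \<in> {a..c} ==> f t <= g t"
 shows "F c - F a <= G c - G a"
proof -
 have 1: "(f has_integral (F c - F a)) {a..c}"
  by (rule fundamental_theorem_of_calculus)
   (use assms in \<open>auto simp: has_real_derivative_iff_has_vector_derivative\<close>)
 have 2: "(g has_integral (G c - G a)) {a..c}"
  by (rule fundamental_theorem_of_calculus)
   (use assms in \<open>auto simp: has_real_derivative_iff_has_vector_derivative\<close>)
 show ?thesis by (rule has_integral_le[OF 1 2]) (use assms in auto)
qed

lemma cone_cut_box_zero:
 assumes "0 < d" "0 <= t" "<|a|> + <|c|> + <|R|> <= S" "z \<notin> sq_box S"
 shows "cone_cut d a c R t $$ z = 0"
 using assms by (intro cone_cut_zero) (auto simp: in_sq_box)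

lemma cont_cone_cut: "0 < d ==> cont3 (cone_cut d a c R)"
 unfolding cont3_def cone_cut_def jap_def by (intro continuous_intros)

text \<open>The integrated inequality for one fixed cone. Centre and smoothing stay free because
  finite propagation speed later needs a narrow cone about a prescribed point.\<close>

lemma current_cut_bound:
 assumes cur: "is_current e q1 q2 b" and d: "0 < d" and t1: "0 <= t1"
  and causal: "!!t x y v w. v^2 + w^2 <= 1 ==> v * q1 t x y + w * q2 t x y <= e t x y"
  and B: "!!t. t \<in> {0..t1} ==> (B hrd B' t) (at t within {0..t1})"
  and bB: "!!t. t \<in> {0..t1} ==> (LL z. cone_cut d a c R t $$ z * b t $$ z) <= B' t"
 shows "(LL z. cone_cut d a c R t1 $$ z * e t1 $$ z)
  <= (LL z. cone_cut d a c R 0 $$ z * e 0 $$ z) + (B t1 - B 0)"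
proof -
 define S where "S = <|a|> + <|c|> + <|R|>"
 let ?k = "cone_cut d a c R"
 have c: "cont3 e" "cont3 b" using is_current_cont[OF cur] by auto
 obtain b' where b': "is_current (%t x y. ?k t x y * e t x y) (%t x y. ?k t x y * q1 t x y)
  (%t x y. ?k t x y * q2 t x y) b'" "!!t x y. b' t x y <= ?k t x y * b t x y"
  using current_cone_cut[OF cur d causal] by blast
 have cb': "cont3 b'" using is_current_cont[OF b'(1)] by auto
 have L: "(LL z. ?k t $$ z * f t $$ z) =
   integral (sq_box S) (%z. ?k t $$ z * f t $$ z)"
  if "t \<in> {0..t1}" "cont3 f" for t f
  by (rule integral_sq_box_lborel)
   (use that d cone_cut_box_zero[of d t a c R S] in \<open>auto simp: S_def intro!: cont3_slice cont3_mult cont_cone_cut\<close>)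
 let ?F = "%t. integral (sq_box S) (%z. ?k t $$ z * e t $$ z)"
 have "?F t1 - ?F 0 <= B t1 - B 0"
 proof (rule DERIV_le_mono_diff[OF t1])
  fix t assume t: "t \<in> {0..t1}"
  show "(?F hrd integral (sq_box S) (%z. b' t $$ z)) (at t within {0..t1})"
   by (rule current_integral_deriv[OF b'(1)])
    (use t d cone_cut_zero[OF d, of _ a c R] in \<open>auto simp: S_def\<close>)
  have "integral (sq_box S) (%z. b' t $$ z) <=
   integral (sq_box S) (%z. ?k t $$ z * b t $$ z)"
   by (rule integral_le)
    (use b'(2) d in \<open>auto intro!: integrable_continuous cont3_slice cont3_mult cb' c cont_cone_cut\<close>)
  then show "integral (sq_box S) (%z. b' t $$ z) <= B' t"
   using bB[OF t] L[OF t c(2)] by simp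
 qed (use B in auto)
 then show ?thesis using L[OF _ c(1)] t1 by simp
qed

lemma cone_cut_nonneg: "0 <= cone_cut d a c R t x y"
 unfolding cone_cut_def psq_def by simp

lemma cone_cut_le: "0 < R ==> 0 <= t ==> cone_cut d a c R t x y / R^2 <= 1"
proof -
 assume *: "0 < R" "0 <= t"
 have "0 <= jap d (x - a) (y - c)" by (simp add: jap_def)
 then have "max 0 (R - t - jap d (x - a) (y - c)) <= R" using * by auto
 then have "cone_cut d a c R t x y <= R^2"
  unfolding cone_cut_def psq_def by (intro power_mono) auto
 then show ?thesis using * by simp
qed

lemma cone_cut_tendsto: "(%n. cone_cut d a c (real (Suc n)) t x y / (real (Suc n))^2) ----> 1"
proof -
 define K where "K = t + jap d (x - a) (y - c)"
 have "(%n. K / real (Suc n)) ----> 0"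
  using LIMSEQ_Suc[OF lim_const_over_n[of K]] by (simp add: of_nat_Suc)
 then have "(%n. (max 0 (1 - K / real (Suc n)))^2) ----> (max 0 (1 - 0))^2"
  by (intro tendsto_intros)
 moreover have "(max 0 (1 - K / real (Suc n)))^2 = cone_cut d a c (real (Suc n)) t x y / (real (Suc n))^2" for n
 proof -
  have "max 0 (1 - K / real (Suc n)) = max 0 (real (Suc n) - K) / real (Suc n)"
   by (auto simp: max_def field_simps simp del: of_nat_Suc)
  then show ?thesis unfolding cone_cut_def psq_def K_def by (simp add: power_divide algebra_simps)
 qed
 ultimately show ?thesis by simp
qed

lemma measurable_cont3: "cont3 f ==> (%z. f t $$ z) \<in> BB"
 by (rule borel_measurable_continuous_onI, rule cont3_slice)

text \<open>Divided by \<open>R^2\<close> the cutoff is at most 1 and tends to 1 as the cone grows,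
  so Fatou's lemma yields the bound on the whole plane without any decay of the solution. The factor
  \<open>R^2\<close> in \<open>bB\<close> anticipates this division.\<close>

proposition current_bound:
 assumes cur: "is_current e q1 q2 b" and t1: "0 <= t1"
  and causal: "!!t x y v w. v^2 + w^2 <= 1 ==> v * q1 t x y + w * q2 t x y <= e t x y"
  and B: "!!t. t \<in> {0..t1} ==> (B hrd B' t) (at t within {0..t1})"
  and bB: "!!R t. t \<in> {0..t1} ==> 0 < R ==>
    (LL z. cone_cut 1 0 0 R t $$ z * b t $$ z) <= R^2 * B' t"
  and fin: "(NN z. EE (e 0 $$ z)) <= EE E0" and E0: "0 <= E0"
 shows "(NN z. EE (e t1 $$ z)) <= EE (E0 + (B t1 - B 0))"
proof -
 let ?k = "%R t z. cone_cut 1 0 0 R t $$ z"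
 let ?e = "%t z. e t $$ z"
 have e0: "0 <= e t x y" for t x y using causal[of 0 0 t x y] by simp
 have c: "cont3 e" using is_current_cont[OF cur] by auto
 have [measurable]: "(%z. ?e t z) \<in> BB" "(%z. ?k R t z) \<in> BB" for t R
  using measurable_cont3[OF c] measurable_cont3[OF cont_cone_cut] by auto
 have i: "integrable lborel (%z. ?k R t z * ?e t z)" if "0 <= t" for R t
  by (rule integral_sq_box_lborel(1)[of "<|R|>"])
   (use that cone_cut_box_zero[of 1 t 0 0 R "<|R|>"] in \<open>auto intro!: cont3_slice cont3_mult c cont_cone_cut\<close>)
 have key: "(NN z. EE (?k R t1 z / R^2 * ?e t1 z)) <= EE (E0 + (B t1 - B 0))" if R: "0 < R" for R
 proof -
  have "(LL z. ?k R t1 z * ?e t1 z) <= (LL z. ?k R 0 z * ?e 0 z) + (R^2 * B t1 - R^2 * B 0)"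
   by (rule current_cut_bound[OF cur _ t1 causal])
    (use B bB R in \<open>auto intro!: DERIV_cmult\<close>)
  then have 1: "(LL z. ?k R t1 z * ?e t1 z) / R^2 <= (LL z. ?k R 0 z * ?e 0 z) / R^2 + (B t1 - B 0)"
   using R by (simp add: field_simps)
  have 2: "EE ((LL z. ?k R t z * ?e t z) / R^2) = (NN z. EE (?k R t z / R^2 * ?e t z))"
   if t: "0 <= t" for t
  proof -
   have "EE (LL z. ?k R t z * ?e t z / R^2) = (NN z. EE (?k R t z * ?e t z / R^2))"
    by (rule nn_integral_eq_integral[symmetric])
     (use i[OF t] e0 cone_cut_nonneg in auto)
   then show ?thesis by simp
  qed
  have "EE ((LL z. ?k R 0 z * ?e 0 z) / R^2) <= (NN z. EE (?e 0 z))"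
   unfolding 2[OF order_refl]
   by (intro nn_integral_mono ennreal_leI mult_left_le_one_le)
    (use e0 cone_cut_nonneg cone_cut_le[OF R] in auto)
  also have "... <= EE E0" by (rule fin)
  finally have "(LL z. ?k R 0 z * ?e 0 z) / R^2 <= E0" using E0 by (simp add: ennreal_le_iff)
  with 1 have "(LL z. ?k R t1 z * ?e t1 z) / R^2 <= E0 + (B t1 - B 0)" by simp
  then show ?thesis unfolding 2[OF t1, symmetric] by (rule ennreal_leI)
 qed
 show ?thesis
 proof (rule nn_integral_le_of_tendsto[where f="%n z. EE (?k (real (Suc n)) t1 z / (real (Suc n))^2 * ?e t1 z)"])
  show "(%n. EE (?k (real (Suc n)) t1 x / (real (Suc n))^2 * ?e t1 x)) ----> EE (?e t1 x)" for x
   using tendsto_mult[OF cone_cut_tendsto tendsto_const] by (intro tendsto_ennrealI) force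
  show "eventually (%n. (NN z. EE (?k (real (Suc n)) t1 z / (real (Suc n))^2 * ?e t1 z)) <=
   (%_. EE (E0 + (B t1 - B 0))) n) sequentially"
   by (rule always_eventually) (use key in \<open>simp del: of_nat_Suc\<close>)
 qed auto
qed

subsection \<open>A Hardy inequality in the plane\<close>

lemma abs_powr_deriv:
 fixes a :: real assumes "1 < a"
 shows "((%s. <|s|> powr a) hrd a * (<|s|> powr (a - 2) * s)) (at s)"
proof (cases s "0::real" rule: linorder_cases)
 case less
 have "((%s. (- s) powr a) hrd a * (<|s|> powr (a - 2) * s)) (at s)"
  using less powr_add[of "-s" "a - 2" 1] by (auto intro!: derivative_eq_intros simp: diff_diff_eq)
 then show ?thesis
  by (rule has_field_derivative_transform_within_open[of _ _ _ "{..<0}"]) (use less in auto)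
next
 case greater
 have "((%s. s powr a) hrd a * (<|s|> powr (a - 2) * s)) (at s)"
  using greater powr_add[of s "a - 2" 1] by (auto intro!: derivative_eq_intros simp: diff_diff_eq)
 then show ?thesis
  by (rule has_field_derivative_transform_within_open[of _ _ _ "{0<..}"]) (use greater in auto)
next
 case equal
 have "((%h::real. <|h|> powr (a - 1)) \<longlongrightarrow> <|0|> powr (a - 1)) (at 0)"
  by (intro tendsto_intros tendsto_powr2) (use assms in \<open>auto simp: eventually_at_filter\<close>)
 then have l: "((%h::real. <|h|> powr (a - 1)) \<longlongrightarrow> 0) (at 0)" using assms by simp
 have "((%h. (<|h|> powr a) / h) \<longlongrightarrow> 0) (at 0)"
 proof (rule tendsto_0_le[OF l, of _ 1])
  show "\<forall>\<^sub>F x in at 0. norm (<|x|> powr a / x) <= norm (<|x|> powr (a - 1)) * 1" for x :: real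
   using powr_add[of "<|x|>" "a - 1" 1 for x]
   by (auto simp: eventually_at_filter abs_mult field_simps)
 qed
 then show ?thesis using equal assms by (simp add: DERIV_def)
qed

lemma continuous_on_abs_powr:
 fixes a :: real assumes "0 < a" "CO S f"
 shows "CO S (%z. <|f z|> powr a)"
 by (intro continuous_on_powr' continuous_intros assms) (use assms in auto)

lemma continuous_on_powr_sgn:
 fixes a :: real and f :: "'a::topological_space => real"
 assumes "0 < a" "CO S f"
 shows "CO S (%z. <|f z|> powr (a - 1) * f z)"
proof -
 \<comment> \<open>Writing the function as a difference of powers of positive and negative part
   avoids the factor \<open>powr (a - 1)\<close>, which is singular at 0 when
   \<open>a < 1\<close>.\<close>
 have *: "<|x|> powr (a - 1) * x = (max 0 x) powr a - (max 0 (-x)) powr a" for x :: real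
 proof (cases x "0::real" rule: linorder_cases)
  case less then show ?thesis using assms powr_add[of "-x" "a - 1" 1] by (auto simp: max_def)
 next
  case greater then show ?thesis using assms powr_add[of x "a - 1" 1] by (auto simp: max_def)
 qed (use assms in auto)
 show ?thesis unfolding *
  by (intro continuous_intros continuous_on_powr' assms) (use assms in auto)
qed

lemma nn_integral_dilate:
 fixes g :: "real \<times> real => ennreal"
 assumes [measurable]: "g \<in> BB" and s: "0 < s"
 shows "(NN z. g (s *\<^sub>R z)) = EE (1 / s^2) * (NN z. g z)"
proof -
 have "(NN z. g z) = (\<integral>\<^sup>+z. g z \<partial>density (distr lborel borel (%x. 0 + s *\<^sub>R x)) (%_. <|s|> ^ DIM(real \<times> real)))"
  using lborel_affine[of s "0::real \<times> real"] s by simp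
 also have "... = EE (s^2) * (NN z. g (s *\<^sub>R z))"
  using s by (simp add: nn_integral_density nn_integral_distr nn_integral_cmult power2_eq_square)
 finally have I: "(NN z. g z) = EE (s^2) * (NN z. g (s *\<^sub>R z))" .
 have "EE (1 / s^2) * EE (s^2) = 1"
  using s by (subst ennreal_mult[symmetric]) auto
 then show ?thesis unfolding I by (simp add: mult.assoc[symmetric])
qed

lemma nn_integral_compact_continuous:
 fixes f :: "'a::euclidean_space => real"
 assumes "compact S" "CO S f" "!!s. s \<in> S ==> 0 <= f s"
 shows "(NN s. EE (f s) * ind S s) = EE (integral S f)"
proof -
 have si: "set_integrable lborel S f"
  unfolding set_integrable_def by (rule borel_integrable_compact[OF assms(1,2)])
 have "(NN s. EE (f s) * ind S s) = (NN s. EE (ind S s *\<^sub>R f s))"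
  by (intro nn_integral_cong) (auto simp: indicator_def)
 also have "... = EE (LL s. ind S s *\<^sub>R f s)"
  by (rule nn_integral_eq_integral) (use si assms in \<open>auto simp: set_integrable_def indicator_def\<close>)
 also have "... = EE (integral S f)"
  using set_borel_integral_eq_integral(2)[OF si] by (simp add: set_lebesgue_integral_def)
 finally show ?thesis .
qed

text \<open>Cauchy-Schwarz read off from a nonnegative variance: subtract the mean \<open>m\<close>
  and integrate the square.\<close>

lemma integral_sq_le:
 fixes k :: "real => real"
 assumes k: "CO {a..b} k" and ab: "a < b" and F: "(k has_integral F) {a..b}"
 shows "F^2 <= (b - a) * integral {a..b} (%s. (k s)^2)"
proof -
 define m where "m = F / (b - a)"
 have i2: "(%s. (k s)^2) integrable_on {a..b}"
  by (intro integrable_continuous_interval continuous_intros k)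
 have "((%s. (k s)^2 - (2 * m) * k s + m^2) has_integral
   (integral {a..b} (%s. (k s)^2) - (2 * m) * F + (b - a) * m^2)) {a..b}"
  using ab by (intro has_integral_add has_integral_diff has_integral_mult_right F integrable_integral i2)
   (use has_integral_const_real[of "m^2" a b] in auto)
 then have "0 <= integral {a..b} (%s. (k s)^2) - (2 * m) * F + (b - a) * m^2"
  by (rule has_integral_nonneg) (use zero_le_power2[of "k s - m" for s] in \<open>auto simp: power2_diff algebra_simps\<close>)
 also have "... = integral {a..b} (%s. (k s)^2) - F^2 / (b - a)"
 proof -
  define d where "d = b - a"
  have "d ~= 0" using ab by (simp add: d_def)
  then show ?thesis unfolding m_def d_def[symmetric] by (simp add: field_simps power2_eq_square)
 qed
 finally show ?thesis using ab by (simp add: field_simps)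
qed

text \<open>Integrate the radial derivative along the ray from \<open>(x, y)\<close> to
  \<open>4 (x, y)\<close>. The interval has length 3 and the square of a sum costs 2, hence the
  6.\<close>

lemma dilate_diff_sq:
 fixes w wx wy :: "real => real => real"
 assumes dw: "!!x y. ((%z. w $$ z) has_derivative (%h. fst h * wx x y + snd h * wy x y)) (at (x,y))"
  and c: "CO UNIV (%z. wx $$ z)" "CO UNIV (%z. wy $$ z)"
 shows "(w x y)^2 <= 2 * (w (4*x) (4*y))^2 + 6 * integral {1..4} (%s. (x^2+y^2) * ((wx (s*x) (s*y))^2 + (wy (s*x) (s*y))^2))"
proof -
 define k where "k = (%s. x * wx (s*x) (s*y) + y * wy (s*x) (s*y))"
 have cw: "CO S (%s. wx (s*x) (s*y))" "CO S (%s. wy (s*x) (s*y))" for S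
 proof -
  have "CO S (%s. (s*x, s*y))" by (intro continuous_intros)
  then show "CO S (%s. wx (s*x) (s*y))" "CO S (%s. wy (s*x) (s*y))"
   using continuous_on_compose2[OF c(1), of S "%s. (s*x, s*y)"] continuous_on_compose2[OF c(2), of S "%s. (s*x, s*y)"]
   by auto
 qed
 have ck: "CO {1..4} k" unfolding k_def by (intro continuous_intros cw)
 have "(k has_integral (w (4*x) (4*y) - w (1*x) (1*y))) {1..4}"
 proof (rule fundamental_theorem_of_calculus)
  fix s :: real assume "s \<in> {1..4}"
  have "((%s. (s*x, s*y)) has_derivative (%h. (h*x, h*y))) (at s within {1..4})"
   by (auto intro!: derivative_eq_intros)
  from has_derivative_compose[OF this dw[of "s*x" "s*y"]]
  have "((%s. w (s*x) (s*y)) has_derivative (%h. h * x * wx (s*x) (s*y) + h * y * wy (s*x) (s*y))) (at s within {1..4})"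
   by simp
  then show "((%s. w (s*x) (s*y)) has_vector_derivative k s) (at s within {1..4})"
   unfolding has_vector_derivative_def k_def by (simp add: algebra_simps)
 qed auto
 from integral_sq_le[OF ck _ this] have 1: "(w (4*x) (4*y) - w x y)^2 <= 3 * integral {1..4} (%s. (k s)^2)" by simp
 have "integral {1..4} (%s. (k s)^2) <= integral {1..4} (%s. (x^2+y^2) * ((wx (s*x) (s*y))^2 + (wy (s*x) (s*y))^2))"
 proof (rule integral_le)
  fix s
  have "(x * a + y * b)^2 <= (x^2+y^2) * (a^2 + b^2)" for a b :: real
   using zero_le_power2[of "x * b - y * a"] by (simp add: power2_eq_square algebra_simps)
  then show "(k s)^2 <= (x^2+y^2) * ((wx (s*x) (s*y))^2 + (wy (s*x) (s*y))^2)"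
   unfolding k_def .
 qed (intro integrable_continuous_interval continuous_intros cw ck)+
 moreover have "(w x y)^2 <= 2 * (w (4*x) (4*y))^2 + 2 * (w (4*x) (4*y) - w x y)^2"
 proof -
  have "a^2 <= 2 * b^2 + 2 * (b - a)^2" for a b :: real
   using zero_le_power2[of "2 * b - a"] by (simp add: power2_eq_square algebra_simps)
  then show ?thesis .
 qed
 ultimately show ?thesis using 1 by linarith
qed

lemma measurable_pair_cont:
 "CO UNIV (%z. f $$ z) ==> (%z::real\<times>real. f $$ z :: real) \<in> BB"
 by (rule borel_measurable_continuous_onI)

text \<open>Iterating \<open>u(x) - u(4x)\<close> replaces a boundary term at infinity by the mild growth
 allowed by \<open>L\<^sup>p\<^sup>+\<^sup>1\<close>.\<close>
lemma hardy_2d: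
 fixes w wx wy :: "real => real => real"
 assumes dw: "!!x y. ((%z. w $$ z) has_derivative (%h. fst h * wx x y + snd h * wy x y)) (at (x,y))"
  and c: "CO UNIV (%z. wx $$ z)" "CO UNIV (%z. wy $$ z)"
  and p: "1 < p" "p <= 5" and D: "0 <= D"
  and g: "(NN z. EE (((fst z)^2+(snd z)^2) * ((wx $$ z)^2 + (wy $$ z)^2))) <= EE D"
  and K: "(NN z. EE (<|w $$ z|> powr (p+1))) < \<infinity>"
 shows "(NN z. EE ((w $$ z)^2)) <= EE (21 * D)"
proof -
 have cw: "CO UNIV (%z. w $$ z)"
 proof (rule continuous_at_imp_continuous_on, rule ballI)
  fix z :: "real \<times> real"
  show "isCont (%z. w $$ z) z" using has_derivative_continuous[OF dw[of "fst z" "snd z"]] by simp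
 qed
 define W where "W = (%z. (w $$ z)^2)"
 define G where "G = (%z. ((fst z)^2+(snd z)^2) * ((wx $$ z)^2 + (wy $$ z)^2))"
 note [measurable] = measurable_pair_cont[OF cw] measurable_pair_cont[OF c(1)] measurable_pair_cont[OF c(2)]
 have cWU: "CO S W" for S
  unfolding W_def by (intro continuous_intros continuous_on_subset[OF cw]) auto
 have [measurable]: "W \<in> BB" "G \<in> BB"
  unfolding W_def G_def by (intro borel_measurable_continuous_onI continuous_intros c cw)+
 have G0: "0 <= G z" for z by (simp add: G_def)
 have gG: "(NN z. EE (G z)) <= EE D" using g by (simp add: G_def)
 define a where "a = (%R. (NN z. EE (W z) * ind (sq_box R) z))"
 have afin: "a R < \<infinity>" for R
 proof -
  have "integrable lborel (%z. ind (sq_box R) z *\<^sub>R W z)"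
   by (rule borel_integrable_compact) (auto intro: cWU)
  then have "(NN z. EE (norm (ind (sq_box R) z *\<^sub>R W z))) < \<infinity>"
   by (simp add: integrable_iff_bounded)
  also have "(NN z. EE (norm (ind (sq_box R) z *\<^sub>R W z))) = a R"
   unfolding a_def by (intro nn_integral_cong) (auto simp: W_def indicator_def)
  finally show ?thesis .
 qed
 \<comment> \<open>The dilation by 4 contributes \<open>1/16\<close> in the plane, doubled to
   \<open>1/8\<close>; \<open>18 = 6 * 3\<close>, since each \<open>s\<close> in
   \<open>{1..4}\<close> contributes at most \<open>D\<close>. The ratio 4 is large enough for the
   factor \<open>1/8\<close> to beat the growth \<open>4 powr (4/3)\<close> below; a ratio of 2
   would leave the factor \<open>1/2\<close> against \<open>2 powr (4/3)\<close>.\<close>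
 have step: "a R <= EE (1/8) * a (4 * R) + EE (18 * D)" if R: "0 < R" for R
 proof -
  have pt: "EE (W z) <= 2 * EE (W (4 *\<^sub>R z)) + 6 * (NN s. EE (1/s^2 * G (s *\<^sub>R z)) * ind {1..4} s)" for z
  proof -
   obtain x y where z: "z = (x,y)" by (cases z)
   have cc: "CO {1..4} (%s. (x^2+y^2) * ((wx (s*x) (s*y))^2 + (wy (s*x) (s*y))^2))"
   proof -
    have "CO {1..4} (%s. (s*x, s*y))" by (intro continuous_intros)
    then have "CO {1..4} (%s. wx (s*x) (s*y))" "CO {1..4} (%s. wy (s*x) (s*y))"
     using continuous_on_compose2[OF c(1), of "{1..4}" "%s. (s*x, s*y)"] continuous_on_compose2[OF c(2), of "{1..4}" "%s. (s*x, s*y)"]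
     by auto
    then show ?thesis by (intro continuous_intros)
   qed
   let ?I = "integral {1..4} (%s. (x^2+y^2) * ((wx (s*x) (s*y))^2 + (wy (s*x) (s*y))^2))"
   have eq: "(x^2+y^2) * ((wx (s*x) (s*y))^2 + (wy (s*x) (s*y))^2) = 1/s^2 * G (s *\<^sub>R z)" if "s \<in> {1..4}" for s
    using that unfolding G_def z by (simp add: power_mult_distrib field_simps)
   have "(NN s. EE (1/s^2 * G (s *\<^sub>R z)) * ind {1..4} s) =
    (NN s. EE ((x^2+y^2) * ((wx (s*x) (s*y))^2 + (wy (s*x) (s*y))^2)) * ind {1..4} s)"
    by (intro nn_integral_cong) (use eq in \<open>auto simp: indicator_def\<close>)
   also have "... = ennreal ?I"
    by (rule nn_integral_compact_continuous[OF _ cc]) auto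
   finally have I: "(NN s. EE (1/s^2 * G (s *\<^sub>R z)) * ind {1..4} s) = ennreal ?I" .
   have I0: "0 <= ?I" by (rule integral_nonneg[OF integrable_continuous_interval[OF cc]]) auto
   have "EE (W z) <= EE (2 * W (4 *\<^sub>R z) + 6 * ?I)"
    using dilate_diff_sq[OF dw c, of x y] unfolding z W_def by (intro ennreal_leI) simp
   also have "... = 2 * EE (W (4 *\<^sub>R z)) + 6 * ennreal ?I"
    using I0 by (simp add: ennreal_plus ennreal_mult W_def)
   finally show ?thesis unfolding I .
  qed
  have m1: "(%(z,s). EE (1/s^2 * G (s *\<^sub>R z)) * ind {1..4} s) \<in> borel_measurable (lborel \<Otimes>\<^sub>M lborel)"
   by measurable
  have "a R <= (NN z. (2 * EE (W (4 *\<^sub>R z)) + 6 * (NN s. EE (1/s^2 * G (s *\<^sub>R z)) * ind {1..4} s)) * ind (sq_box R) z)"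
   unfolding a_def by (intro nn_integral_mono mult_right_mono pt) auto
  also have "... <= (NN z. 2 * (EE (W (4 *\<^sub>R z)) * ind (sq_box (4*R)) (4 *\<^sub>R z)) + 6 * (NN s. EE (1/s^2 * G (s *\<^sub>R z)) * ind {1..4} s))"
   by (intro nn_integral_mono) (auto simp: indicator_def in_sq_box split: if_splits)
  also have "... = (NN z. 2 * (EE (W (4 *\<^sub>R z)) * ind (sq_box (4*R)) (4 *\<^sub>R z))) + (NN z. 6 * (NN s. EE (1/s^2 * G (s *\<^sub>R z)) * ind {1..4} s))"
   by (intro nn_integral_add) (auto intro!: borel_measurable_times_ennreal lborel.borel_measurable_nn_integral[of _ lborel, unfolded case_prod_beta'] m1[unfolded case_prod_beta'])
  also have "... = 2 * (NN z. (EE (W (4 *\<^sub>R z)) * ind (sq_box (4*R)) (4 *\<^sub>R z))) + 6 * (NN z. (NN s. EE (1/s^2 * G (s *\<^sub>R z)) * ind {1..4} s))"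
   by (intro arg_cong2[where f="(+)"] nn_integral_cmult) (auto intro!: lborel.borel_measurable_nn_integral[of _ lborel, unfolded case_prod_beta'] m1[unfolded case_prod_beta'])
  also have "(NN z. (EE (W (4 *\<^sub>R z)) * ind (sq_box (4*R)) (4 *\<^sub>R z))) = EE (1/16) * a (4*R)"
   unfolding a_def by (subst nn_integral_dilate[of "%z. EE (W z) * ind (sq_box (4*R)) z" 4]) auto
  also have "(NN z. (NN s. EE (1/s^2 * G (s *\<^sub>R z)) * ind {1..4} s)) =
   (NN s. (NN z. EE (1/s^2 * G (s *\<^sub>R z)) * ind {1..4} s))"
   by (rule lborel_pair.Fubini'[symmetric]) (use m1 in \<open>simp add: lborel_prod\<close>)
  also have "... <= (NN s. EE D * ind {1..4} (s::real))"
  proof (intro nn_integral_mono)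
   fix s :: real
   show "(NN z. EE (1/s^2 * G (s *\<^sub>R z)) * ind {1..4} s) <= EE D * ind {1..4} s"
   proof (cases "s \<in> {1..4}")
    case True
    then have s: "1 <= s" by simp
    have "(NN z. EE (1/s^2 * G (s *\<^sub>R z))) = (NN z. EE (1/s^2) * EE (G (s *\<^sub>R z)))"
     by (intro nn_integral_cong ennreal_mult'' G0)
    also have "... = EE (1/s^2) * (EE (1/s^2) * (NN z. EE (G z)))"
     using s by (subst nn_integral_cmult, measurable) (simp add: nn_integral_dilate[of "%z. EE (G z)" s])
    also have "... <= EE 1 * (EE 1 * EE D)"
     using s gG by (intro mult_mono ennreal_leI) (auto simp: divide_le_eq one_le_power)
    finally show ?thesis using True by simp
   qed auto
  qed
  also have "... = EE D * 3" by (simp add: nn_integral_cmult)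
  also have "2 * (EE (1/16) * a (4*R)) + 6 * (EE D * 3) = EE (1/8) * a (4*R) + EE (18*D)"
  proof -
   obtain r where r: "a (4*R) = EE r" "0 <= r" using afin[of "4*R"] by (cases "a (4*R)") auto
   show ?thesis unfolding r(1) ennreal_numeral[symmetric]
    using r(2) D by (simp add: ennreal_mult'[symmetric] ennreal_plus[symmetric] del: ennreal_plus ennreal_numeral)
  qed
  finally show ?thesis by (simp add: add_mono mult_left_mono)
 qed
 define A where "A = (%R. enn2real (a R))"
 have A: "a R = EE (A R)" for R using afin[of R] by (simp add: A_def)
 have A0: "0 <= A R" for R by (simp add: A_def)
 have stepA: "A R <= A (4*R) / 8 + 18 * D" if "0 < R" for R
 proof -
  have "EE (A R) <= EE (A (4*R) / 8 + 18 * D)"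
   using step[OF that] A0 D unfolding A by (simp add: ennreal_mult'[symmetric] ennreal_plus[symmetric] del: ennreal_plus)
  then show ?thesis using A0 D by (simp add: ennreal_le_iff del: ennreal_plus)
 qed
 \<comment> \<open>\<open>144/7 * D\<close> is the fixed point of the recursion
   \<open>A = A / 8 + 18 * D\<close>, so the deviation from it contracts by 8 per step.\<close>
 have iter: "A R - 144/7 * D <= (A (4^k * R) - 144/7 * D) / 8^k" if "0 < R" for R k
 proof (induction k)
  case (Suc k)
  have "A (4^k * R) - 144/7 * D <= (A (4^(Suc k) * R) - 144/7 * D) / 8"
   using stepA[of "4^k * R"] that by (simp add: mult.assoc field_simps)
  then have "(A (4^k * R) - 144/7 * D) / 8^k <= (A (4^(Suc k) * R) - 144/7 * D) / 8 / 8^k"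
   by (rule divide_right_mono) auto
  also have "(A (4^(Suc k) * R) - 144/7 * D) / 8 / 8^k = (A (4^(Suc k) * R) - 144/7 * D) / 8^(Suc k)"
   by (simp only: divide_divide_eq_left power_Suc)
  finally show ?case using Suc by linarith
 qed auto
 obtain k0 where k0: "(NN z. EE (<|w $$ z|> powr (p+1))) = EE k0" "0 <= k0"
  using K by (cases "(NN z. EE (<|w $$ z|> powr (p+1)))") auto
 \<comment> \<open>Values below the height \<open>M\<close> are paid for by the area of the box,
   values above it by the \<open>p + 1\<close> integral. The choice of \<open>M\<close> makes both
   contributions \<open>S powr (2 * (p - 1) / (p + 1))\<close>, and this exponent is at most
   \<open>4/3\<close> because \<open>p <= 5\<close>.\<close>
 have grow: "A S <= (4 + k0) * S powr (4/3)" if S: "1 <= S" for S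
 proof -
  define M where "M = S powr (-2/(p+1))"
  have M: "0 < M" using S by (simp add: M_def)
  have pt: "W z <= M^2 + M powr (1-p) * <|w $$ z|> powr (p+1)" for z
  proof (cases "<|w $$ z|> <= M")
   case True
   then have "W z <= M^2" unfolding W_def by (metis abs_le_square_iff abs_of_pos M)
   then show ?thesis using M by (simp add: add_increasing2)
  next
   case False
   define v where "v = <|w $$ z|>"
   have v: "M < v" using False v_def by simp
   have "v^2 = v powr (1-p) * v powr (p+1)"
    using v M by (simp add: powr_add[symmetric] powr_numeral)
   also have "... <= M powr (1-p) * v powr (p+1)"
    using v M p by (intro mult_right_mono powr_mono2') auto
   finally show ?thesis using M unfolding W_def v_def by (simp add: add_increasing)
  qed
  have "a S <= (NN z. (EE (M^2) * ind (sq_box S) z + EE (M powr (1-p)) * EE (<|w $$ z|> powr (p+1))))"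
   unfolding a_def
  proof (intro nn_integral_mono)
   fix z
   have "EE (W z) <= EE (M^2) + EE (M powr (1-p)) * EE (<|w $$ z|> powr (p+1))"
    using ennreal_leI[OF pt[of z]] M by (simp add: ennreal_plus ennreal_mult)
   then show "EE (W z) * ind (sq_box S) z <= EE (M^2) * ind (sq_box S) z + EE (M powr (1-p)) * EE (<|w $$ z|> powr (p+1))"
    by (auto simp: indicator_def)
  qed
  also have "... = EE (M^2) * emeasure lborel (sq_box S) + EE (M powr (1-p)) * EE k0"
   by (subst nn_integral_add, simp, simp, subst nn_integral_cmult, simp, subst nn_integral_cmult, simp, simp add: k0)
  also have "emeasure lborel (sq_box S) = EE (4 * S^2)"
   using S by (simp add: emeasure_lborel_cbox_eq Basis_prod_def prod.union_disjoint power2_eq_square)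
  also have "EE (M^2) * EE (4 * S^2) + EE (M powr (1-p)) * EE k0 = EE (M^2 * (4 * S^2) + M powr (1-p) * k0)"
   using M S k0 by (simp add: ennreal_mult ennreal_plus)
  finally have "A S <= M^2 * (4 * S^2) + M powr (1-p) * k0"
   unfolding A using M S k0 by (simp add: ennreal_le_iff del: ennreal_plus)
  also have "M^2 * (4*S^2) = 4 * S powr (2*(p-1)/(p+1))"
  proof -
   have "2 + - (2 / (p+1)) + - (2/(p+1)) = 2*(p-1)/(p+1)"
   proof -
    have "2*(p-1)/(p+1) = (2*(p+1) - 4)/(p+1)" by (simp add: algebra_simps)
    also have "... = 2*(p+1)/(p+1) - 4/(p+1)" by (rule diff_divide_distrib)
    also have "... = 2 - 4/(p+1)" using p nonzero_mult_div_cancel_right[of "p+1" 2] by linarith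
    finally show ?thesis by simp
   qed
   moreover have "M^2 * S^2 = S powr 2 * S powr (- (2/(p+1))) * S powr (- (2/(p+1)))"
    using S by (simp add: M_def power2_eq_square powr_numeral mult_ac)
   ultimately have "M^2 * S^2 = S powr (2*(p-1)/(p+1))" by (simp only: powr_add[symmetric])
   then show ?thesis by simp
  qed
  also have "M powr (1-p) = S powr (2*(p-1)/(p+1))"
  proof -
   have "-2/(p+1) * (1-p) = (2*(p-1))/(p+1)"
    unfolding times_divide_eq_left by (simp add: algebra_simps)
   then show ?thesis unfolding M_def powr_powr by simp
  qed
  also have "4 * S powr (2*(p-1)/(p+1)) + S powr (2*(p-1)/(p+1)) * k0 = (4 + k0) * S powr (2*(p-1)/(p+1))"
   by (simp add: algebra_simps)
  also have "... <= (4 + k0) * S powr (4/3)"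
   using S p k0 by (intro mult_left_mono powr_mono) (auto simp: field_simps)
  finally show ?thesis .
 qed
 have AR: "A (real (Suc n)) <= 144/7 * D" for n
 proof -
  let ?R = "real (Suc n)"
  \<comment> \<open>\<open>q\<close> is growth against contraction per iteration;
    \<open>q < 1\<close> since \<open>4 powr (4/3) = 2 powr (8/3)\<close> is below 8.\<close>
  define q where "q = (4::real) powr (4/3) / 8"
  have q: "0 < q" "q < 1"
  proof -
   have "(4::real) powr (4/3) = 2 powr (8/3)"
    using powr_powr[of 2 2 "4/3"] by (simp add: powr_numeral)
   also have "... < 2 powr 3" by (intro powr_less_mono) auto
   finally show "q < 1" by (simp add: q_def powr_numeral)
  qed (simp add: q_def)
  have "A ?R - 144/7 * D <= (4 + k0) * ?R powr (4/3) * q^k" for k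
  proof -
   have "A ?R - 144/7 * D <= (A (4^k * ?R) - 144/7 * D) / 8^k" by (rule iter) simp
   also have "... <= A (4^k * ?R) / 8^k" using D by (intro divide_right_mono) auto
   also have "... <= (4 + k0) * (4^k * ?R) powr (4/3) / 8^k"
    by (intro divide_right_mono grow) (auto simp: mult_ge1_I simp del: of_nat_Suc intro!: mult_ge1_I)
   also have "(4^k * ?R) powr (4/3) = (4 powr (4/3))^k * ?R powr (4/3)"
    by (simp add: powr_mult powr_realpow[symmetric] powr_powr mult.commute)
   also have "(4 + k0) * ((4 powr (4/3))^k * ?R powr (4/3)) / 8^k = (4 + k0) * ?R powr (4/3) * q^k"
    by (simp add: q_def power_divide mult_ac)
   finally show ?thesis .
  qed
  moreover have "(%k. (4 + k0) * ?R powr (4/3) * q^k) ----> (4 + k0) * ?R powr (4/3) * 0"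
   by (intro tendsto_intros LIMSEQ_realpow_zero) (use q in auto)
  ultimately have "A ?R - 144/7 * D <= (4 + k0) * ?R powr (4/3) * 0"
   by (intro LIMSEQ_le_const) auto
  then show ?thesis by simp
 qed
 have "(NN z. EE (W z)) <= EE (144/7 * D)"
 proof (rule nn_integral_le_of_tendsto[where f="%n z. EE (W z) * ind (sq_box (real (Suc n))) z"])
  fix z :: "real \<times> real"
  have "eventually (%n. z \<in> sq_box (real (Suc n))) sequentially"
  proof -
   obtain N :: nat where "<|fst z|> + <|snd z|> <= real N" using real_arch_simple by blast
   then show ?thesis unfolding in_sq_box by (intro eventually_sequentiallyI[of N]) auto
  qed
  then show "(%n. EE (W z) * ind (sq_box (real (Suc n))) z) ----> EE (W z)"
   by (intro tendsto_eventually) (auto elim: eventually_mono)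
  show "eventually (%n. (NN z. EE (W z) * ind (sq_box (real (Suc n))) z) <= (%_. EE (144/7 * D)) n) sequentially"
   using ennreal_leI[OF AR, folded A] unfolding a_def by (intro always_eventually) simp
 qed auto
 also have "... <= EE (21 * D)" using D by (intro ennreal_leI) auto
 finally show ?thesis by (simp add: W_def)
qed

subsection \<open>Weighted null currents and decay of the potential energy\<close>

text \<open>With \<open>c^2 <= 4 P Q\<close> the flux \<open>(s (Q - P), c)\<close> has squared
  length at most \<open>(Q - P)^2 + 4 P Q = (P + Q)^2\<close>, that is, it is no longer than the
  density.\<close>

lemma causal_PQ:
 fixes P Q c v w :: real
 assumes "0 <= P" "0 <= Q" "c^2 <= 4 * P * Q" "v^2 + w^2 <= 1" "s^2 = 1"
 shows "v * (s * (Q - P)) + w * c <= P + Q"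
proof -
 have "(v * (s * (Q - P)) + w * c)^2 <= (v^2 + w^2) * ((s * (Q - P))^2 + c^2)"
  using zero_le_power2[of "v * c - w * (s * (Q - P))"] by (simp add: power2_eq_square algebra_simps)
 also have "... <= 1 * ((s * (Q - P))^2 + c^2)"
  by (intro mult_right_mono assms) auto
 also have "... <= (P + Q)^2"
  using assms(3,5) by (simp add: power_mult_distrib) (simp add: power2_eq_square algebra_simps)
 finally show ?thesis using assms(1,2) by (simp add: power2_le_iff_abs_le abs_le_iff)
qed

text \<open>The equation with every first and second partial derivative as a named function of
  \<open>(t, x, y)\<close>; \<open>utx\<close>, \<open>uty\<close> and \<open>uxy\<close> serve for
  both orders of differentiation. \<open>dux_joint\<close> gives in addition the joint spatial
  derivative, which differentiation along rays and composition with cutoffs require.\<close>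

locale nlw =
 fixes p :: real and u ut ux uy utt utx uty uxx uxy uyy :: "real => real => real => real"
 assumes p1: "1 < p" and p5: "p <= 5"
  and du: "!!t x y. ((%s. u s x y) hrd ut t x y) (at t)"
   "!!t x y. ((%s. u t s y) hrd ux t x y) (at x)"
   "!!t x y. ((%s. u t x s) hrd uy t x y) (at y)"
  and dut: "!!t x y. ((%s. ut s x y) hrd utt t x y) (at t)"
   "!!t x y. ((%s. ut t s y) hrd utx t x y) (at x)"
   "!!t x y. ((%s. ut t x s) hrd uty t x y) (at y)"
  and dux: "!!t x y. ((%s. ux s x y) hrd utx t x y) (at t)"
   "!!t x y. ((%s. ux t s y) hrd uxx t x y) (at x)"
   "!!t x y. ((%s. ux t x s) hrd uxy t x y) (at y)"
  and duy: "!!t x y. ((%s. uy s x y) hrd uty t x y) (at t)"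
   "!!t x y. ((%s. uy t s y) hrd uxy t x y) (at x)"
   "!!t x y. ((%s. uy t x s) hrd uyy t x y) (at y)"
  and dux_joint: "!!t x y. ((%z. u t $$ z) has_derivative (%h. fst h * ux t x y + snd h * uy t x y)) (at (x,y))"
  and cont: "cont3 u" "cont3 ut" "cont3 ux" "cont3 uy" "cont3 utt" "cont3 utx" "cont3 uty" "cont3 uxx" "cont3 uxy" "cont3 uyy"
  and eq: "!!t x y. utt t x y = uxx t x y + uyy t x y - <|u t x y|> powr (p - 1) * u t x y"
begin

definition V where "V t x y = <|u t x y|> powr (p + 1) / (p + 1)"
definition N where "N t x y = <|u t x y|> powr (p - 1) * u t x y"

lemma V_nonneg: "0 <= V t x y" using p1 by (simp add: V_def)

text \<open>This identity turns the coefficient 6 in the null divergence into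
  \<open>6 - (p + 1) = 5 - p\<close>.\<close>

lemma Nu: "N t x y * u t x y = (p + 1) * V t x y"
proof (cases "u t x y = 0")
 case False
 then have "<|u t x y|> powr (p + 1) = <|u t x y|> powr (p - 1) * <|u t x y|>^2"
  using powr_add[of "<|u t x y|>" "p - 1" 2] by (simp add: powr_numeral add.commute)
 then show ?thesis using p1 by (simp add: V_def N_def power2_eq_square)
qed (use p1 in \<open>auto simp: V_def N_def\<close>)

lemma dV0: "((%s. <|s|> powr (p + 1) / (p + 1)) hrd <|s|> powr (p - 1) * s) (at s)"
 by (rule DERIV_cong[OF DERIV_cdivide[OF abs_powr_deriv]]) (use p1 in auto)

lemma dV: "((%s. V s x y) hrd N t x y * ut t x y) (at t)"
   "((%s. V t s y) hrd N t x y * ux t x y) (at x)"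
   "((%s. V t x s) hrd N t x y * uy t x y) (at y)"
 unfolding V_def N_def
 by (rule DERIV_chain2[OF dV0 du(1)] DERIV_chain2[OF dV0 du(2)] DERIV_chain2[OF dV0 du(3)])+

lemma contV: "cont3 V"
 unfolding V_def cont3_def
 by (intro continuous_intros continuous_on_abs_powr cont3_comp[OF cont(1)]) (use p1 in auto)

lemma contN: "cont3 N"
 unfolding N_def cont3_def
 using continuous_on_powr_sgn[of p UNIV "%z. u (fst z) (fst (snd z)) (snd (snd z))"] p1 cont(1)
 by (simp add: cont3_def)

text \<open>For \<open>s = 1\<close> and \<open>s = -1\<close> together, \<open>A\<close> and
  \<open>B\<close> recombine to the rotation, boost and scaling derivatives about the time origin
  \<open>-1\<close>. The undifferentiated \<open>u\<close> in \<open>B\<close> is the lower order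
  correction of the conformal multiplier. \<open>P\<close> and \<open>Q\<close> are the two null
  components of the resulting energy density.\<close>

definition A where "A s t x y = y * (ut t x y + s * ux t x y) + (1 + t - s * x) * uy t x y"
definition B where "B s t x y = (1 + t - s * x) * (ut t x y - s * ux t x y) + y * uy t x y + u t x y"
definition P where "P s t x y = (A s t x y)^2 / 2 + (1 + t - s * x)^2 * V t x y"
definition Q where "Q s t x y = (B s t x y)^2 / 2 + y^2 * V t x y"
definition En where "En t x y = ((ut t x y)^2 + (ux t x y)^2 + (uy t x y)^2) / 2 + V t x y"

lemma PQ_nonneg: "0 <= P s t x y" "0 <= Q s t x y"
 using V_nonneg by (auto simp: P_def Q_def)

lemma En_nonneg: "0 <= En t x y" using V_nonneg by (simp add: En_def)

lemma energy_current: "is_current En (%t x y. - ut t x y * ux t x y) (%t x y. - ut t x y * uy t x y) (%_ _ _. 0)"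
proof (rule is_currentI)
 fix t x y
 show "((%s. En s x y) hrd ut t x y * utt t x y + ux t x y * utx t x y + uy t x y * uty t x y + N t x y * ut t x y) (at t)"
  unfolding En_def by (auto intro!: derivative_eq_intros du dut dux duy dV simp: algebra_simps)
 show "((%s. - ut t s y * ux t s y) hrd - utx t x y * ux t x y - ut t x y * uxx t x y) (at x)"
  by (auto intro!: derivative_eq_intros dut dux)
 show "((%s. - ut t x s * uy t x s) hrd - uty t x y * uy t x y - ut t x y * uyy t x y) (at y)"
  by (auto intro!: derivative_eq_intros dut duy)
 show "ut t x y * utt t x y + ux t x y * utx t x y + uy t x y * uty t x y + N t x y * ut t x y +
   (- utx t x y * ux t x y - ut t x y * uxx t x y) + (- uty t x y * uy t x y - ut t x y * uyy t x y) = 0"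
  unfolding eq N_def[symmetric] by (simp add: algebra_simps)
qed (unfold cont3_def En_def, (intro continuous_intros cont3_comp[OF contV] cont3_comp[OF contN] cont3_comp[OF cont(2)] cont3_comp[OF cont(3)]
  cont3_comp[OF cont(4)] cont3_comp[OF cont(5)] cont3_comp[OF cont(6)] cont3_comp[OF cont(7)] cont3_comp[OF cont(8)] cont3_comp[OF cont(10)]; simp)+)

lemma energy_causal:
 assumes "v^2 + w^2 <= 1"
 shows "v * (- ut t x y * ux t x y) + w * (- ut t x y * uy t x y) <= En t x y"
proof -
 define a b c where "a = ut t x y" "b = ux t x y" "c = uy t x y"
 have "(v * b + w * c)^2 <= (v^2 + w^2) * (b^2 + c^2)"
  using zero_le_power2[of "v * c - w * b"] by (simp add: power2_eq_square algebra_simps)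
 also have "... <= 1 * (b^2 + c^2)" by (intro mult_right_mono assms) auto
 finally have "0 <= a^2 + 2 * a * (v * b + w * c) + (b^2 + c^2)"
  using zero_le_power2[of "a + (v * b + w * c)"] by (simp add: power2_sum)
 then have "0 <= (a^2 + 2 * a * (v * b + w * c) + (b^2 + c^2)) / 2" by simp
 then show ?thesis using V_nonneg[of t x y]
  unfolding En_def a_b_c_def[symmetric] by (simp add: algebra_simps add_divide_distrib)
qed

text \<open>With \<open>L = \<partial>\<^sub>t + s \<partial>\<^sub>x\<close> and \<open>L' = \<partial>\<^sub>t - s \<partial>\<^sub>x\<close> the equation becomes the symmetric
 system \<open>L' A = \<partial>\<^sub>y B - y N\<close>, \<open>L B = \<partial>\<^sub>y A - U N\<close>, where \<open>U = 1 + t - s x\<close>: this is the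
 multiplier given by the conformal Killing field of the null direction \<open>L\<close>.\<close>
lemma null_current:
 assumes s: "s^2 = 1"
 shows "is_current (%t x y. P s t x y + Q s t x y) (%t x y. s * (Q s t x y - P s t x y))
  (%t x y. 2 * (1 + t - s * x) * y * V t x y - A s t x y * B s t x y)
  (%t x y. (5 - p) * (1 + t - s * x) * V t x y)"
proof -
 define U where "U = (%t x. 1 + t - s * x)"
 define At where "At = (%t x y. y * (utt t x y + s * utx t x y) + uy t x y + U t x * uty t x y)"
 define Ax where "Ax = (%t x y. y * (utx t x y + s * uxx t x y) - s * uy t x y + U t x * uxy t x y)"
 define Ay where "Ay = (%t x y. (ut t x y + s * ux t x y) + y * (uty t x y + s * uxy t x y) + U t x * uyy t x y)"
 define Bt where "Bt = (%t x y. (ut t x y - s * ux t x y) + U t x * (utt t x y - s * utx t x y) + y * uty t x y + ut t x y)"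
 define Bx where "Bx = (%t x y. - s * (ut t x y - s * ux t x y) + U t x * (utx t x y - s * uxx t x y) + y * uxy t x y + ux t x y)"
 define By where "By = (%t x y. U t x * (uty t x y - s * uxy t x y) + uy t x y + y * uyy t x y + uy t x y)"
 have dA: "((%s'. A s s' x y) hrd At t x y) (at t)"
  "((%s'. A s t s' y) hrd Ax t x y) (at x)"
  "((%s'. A s t x s') hrd Ay t x y) (at y)" for t x y
  unfolding A_def At_def Ax_def Ay_def U_def
  by (auto intro!: derivative_eq_intros du dut dux duy simp: algebra_simps)
 have dB: "((%s'. B s s' x y) hrd Bt t x y) (at t)"
  "((%s'. B s t s' y) hrd Bx t x y) (at x)"
  "((%s'. B s t x s') hrd By t x y) (at y)" for t x y
  unfolding B_def Bt_def Bx_def By_def U_def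
  by (auto intro!: derivative_eq_intros du dut dux duy simp: algebra_simps)
 define Pt where "Pt = (%t x y. A s t x y * At t x y + 2 * U t x * V t x y + (U t x)^2 * (N t x y * ut t x y))"
 define Px where "Px = (%t x y. A s t x y * Ax t x y - 2 * s * U t x * V t x y + (U t x)^2 * (N t x y * ux t x y))"
 define Qt where "Qt = (%t x y. B s t x y * Bt t x y + y^2 * (N t x y * ut t x y))"
 define Qx where "Qx = (%t x y. B s t x y * Bx t x y + y^2 * (N t x y * ux t x y))"
 define cy where "cy = (%t x y. 2 * U t x * V t x y + 2 * U t x * y * (N t x y * uy t x y) - Ay t x y * B s t x y - A s t x y * By t x y)"
 have dP: "((%s'. P s s' x y) hrd Pt t x y) (at t)"
  "((%s'. P s t s' y) hrd Px t x y) (at x)" for t x y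
  unfolding P_def Pt_def Px_def
  by (auto intro!: derivative_eq_intros dA dV simp: U_def algebra_simps)
 have dQ: "((%s'. Q s s' x y) hrd Qt t x y) (at t)"
  "((%s'. Q s t s' y) hrd Qx t x y) (at x)" for t x y
  unfolding Q_def Qt_def Qx_def
  by (auto intro!: derivative_eq_intros dB dV)
 note cc = cont3_comp[OF cont(1)] cont3_comp[OF cont(2)] cont3_comp[OF cont(3)] cont3_comp[OF cont(4)] cont3_comp[OF cont(5)]
  cont3_comp[OF cont(6)] cont3_comp[OF cont(7)] cont3_comp[OF cont(8)] cont3_comp[OF cont(9)] cont3_comp[OF cont(10)]
  cont3_comp[OF contV] cont3_comp[OF contN]
 have cA: "cont3 (A s)" "cont3 At" "cont3 Ax" "cont3 Ay" "cont3 (B s)" "cont3 Bt" "cont3 Bx" "cont3 By"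
  unfolding cont3_def A_def At_def Ax_def Ay_def B_def Bt_def Bx_def By_def U_def
  by (intro continuous_intros cc; simp)+
 note ca = cont3_comp[OF cA(1)] cont3_comp[OF cA(2)] cont3_comp[OF cA(3)] cont3_comp[OF cA(4)] cont3_comp[OF cA(5)]
  cont3_comp[OF cA(6)] cont3_comp[OF cA(7)] cont3_comp[OF cA(8)]
 have cP: "cont3 (P s)" "cont3 Pt" "cont3 Px" "cont3 (Q s)" "cont3 Qt" "cont3 Qx" "cont3 cy"
  unfolding cont3_def P_def Q_def Pt_def Px_def Qt_def Qx_def cy_def U_def
  by (intro continuous_intros cc ca; simp)+
 note cp = cont3_comp[OF cP(1)] cont3_comp[OF cP(2)] cont3_comp[OF cP(3)] cont3_comp[OF cP(4)] cont3_comp[OF cP(5)]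
  cont3_comp[OF cP(6)] cont3_comp[OF cP(7)]
 have ident: "Pt t x y + Qt t x y + s * (Qx t x y - Px t x y) + cy t x y = (5 - p) * U t x * V t x y" for t x y
 proof -
  define a b c d e f g h i j k l m n where v: "a = u t x y" "b = ut t x y" "c = ux t x y" "d = uy t x y"
   "e = utx t x y" "f = uty t x y" "g = uxx t x y" "h = uxy t x y" "i = uyy t x y" "j = V t x y" "k = N t x y" "l = U t x"
   "m = A s t x y" "n = B s t x y"
  have tt: "utt t x y = g + i - k" unfolding v N_def by (rule eq)
  have m: "m = y * (b + s * c) + l * d" unfolding v A_def U_def ..
  have n: "n = l * (b - s * c) + y * d + a" unfolding v B_def U_def ..
  have ss: "s = 1 | s = - 1" using s by (simp add: power2_eq_1_iff)
  have ka: "k * a = (p + 1) * j" unfolding v by (rule Nu)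
  have At: "At t x y - s * Ax t x y = By t x y - y * k"
   unfolding At_def Ax_def By_def tt v[symmetric] using ss by (auto simp: algebra_simps)
  have Bt: "Bt t x y + s * Bx t x y = Ay t x y - l * k"
   unfolding Bt_def Bx_def Ay_def tt v[symmetric] using ss by (auto simp: algebra_simps)
  have "Pt t x y + Qt t x y + s * (Qx t x y - Px t x y) + cy t x y =
   m * (At t x y - s * Ax t x y) + n * (Bt t x y + s * Bx t x y) - Ay t x y * n - m * By t x y
   + (2 * l * j + 2 * s^2 * l * j + 2 * l * j) + k * (l^2 * (b - s * c) + y^2 * (b + s * c) + 2 * l * y * d)"
   unfolding Pt_def Px_def Qt_def Qx_def cy_def v[symmetric] by (simp add: algebra_simps power2_eq_square)
  also have "... = 6 * l * j - y * k * m - l * k * n + k * (l^2 * (b - s * c) + y^2 * (b + s * c) + 2 * l * y * d)"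
   unfolding At Bt s by (simp add: algebra_simps)
  \<comment> \<open>By the formulas for \<open>m\<close> and \<open>n\<close> all terms with a
    derivative of the solution cancel; only the undifferentiated \<open>a\<close> inside
    \<open>n\<close> survives next to \<open>k\<close>.\<close>
  also have "... = 6 * l * j - l * (k * a)"
   unfolding m n by (simp add: algebra_simps power2_eq_square)
  finally show ?thesis unfolding ka v(10,12)[symmetric] by (simp add: algebra_simps)
 qed
 show ?thesis
 proof (rule is_currentI)
  fix t x y
  show "((%s'. P s s' x y + Q s s' x y) hrd Pt t x y + Qt t x y) (at t)"
   by (intro derivative_intros dP dQ)
  show "((%s'. s * (Q s t s' y - P s t s' y)) hrd s * (Qx t x y - Px t x y)) (at x)"
   by (intro DERIV_cmult DERIV_diff dP dQ)
  show "((%s'. 2 * (1 + t - s * x) * s' * V t x s' - A s t x s' * B s t x s') hrd cy t x y) (at y)"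
   unfolding cy_def by (auto intro!: derivative_eq_intros dA dB dV simp: U_def algebra_simps)
  show "Pt t x y + Qt t x y + s * (Qx t x y - Px t x y) + cy t x y = (5 - p) * (1 + t - s * x) * V t x y"
   using ident by (simp add: U_def)
 qed (unfold cont3_def, (intro continuous_intros cc ca cp; simp)+)
qed

text \<open>Causality amounts to \<open>4 P Q\<close> dominating the square of the transverse flux,
  and the difference of the two is \<open>2 V\<close> times a perfect square.\<close>

lemma null_causal:
 assumes s: "s^2 = 1" and vw: "v^2 + w^2 <= 1"
 shows "v * (s * (Q s t x y - P s t x y)) + w * (2 * (1 + t - s * x) * y * V t x y - A s t x y * B s t x y)
  <= P s t x y + Q s t x y"
proof (rule causal_PQ[OF PQ_nonneg _ vw s])
 define a b c l where v: "a = A s t x y" "b = B s t x y" "c = V t x y" "l = 1 + t - s * x"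
 have "4 * (a^2 / 2 + l^2 * c) * (b^2 / 2 + y^2 * c) - (2 * l * y * c - a * b)^2 = 2 * c * (a * y + l * b)^2"
  by (simp add: algebra_simps power2_eq_square)
 moreover have "0 <= 2 * c * (a * y + l * b)^2" using V_nonneg unfolding v by simp
 ultimately show "(2 * (1 + t - s * x) * y * V t x y - A s t x y * B s t x y)^2 <= 4 * P s t x y * Q s t x y"
  unfolding P_def Q_def v[symmetric] by linarith
qed

text \<open>For \<open>U > 0\<close> it solves \<open>2 (1 + U^2) wt' = - (5 - p) U wt\<close>, the
  exact balance against the divergence \<open>(5 - p) U V\<close>. For \<open>U <= 0\<close> that
  divergence already has the good sign, and \<open>psq\<close> makes the weight constant
  there.\<close>

definition wt :: "real => real" where "wt U = (1 + psq U) powr (- (5 - p) / 4)"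

lemma psq_pos: "0 < 1 + psq U" by (auto simp: psq_def intro: add_pos_nonneg)

lemma psq_nz: "1 + psq U ~= 0" using psq_pos[of U] by simp

lemma wt_pos: "0 < wt U" unfolding wt_def using psq_pos[of U] by simp

lemma wt_le_1: "wt U <= 1"
proof -
 have "(1 + psq U) powr (- (5 - p) / 4) <= (1 + psq U) powr 0"
  by (intro powr_mono) (use p5 in \<open>auto simp: psq_def\<close>)
 then show ?thesis using psq_nz[of U] by (simp add: wt_def)
qed

definition wt' :: "real => real" where "wt' U = - (5 - p) / 2 * max 0 U * wt U / (1 + psq U)"

lemma wt_deriv: "(wt hrd wt' U) (at U)"
proof -
 define e where "e = - (5 - p) / 4"
 have w: "wt = (%U. (1 + psq U) powr e)" unfolding e_def by (rule ext) (simp only: wt_def)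
 have "((%U. (1 + psq U) powr e) hrd e * (1 + psq U) powr (e - of_nat 1) * (2 * max 0 U)) (at U)"
  by (rule DERIV_fun_powr) (auto intro!: derivative_eq_intros psq_deriv simp: psq_pos)
 moreover have "e * (1 + psq U) powr (e - of_nat 1) * (2 * max 0 U) = wt' U"
 proof -
  define q where "q = 1 + psq U"
  have "0 < q" using psq_pos by (simp add: q_def)
  then show ?thesis unfolding wt'_def w powr_diff q_def[symmetric] by (simp add: e_def field_simps)
 qed
 ultimately show ?thesis unfolding w by simp
qed

lemma wt_cont: "CO S f ==> CO S (%z. wt (f z))" "CO S f ==> CO S (%z. wt' (f z))"
proof -
 show 1: "CO S (%z. wt (f z))" if "CO S f" for f
  unfolding wt_def using that psq_nz by (intro continuous_intros ballI) auto
 show "CO S (%z. wt' (f z))" if "CO S f"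
  unfolding wt'_def using that psq_nz by (intro continuous_intros 1 ballI) auto
qed

text \<open>The weight \<open>wt(U)\<close> is tuned so that its derivative absorbs the divergence
 \<open>(5 - p) U V\<close> of the null current, using the extra copy of the energy near \<open>U = 0\<close>.\<close>
lemma weighted_null_bound:
 assumes s: "s^2 = 1" and t1: "0 <= t1" and E0: "0 <= E0"
  and fin: "(NN z. EE (wt (1 - s * fst z) * (P s 0 $$ z + Q s 0 $$ z + 2 * En 0 $$ z))) <= EE E0"
 shows "(NN z. EE (wt (1 + t1 - s * fst z) * (P s t1 $$ z + Q s t1 $$ z + 2 * En t1 $$ z))) <= EE E0"
proof -
 let ?e = "%t x y. P s t x y + Q s t x y + (En t x y + En t x y)"
 let ?q1 = "%t x y. s * (Q s t x y - P s t x y) + (- ut t x y * ux t x y + - ut t x y * ux t x y)"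
 let ?q2 = "%t x y. (2 * (1 + t - s * x) * y * V t x y - A s t x y * B s t x y) + (- ut t x y * uy t x y + - ut t x y * uy t x y)"
 let ?b = "%t x y. (5 - p) * (1 + t - s * x) * V t x y + (0 + 0)"
 have cur: "is_current ?e ?q1 ?q2 ?b"
  by (rule is_current_add[OF null_current[OF s] is_current_add[OF energy_current energy_current]])
 let ?w = "%t x (y::real). wt (1 + t - s * x)"
 let ?b' = "%t x y. ?w t x y * ?b t x y + (wt' (1 + t - s * x) * ?e t x y + (- s * wt' (1 + t - s * x)) * ?q1 t x y + 0 * ?q2 t x y)"
 have cur': "is_current (%t x y. ?w t x y * ?e t x y) (%t x y. ?w t x y * ?q1 t x y) (%t x y. ?w t x y * ?q2 t x y) ?b'"
 proof (rule is_current_mult[OF cur])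
  fix t x y
  show "((%s'. wt (1 + s' - s * x)) hrd wt' (1 + t - s * x)) (at t)"
   by (rule DERIV_cong[OF DERIV_chain2[OF wt_deriv]]) (auto intro!: derivative_eq_intros)
  show "((%s'. wt (1 + t - s * s')) hrd - s * wt' (1 + t - s * x)) (at x)"
   by (rule DERIV_cong[OF DERIV_chain2[OF wt_deriv]]) (auto intro!: derivative_eq_intros)
 qed (auto simp: cont3_def intro!: continuous_intros wt_cont)
 have neg: "?b' t x y <= 0" for t x y
 proof -
  define U where "U = 1 + t - s * x"
  \<comment> \<open>The gradient of \<open>U\<close> is null, so contracting the current with it
    retains \<open>2 P\<close> from the null current and \<open>2 e\<close> from the two copies of
    the energy. Since \<open>P >= U^2 V\<close> and \<open>e >= V\<close>, together they supply the
    full \<open>(1 + U^2) V\<close>.\<close>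
  define e where "e = En t x y + s * (ut t x y * ux t x y)"
  have e: "V t x y <= e"
  proof -
   have "e - V t x y = ((ut t x y + s * ux t x y)^2 + (uy t x y)^2) / 2"
    unfolding e_def En_def using s by (simp add: power2_sum power_mult_distrib field_simps)
   then show ?thesis by (smt (verit) divide_nonneg_nonneg zero_le_power2)
  qed
  have PP: "U^2 * V t x y <= P s t x y" by (simp add: P_def U_def)
  have "?b' t x y = wt U * ((5 - p) * U * V t x y) + wt' U * (P s t x y + Q s t x y - s^2 * (Q s t x y - P s t x y) + 2 * e)"
   unfolding U_def[symmetric] e_def by (simp add: algebra_simps power2_eq_square)
  also have "... = wt U * ((5 - p) * U * V t x y) + 2 * wt' U * (P s t x y + e)"
   unfolding s by (simp add: algebra_simps)
  also have "... <= 0"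
  proof (cases "U <= 0")
   case True
   then have "wt' U = 0" by (simp add: wt'_def)
   moreover have "wt U * ((5 - p) * U * V t x y) <= 0"
    using True wt_pos[of U] p5 V_nonneg[of t x y]
    by (intro mult_nonneg_nonpos mult_nonpos_nonneg) auto
   ultimately show ?thesis by simp
  next
   case False
   have w': "wt' U <= 0"
    unfolding wt'_def using False p5 wt_pos[of U] psq_pos[of U]
    by (intro divide_nonpos_pos mult_nonpos_nonneg) auto
   have "wt' U * (P s t x y + e) <= wt' U * ((1 + U^2) * V t x y)"
    using PP e by (intro mult_left_mono_neg w') (simp add: algebra_simps)
   also have "wt' U * ((1 + U^2) * V t x y) = - (5 - p) / 2 * U * wt U * V t x y"
   proof -
    have "psq U = U^2" using False by (simp add: psq_def)
    moreover define q where "q = 1 + U^2"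
    moreover have "q ~= 0" using psq_pos[of U] calculation by simp
    moreover have "max 0 U = U" using False by simp
    moreover have "1 + psq U = q" using calculation by simp
    ultimately show ?thesis unfolding wt'_def \<open>1 + psq U = q\<close> q_def[symmetric] by simp
   qed
   finally show ?thesis by (simp add: algebra_simps)
  qed
  finally show ?thesis .
 qed
 have "(NN z. EE (?w t1 $$ z * ?e t1 $$ z)) <= EE (E0 + ((%_. 0) t1 - (%_. 0) (0::real)))"
 proof (rule current_bound[OF cur' t1, where B'="%_. 0"])
  fix t x y v w :: real assume vw: "v^2 + w^2 <= 1"
  have "v * ?q1 t x y + w * ?q2 t x y <= ?e t x y"
   using null_causal[OF s vw, of t x y] energy_causal[OF vw, of t x y] by (simp only: distrib_left)
  from mult_left_mono[OF this less_imp_le[OF wt_pos[of "1 + t - s * x"]]]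
  show "v * (wt (1 + t - s * x) * ?q1 t x y) + w * (wt (1 + t - s * x) * ?q2 t x y) <= wt (1 + t - s * x) * ?e t x y"
   by (simp only: distrib_left mult.left_commute)
 next
  fix R t :: real
  have "0 <= (LL z. - (cone_cut 1 0 0 R t $$ z * ?b' t $$ z))"
   by (intro Bochner_Integration.integral_nonneg) (use neg cone_cut_nonneg in \<open>simp add: mult_nonneg_nonpos\<close>)
  then show "(LL z. cone_cut 1 0 0 R t $$ z * ?b' t $$ z) <= R^2 * 0"
   by (simp only: Bochner_Integration.integral_minus)
 next
  show "(NN z. EE (wt (1 + 0 - s * fst z) * ?e 0 $$ z)) <= EE E0"
   using fin by (simp only: add_0_right mult_2)
 qed (use E0 in auto)
 then show ?thesis by (simp only: mult_2 diff_self add_0_right)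
qed

section \<open>Control of the initial data and decay of the potential energy\<close>

definition dat :: "real => real => real" where
 "dat x y = (1 + sqrt (x^2 + y^2))^2 * ((ux 0 x y)^2 + (uy 0 x y)^2 + (ut 0 x y)^2)
  + (1 + sqrt (x^2 + y^2))^2 * <|u 0 x y|> powr (p + 1)"

lemma contdat: "CO UNIV (%z. dat $$ z)"
proof -
 have c0: "CO UNIV (%z. <|u 0 $$ z|> powr (p + 1))"
  using p1 by (intro continuous_on_abs_powr cont[THEN cont3_slice]) auto
 show ?thesis unfolding dat_def
  by (intro continuous_on_add[OF _ continuous_on_mult[OF _ c0]]) (intro continuous_intros cont[THEN cont3_slice]; simp)+
qed

lemma V_le: "V t x y <= <|u t x y|> powr (p + 1) / 2"
 unfolding V_def using p1 by (intro divide_left_mono) auto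

text \<open>Squaring the three terms of \<open>A\<close> and the four of \<open>B\<close> costs
  \<open>3/2\<close> and \<open>2\<close> times the weighted data, the energy costs 1. The
  undifferentiated \<open>u\<close> in \<open>B\<close> leaves \<open>2 u^2\<close>, which is the
  reason for the Hardy inequality.\<close>

lemma data_pointwise:
 assumes s: "s^2 = 1"
 shows "P s 0 x y + Q s 0 x y + 2 * En 0 x y <= 5 * dat x y + 2 * (u 0 x y)^2"
proof -
 define r where "r = (1 + sqrt (x^2 + y^2))^2"
 define a b c d v where v: "a = ut 0 x y" "b = ux 0 x y" "c = uy 0 x y" "d = u 0 x y" "v = V 0 x y"
 define U where "U = 1 + 0 - s * x"
 have ss: "s = 1 | s = - 1" using s by (simp add: power2_eq_1_iff)
 have xr: "<|x|> <= sqrt (x^2 + y^2)" "<|y|> <= sqrt (x^2 + y^2)" by (auto intro: real_le_rsqrt)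
 have r1: "1 <= r" unfolding r_def by (simp add: one_le_power)
 have U: "U^2 <= r"
 proof -
  have "<|s * x|> = <|x|>" using ss by auto
  then have "<|U|> <= 1 + sqrt (x^2+y^2)" using xr(1) unfolding U_def by linarith
  then show ?thesis unfolding r_def by (metis abs_ge_zero power2_abs power_mono)
 qed
 have Y: "y^2 <= r"
 proof -
  have "<|y|> <= 1 + sqrt (x^2+y^2)" using xr(2) by linarith
  then show ?thesis unfolding r_def by (metis abs_ge_zero power2_abs power_mono)
 qed
 have sb: "(s * b)^2 = b^2" using s by (simp add: power_mult_distrib)
 have e: "(y * (s * b))^2 = y^2 * b^2" "(- U * (s * b))^2 = U^2 * b^2"
  by (simp_all only: power_mult_distrib[of y "s * b"] power_mult_distrib[of "- U" "s * b"] sb power2_minus)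
 have sq3: "(f + g + h)^2 <= 3 * (f^2 + g^2 + h^2)" for f g h :: real
  using zero_le_power2[of "f - g"] zero_le_power2[of "g - h"] zero_le_power2[of "f - h"]
  by (simp add: power2_eq_square algebra_simps)
 have sq4: "(f + g + h + k)^2 <= 4 * (f^2 + g^2 + h^2 + k^2)" for f g h k :: real
 proof -
  have sq2: "(x + y)^2 <= 2 * (x^2 + y^2)" for x y :: real
   using zero_le_power2[of "x - y"] by (simp add: power2_sum power2_diff)
  show ?thesis using sq2[of "f + g" "h + k"] sq2[of f g] sq2[of h k] by (simp add: add.assoc)
 qed
 have m: "y^2 * f^2 <= r * f^2" "U^2 * f^2 <= r * f^2" for f :: real
  using Y U by (auto intro: mult_right_mono)
 have "A s 0 x y = y * a + y * (s * b) + U * c" unfolding A_def v U_def by (simp add: algebra_simps)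
 then have "(A s 0 x y)^2 <= 3 * ((y * a)^2 + (y * (s * b))^2 + (U * c)^2)" using sq3 by metis
 also have "... <= 3 * (r * a^2 + r * b^2 + r * c^2)"
  unfolding e power_mult_distrib[of y a] power_mult_distrib[of U c] using m(1)[of a] m(1)[of b] m(2)[of c] by (simp add: distrib_left)
 finally have A2: "(A s 0 x y)^2 <= 3 * (r * a^2 + r * b^2 + r * c^2)" .
 have "B s 0 x y = U * a + (- U * (s * b)) + y * c + d" unfolding B_def v U_def by (simp add: algebra_simps)
 then have "(B s 0 x y)^2 <= 4 * ((U * a)^2 + (- U * (s * b))^2 + (y * c)^2 + d^2)" using sq4 by metis
 also have "... <= 4 * (r * a^2 + r * b^2 + r * c^2 + d^2)"
  unfolding e power_mult_distrib[of U a] power_mult_distrib[of y c] using m(2)[of a] m(2)[of b] m(1)[of c] by (simp add: distrib_left)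
 finally have B2: "(B s 0 x y)^2 <= 4 * (r * a^2 + r * b^2 + r * c^2 + d^2)" .
 have g: "a^2 + b^2 + c^2 <= r * a^2 + r * b^2 + r * c^2"
  using r1 mult_right_mono[of 1 r "a^2"] mult_right_mono[of 1 r "b^2"] mult_right_mono[of 1 r "c^2"] by simp
 have v0: "0 <= v" using V_nonneg v by simp
 have Vb: "U^2 * v <= r * v" "y^2 * v <= r * v" "v <= r * v"
  using U Y r1 v0 mult_right_mono[of 1 r v] by (auto intro: mult_right_mono)
 have "r * v <= r * (<|d|> powr (p + 1) / 2)"
  using V_le[of 0 x y] r1 unfolding v by (intro mult_left_mono) auto
 then have Vd: "2 * (r * v) <= r * <|d|> powr (p + 1)" by simp
 have ge: "0 <= r * a^2" "0 <= r * b^2" "0 <= r * c^2" "0 <= r * <|d|> powr (p + 1)" using r1 by auto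
 have E: "2 * En 0 x y = a^2 + b^2 + c^2 + 2 * v" unfolding En_def v by simp
 have dd: "dat x y = r * a^2 + r * b^2 + r * c^2 + r * <|d|> powr (p + 1)"
  unfolding dat_def r_def[symmetric] v by (simp add: algebra_simps)
 \<comment> \<open>Stated for plain variables so that only linear arithmetic remains.\<close>
 have lin: "A2 / 2 + uv + (B2 / 2 + yv) + (gg + 2 * v') <= 5 * (ra + rb + rc + rd) + 2 * d2"
  if "A2 <= 3 * (ra + rb + rc)" "B2 <= 4 * (ra + rb + rc + d2)" "gg <= ra + rb + rc" "uv <= rv" "yv <= rv" "v' <= rv"
   "2 * rv <= rd" "0 <= ra" "0 <= rb" "0 <= rc" "0 <= rd" for A2 B2 gg uv yv v' ra rb rc rd rv d2 :: real
  using that by simp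
 show ?thesis unfolding P_def Q_def U_def[symmetric] E dd v(4,5)[symmetric]
  by (rule lin[OF A2 B2 g Vb Vd ge])
qed

context
 fixes D :: real
 assumes D0: "0 <= D" and D: "(NN z. EE (dat $$ z)) <= EE D"
begin

lemma dat_ge: "0 <= (1 + sqrt (x^2 + y^2))^2 * <|u 0 x y|> powr (p + 1)"
 "0 <= (1 + sqrt (x^2 + y^2))^2 * ((ux 0 x y)^2 + (uy 0 x y)^2 + (ut 0 x y)^2)"
 by auto

lemma one_le_wt: "1 <= (1 + sqrt (x^2 + y^2))^2" for x y :: real
 by (simp add: one_le_power)

lemma data_L2: "(NN z. EE ((u 0 $$ z)^2)) <= EE (21 * D)"
proof (rule hardy_2d[OF dux_joint _ _ p1 p5 D0])
 have "(NN z. EE (((fst z)^2+(snd z)^2) * ((ux 0 $$ z)^2 + (uy 0 $$ z)^2))) <=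
  (NN z. EE (dat $$ z))"
 proof (intro nn_integral_mono ennreal_leI)
  fix z :: "real \<times> real"
  obtain x y where z: "z = (x,y)" by (cases z)
  have 1: "x^2 + y^2 <= (1 + sqrt (x^2 + y^2))^2"
   by (simp add: power2_sum)
  have "(x^2+y^2) * ((ux 0 x y)^2 + (uy 0 x y)^2) <= (1 + sqrt (x^2 + y^2))^2 * ((ux 0 x y)^2 + (uy 0 x y)^2 + (ut 0 x y)^2)"
   by (intro mult_mono 1) auto
  then show "((fst z)^2+(snd z)^2) * ((ux 0 $$ z)^2 + (uy 0 $$ z)^2) <= dat $$ z"
   unfolding z dat_def fst_conv snd_conv using dat_ge(1)[of x y] by linarith
 qed
 then show "(NN z. EE (((fst z)^2+(snd z)^2) * ((ux 0 $$ z)^2 + (uy 0 $$ z)^2))) <= EE D"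
  using D by (rule order_trans)
 have "(NN z. EE (<|u 0 $$ z|> powr (p+1))) <= (NN z. EE (dat $$ z))"
 proof (intro nn_integral_mono ennreal_leI)
  fix z :: "real \<times> real"
  obtain x y where z: "z = (x,y)" by (cases z)
  have "1 * <|u 0 x y|> powr (p+1) <= (1 + sqrt (x^2 + y^2))^2 * <|u 0 x y|> powr (p+1)"
   by (intro mult_right_mono one_le_wt) auto
  then show "<|u 0 $$ z|> powr (p+1) <= dat $$ z"
   unfolding z dat_def fst_conv snd_conv using dat_ge(2)[of x y] by linarith
 qed
 also have "... < \<infinity>" using D by (simp add: le_less_trans)
 finally show "(NN z. EE (<|u 0 $$ z|> powr (p+1))) < \<infinity>" .
qed (use cont in \<open>auto intro: cont3_slice\<close>)

text \<open>\<open>47 = 5 + 2 * 21\<close>, where 21 is the Hardy constant.\<close>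

lemma data_null:
 assumes s: "s^2 = 1"
 shows "(NN z. EE (P s 0 $$ z + Q s 0 $$ z + 2 * En 0 $$ z)) <= EE (47 * D)"
proof -
 have [measurable]: "(%z. dat $$ z) \<in> BB" "(%z. (u 0 $$ z)) \<in> BB"
  using contdat cont3_slice[OF cont(1)] by (auto intro: borel_measurable_continuous_onI)
 have dat0: "0 <= dat x y" for x y unfolding dat_def by simp
 have "(NN z. EE (P s 0 $$ z + Q s 0 $$ z + 2 * En 0 $$ z))
  <= (NN z. EE 5 * EE (dat $$ z) + EE 2 * EE ((u 0 $$ z)^2))"
  using data_pointwise[OF s] dat0
  by (intro nn_integral_mono) (simp add: ennreal_mult[symmetric] ennreal_plus[symmetric] ennreal_leI del: ennreal_plus ennreal_numeral)
 also have "... = EE 5 * (NN z. EE (dat $$ z)) + EE 2 * (NN z. EE ((u 0 $$ z)^2))"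
  by (subst nn_integral_add, measurable) (simp add: nn_integral_cmult del: ennreal_numeral)
 also have "... <= EE 5 * EE D + EE 2 * EE (21 * D)"
  by (intro add_mono mult_left_mono D data_L2) auto
 also have "... = EE (47 * D)"
  using D0 by (simp add: ennreal_mult[symmetric] ennreal_plus[symmetric] del: ennreal_plus ennreal_numeral)
 finally show ?thesis .
qed

text \<open>On the half plane \<open>s * x <= 0\<close> one has \<open>U >= 1 + t\<close>, and
  \<open>wt U * (1 + U^2) = (1 + U^2) powr ((p - 1) / 4)\<close> is then at least
  \<open>(1 + t) powr ((p - 1) / 2)\<close>: what the weight loses is the difference to the full
  conformal rate. The constant is \<open>282 = 6 * 47\<close> with
  \<open>p + 1 <= 6\<close>.\<close>

lemma potential_half:
 assumes s: "s^2 = 1" and t: "0 <= t"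
 shows "(NN z. EE (<|u t $$ z|> powr (p + 1)) * ind {z. s * fst z <= 0} z)
  <= EE (282 * D * (1 + t) powr (- (p - 1) / 2))"
proof -
 define k where "k = 6 * (1 + t) powr (- (p - 1) / 2)"
 let ?E = "%z. wt (1 + t - s * fst z) * (P s t $$ z + Q s t $$ z + 2 * En t $$ z)"
 have k: "0 <= k" by (simp add: k_def)
 have "(NN z. EE (wt (1 - s * fst z) * (P s 0 $$ z + Q s 0 $$ z + 2 * En 0 $$ z)))
  <= (NN z. EE (P s 0 $$ z + Q s 0 $$ z + 2 * En 0 $$ z))"
  using wt_pos wt_le_1 PQ_nonneg En_nonneg by (intro nn_integral_mono ennreal_leI mult_left_le_one_le) (auto intro: less_imp_le)
 also have "... <= EE (47 * D)" by (rule data_null[OF s])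
 finally have E: "(NN z. EE (?E z)) <= EE (47 * D)"
  using D0 by (intro weighted_null_bound[OF s t]) auto
 have pt: "<|u t x y|> powr (p + 1) <= k * (wt (1 + t - s * x) * (P s t x y + Q s t x y + 2 * En t x y))" if x: "s * x <= 0" for x y
 proof -
  define U where "U = 1 + t - s * x"
  have U: "1 + t <= U" using x by (simp add: U_def)
  have ps: "psq U = U^2" using U t by (simp add: psq_def)
  have "(1 + t) powr ((p - 1) / 2) <= U powr ((p - 1) / 2)"
   using U t p1 by (intro powr_mono2) auto
  also have "... = (U^2) powr ((p - 1) / 4)"
  proof -
   have e: "2 * ((p - 1) / 4) = (p - 1) / 2" by simp
   have "(U^2) powr ((p - 1) / 4) = (U powr 2) powr ((p - 1) / 4)" using U t by (simp add: powr_numeral)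
   then show ?thesis unfolding powr_powr e by simp
  qed
  also have "... <= (1 + U^2) powr ((p - 1) / 4)"
   using p1 by (intro powr_mono2) auto
  also have "... = wt U * (1 + U^2)"
  proof -
   have q: "0 < 1 + U^2" by (auto intro: add_pos_nonneg)
   have e: "(p - 1) / 4 = - (5 - p) / 4 + 1" by (simp add: field_simps)
   show ?thesis unfolding wt_def ps e powr_add using q by simp
  qed
  finally have 1: "(1 + t) powr ((p - 1) / 2) <= wt U * (1 + U^2)" .
  have 2: "(1 + U^2) * V t x y <= P s t x y + Q s t x y + 2 * En t x y"
   unfolding P_def Q_def En_def U_def[symmetric] using V_nonneg[of t x y] by (simp add: algebra_simps)
  have "(1 + t) powr ((p - 1) / 2) * V t x y <= wt U * (1 + U^2) * V t x y"
   by (intro mult_right_mono 1 V_nonneg)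
  also have "... <= wt U * (P s t x y + Q s t x y + 2 * En t x y)"
   unfolding mult.assoc using 2 wt_pos[of U] by (intro mult_left_mono) auto
  finally have 3: "(1 + t) powr ((p - 1) / 2) * V t x y <= wt U * (P s t x y + Q s t x y + 2 * En t x y)" .
  have "<|u t x y|> powr (p + 1) = (p + 1) * V t x y" using p1 by (simp add: V_def)
  also have "... <= 6 * V t x y" using p5 V_nonneg by (intro mult_right_mono) auto
  also have "... = k * ((1 + t) powr ((p - 1) / 2) * V t x y)"
  proof -
   have "(1 + t) powr (- (p - 1) / 2) * (1 + t) powr ((p - 1) / 2) = 1"
   proof -
    have z: "- (p - 1) / 2 + (p - 1) / 2 = 0" by linarith
    show ?thesis using powr_add[of "1 + t" "- (p - 1) / 2" "(p - 1) / 2", unfolded z] t by simp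
   qed
   then show ?thesis unfolding k_def by (simp add: mult.assoc[symmetric])
  qed
  also have "... <= k * (wt U * (P s t x y + Q s t x y + 2 * En t x y))"
   by (intro mult_left_mono 3 k)
  finally show ?thesis unfolding U_def .
 qed
 have cP: "CO UNIV (%z. ?E z)"
  unfolding P_def Q_def A_def B_def En_def
  by (intro continuous_intros wt_cont cont[THEN cont3_slice] contV[THEN cont3_slice]; simp)
 have [measurable]: "?E \<in> BB" by (rule borel_measurable_continuous_onI[OF cP])
 have E0: "0 <= ?E z" for z
  using wt_pos[of "1 + t - s * fst z"] PQ_nonneg[of s t "fst z" "snd z"] En_nonneg[of t "fst z" "snd z"]
  by (intro mult_nonneg_nonneg add_nonneg_nonneg) auto
 have "(NN z. EE (<|u t $$ z|> powr (p + 1)) * ind {z. s * fst z <= 0} z)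
  <= (NN z. EE k * EE (?E z))"
  using pt k E0 by (intro nn_integral_mono) (auto simp: indicator_def ennreal_mult[symmetric] intro!: ennreal_leI)
 also have "... = EE k * (NN z. EE (?E z))" by (rule nn_integral_cmult) measurable
 also have "... <= EE k * EE (47 * D)" by (intro mult_left_mono E) auto
 also have "... = EE (282 * D * (1 + t) powr (- (p - 1) / 2))"
  using D0 k by (simp add: ennreal_mult[symmetric] k_def)
 finally show ?thesis .
qed

theorem potential_decay:
 assumes t: "0 <= t"
 shows "(NN z. EE (<|u t $$ z|> powr (p + 1))) <= EE (564 * D * (1 + t) powr (- (p - 1) / 2))"
proof -
 let ?f = "%z. EE (<|u t $$ z|> powr (p + 1))"
 define S where "S = (%s. {z::real\<times>real. s * fst z <= 0})"
 have [measurable]: "(%z. (u t $$ z)) \<in> BB"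
  using cont3_slice[OF cont(1)] by (auto intro: borel_measurable_continuous_onI)
 have [measurable]: "S s \<in> sets borel" for s
  unfolding S_def by (intro borel_closed closed_Collect_le continuous_intros)
 have "(NN z. ?f z) <= (NN z. ?f z * ind (S 1) z + ?f z * ind (S (-1)) z)"
  by (intro nn_integral_mono) (auto simp: indicator_def S_def)
 also have "... = (NN z. ?f z * ind (S 1) z) + (NN z. ?f z * ind (S (-1)) z)"
  by (rule nn_integral_add) auto
 also have "... <= EE (282 * D * (1 + t) powr (- (p - 1) / 2)) + EE (282 * D * (1 + t) powr (- (p - 1) / 2))"
  unfolding S_def by (intro add_mono potential_half t) auto
 also have "... = EE (564 * D * (1 + t) powr (- (p - 1) / 2))"
  using D0 by (simp add: ennreal_plus[symmetric] del: ennreal_plus)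
 finally show ?thesis .
qed

end

end

section \<open>Unweighted conformal energy and growth of the square integral\<close>

lemma nn_integral_square_sum:
 fixes f g :: "'a => real"
 assumes [measurable]: "f \<in> borel_measurable M" "g \<in> borel_measurable M" and "0 <= c" "0 <= d"
  and "!!x. 0 <= f x" "!!x. 0 <= g x"
  and F: "(\<integral>\<^sup>+x. EE (f x) \<partial>M) <= EE F" and G: "(\<integral>\<^sup>+x. EE (g x) \<partial>M) <= EE G" "0 <= F" "0 <= G"
 shows "(\<integral>\<^sup>+x. EE (c * f x + d * g x) \<partial>M) <= EE (c * F + d * G)"
proof -
 have "(\<integral>\<^sup>+x. EE (c * f x + d * g x) \<partial>M) = (\<integral>\<^sup>+x. EE c * EE (f x) + EE d * EE (g x) \<partial>M)"
  using assms by (intro nn_integral_cong) (simp add: ennreal_plus ennreal_mult)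
 also have "... = EE c * (\<integral>\<^sup>+x. EE (f x) \<partial>M) + EE d * (\<integral>\<^sup>+x. EE (g x) \<partial>M)"
  by (simp add: nn_integral_add nn_integral_cmult)
 also have "... <= EE c * EE F + EE d * EE G"
  by (intro add_mono mult_left_mono F G) auto
 also have "... = EE (c * F + d * G)" using assms by (simp add: ennreal_plus ennreal_mult)
 finally show ?thesis .
qed

lemma nn_integral_le_integrable:
 fixes f :: "'a => real"
 assumes "f \<in> borel_measurable M" "!!x. 0 <= f x" "(\<integral>\<^sup>+x. EE (f x) \<partial>M) <= EE F" "0 <= F"
 shows "integrable M f" "integral\<^sup>L M f <= F"
proof -
 show 1: "integrable M f"
  using assms by (intro integrableI_nonneg) (auto simp: le_less_trans)
 have "EE (integral\<^sup>L M f) = (\<integral>\<^sup>+x. EE (f x) \<partial>M)"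
  using nn_integral_eq_integral[OF 1] assms(2) by simp
 also have "... <= EE F" by (rule assms(3))
 finally show "integral\<^sup>L M f <= F" using assms(4) by (simp add: ennreal_le_iff)
qed

context nlw
begin

definition Sc where "Sc t x y = (1 + t) * ut t x y + x * ux t x y + y * uy t x y + u t x y"

lemma Sc_B: "Sc t x y = (B 1 t x y + B (-1) t x y) / 2"
 unfolding Sc_def B_def by (simp add: algebra_simps)

lemma cont_slice_all:
 "CO S (%z. P s t $$ z)" "CO S (%z. Q s t $$ z)"
 "CO S (%z. En t $$ z)" "CO S (%z. Sc t $$ z)"
 "CO S (%z. A s t $$ z)" "CO S (%z. B s t $$ z)"
 unfolding P_def Q_def A_def B_def En_def Sc_def
 by (intro continuous_intros cont[THEN cont3_slice] contV[THEN cont3_slice]; simp)+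

lemma meas_slice[measurable]:
 "(%z. P s t $$ z) \<in> BB" "(%z. Q s t $$ z) \<in> BB"
 "(%z. En t $$ z) \<in> BB" "(%z. Sc t $$ z) \<in> BB"
 "(%z. A s t $$ z) \<in> BB" "(%z. B s t $$ z) \<in> BB"
 "(%z. u t $$ z) \<in> BB" "(%z. ut t $$ z) \<in> BB"
 "(%z. ux t $$ z) \<in> BB" "(%z. uy t $$ z) \<in> BB"
 "(%z. V t $$ z) \<in> BB" "(%z. N t $$ z) \<in> BB"
 by (intro borel_measurable_continuous_onI cont_slice_all cont[THEN cont3_slice] contV[THEN cont3_slice] contN[THEN cont3_slice])+

text \<open>The conformal energy density without the weight. For \<open>p < 5\<close> its integral
  is bounded only by a growing power of \<open>1 + t\<close>, but it controls all conformal
  derivatives at once.\<close>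

definition Qsum where "Qsum t x y = P 1 t x y + Q 1 t x y + (P (-1) t x y + Q (-1) t x y)"

lemma Qsum_nonneg: "0 <= Qsum t x y" unfolding Qsum_def using PQ_nonneg by simp

lemma Sc_sq: "(Sc t x y)^2 <= Qsum t x y"
proof -
 have "(Sc t x y)^2 <= ((B 1 t x y)^2 + (B (-1) t x y)^2) / 2"
  unfolding Sc_B using zero_le_power2[of "B 1 t x y - B (-1) t x y"]
  by (simp add: power_divide power2_sum power2_diff field_simps)
 also have "... <= Qsum t x y"
  using PQ_nonneg[of 1 t x y] PQ_nonneg[of "-1" t x y] V_nonneg[of t x y] unfolding Qsum_def P_def Q_def
  by (simp add: add_divide_distrib)
 finally show ?thesis .
qed

context
 fixes D :: real
 assumes D0: "0 <= D" and D: "(NN z. EE (dat $$ z)) <= EE D"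
begin

lemma potential_V:
 assumes t: "0 <= t"
 shows "integrable lborel (%z. V t $$ z)"
  "(LL z. V t $$ z) <= 282 * D * (1 + t) powr (- (p - 1) / 2)"
proof -
 have "(NN z. EE (2 * V t $$ z)) <= (NN z. EE (<|u t $$ z|> powr (p + 1)))"
  using V_le by (intro nn_integral_mono ennreal_leI) (simp add: mult.commute)
 also have "... <= EE (564 * D * (1 + t) powr (- (p - 1) / 2))"
  by (rule potential_decay[OF D0 D t])
 finally have 1: "(NN z. EE (2 * V t $$ z)) <= EE (564 * D * (1 + t) powr (- (p - 1) / 2))" .
 have "integrable lborel (%z. 2 * V t $$ z)" "(LL z. 2 * V t $$ z) <= 564 * D * (1 + t) powr (- (p - 1) / 2)"
  by (rule nn_integral_le_integrable[OF _ _ 1]; use V_nonneg D0 in simp)+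
 then show "integrable lborel (%z. V t $$ z)"
  "(LL z. V t $$ z) <= 282 * D * (1 + t) powr (- (p - 1) / 2)" by auto
qed

lemma energy_bound:
 assumes t: "0 <= t"
 shows "(NN z. EE (En t $$ z)) <= EE (47 * D)"
proof -
 have "(NN z. EE (En t $$ z)) <= EE (47 * D + ((%_. 0) t - (%_. 0) (0::real)))"
 proof (rule current_bound[OF energy_current t energy_causal, where B'="%_. 0"])
  have "(NN z. EE (En 0 $$ z)) <=
   (NN z. EE (P 1 0 $$ z + Q 1 0 $$ z + 2 * En 0 $$ z))"
  proof (intro nn_integral_mono ennreal_leI)
   fix z
   show "En 0 $$ z <= P 1 0 $$ z + Q 1 0 $$ z + 2 * En 0 $$ z"
    using PQ_nonneg[of 1 0 "fst z" "snd z"] En_nonneg[of 0 "fst z" "snd z"] by linarith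
  qed
  also have "... <= EE (47 * D)" by (rule data_null[OF D0 D]) simp
  finally show "(NN z. EE (En 0 $$ z)) <= EE (47 * D)" .
 qed (use D0 in auto)
 then show ?thesis by simp
qed

text \<open>Adding the two null directions cancels the dependence of the divergence on
  \<open>x\<close> and leaves \<open>2 (5 - p) (1 + t) V\<close>, to which the decay of the
  potential applies. The constant is the antiderivative:
  \<open>2 (5 - p) * 282 = 1128 * ((5 - p) / 2)\<close>; at time 0 the two directions give
  \<open>94 = 2 * 47\<close>, which is smaller.\<close>

lemma conformal_bound:
 assumes t: "0 <= t"
 shows "(NN z. EE (Qsum t $$ z)) <= EE (1128 * D * (1 + t) powr ((5 - p) / 2))"
proof -
 let ?a = "(5 - p) / 2"
 let ?B = "%t. 1128 * D * (1 + t) powr ?a"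
 let ?q1 = "%t x y. 1 * (Q 1 t x y - P 1 t x y) + (-1) * (Q (-1) t x y - P (-1) t x y)"
 let ?q2 = "%t x y. (2 * (1 + t - 1 * x) * y * V t x y - A 1 t x y * B 1 t x y) + (2 * (1 + t - (-1) * x) * y * V t x y - A (-1) t x y * B (-1) t x y)"
 let ?b = "%t x y. (5 - p) * (1 + t - 1 * x) * V t x y + (5 - p) * (1 + t - (-1) * x) * V t x y"
 have s1: "(1::real)^2 = 1" "(-1::real)^2 = 1" by auto
 have cur: "is_current Qsum ?q1 ?q2 ?b"
  unfolding Qsum_def[abs_def] by (rule is_current_add[OF null_current[OF s1(1)] null_current[OF s1(2)]])
 have b: "?b t x y = 2 * (5 - p) * (1 + t) * V t x y" for t x y by (simp add: algebra_simps)
 have "(NN z. EE (Qsum t $$ z)) <= EE (94 * D + (?B t - ?B 0))"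
 proof (rule current_bound[OF cur t])
  fix t x y v w :: real assume vw: "v^2 + w^2 <= 1"
  show "v * ?q1 t x y + w * ?q2 t x y <= Qsum t x y"
   using null_causal[OF s1(1) vw, of t x y] null_causal[OF s1(2) vw, of t x y]
   unfolding Qsum_def by (simp only: distrib_left)
 next
  fix t' assume "t' \<in> {0..t}"
  then have "0 < 1 + t'" by simp
  then show "(?B hrd 1128 * D * (?a * (1 + t') powr (?a - 1))) (at t' within {0..t})"
   by (auto intro!: derivative_eq_intros simp: powr_diff)
 next
  fix R t' assume t': "t' \<in> {0..t}" and R: "(0::real) < R"
  let ?k = "%z. cone_cut 1 0 0 R t' $$ z"
  have k: "?k z <= R^2" for z using cone_cut_le[OF R, of t' 1 0 0 "fst z" "snd z"] R t' by simp
  have i: "integrable lborel (%z. R^2 * (2 * (5 - p) * (1 + t') * V t' $$ z))"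
   using potential_V(1)[of t'] t' by simp
  have le: "?k z * ?b t' $$ z <= R^2 * (2 * (5 - p) * (1 + t') * V t' $$ z)" for z
   unfolding b using t' p5 V_nonneg by (intro mult_right_mono k) auto
  have "(LL z. ?k z * ?b t' $$ z) <= (LL z. R^2 * (2 * (5 - p) * (1 + t') * V t' $$ z))"
   by (rule Bochner_Integration.integral_mono'[OF i le]) (use t' p5 V_nonneg in \<open>auto\<close>)
  also have "... = R^2 * (2 * (5 - p) * (1 + t')) * (LL z. V t' $$ z)" by simp
  also have "... <= R^2 * (2 * (5 - p) * (1 + t')) * (282 * D * (1 + t') powr (- (p - 1) / 2))"
   using t' p5 potential_V(2)[of t'] by (intro mult_left_mono) auto
  also have "... = R^2 * (1128 * D * (?a * (1 + t') powr (?a - 1)))"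
  proof -
   have e: "?a - 1 = 1 + - (p - 1) / 2" by (simp add: field_simps)
   have gen: "R^2 * (2 * (2 * q) * T) * (282 * D * X) = R^2 * (1128 * D * (q * (T * X)))" for q T X :: real
    by (simp add: mult_ac)
   have h: "2 * (5 - p) = 2 * (2 * ?a)" by simp
   have p1: "(1 + t') powr 1 = 1 + t'" using t' by simp
   show ?thesis unfolding e powr_add h p1 by (rule gen)
  qed
  finally show "(LL z. ?k z * ?b t' $$ z) <= R^2 * (1128 * D * (?a * (1 + t') powr (?a - 1)))" .
 next
  have "(NN z. EE (Qsum 0 $$ z)) <=
    (NN z. EE (1 * (P 1 0 $$ z + Q 1 0 $$ z + 2 * En 0 $$ z)
     + 1 * (P (-1) 0 $$ z + Q (-1) 0 $$ z + 2 * En 0 $$ z)))"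
   unfolding Qsum_def using En_nonneg by (intro nn_integral_mono ennreal_leI) (simp add: add_increasing2)
  also have "... <= EE (1 * (47 * D) + 1 * (47 * D))"
  proof -
   have nn: "0 <= P s t $$ z + Q s t $$ z + 2 * En t $$ z" for s t z
    using PQ_nonneg[of s t "fst z" "snd z"] En_nonneg[of t "fst z" "snd z"] by linarith
   show ?thesis by (rule nn_integral_square_sum) (use D0 data_null[OF D0 D] nn in auto)
  qed
  finally show "(NN z. EE (Qsum 0 $$ z)) <= EE (94 * D)" by simp
 qed (use D0 in auto)
 also have "... <= EE (?B t)" using D0 by (intro ennreal_leI) simp
 finally show ?thesis .
qed

lemma Sc_bound: "0 <= t ==> (NN z. EE ((Sc t $$ z)^2)) <= EE (1128 * D * (1 + t) powr ((5 - p) / 2))"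
 by (rule order_trans[OF nn_integral_mono conformal_bound]) (auto intro!: ennreal_leI Sc_sq)

text \<open>\<open>T (d/dt) \<integral> u\<^sup>2 = 2 \<integral> u S\<close> with \<open>T = 1 + t\<close>, cut off at \<open>|x| <= R T\<close>, which is transported by the
 scaling field.\<close>
lemma L2_growth:
 assumes t1: "0 <= t1" and p: "p < 5"
 shows "(NN z. EE ((u t1 $$ z)^2))
  <= EE ((21 + 18048 / (5 - p)^2) * D * (1 + t1) powr ((5 - p) / 2))"
proof -
 define a where "a = (5 - p) / 2"
 define d where "d = a / 2"
 define c where "c = 1128 * D"
 have a: "0 < a" "0 < d" using p by (auto simp: a_def d_def)
 have c0: "0 <= c" using D0 by (simp add: c_def)
 define m where "m = (%R t x y. psq (R^2 * (1 + t)^2 - x^2 - y^2))"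
 define M where "M = (%(R::real) t x y. 2 * max 0 (R^2 * (1 + t)^2 - x^2 - y^2))"
 have cur0: "is_current (%t x y. (1 + t) * (u t x y)^2) (%t x y. x * (u t x y)^2) (%t x y. y * (u t x y)^2)
   (%t x y. (u t x y)^2 + 2 * u t x y * Sc t x y)"
 proof (rule is_currentI)
  fix t x y
  show "((%t. (1 + t) * (u t x y)^2) hrd (u t x y)^2 + 2 * (1 + t) * u t x y * ut t x y) (at t)"
   by (auto intro!: derivative_eq_intros du)
  show "((%x. x * (u t x y)^2) hrd (u t x y)^2 + 2 * x * u t x y * ux t x y) (at x)"
   by (auto intro!: derivative_eq_intros du)
  show "((%y. y * (u t x y)^2) hrd (u t x y)^2 + 2 * y * u t x y * uy t x y) (at y)"
   by (auto intro!: derivative_eq_intros du)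
  show "(u t x y)^2 + 2 * (1 + t) * u t x y * ut t x y + ((u t x y)^2 + 2 * x * u t x y * ux t x y) +
   ((u t x y)^2 + 2 * y * u t x y * uy t x y) = (u t x y)^2 + 2 * u t x y * Sc t x y"
   unfolding Sc_def by (simp add: algebra_simps power2_eq_square)
 qed (unfold cont3_def, (intro continuous_intros cont[THEN cont3_comp]; simp)+)
 have cur: "is_current (%t x y. m R t x y * ((1 + t) * (u t x y)^2)) (%t x y. m R t x y * (x * (u t x y)^2)) (%t x y. m R t x y * (y * (u t x y)^2))
   (%t x y. m R t x y * (5 * (u t x y)^2 + 2 * u t x y * Sc t x y))" for R
 proof -
  have "is_current (%t x y. m R t x y * ((1 + t) * (u t x y)^2)) (%t x y. m R t x y * (x * (u t x y)^2)) (%t x y. m R t x y * (y * (u t x y)^2))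
   (%t x y. m R t x y * ((u t x y)^2 + 2 * u t x y * Sc t x y) +
    ((M R t x y * (R^2 * (2 * (1 + t)))) * ((1 + t) * (u t x y)^2) + (M R t x y * (- 2 * x)) * (x * (u t x y)^2) + (M R t x y * (- 2 * y)) * (y * (u t x y)^2)))"
  proof (rule is_current_mult[OF cur0])
   fix t x y
   show "((%s. m R s x y) hrd M R t x y * (R^2 * (2 * (1 + t)))) (at t)"
    unfolding m_def M_def by (auto intro!: derivative_eq_intros)
   show "((%s. m R t s y) hrd M R t x y * (- 2 * x)) (at x)"
    unfolding m_def M_def by (auto intro!: derivative_eq_intros)
   show "((%s. m R t x s) hrd M R t x y * (- 2 * y)) (at y)"
    unfolding m_def M_def by (auto intro!: derivative_eq_intros)
  qed (auto simp: cont3_def m_def M_def intro!: continuous_intros)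
  \<comment> \<open>Euler's identity: \<open>m\<close> without its positive part is homogeneous of
    degree 4 in \<open>(1 + t, x, y)\<close>, and the positive part respects this, so the scaling
    field acts on the cutoff as multiplication by 4. With the divergence 1 already present this
    gives the 5.\<close>
  moreover have e1: "(M R t x y * (R^2 * (2 * (1 + t)))) * ((1 + t) * v) + (M R t x y * (- 2 * x)) * (x * v) + (M R t x y * (- 2 * y)) * (y * v)
   = 4 * m R t x y * v" for t x y v
  proof -
   have k: "max 0 k * k = (max 0 k)^2" for k :: real by (auto simp: max_def power2_eq_square)
   have "(M R t x y * (R^2 * (2 * (1 + t)))) * ((1 + t) * v) + (M R t x y * (- 2 * x)) * (x * v) + (M R t x y * (- 2 * y)) * (y * v)
    = 4 * v * (max 0 (R^2 * (1 + t)^2 - x^2 - y^2) * (R^2 * (1 + t)^2 - x^2 - y^2))"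
    unfolding M_def by (simp add: algebra_simps power2_eq_square)
   then show ?thesis unfolding k m_def psq_def by simp
  qed
  ultimately show ?thesis unfolding e1 by (simp add: algebra_simps)
 qed
 have m0: "0 <= m R t x y" for R t x y by (simp add: m_def psq_def)
 have mz: "m R t x y = 0" if "R * (1 + t1) <= <|x|> | R * (1 + t1) <= <|y|>" "0 < R" "t \<in> {0..t1}" for R t x y
 proof -
  have "R * (1 + t) <= R * (1 + t1)" using that by simp
  then have "R * (1 + t) <= <|x|> | R * (1 + t) <= <|y|>" using that(1) by linarith
  moreover have "0 <= R * (1 + t)" using that by simp
  ultimately have "(R * (1 + t))^2 <= x^2 + y^2"
   by (metis abs_le_square_iff abs_of_nonneg add_increasing add_increasing2 zero_le_power2)
  then show ?thesis by (simp add: m_def psq_def power_mult_distrib)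
 qed
 have mle: "m R t x y <= R^4 * (1 + t)^4" for R t x y
 proof -
  have "max 0 (R^2 * (1 + t)^2 - x^2 - y^2) <= R^2 * (1 + t)^2" by auto
  then have "m R t x y <= (R^2 * (1 + t)^2)^2" unfolding m_def psq_def by (intro power_mono) auto
  then show ?thesis by (simp add: power_mult_distrib)
 qed
 have key: "(NN z. EE (m R t1 $$ z / (R^4 * (1 + t1)^4) * (u t1 $$ z)^2))
  <= EE ((21 + 18048 / (5 - p)^2) * D * (1 + t1) powr a)" if R: "0 < R" for R
 proof -
  define S where "S = R * (1 + t1)"
  define g where "g = (%t. integral (sq_box S) (%z. m R t $$ z * (u t $$ z)^2))"
  define b where "b = (%t. integral (sq_box S) (%z. m R t $$ z * (5 * (u t $$ z)^2 + 2 * u t $$ z * Sc t $$ z)))"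
  have S0: "0 <= S" using R t1 by (simp add: S_def)
  have cm: "CO A (%z. m R t $$ z)" for A t
   unfolding m_def by (intro continuous_intros)
  note ci = continuous_intros cm cont[THEN cont3_slice] cont_slice_all
  have G: "((%t. (1 + t) * g t) hrd b t) (at t within {0..t1})" if t: "t \<in> {0..t1}" for t
  proof -
   have "((%t. integral (sq_box S) (%z. m R t $$ z * ((1 + t) * (u t $$ z)^2))) hrd b t) (at t within {0..t1})"
    unfolding b_def
    by (rule current_integral_deriv[OF cur S0 _ _ t]) (use mz[OF _ R] in \<open>auto simp: S_def\<close>)
   moreover have "integral (sq_box S) (%z. m R t $$ z * ((1 + t) * (u t $$ z)^2)) = (1 + t) * g t" for t
    unfolding g_def integral_mult_right[symmetric] by (simp add: mult_ac)
   ultimately show ?thesis by simp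
  qed
  have bb: "b t <= (5 + d) * g t + R^4 * (c / d) * (1 + t) powr (4 + a)" if t: "t \<in> {0..t1}" for t
  proof -
   have i: "integrable lborel (%z. (Sc t $$ z)^2)" "(LL z. (Sc t $$ z)^2) <= c * (1 + t) powr a"
    unfolding c_def a_def using t D0 by (auto intro!: nn_integral_le_integrable[OF _ _ Sc_bound])
   have "b t <= integral (sq_box S) (%z. (5 + d) * (m R t $$ z * (u t $$ z)^2) + R^4 * (1 + t)^4 / d * (Sc t $$ z)^2)"
    unfolding b_def
   proof (rule integral_le)
    fix z :: "real \<times> real"
    define v w k where v: "v = u t $$ z" "w = Sc t $$ z" "k = m R t $$ z"
    have "2 * v * w <= d * v^2 + w^2 / d"
    proof -
     have "0 <= (d * v - w)^2 / d" using a by simp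
     also have "... = d * v^2 - 2 * v * w + w^2 / d" using a by (simp add: power2_diff field_simps power2_eq_square)
     finally show ?thesis by simp
    qed
    then have "k * (5 * v^2 + 2 * v * w) <= k * ((5 + d) * v^2 + w^2 / d)"
     using m0 v(3) by (intro mult_left_mono) (auto simp: algebra_simps)
    also have "... = (5 + d) * (k * v^2) + k * (w^2 / d)" by (simp add: algebra_simps)
    also have "k * (w^2 / d) <= R^4 * (1 + t)^4 * (w^2 / d)"
     using mle v(3) a by (intro mult_right_mono) auto
    finally show "k * (5 * v^2 + 2 * v * w) <= (5 + d) * (k * v^2) + R^4 * (1 + t)^4 / d * w^2" by simp
   qed (intro integrable_continuous ci; simp)+
   also have "... = (5 + d) * g t + R^4 * (1 + t)^4 / d * integral (sq_box S) (%z. (Sc t $$ z)^2)"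
   proof -
    have "(%z. (5 + d) * (m R t $$ z * (u t $$ z)^2)) integrable_on sq_box S"
     "(%z. R^4 * (1 + t)^4 / d * (Sc t $$ z)^2) integrable_on sq_box S"
     by (intro integrable_continuous ci; simp)+
    then show ?thesis by (simp add: integral_add g_def)
   qed
   finally have 1: "b t <= (5 + d) * g t + R^4 * (1 + t)^4 / d * integral (sq_box S) (%z. (Sc t $$ z)^2)" .
   have "integral (sq_box S) (%z. (Sc t $$ z)^2) <= integral UNIV (%z. (Sc t $$ z)^2)"
    by (rule integral_subset_le) (use i(1) in \<open>auto intro!: integrable_continuous ci integrable_on_lborel\<close>)
   also have "... = (LL z. (Sc t $$ z)^2)" using i(1) by (rule integral_lborel)
   also note i(2)
   finally have "R^4 * (1 + t)^4 / d * integral (sq_box S) (%z. (Sc t $$ z)^2) <= R^4 * (1 + t)^4 / d * (c * (1 + t) powr a)"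
    using a t by (intro mult_left_mono) auto
   moreover have "R^4 * (1 + t)^4 / d * (c * (1 + t) powr a) = R^4 * (c / d) * (1 + t) powr (4 + a)"
   proof -
    have "(1 + t) powr 4 = (1 + t)^4" using t by (simp add: powr_numeral)
    then show ?thesis by (simp add: powr_add)
   qed
   ultimately show ?thesis using 1 by linarith
  qed
  have dpow: "((%t. (1 + t) powr e) hrd e * (1 + t) powr (e - 1)) (at t within A)" if "0 < 1 + t" for e t A
   using that by (auto intro!: derivative_eq_intros has_field_derivative_at_within[OF DERIV_chain2[where g="%t. 1 + t", OF has_real_derivative_powr]])
  have pw1: "x powr (e - 1) * x = x powr e" if "0 < x" for x e :: real
   using that by (simp add: powr_diff)
  \<comment> \<open>Gronwall with an integrating factor: \<open>5 + d\<close> is the coefficient of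
    \<open>g\<close> in \<open>bb\<close>, and \<open>d = a / 2\<close> stays below
    \<open>a\<close>, so the forcing term integrates to the growing power \<open>a - d\<close> and
    multiplying back gives the rate \<open>a\<close>.\<close>
  let ?F = "%t. ((1 + t) * g t) * (1 + t) powr (- 5 - d)"
  let ?H = "%t. R^4 * (c / d) / (a - d) * (1 + t) powr (a - d)"
  have "?F t1 - ?F 0 <= ?H t1 - ?H 0"
  proof (rule DERIV_le_mono_diff[OF t1])
   fix t assume t: "t \<in> {0..t1}"
   then have T: "0 < 1 + t" by simp
   show "(?F hrd b t * (1 + t) powr (- 5 - d) + ((- 5 - d) * (1 + t) powr (- 5 - d - 1)) * ((1 + t) * g t)) (at t within {0..t1})"
    by (intro DERIV_mult G[OF t] dpow T)
   show "(?H hrd R^4 * (c / d) * (1 + t) powr (a - d - 1)) (at t within {0..t1})"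
    by (rule DERIV_cong[OF DERIV_cmult[OF dpow[OF T]]]) (use a in \<open>simp add: d_def\<close>)
   have e: "(1 + t) powr (- 5 - d - 1) * (1 + t) = (1 + t) powr (- 5 - d)"
    by (rule pw1[OF T])
   have "b t * (1 + t) powr (- 5 - d) + ((- 5 - d) * (1 + t) powr (- 5 - d - 1)) * ((1 + t) * g t)
     = (b t - (5 + d) * g t) * (1 + t) powr (- 5 - d)"
    unfolding e[symmetric] by (simp add: algebra_simps)
   also have "... <= (R^4 * (c / d) * (1 + t) powr (4 + a)) * (1 + t) powr (- 5 - d)"
    using bb[OF t] by (intro mult_right_mono) auto
   also have "... = R^4 * (c / d) * (1 + t) powr (a - d - 1)"
    by (simp add: powr_add[symmetric] mult.assoc)
   finally show "b t * (1 + t) powr (- 5 - d) + ((- 5 - d) * (1 + t) powr (- 5 - d - 1)) * ((1 + t) * g t) <= R^4 * (c / d) * (1 + t) powr (a - d - 1)" .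
  qed
  moreover have "?F 0 = g 0" by simp
  moreover have "0 <= ?H 0" using R a c0 by (simp add: d_def)
  ultimately have 1: "?F t1 <= g 0 + R^4 * (c / d) / (a - d) * (1 + t1) powr (a - d)" by linarith
  have g0: "g 0 <= R^4 * (21 * D)"
  proof -
   have i: "integrable lborel (%z. (u 0 $$ z)^2)" "(LL z. (u 0 $$ z)^2) <= 21 * D"
    using D0 by (auto intro!: nn_integral_le_integrable[OF _ _ data_L2[OF D0 D]])
   have "g 0 <= integral (sq_box S) (%z. R^4 * (u 0 $$ z)^2)"
    unfolding g_def
    by (rule integral_le) (use mle[of R 0] in \<open>auto intro!: integrable_continuous ci mult_right_mono\<close>)
   also have "... <= integral UNIV (%z. R^4 * (u 0 $$ z)^2)"
    by (rule integral_subset_le) (use i(1) in \<open>auto intro!: integrable_continuous ci integrable_on_lborel\<close>)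
   also have "... = R^4 * (LL z. (u 0 $$ z)^2)" using integral_lborel[OF i(1)] by simp
   also have "... <= R^4 * (21 * D)" using i(2) by (intro mult_left_mono) auto
   finally show ?thesis .
  qed
  have T1: "1 <= 1 + t1" "0 < 1 + t1" using t1 by auto
  have "g t1 / (1 + t1)^4 * (1 + t1) powr (- d) = ?F t1"
  proof -
   define T where "T = 1 + t1"
   have T: "0 < T" using T1 by (simp add: T_def)
   have e: "- 5 - d = - d - 5" by simp
   have "T powr 5 = T * T^4" using T by (simp add: powr_numeral power_numeral_reduce)
   then have "T powr (- 5 - d) = T powr (- d) / (T * T^4)" unfolding e powr_diff by simp
   then show ?thesis unfolding T_def[symmetric] using T by simp
  qed
  then have "g t1 / (1 + t1)^4 * (1 + t1) powr (- d) <= R^4 * (21 * D) + R^4 * (c / d) / d * (1 + t1) powr d"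
   using 1 g0 by (simp add: d_def)
  then have "g t1 / (1 + t1)^4 * (1 + t1) powr (- d) * (1 + t1) powr d <= (R^4 * (21 * D) + R^4 * (c / d) / d * (1 + t1) powr d) * (1 + t1) powr d"
   by (intro mult_right_mono) auto
  also have "g t1 / (1 + t1)^4 * (1 + t1) powr (- d) * (1 + t1) powr d = g t1 / (1 + t1)^4"
   using T1 by (simp add: powr_minus)
  also have "(R^4 * (21 * D) + R^4 * (c / d) / d * (1 + t1) powr d) * (1 + t1) powr d = R^4 * (21 * D * (1 + t1) powr d + c / d^2 * (1 + t1) powr a)"
   by (simp add: algebra_simps power2_eq_square powr_add[symmetric] d_def)
  also have "... <= R^4 * (21 * D * (1 + t1) powr a + c / d^2 * (1 + t1) powr a)"
   using T1 a D0 by (intro mult_left_mono add_mono order_refl powr_mono) (auto simp: d_def)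
  also have "... = R^4 * ((21 + 18048 / (5 - p)^2) * D * (1 + t1) powr a)"
  proof -
   \<comment> \<open>\<open>d = (5 - p) / 4\<close> and \<open>18048 = 16 * 1128\<close>.\<close>
   have "c / d^2 = 18048 / (5 - p)^2 * D" using p by (simp add: c_def d_def a_def power_divide)
   then show ?thesis by (simp add: algebra_simps)
  qed
  finally have gg: "g t1 / (1 + t1)^4 / R^4 <= (21 + 18048 / (5 - p)^2) * D * (1 + t1) powr a"
  proof -
   have R4: "0 < R^4" using R by simp
   show ?thesis if "g t1 / (1 + t1)^4 <= R^4 * ((21 + 18048 / (5 - p)^2) * D * (1 + t1) powr a)"
    using that unfolding pos_divide_le_eq[OF R4] by (simp only: mult.commute)
  qed
  have z: "m R t1 $$ z = 0" if "z \<notin> sq_box S" for z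
   using that mz[of R "fst z" "snd z" t1] R t1 unfolding in_sq_box S_def by auto
  have cc: "CO (sq_box S) (%z. m R t1 $$ z / (R^4 * (1 + t1)^4) * (u t1 $$ z)^2)"
   using R T1 by (intro ci) auto
  have "m R t1 $$ z / (R^4 * (1 + t1)^4) * (u t1 $$ z)^2 = 0" if "z \<notin> sq_box S" for z
   using z[OF that] by simp
  note integral_sq_box_lborel[OF cc this]
  moreover have "integral (sq_box S) (%z. m R t1 $$ z / (R^4 * (1 + t1)^4) * (u t1 $$ z)^2) = g t1 / (1 + t1)^4 / R^4"
   unfolding g_def by (simp add: mult.commute)
  ultimately show ?thesis
   using gg m0 R T1 by (subst nn_integral_eq_integral) (auto intro!: ennreal_leI)
 qed
 have "(NN z. EE ((u t1 $$ z)^2)) <= EE ((21 + 18048 / (5 - p)^2) * D * (1 + t1) powr a)"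
 proof (rule nn_integral_le_of_tendsto[where f="%n z. EE (m (real (Suc n)) t1 $$ z / ((real (Suc n))^4 * (1 + t1)^4) * (u t1 $$ z)^2)"])
  fix n
  show "(%z. EE (m (real (Suc n)) t1 $$ z / ((real (Suc n))^4 * (1 + t1)^4) * (u t1 $$ z)^2)) \<in> borel_measurable lborel"
  proof -
   have [measurable]: "(%z. m (real (Suc n)) t1 $$ z) \<in> BB"
    unfolding m_def by (intro borel_measurable_continuous_onI continuous_intros)
   show ?thesis by measurable
  qed
 next
  fix z :: "real \<times> real"
  define K where "K = ((fst z)^2 + (snd z)^2) / (1 + t1)^2"
  have T1: "0 < 1 + t1" using t1 by simp
  have l: "(%n. 1 / real (Suc n)) ----> 0" using LIMSEQ_Suc[OF lim_1_over_n] by simp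
  have "(%n. (max 0 (1 - K * (1 / real (Suc n) * (1 / real (Suc n)))))^2 * (u t1 $$ z)^2) ----> (max 0 (1 - K * (0 * 0)))^2 * (u t1 $$ z)^2"
   by (intro tendsto_intros l)
  moreover have "(max 0 (1 - K * (1 / real (Suc n) * (1 / real (Suc n)))))^2 = m (real (Suc n)) t1 $$ z / ((real (Suc n))^4 * (1 + t1)^4)" for n
  proof -
   define q where "q = (real (Suc n))^2 * (1 + t1)^2"
   have q: "0 < q" using T1 by (simp add: q_def)
   have "1 - K * (1 / real (Suc n) * (1 / real (Suc n))) = (q - (fst z)^2 - (snd z)^2) / q"
   proof -
    have "K * (1 / real (Suc n) * (1 / real (Suc n))) = ((fst z)^2 + (snd z)^2) / q"
     using T1 by (simp add: K_def q_def power2_eq_square mult_ac del: of_nat_Suc)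
    then show ?thesis using q by (simp add: diff_divide_distrib add_divide_distrib)
   qed
   then have "max 0 (1 - K * (1 / real (Suc n) * (1 / real (Suc n)))) = max 0 (q - (fst z)^2 - (snd z)^2) / q"
    using q by (simp add: max_def zero_le_divide_iff)
   then show ?thesis unfolding m_def psq_def q_def[symmetric] by (simp add: power_divide q_def power_mult_distrib del: of_nat_Suc)
  qed
  ultimately show "(%n. EE (m (real (Suc n)) t1 $$ z / ((real (Suc n))^4 * (1 + t1)^4) * (u t1 $$ z)^2)) ----> EE ((u t1 $$ z)^2)"
   by (intro tendsto_ennrealI) simp
 qed (use key in auto)
 then show ?thesis by (simp add: a_def)
qed

end

end

subsection \<open>A Gagliardo inequality in polar coordinates\<close>

text \<open>The cosine of the angle of a ray with slope \<open>s\<close>. The point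
  \<open>(r * ks s, r * ks s * s)\<close> has norm \<open>r\<close>, and \<open>(ks s)^2\<close> is
  the derivative of the angle with respect to the slope.\<close>

definition ks :: "real => real" where "ks s = 1 / sqrt (1 + s^2)"

lemma ks: "0 < ks s" "(ks s)^2 * (1 + s^2) = 1" "s \<in> {-1..1} ==> 1/2 <= (ks s)^2" "(ks hrd - s * (ks s)^3) (at s)"
proof -
 have p: "0 < 1 + s^2" for s :: real by (simp add: add_pos_nonneg)
 then show "0 < ks s" by (simp add: ks_def)
 have kk: "(ks s)^2 = 1 / (1 + s^2)" using p[of s] by (simp add: ks_def power_divide)
 then show "(ks s)^2 * (1 + s^2) = 1" using p[of s] by simp
 show "1/2 <= (ks s)^2" if "s \<in> {-1..1}"
 proof -
  have "s^2 <= 1" using that by (simp add: abs_square_le_1 abs_le_iff)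
  then show ?thesis unfolding kk using p[of s] by (simp add: field_simps)
 qed
 have w: "sqrt (1 + s^2) ~= 0" using p[of s] by simp
 have dw: "((%s. sqrt (1 + s^2)) hrd s / sqrt (1 + s^2)) (at s)"
  using p[of s] by (auto intro!: derivative_eq_intros simp: field_simps)
 show "(ks hrd - s * (ks s)^3) (at s)" unfolding ks_def[abs_def]
  by (rule DERIV_cong[OF DERIV_divide[OF DERIV_const dw w]]) (simp add: power3_eq_cube)
qed

text \<open>Polar coordinates from two one-dimensional affine substitutions:
  \<open>y = x * s\<close> for fixed \<open>x\<close>, then \<open>x = r * ks s\<close> for fixed
  \<open>s\<close>. Using the slope in place of the angle makes this possible; the Jacobian is
  \<open>r * (ks s)^2\<close>.\<close>

lemma nn_integral_sector:
 fixes F :: "real \<times> real => ennreal"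
 assumes [measurable]: "F \<in> BB"
 shows "(NN z. F z * ind {z. 0 < fst z & <|snd z|> <= fst z} z)
  = (NN s. (NN r. EE (r * (ks s)^2) * F (r * ks s, r * ks s * s) * ind {0<..} r) * ind {-1..1} s)"
proof -
 let ?S = "{z::real\<times>real. 0 < fst z & <|snd z|> <= fst z}"
 have [measurable]: "?S \<in> sets borel"
 proof -
  have "?S = {z. 0 < fst z} \<inter> {z. <|snd z|> <= fst z}" by auto
  also have "... \<in> sets borel"
   by (intro sets.Int borel_closed borel_open closed_Collect_le open_Collect_less continuous_intros)
  finally show ?thesis .
 qed
 have mF: "(%z. F z * ind ?S z) \<in> borel_measurable (lborel \<Otimes>\<^sub>M lborel)"
  by (simp add: lborel_prod)
 have [measurable]: "F \<in> borel_measurable (borel \<Otimes>\<^sub>M borel)" by (simp add: borel_prod)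
 have "(NN z. F z * ind ?S z) = (NN x. (NN y. F (x, y) * ind ?S (x, y)))"
  using lborel.nn_integral_fst[OF mF] by (simp add: lborel_prod)
 also have "... = (NN x. (NN s. EE x * F (x, x * s) * ind {0<..} x * ind {-1..1} s))"
 proof (rule nn_integral_cong)
  fix x :: real
  show "(NN y. F (x, y) * ind ?S (x, y)) = (NN s. EE x * F (x, x * s) * ind {0<..} x * ind {-1..1} s)"
  proof (cases "0 < x")
   case True
   have "(NN y. F (x, y) * ind ?S (x, y)) = EE <|x|> * (NN s. F (x, 0 + x * s) * ind ?S (x, 0 + x * s))"
   proof (rule nn_integral_real_affine)
    have "(%y. F (x, y) * ind {y. <|y|> <= x} y) \<in> BB" by measurable
    then show "(%y. F (x, y) * ind ?S (x, y)) \<in> BB"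
     using True by (simp add: indicator_def)
   qed (use True in auto)
   also have "... = (NN s. EE x * (F (x, x * s) * ind {-1..1} s))"
   proof -
    have "<|x * s|> <= x \<longleftrightarrow> s \<in> {-1..1}" for s
     using True mult_le_cancel_left_pos[of x "<|s|>" 1] by (auto simp: abs_mult abs_le_iff)
    then have "ind ?S (x, x * s) = (ind {-1..1} s :: ennreal)" for s using True by (simp add: indicator_def)
    then show ?thesis using True by (subst nn_integral_cmult) auto
   qed
   finally show ?thesis using True by (simp add: mult.assoc)
  qed (auto simp: indicator_def)
 qed
 also have "... = (NN s. (NN x. EE x * F (x, x * s) * ind {0<..} x * ind {-1..1} s))"
  by (rule lborel_pair.Fubini'[symmetric]) measurable
 also have "... = (NN s. (NN r. EE (r * (ks s)^2) * F (r * ks s, r * ks s * s) * ind {0<..} r) * ind {-1..1} s)"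
 proof (rule nn_integral_cong)
  fix s :: real
  define c where "c = ks s"
  have c: "0 < c" using ks(1) by (simp add: c_def)
  have "(NN x. EE x * F (x, x * s) * ind {0<..} x) = EE <|c|> * (NN r. EE (0 + c * r) * F (0 + c * r, (0 + c * r) * s) * ind {0<..} (0 + c * r))"
   using c by (intro nn_integral_real_affine) auto
  also have "... = (NN r. EE c * (EE (c * r) * F (c * r, c * r * s) * ind {0<..} (c * r)))"
   using c by (subst nn_integral_cmult) auto
  also have "... = (NN r. EE (r * (ks s)^2) * F (r * ks s, r * ks s * s) * ind {0<..} r)"
  proof (rule nn_integral_cong)
   fix r :: real
   have "0 < r ==> ennreal c * EE (c * r) = EE (r * c^2)" using c by (simp add: ennreal_mult[symmetric] power2_eq_square mult_ac)
   then show "EE c * (EE (c * r) * F (c * r, c * r * s) * ind {0<..} (c * r)) = EE (r * (ks s)^2) * F (r * ks s, r * ks s * s) * ind {0<..} r"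
    using c by (cases "0 < r") (simp_all add: c_def[symmetric] mult.assoc[symmetric] mult.commute[of r] zero_less_mult_iff)
  qed
  finally have 1: "(NN x. EE x * F (x, x * s) * ind {0<..} x) = (NN r. EE (r * (ks s)^2) * F (r * ks s, r * ks s * s) * ind {0<..} r)" .
  show "(NN x. EE x * F (x, x * s) * ind {0<..} x * ind {-1..1} s) = (NN r. EE (r * (ks s)^2) * F (r * ks s, r * ks s * s) * ind {0<..} r) * ind {-1..1} s"
   unfolding 1[symmetric] by (rule nn_integral_multc) measurable
 qed
 finally show ?thesis .
qed

lemma abs_diff_le_nn_integral:
 fixes H :: "real => real"
 assumes "!!r. (H hrd H' r) (at r)" "CO UNIV H'" "a <= b"
 shows "EE <|H b - H a|> <= (NN r. EE <|H' r|> * ind {a..b} r)"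
proof -
 have c: "CO {a..b} H'" using assms(2) continuous_on_subset by blast
 have i: "(H' has_integral (H b - H a)) {a..b}"
  by (rule fundamental_theorem_of_calculus[OF assms(3)])
   (use assms(1) in \<open>auto simp: has_real_derivative_iff_has_vector_derivative[symmetric] intro: has_field_derivative_at_within\<close>)
 have "norm (integral {a..b} H') <= integral {a..b} (%r. <|H' r|>)"
  by (rule integral_norm_bound_integral) (use c in \<open>auto intro!: integrable_continuous_interval continuous_intros\<close>)
 then have "EE <|H b - H a|> <= EE (integral {a..b} (%r. <|H' r|>))"
  using integral_unique[OF i] by (intro ennreal_leI) simp
 also have "... = (NN r. EE <|H' r|> * ind {a..b} r)"
  by (rule nn_integral_compact_continuous[symmetric]) (use c in \<open>auto intro!: continuous_intros\<close>)
 finally show ?thesis .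
qed

lemma nn_integral_rot:
 fixes F :: "real \<times> real => ennreal"
 assumes [measurable]: "F \<in> BB"
 shows "(NN z. F (- snd z, fst z)) = (NN z. F z)"
proof -
 have [measurable]: "F \<in> borel_measurable (borel \<Otimes>\<^sub>M borel)" by (simp add: borel_prod)
 have m: "(%z. F (- snd z, fst z)) \<in> borel_measurable (lborel \<Otimes>\<^sub>M lborel)" "F \<in> borel_measurable (lborel \<Otimes>\<^sub>M lborel)"
  by measurable
 have "(NN z. F (- snd z, fst z)) = (NN x. (NN y. F (- y, x)))"
  using lborel.nn_integral_fst[OF m(1)] by (simp add: lborel_prod)
 also have "... = (NN x. (NN y. F (y, x)))"
 proof (rule nn_integral_cong)
  fix x :: real
  show "(NN y. F (- y, x)) = (NN y. F (y, x))"
   using nn_integral_real_affine[of "%y. F (y, x)" "-1" 0] by simp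
 qed
 also have "... = (NN z. F z)"
  using lborel_pair.nn_integral_snd[OF m(2)] by (simp add: lborel_prod)
 finally show ?thesis .
qed

lemma continuous_on_compose_pair:
 assumes "CO UNIV (%z. f $$ z)" "CO S a" "CO S b"
 shows "CO S (%x. f (a x) (b x))"
 using continuous_on_compose2[OF assms(1) continuous_on_Pair[OF assms(2,3)]] by simp

text \<open>Complex multiplication by \<open>e\<close>; \<open>quarter\<close> lists the four powers
  of the imaginary unit.\<close>

definition rot :: "real \<times> real => real \<times> real => real \<times> real" where
 "rot e z = (fst e * fst z - snd e * snd z, snd e * fst z + fst e * snd z)"
definition quarter :: "(real \<times> real) set" where "quarter = {(1, 0), (0, 1), (-1, 0), (0, -1)}"

text \<open>The integral over the quarter plane around direction \<open>e\<close>, in the coordinates radius and slope.\<close>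
definition sector :: "real \<times> real => (real \<times> real => real) => ennreal" where
 "sector e F = (NN s. (NN r. EE (r * (ks s)^2 * F (rot e (r * ks s, r * ks s * s))) * ind {0<..} r) * ind {-1..1} s)"

lemma rot_meas: "rot e \<in> BB"
 unfolding rot_def[abs_def] by (intro borel_measurable_continuous_onI continuous_intros)

lemma nn_integral_rot4:
 assumes e: "e \<in> quarter" and F: "F \<in> BB"
 shows "(NN z. F (rot e z)) = (NN z. F z :: ennreal)"
proof -
 have r: "(NN z. F (- snd z, fst z)) = (NN z. F z)" if "F \<in> BB" for F :: "real \<times> real => ennreal" by (rule nn_integral_rot[OF that])
 have m: "(%z. F (rot d z)) \<in> BB" for d by (rule measurable_compose[OF rot_meas F])
 show ?thesis using e r[OF F] r[OF m[of "(0,1)"]] r[OF m[of "(-1,0)"]] by (auto simp: quarter_def rot_def)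
qed

lemma sector_eq:
 assumes e: "e \<in> quarter" and F: "F \<in> BB" "!!z. 0 <= F z"
 shows "sector e F = (NN z. EE (F (rot e z)) * ind {z. 0 < fst z & <|snd z|> <= fst z} z)"
 unfolding sector_def
 by (subst nn_integral_sector) (auto simp: ennreal_mult F indicator_def intro!: nn_integral_cong measurable_compose[OF rot_meas F(1)] measurable_compose[OF measurable_compose[OF rot_meas F(1)] measurable_ennreal])

lemma sector_le:
 assumes e: "e \<in> quarter" and F: "F \<in> BB" "!!z. 0 <= F z"
 shows "sector e F <= (NN z. EE (F z))"
proof -
 have "sector e F <= (NN z. EE (F (rot e z)))" unfolding sector_eq[OF assms] by (intro nn_integral_mono) (auto simp: indicator_def)
 also have "... = (NN z. EE (F z))" using nn_integral_rot4[OF e measurable_compose[OF F(1) measurable_ennreal]] .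
 finally show ?thesis .
qed

lemma sector_cover:
 assumes [measurable]: "F \<in> BB" and F0: "!!z. 0 <= F z"
 shows "(NN z. EE (F z)) <= (\<Sum>e\<in>quarter. sector e F)"
proof -
 \<comment> \<open>\<open>?c e\<close> is the complex conjugate of \<open>e\<close> and undoes its
   rotation. The four rotated sectors cover the plane except the origin, and overlaps do no harm to
   an upper bound.\<close>
 let ?S = "{z::real\<times>real. 0 < fst z & <|snd z|> <= fst z}" and ?c = "%e::real\<times>real. (fst e, - snd e)"
 have mS: "?S \<in> sets borel"
 proof -
  have "?S = {z. 0 < fst z} \<inter> {z. <|snd z|> <= fst z}" by auto
  also have "... \<in> sets borel" by (intro sets.Int borel_closed borel_open closed_Collect_le open_Collect_less continuous_intros)
  finally show ?thesis .
 qed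
 note [measurable] = measurable_compose[OF rot_meas borel_measurable_indicator[OF mS]]
 have "(NN z. EE (F z)) <= (NN z. (\<Sum>e\<in>quarter. EE (F z) * ind ?S (rot (?c e) z)))"
 proof (rule nn_integral_mono_AE)
  show "AE z in lborel. EE (F z) <= (\<Sum>e\<in>quarter. EE (F z) * ind ?S (rot (?c e) z))"
   using AE_lborel_singleton[of "0::real\<times>real"]
  proof eventually_elim
   case (elim z)
   then have "fst z ~= 0 | snd z ~= 0" by (simp add: prod_eq_iff)
   then have "\<exists>e\<in>quarter. rot (?c e) z \<in> ?S" by (auto simp: quarter_def rot_def)
   then obtain e where e: "e \<in> quarter" "rot (?c e) z \<in> ?S" by blast
   have "EE (F z) * ind ?S (rot (?c e) z) <= (\<Sum>e\<in>quarter. EE (F z) * ind ?S (rot (?c e) z))"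
    by (rule member_le_sum[OF e(1)]) (auto simp: quarter_def)
   then show ?case using e(2) by simp
  qed
 qed
 also have "... = (\<Sum>e\<in>quarter. NN z. EE (F z) * ind ?S (rot (?c e) z))" by (rule nn_integral_sum) measurable
 also have "... = (\<Sum>e\<in>quarter. sector e F)"
 proof (rule sum.cong[OF refl])
  fix e assume e: "e \<in> quarter"
  have "rot (?c e) (rot e z) = z" for z using e by (auto simp: quarter_def rot_def)
  then show "(NN z. EE (F z) * ind ?S (rot (?c e) z)) = sector e F"
   using nn_integral_rot4[OF e, of "%z. EE (F z) * ind ?S (rot (?c e) z)"] by (simp add: sector_eq[OF e _ F0])
 qed
 finally show ?thesis .
qed

text \<open>Near the origin the values of \<open>f\<close> are not divided by \<open>T\<close>
  profitably, so they are traded for values at \<open>r >= T/2\<close> and for \<open>r * f'\<close>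
  in the interior. The factor \<open>r\<close> appears by Tonelli, as the length of the set of
  starting points below \<open>r\<close>.\<close>

lemma nn_integral_outer_bound:
 fixes f :: "real => real"
 assumes d: "!!r. (f hrd f' r) (at r)" and c: "CO UNIV f'" and T: "0 < T"
 shows "(NN r. EE <|f r|> * ind {0<..} r) <= (NN r. EE ((if T/2 <= r then 3 * <|f r|> else 0) + (if r < 3/4*T then r * <|f' r|> else 0)) * ind {0<..} r)"
proof -
 have cf: "CO S f" for S using d by (meson DERIV_isCont continuous_at_imp_continuous_on)
 have [measurable]: "f \<in> BB" "f' \<in> BB" using c cf by (auto intro: borel_measurable_continuous_onI)
 \<comment> \<open>The window has length \<open>T/4\<close> and \<open>q\<close> minimises there, so
   \<open>T/2\<close> times the value at \<open>q\<close> is at most the integral of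
   \<open>2 * f\<close> in absolute value over the window; with the outer part itself this makes
   3.\<close>
 obtain q where q: "q \<in> {T/2..3/4*T}" "!!r. r \<in> {T/2..3/4*T} ==> <|f q|> <= <|f r|>"
  using continuous_attains_inf[of "{T/2..3/4*T}" "%r. <|f r|>"] continuous_on_rabs[OF cf] T by (simp add: Bex_def Ball_def) metis
 define C where "C = {z::real\<times>real. fst z <= snd z & snd z <= q}"
 have "closed ({z::real\<times>real. fst z <= snd z} \<inter> {z. snd z <= q})" by (intro closed_Int closed_Collect_le continuous_intros)
 then have [measurable]: "C \<in> sets (borel \<Otimes>\<^sub>M borel)" using borel_closed[of C] unfolding C_def by (metis borel_prod Collect_conj_eq)
 let ?K = "%r x. EE <|f' x|> * ind C (r, x) * ind {0<..<T/2} r"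
 have iC: "ind {r..q} x = (ind C (r, x) :: ennreal)" for r x by (auto simp: C_def indicator_def)
 have "(NN r. EE <|f r|> * ind {0<..<T/2} r) <= (NN r. EE <|f q|> * ind {0<..<T/2} r + (NN x. ?K r x))"
 proof (rule nn_integral_mono)
  fix r
  show "EE <|f r|> * ind {0<..<T/2} r <= EE <|f q|> * ind {0<..<T/2} r + (NN x. ?K r x)"
  proof (cases "r \<in> {0<..<T/2}")
   case True
   have "EE <|f r|> <= EE (<|f q|> + <|f q - f r|>)" by (intro ennreal_leI) linarith
   also have "... = EE <|f q|> + EE <|f q - f r|>" by simp
   also have "EE <|f q - f r|> <= (NN x. EE <|f' x|> * ind {r..q} x)"
    using True q by (intro abs_diff_le_nn_integral[OF d c]) auto
   finally show ?thesis using True by (simp add: add_left_mono iC)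
  qed auto
 qed
 also have "... = (NN r. EE <|f q|> * ind {0<..<T/2} r) + (NN r. NN x. ?K r x)" by (rule nn_integral_add) measurable
 also have "(NN r. NN x. ?K r x) = (NN x. NN r. ?K r x)" by (rule lborel_pair.Fubini'[symmetric]) measurable
 also have "... <= (NN x. EE (if x < 3/4*T then x * <|f' x|> else 0) * ind {0<..} x)"
 proof (rule nn_integral_mono_AE)
  show "AE x in lborel. (NN r. ?K r x) <= EE (if x < 3/4*T then x * <|f' x|> else 0) * ind {0<..} x"
   using AE_lborel_singleton[of "3/4*T"]
  proof eventually_elim
   case (elim x)
   have "(NN r. ?K r x) <= (NN r. EE (if x < 3/4*T then <|f' x|> else 0) * ind {0..x} r * ind {0<..} x)"
    using q elim by (intro nn_integral_mono) (auto simp: indicator_def C_def)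
   also have "... = EE (if x < 3/4*T then x * <|f' x|> else 0) * ind {0<..} x"
    by (cases "0 < x") (auto simp: nn_integral_cmult_indicator ennreal_mult[symmetric] mult.commute)
   finally show ?case .
  qed
 qed
 also have "(NN r. EE <|f q|> * ind {0<..<T/2} r) = (NN r. EE (2 * <|f q|>) * ind {T/2..3/4*T} r)"
  using T by (simp add: nn_integral_cmult_indicator ennreal_mult[symmetric])
 also have "... <= (NN r. EE (2 * <|f r|>) * ind {T/2..} r)"
  using q by (intro nn_integral_mono) (auto simp: indicator_def intro!: ennreal_leI)
 finally have 1: "(NN r. EE <|f r|> * ind {0<..<T/2} r) <= (NN r. EE (2 * <|f r|>) * ind {T/2..} r) + (NN x. EE (if x < 3/4*T then x * <|f' x|> else 0) * ind {0<..} x)"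
  by (simp add: add_right_mono)
 have "(NN r. EE <|f r|> * ind {0<..} r) = (NN r. EE <|f r|> * ind {T/2..} r) + (NN r. EE <|f r|> * ind {0<..<T/2} r)"
  using T by (subst nn_integral_add[symmetric]) (auto intro!: nn_integral_cong simp: indicator_def)
 also have "... <= (NN r. EE <|f r|> * ind {T/2..} r) + ((NN r. EE (2 * <|f r|>) * ind {T/2..} r) + (NN x. EE (if x < 3/4*T then x * <|f' x|> else 0) * ind {0<..} x))"
  using 1 by (rule add_left_mono)
 also have "... = (NN r. EE ((if T/2 <= r then 3 * <|f r|> else 0) + (if r < 3/4*T then r * <|f' r|> else 0)) * ind {0<..} r)"
  using T by (simp add: nn_integral_add[symmetric]) (auto intro!: nn_integral_cong simp: indicator_def ennreal_plus[symmetric] simp del: ennreal_plus)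
 finally show ?thesis .
qed

text \<open>A Gagliardo inequality in polar coordinates: tangential derivatives gain a factor \<open>1 / T\<close> away from the origin.\<close>
lemma gagliardo_polar:
 fixes h hx hy :: "real => real => real"
 assumes dh: "!!x y. ((%z. h $$ z) has_derivative (%k. fst k * hx x y + snd k * hy x y)) (at (x,y))"
  and c: "CO UNIV (%z. hx $$ z)" "CO UNIV (%z. hy $$ z)"
  and supp: "!!x y. R^2 <= x^2 + y^2 ==> h x y = 0" and T: "0 < T"
 shows "(NN z. EE ((h $$ z)^2))
  <= 144 * (NN z. EE (sqrt ((hx $$ z)^2 + (hy $$ z)^2)))
   * ((NN z. EE ((<|h $$ z|> + <|fst z * hy $$ z - snd z * hx $$ z|>) / T))
    + (NN z. EE (sqrt ((hx $$ z)^2 + (hy $$ z)^2)) * ind {z. (fst z)^2 + (snd z)^2 < (3/4 * T)^2} z))"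
proof -
 define G where "G = (%x y. sqrt ((hx x y)^2 + (hy x y)^2))"
 define Om where "Om = (%x y. x * hy x y - y * hx x y)"
 define WI where "WI = (%x y. (<|h x y|> + <|Om x y|>) / T + (if x^2 + y^2 < (3/4*T)^2 then G x y else 0))"
 have ch: "CO UNIV (%z. h $$ z)"
 proof (rule continuous_at_imp_continuous_on, rule ballI)
  fix z show "isCont (%z. h $$ z) z" using has_derivative_continuous[OF dh[of "fst z" "snd z"]] by simp
 qed
 note cc = continuous_on_compose_pair[OF ch] continuous_on_compose_pair[OF c(1)] continuous_on_compose_pair[OF c(2)]
 have G0: "0 <= G x y" "0 <= WI x y" for x y using T by (auto simp: G_def WI_def)
 have mh: "(%z. h $$ z) \<in> BB" "(%z. G $$ z) \<in> BB" "(%z. (<|h $$ z|> + <|Om $$ z|>) / T) \<in> BB" unfolding G_def Om_def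
  by (intro borel_measurable_continuous_onI continuous_intros c ch; use T in simp)+
 have mb: "{z::real\<times>real. (fst z)^2 + (snd z)^2 < (3/4*T)^2} \<in> sets borel" by (intro borel_open open_Collect_less continuous_intros)
 note [measurable] = mh mb
 have mI: "(%z. EE (G $$ z) * ind {z. (fst z)^2 + (snd z)^2 < (3/4*T)^2} z) \<in> BB" by measurable
 have mWI: "(%z. WI $$ z) \<in> BB"
 proof -
  have "(%z. (<|h $$ z|> + <|Om $$ z|>) / T + G $$ z * ind {z. (fst z)^2 + (snd z)^2 < (3/4*T)^2} z) \<in> BB" by measurable
  then show ?thesis by (rule back_subst[where P="%f. f \<in> BB"]) (auto simp: WI_def indicator_def)
 qed
 define IG where "IG = (NN z. EE (G $$ z))"
 define IW where "IW = (NN z. EE (WI $$ z))"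
 have sec: "sector e (%z. (h $$ z)^2) <= 2 * IG * (18 * IW)" if e: "e \<in> quarter" for e
 proof -
  \<comment> \<open>\<open>(cs s, ds s)\<close> is the unit vector of the ray with slope
    \<open>s\<close> in the sector around \<open>e\<close>.\<close>
  define cs where "cs = (%s. ks s * (fst e - s * snd e))"
  define ds where "ds = (%s. ks s * (snd e + s * fst e))"
  have rot: "rot e (r * ks s, r * ks s * s) = (r * cs s, r * ds s)" for r s by (simp add: rot_def cs_def ds_def algebra_simps)
  have e1: "(fst e)^2 + (snd e)^2 = 1" using e by (auto simp: quarter_def)
  have cd: "(cs s)^2 + (ds s)^2 = 1" for s
  proof -
   have "(cs s)^2 + (ds s)^2 = (ks s)^2 * (1 + s^2) * ((fst e)^2 + (snd e)^2)" by (simp add: cs_def ds_def power2_eq_square algebra_simps)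
   then show ?thesis by (simp add: ks(2) e1)
  qed
  have al: "- s * K^3 * (a - s * b) + - b * K = - (K^2 * (K * (b + s * a)))" "- s * K^3 * (b + s * a) + a * K = K^2 * (K * (a - s * b))"
   if "K^2 * (1 + s^2) = 1" for K a b s :: real using that by algebra+
  have l: "((%s. a - s * b) hrd - b) (at s)" "((%s. a + s * b) hrd b) (at s)" for a b s :: real
   by (auto intro!: derivative_eq_intros)
  have dcs: "(cs hrd - ((ks s)^2 * ds s)) (at s)" "(ds hrd (ks s)^2 * cs s) (at s)" for s
   unfolding cs_def ds_def
   by (rule DERIV_cong[OF DERIV_mult[OF ks(4) l(1)] al(1)] DERIV_cong[OF DERIV_mult[OF ks(4) l(2)] al(2)], rule ks(2))+
  have ccs: "CO S cs" "CO S ds" "CO S ks" for S using dcs ks(4) by (meson DERIV_isCont continuous_at_imp_continuous_on)+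
  define H where "H = (%r s. h (r * cs s) (r * ds s))"
  define Hr where "Hr = (%r s. cs s * hx (r * cs s) (r * ds s) + ds s * hy (r * cs s) (r * ds s))"
  define Hs where "Hs = (%r s. (ks s)^2 * Om (r * cs s) (r * ds s))"
  have dHr: "((%r. H r s) hrd Hr r s) (at r)" for r s
  proof -
   have "((%r. (r * cs s, r * ds s)) has_derivative (%e. (e * cs s, e * ds s))) (at r)" by (auto intro!: derivative_eq_intros)
   from has_derivative_compose[OF this dh] show ?thesis
    by (simp add: H_def has_field_derivative_def) (erule has_derivative_eq_rhs, simp add: fun_eq_iff Hr_def algebra_simps)
  qed
  have dHs: "((%s. H r s) hrd Hs r s) (at s)" for r s
  proof -
   have "((%s. (r * cs s, r * ds s)) has_derivative (%e. (r * (- ((ks s)^2 * ds s)) * e, r * ((ks s)^2 * cs s) * e))) (at s)"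
    using DERIV_cmult[OF dcs(1), of r s] DERIV_cmult[OF dcs(2), of r s] unfolding has_field_derivative_def by (rule has_derivative_Pair)
   from has_derivative_compose[OF this dh] show ?thesis
    by (simp add: H_def has_field_derivative_def) (erule has_derivative_eq_rhs, simp add: fun_eq_iff Hs_def Om_def algebra_simps)
  qed
  have ck: "CO S f ==> CO S (%x. cs (f x))" "CO S f ==> CO S (%x. ds (f x))" "CO S f ==> CO S (%x. ks (f x))"
   for S and f :: "'b::topological_space => real"
   using continuous_on_compose2[OF ccs(1)[of UNIV]] continuous_on_compose2[OF ccs(2)[of UNIV]] continuous_on_compose2[OF ccs(3)[of UNIV]] by auto
  have cH: "CO S f ==> CO S g ==> CO S (%x. H (f x) (g x))"
   "CO S f ==> CO S g ==> CO S (%x. Hr (f x) (g x))"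
   "CO S f ==> CO S g ==> CO S (%x. Hs (f x) (g x))"
   for S and f g :: "'b::topological_space => real"
   unfolding H_def Hr_def Hs_def Om_def by (intro continuous_intros cc ck; assumption)+
  have [measurable]: "(%z. H $$ z) \<in> borel_measurable (borel \<Otimes>\<^sub>M borel)" "(%z. Hr $$ z) \<in> borel_measurable (borel \<Otimes>\<^sub>M borel)" "(%z. Hs $$ z) \<in> borel_measurable (borel \<Otimes>\<^sub>M borel)"
   unfolding borel_prod by (intro borel_measurable_continuous_onI cH continuous_intros)+
  have [measurable]: "(%r. H r s) \<in> BB" "(%r. Hr r s) \<in> BB" "(%r. Hs r s) \<in> BB" "(%s. H r s) \<in> BB" "(%s. Hs r s) \<in> BB" for r s
   by (intro borel_measurable_continuous_onI cH continuous_intros)+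
  have CS: "<|c * X + d * Y|> <= sqrt (X^2 + Y^2)" if "c^2 + d^2 = 1" for c d X Y :: real
  proof (rule real_le_rsqrt)
   have "(c * X + d * Y)^2 + (c * Y - d * X)^2 = (c^2 + d^2) * (X^2 + Y^2)" by (simp add: power2_eq_square algebra_simps)
   then show "<|c * X + d * Y|>^2 <= X^2 + Y^2" using zero_le_power2[of "c * Y - d * X"] unfolding that power2_abs mult_1 by linarith
  qed
  have HrG: "<|Hr r s|> <= G (r * cs s) (r * ds s)" for r s unfolding G_def Hr_def by (rule CS[OF cd])
  have OmG: "<|Om (r * cs s) (r * ds s)|> <= r * G (r * cs s) (r * ds s)" if "0 < r" for r s
  proof -
   define X Y where "X = hx (r * cs s) (r * ds s)" and "Y = hy (r * cs s) (r * ds s)"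
   have "Om (r * cs s) (r * ds s) = r * (cs s * Y + - ds s * X)" by (simp add: Om_def X_def Y_def algebra_simps)
   moreover have "<|cs s * Y + - ds s * X|> <= G (r * cs s) (r * ds s)"
    using CS[of "cs s" "- ds s" Y X] cd[of s] by (simp add: G_def X_def Y_def add.commute)
   ultimately show ?thesis using that by (simp add: abs_mult)
  qed
  \<comment> \<open>Gagliardo's factorisation: \<open>r\<close> times the modulus of
    \<open>H\<close> is bounded by the radial integral \<open>a s\<close> and the modulus itself by
    the angular integral \<open>b r\<close>, so the double integral of \<open>r * H^2\<close> splits
    into a product.\<close>
  define a where "a = (%s. NN x. EE (x * <|Hr x s|>) * ind {0<..} x)"
  define b where "b = (%r. NN s. EE (<|H r s|> / 2 + <|Hs r s|>) * ind {-1..1} s)"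
  have [measurable]: "(%z. Hr (snd z) (fst z)) \<in> borel_measurable (borel \<Otimes>\<^sub>M borel)" unfolding borel_prod by (intro borel_measurable_continuous_onI cH continuous_intros)
  have [measurable]: "a \<in> BB" unfolding a_def by measurable
  have [measurable]: "b \<in> BB" unfolding b_def by measurable
  have leA: "EE (r * <|H r s|>) <= a s" if r: "0 < r" for r s
  proof -
   \<comment> \<open>At radius \<open>q\<close> the function vanishes. Integrating inwards from
     there, \<open>r\<close> may be replaced by the larger integration variable.\<close>
   define q where "q = max r <|R|>"
   have "(q * cs s)^2 + (q * ds s)^2 = q^2" using arg_cong[OF cd[of s], of "%w. q^2 * w"] by (simp add: power_mult_distrib distrib_left)
   moreover have "R^2 <= q^2" unfolding q_def by (simp add: abs_le_square_iff[symmetric])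
   ultimately have "H q s = 0" unfolding H_def by (intro supp) simp
   moreover have "CO UNIV (%r. Hr r s)" by (intro cH continuous_intros)
   ultimately have "EE <|H r s|> <= (NN x. EE <|Hr x s|> * ind {r..q} x)"
    using abs_diff_le_nn_integral[OF dHr, of s r q] by (simp add: q_def)
   then have "EE r * EE <|H r s|> <= EE r * (NN x. EE <|Hr x s|> * ind {r..q} x)" by (rule mult_left_mono) simp
   also have "... = (NN x. EE (r * <|Hr x s|>) * ind {r..q} x)" using r by (subst nn_integral_cmult[symmetric]) (auto simp: ennreal_mult mult.assoc)
   also have "... <= a s" unfolding a_def using r by (intro nn_integral_mono) (auto simp: indicator_def intro!: ennreal_leI mult_right_mono)
   finally show ?thesis using r by (simp add: ennreal_mult)
  qed
  have leB: "EE <|H r s|> <= b r" if s: "s \<in> {-1..1}" for r s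
  proof -
   have e2: "emeasure lborel {-1..1::real} = 2" by simp
   define J where "J = (NN x. EE <|Hs r x|> * ind {-1..1} x)"
   have d: "EE <|H r s|> <= EE <|H r y|> + J" if y: "y \<in> {-1..1}" for y
   proof -
    have "EE <|H r s - H r y|> <= J"
    proof (cases "y <= s")
     case True
     have "EE <|H r s - H r y|> <= (NN x. EE <|Hs r x|> * ind {y..s} x)"
      by (rule abs_diff_le_nn_integral[OF dHs _ True]) (intro cH continuous_intros)
     also have "... <= J" unfolding J_def using s y by (intro nn_integral_mono) (auto simp: indicator_def)
     finally show ?thesis .
    next
     case False
     have "EE <|H r y - H r s|> <= (NN x. EE <|Hs r x|> * ind {s..y} x)"
      by (rule abs_diff_le_nn_integral[OF dHs]) (use False in \<open>auto intro!: cH continuous_intros\<close>)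
     also have "... <= J" unfolding J_def using s y by (intro nn_integral_mono) (auto simp: indicator_def)
     finally show ?thesis by (simp add: abs_minus_commute)
    qed
    moreover have "EE <|H r s|> <= EE <|H r y|> + EE <|H r s - H r y|>" by (simp add: ennreal_plus[symmetric] ennreal_leI del: ennreal_plus)
    ultimately show ?thesis by (meson add_left_mono order_trans)
   qed
   \<comment> \<open>Averaging the estimate \<open>d\<close> over the slope interval of length 2
     explains the \<open>1/2\<close> in \<open>b\<close>.\<close>
   have "EE <|H r s|> = (NN y. EE (<|H r s|> / 2) * ind {-1..1::real} y)"
    by (simp add: nn_integral_cmult_indicator ennreal_mult'[symmetric] flip: ennreal_numeral)
   also have "... <= (NN y. EE (<|H r y|> / 2) * ind {-1..1} y + EE (1/2) * J * ind {-1..1} y)"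
   proof (rule nn_integral_mono)
    fix y
    have hf: "EE (x / 2) = EE (1/2) * EE x" if "0 <= x" for x using ennreal_mult[of "1/2" x] that by simp
    show "EE (<|H r s|> / 2) * ind {-1..1} y <= EE (<|H r y|> / 2) * ind {-1..1} y + EE (1/2) * J * ind {-1..1} y"
     using mult_left_mono[OF d[of y], of "EE (1/2)"] by (auto simp: indicator_def hf distrib_left)
   qed
   also have "... = (NN y. EE (<|H r y|> / 2) * ind {-1..1} y) + (NN y. EE (1/2) * J * ind {-1..1::real} y)" by (rule nn_integral_add) measurable
   also have "(NN y. EE (1/2) * J * ind {-1..1::real} y) = EE (1/2) * J * 2" by (subst nn_integral_cmult_indicator, simp, simp only: e2)
   also have "EE (1/2) * J * 2 = J"
   proof -
    have "EE (1/2) * 2 = 1" by (subst ennreal_numeral[symmetric], subst ennreal_mult[symmetric]) simp_all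
    then show ?thesis by (metis mult.assoc mult.commute mult_1)
   qed
   also have "(NN y. EE (<|H r y|> / 2) * ind {-1..1} y) + J = b r" unfolding J_def b_def
    by (subst nn_integral_add[symmetric]) (auto intro!: nn_integral_cong simp: indicator_def)
   finally show ?thesis .
  qed
  have q1: "(ks s)^2 <= 1" for s using ks(2)[of s] mult_left_mono[of 1 "1 + s^2" "(ks s)^2"] by simp
  have "sector e (%z. (h $$ z)^2) <= (NN s. (NN r. a s * (b r * ind {0<..} r)) * ind {-1..1} s)"
   unfolding sector_def rot
  proof (intro nn_integral_mono)
   fix s :: real
   have "(NN r. EE (r * (ks s)^2 * (h $$ (r * cs s, r * ds s))^2) * ind {0<..} r) <= (NN r. a s * (b r * ind {0<..} r))" if s: "s \<in> {-1..1}"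
   proof (rule nn_integral_mono)
    fix r :: real
    have "EE (r * (ks s)^2 * (H r s)^2) <= a s * b r" if r: "0 < r"
    proof -
     have "(ks s)^2 * (r * (H r s)^2) <= 1 * (r * (H r s)^2)" using r by (intro mult_right_mono q1) auto
     then have "r * (ks s)^2 * (H r s)^2 <= r * <|H r s|> * <|H r s|>" by (simp add: power2_eq_square mult_ac)
     then have "EE (r * (ks s)^2 * (H r s)^2) <= EE (r * <|H r s|>) * EE <|H r s|>" using r by (simp add: ennreal_mult[symmetric] ennreal_leI)
     also have "... <= a s * b r" by (intro mult_mono leA leB r s) auto
     finally show ?thesis .
    qed
    then show "EE (r * (ks s)^2 * (h $$ (r * cs s, r * ds s))^2) * ind {0<..} r <= a s * (b r * ind {0<..} r)"
     by (auto simp: indicator_def H_def)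
   qed
   then show "(NN r. EE (r * (ks s)^2 * (h $$ (r * cs s, r * ds s))^2) * ind {0<..} r) * ind {-1..1} s <= (NN r. a s * (b r * ind {0<..} r)) * ind {-1..1} s"
    by (auto simp: indicator_def)
  qed
  also have "... = (NN s. a s * ind {-1..1} s) * (NN r. b r * ind {0<..} r)"
   by (subst nn_integral_multc[symmetric], measurable) (auto simp: nn_integral_cmult mult_ac)
  also have "... <= (2 * IG) * (18 * IW)"
  proof (intro mult_mono)
   have "(NN s. a s * ind {-1..1} s) <= sector e (%z. 2 * G $$ z)" unfolding sector_def rot a_def
   proof (intro nn_integral_mono)
    fix s :: real
    have "x * <|Hr x s|> <= x * (ks s)^2 * (2 * G $$ (x * cs s, x * ds s))" if x: "0 < x" and s: "s \<in> {-1..1}" for x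
    proof -
     have "x * <|Hr x s|> <= x * (1/2) * (2 * G (x * cs s) (x * ds s))" using HrG[of x s] x by simp
     also have "... <= x * (ks s)^2 * (2 * G (x * cs s) (x * ds s))" using ks(3)[OF s] x G0 by (intro mult_right_mono mult_left_mono) auto
     finally show ?thesis by simp
    qed
    then show "(NN x. EE (x * <|Hr x s|>) * ind {0<..} x) * ind {-1..1} s <= (NN r. EE (r * (ks s)^2 * (2 * G $$ (r * cs s, r * ds s))) * ind {0<..} r) * ind {-1..1} s"
     by (auto simp: indicator_def intro!: nn_integral_mono ennreal_leI)
   qed
   also have "... <= (NN z. EE (2 * G $$ z))" by (rule sector_le[OF e]) (use G0 in auto)
   also have "... = 2 * IG" unfolding IG_def by (subst nn_integral_cmult[symmetric]) (auto simp: ennreal_mult' intro!: nn_integral_cong)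
   finally show "(NN s. a s * ind {-1..1} s) <= 2 * IG" .
   define D where "D = (%r s. ((if T/2 <= r then 3 * <|H r s|> else 0) + (if r < 3/4*T then r * <|Hr r s|> else 0)) + <|Hs r s|>)"
   have "(NN r. b r * ind {0<..} r) = (NN r. NN s. EE (<|H r s|> / 2 + <|Hs r s|>) * ind {-1..1} s * ind {0<..} r)"
    unfolding b_def by (intro nn_integral_cong nn_integral_multc[symmetric]) measurable
   also have "... = (NN s. NN r. EE (<|H r s|> / 2 + <|Hs r s|>) * ind {-1..1} s * ind {0<..} r)"
    by (rule lborel_pair.Fubini'[symmetric]) measurable
   also have "... <= (NN s. (NN r. EE (D r s) * ind {0<..} r) * ind {-1..1} s)"
   proof (rule nn_integral_mono)
    fix s :: real
    have "(NN r. EE (<|H r s|> / 2 + <|Hs r s|>) * ind {0<..} r) <= (NN r. EE <|H r s|> * ind {0<..} r + EE <|Hs r s|> * ind {0<..} r)"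
     by (intro nn_integral_mono) (auto simp: indicator_def intro!: add_mono ennreal_leI)
    also have "... = (NN r. EE <|H r s|> * ind {0<..} r) + (NN r. EE <|Hs r s|> * ind {0<..} r)" by (rule nn_integral_add) measurable
    also have "... <= (NN r. EE ((if T/2 <= r then 3 * <|H r s|> else 0) + (if r < 3/4*T then r * <|Hr r s|> else 0)) * ind {0<..} r) + (NN r. EE <|Hs r s|> * ind {0<..} r)"
     by (intro add_right_mono nn_integral_outer_bound[OF dHr _ T] cH continuous_intros)
    also have "... = (NN r. EE (D r s) * ind {0<..} r)"
     by (subst nn_integral_add[symmetric]) (auto intro!: nn_integral_cong simp: D_def indicator_def ennreal_plus[symmetric] simp del: ennreal_plus)
    finally show "(NN r. EE (<|H r s|> / 2 + <|Hs r s|>) * ind {-1..1} s * ind {0<..} r) <= (NN r. EE (D r s) * ind {0<..} r) * ind {-1..1} s"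
     by (auto simp: indicator_def)
   qed
   also have "... <= sector e (%z. 18 * WI $$ z)" unfolding sector_def rot
   proof (intro nn_integral_mono)
    fix s :: real
    \<comment> \<open>For slopes in \<open>{-1..1}\<close> the Jacobian is at least
      \<open>r / 2\<close>. The tangential derivative is divided by \<open>T\<close> when
      \<open>r >= 3/4 * T\<close>, and is at most \<open>r\<close> times the gradient for smaller
      \<open>r\<close>; the coefficients 12, 2 and 2 + 1 are then bounded by 18.\<close>
    have "D r s <= r * (ks s)^2 * (18 * WI $$ (r * cs s, r * ds s))" if r: "0 < r" and s: "s \<in> {-1..1}" for r
    proof -
     let ?h = "<|H r s|>" and ?o = "<|Om (r * cs s) (r * ds s)|>" and ?g = "G (r * cs s) (r * ds s)" and ?q = "r * (ks s)^2"
     have q: "r / 2 <= ?q" "0 <= ?q" using mult_left_mono[OF ks(3)[OF s], of r] r by auto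
     have hs: "<|Hs r s|> <= ?o" "<|Hs r s|> = (ks s)^2 * ?o" unfolding Hs_def abs_mult using mult_right_mono[OF q1[of s], of ?o] by auto
     have "(r * cs s)^2 + (r * ds s)^2 = r^2" using arg_cong[OF cd[of s], of "%w. r^2 * w"] by (simp add: power_mult_distrib distrib_left)
     moreover have "(3/4*T)^2 <= r^2 \<longleftrightarrow> 3/4*T <= r" using r T by (intro power_mono_iff) auto
     ultimately have WI: "WI (r * cs s) (r * ds s) = (?h + ?o) / T + (if r < 3/4*T then ?g else 0)" by (simp add: WI_def H_def not_le[symmetric])
     have n: "0 <= ?h / T" "0 <= ?o / T" "0 <= ?g" using T G0 by auto
     have 1: "(if T/2 <= r then 3 * ?h else 0) <= ?q * (12 * (?h / T))"
     proof (cases "T/2 <= r")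
      case True
      then have "T/4 * (12 * (?h / T)) <= ?q * (12 * (?h / T))" using q n by (intro mult_right_mono) auto
      then show ?thesis using True T by simp
     qed (use mult_nonneg_nonneg[OF q(2), of "12 * (?h / T)"] n in simp)
     have 2: "(if r < 3/4*T then r * <|Hr r s|> else 0) <= ?q * (2 * (if r < 3/4*T then ?g else 0))"
      using mult_left_mono[OF HrG[of r s], of r] mult_right_mono[OF q(1) n(3)] r q n by auto
     have 3: "<|Hs r s|> <= ?q * (2 * (?o / T) + (if r < 3/4*T then ?g else 0))"
     proof (cases "r < 3/4*T")
      case True
      have "<|Hs r s|> <= (ks s)^2 * (r * ?g)" unfolding hs(2) using OmG[OF r, of s] by (intro mult_left_mono) auto
      also have "... <= ?q * (2 * (?o / T) + ?g)" using mult_nonneg_nonneg[OF q(2), of "2 * (?o / T)"] n by (simp add: distrib_left mult_ac)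
      finally show ?thesis using True by simp
     next
      case False
      then have "T * (?o / T) <= 2 * r * (?o / T)" using T n by (intro mult_right_mono) auto
      then have "(ks s)^2 * ?o <= (ks s)^2 * (2 * r * (?o / T))" using T by (intro mult_left_mono) auto
      then show ?thesis using False unfolding hs(2) by (simp add: mult_ac)
     qed
     have "D r s <= ?q * (12 * (?h / T)) + ?q * (2 * (if r < 3/4*T then ?g else 0)) + ?q * (2 * (?o / T) + (if r < 3/4*T then ?g else 0))"
      unfolding D_def using 1 2 3 by linarith
     also have "... <= ?q * (18 * WI (r * cs s) (r * ds s))" unfolding WI distrib_left[symmetric]
      using n by (intro mult_left_mono[OF _ q(2)]) (auto simp: add_divide_distrib)
     finally show ?thesis by simp
    qed
    then show "(NN r. EE (D r s) * ind {0<..} r) * ind {-1..1} s <= (NN r. EE (r * (ks s)^2 * (18 * WI $$ (r * cs s, r * ds s))) * ind {0<..} r) * ind {-1..1} s"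
     by (auto simp: indicator_def intro!: nn_integral_mono ennreal_leI simp del: ennreal_plus)
   qed
   also have "... <= (NN z. EE (18 * WI $$ z))" by (rule sector_le[OF e]) (use G0 mWI in auto)
   also have "... = 18 * IW" unfolding IW_def using mWI by (subst nn_integral_cmult[symmetric]) (auto simp: ennreal_mult' intro!: nn_integral_cong)
   finally show "(NN r. b r * ind {0<..} r) <= 18 * IW" .
  qed auto
  finally show ?thesis .
 qed
 have eI: "EE (a + (if P then b else 0)) = EE a + EE b * of_bool P" if "0 <= a" "0 <= b" for a b P using that by simp
 have "(NN z. EE ((h $$ z)^2)) <= (\<Sum>e\<in>quarter. sector e (%z. (h $$ z)^2))" by (rule sector_cover) auto
 also have "... <= (\<Sum>e\<in>quarter. 2 * IG * (18 * IW))" by (intro sum_mono sec)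
 \<comment> \<open>Four sectors with factors 2 and 18: \<open>4 * 2 * 18 = 144\<close>.\<close>
 also have "... = 144 * IG * IW"
 proof -
  have "4 * (2 * X * (18 * Y)) = 144 * X * (Y::ennreal)" for X Y by (simp add: mult_ac)
  then show ?thesis by (simp add: quarter_def)
 qed
 also have "IW = (NN z. EE ((<|h $$ z|> + <|Om $$ z|>) / T) + EE (G $$ z) * ind {z. (fst z)^2 + (snd z)^2 < (3/4 * T)^2} z)"
  unfolding IW_def WI_def indicator_def mem_Collect_eq by (intro nn_integral_cong eI) (use T G0 in auto)
 also have "... = (NN z. EE ((<|h $$ z|> + <|Om $$ z|>) / T)) + (NN z. EE (G $$ z) * ind {z. (fst z)^2 + (snd z)^2 < (3/4 * T)^2} z)"
  by (rule nn_integral_add) measurable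
 finally show ?thesis unfolding IG_def G_def Om_def .
qed

subsection \<open>Decay of the nonlinearity\<close>

text \<open>The weight \<open>l\<close> is the one for which the two terms of the
  arithmetic-geometric inequality balance.\<close>

lemma nn_integral_cauchy:
 fixes f g :: "'a => real"
 assumes m: "f \<in> borel_measurable M" "g \<in> borel_measurable M"
  and nn: "!!x. 0 <= f x" "!!x. 0 <= g x"
  and F: "(\<integral>\<^sup>+x. EE ((f x)^2) \<partial>M) <= EE F" and G: "(\<integral>\<^sup>+x. EE ((g x)^2) \<partial>M) <= EE G"
  and pos: "0 < F" "0 < G"
 shows "(\<integral>\<^sup>+x. EE (f x * g x) \<partial>M) <= EE (sqrt F * sqrt G)"
proof -
 note [measurable] = m
 define l where "l = sqrt G / sqrt F"
 have l: "0 < l" using pos by (simp add: l_def)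
 have "(\<integral>\<^sup>+x. EE (f x * g x) \<partial>M) <= (\<integral>\<^sup>+x. EE ((l/2) * (f x)^2 + (1/(2*l)) * (g x)^2) \<partial>M)"
 proof (intro nn_integral_mono ennreal_leI)
  fix x
  have "0 <= (l * f x - g x)^2 / (2 * l)" using l by simp
  also have "... = (l/2) * (f x)^2 + (1/(2*l)) * (g x)^2 - f x * g x"
   using l by (simp add: power2_diff field_simps power2_eq_square)
  finally show "f x * g x <= (l/2) * (f x)^2 + (1/(2*l)) * (g x)^2" by simp
 qed
 also have "... <= EE ((l/2) * F + (1/(2*l)) * G)"
  by (rule nn_integral_square_sum) (use l pos F G in auto)
 also have "(l/2) * F + (1/(2*l)) * G = sqrt F * sqrt G"
 proof -
  define a b where "a = sqrt F" "b = sqrt G"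
  have ab: "0 < a" "0 < b" "F = a^2" "G = b^2" using pos by (auto simp: a_b_def)
  show ?thesis unfolding l_def ab(3,4) using ab(1,2) by (simp add: field_simps power2_eq_square)
 qed
 finally show ?thesis .
qed

lemma C1_has_derivative:
 fixes f :: "real => real => real"
 assumes "!!x y. ((%z. f $$ z) has_derivative (%k. fst k * fx x y + snd k * fy x y)) (at (x,y))"
  and "!!s. (\<phi> hrd \<phi>' s) (at s)"
 shows "((%z. \<phi> (f $$ z)) has_derivative (%k. fst k * (\<phi>' (f x y) * fx x y) + snd k * (\<phi>' (f x y) * fy x y))) (at (x,y))"
proof -
 have "(\<phi> has_derivative (*) (\<phi>' (f x y))) (at ((%z. f $$ z) (x,y)))"
  using assms(2)[of "f x y"] by (simp add: has_field_derivative_def)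
 from has_derivative_compose[OF assms(1)[of x y] this] show ?thesis by (simp add: algebra_simps)
qed

context nlw
begin

text \<open>The rotation, and in \<open>boost_AB\<close> the Lorentz boosts about the time origin
  \<open>-1\<close>, are half sums and differences over the two null directions; hence
  \<open>Qsum\<close> bounds them.\<close>

lemma Om_A: "x * uy t x y - y * ux t x y = (A (-1) t x y - A 1 t x y) / 2"
 unfolding A_def by (simp add: algebra_simps)

lemma boost_AB: "y * ut t x y + (1 + t) * uy t x y = (A 1 t x y + A (-1) t x y) / 2"
 "x * ut t x y + (1 + t) * ux t x y = (B (-1) t x y - B 1 t x y) / 2"
 unfolding A_def B_def by (simp_all add: algebra_simps)

lemma sq_half_sum: "((a + b) / 2)^2 <= (a^2 + b^2) / 2" "((a - b) / 2)^2 <= (a^2 + b^2) / (2::real)"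
 using zero_le_power2[of "a - b"] zero_le_power2[of "a + b"] by (simp_all add: power_divide power2_sum power2_diff field_simps)

lemma AB_Qsum: "((A 1 t x y)^2 + (A (-1) t x y)^2) / 2 <= Qsum t x y" "((B 1 t x y)^2 + (B (-1) t x y)^2) / 2 <= Qsum t x y"
 using V_nonneg[of t x y] unfolding Qsum_def P_def Q_def by (simp_all add: add_divide_distrib)

lemma Om_sq: "(x * uy t x y - y * ux t x y)^2 <= Qsum t x y"
 unfolding Om_A using sq_half_sum(2)[of "A (-1) t x y" "A 1 t x y"] AB_Qsum(1)[of t x y] by (simp add: add.commute)

lemma boost_sq: "(y * ut t x y + (1 + t) * uy t x y)^2 <= Qsum t x y" "(x * ut t x y + (1 + t) * ux t x y)^2 <= Qsum t x y"
 unfolding boost_AB using sq_half_sum(1)[of "A 1 t x y" "A (-1) t x y"] AB_Qsum[of t x y] sq_half_sum(2)[of "B (-1) t x y" "B 1 t x y"]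
 by (simp_all add: add.commute)

text \<open>Inside \<open>|x| < 3T/4\<close> the scaling and boost fields span all derivatives.\<close>
lemma interior_grad:
 assumes t: "0 <= t" and r: "x^2 + y^2 < (3/4 * (1 + t))^2"
 shows "(1 + t)^2 * ((ux t x y)^2 + (uy t x y)^2) <= 300 * Qsum t x y + 100 * (u t x y)^2"
proof -
 define T where "T = 1 + t"
 define a b c where v: "a = ut t x y" "b = ux t x y" "c = uy t x y"
 define S bx b_y q w where d: "S = Sc t x y" "bx = x * a + T * b" "b_y = y * a + T * c" "q = Qsum t x y" "w = u t x y"
 have T: "1 <= T" using t by (simp add: T_def)
 have q: "S^2 <= q" "bx^2 <= q" "b_y^2 <= q" using Sc_sq boost_sq unfolding d v T_def by auto
 \<comment> \<open>Eliminating the spatial derivatives between scaling and boosts leaves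
   \<open>ut\<close> times the squared distance to the cone, and that factor is at least
   \<open>7/16 * T^2\<close> in the region considered. The spatial derivatives then follow from the
   boosts.\<close>
 have id: "(T^2 - (x^2 + y^2)) * a = T * (S - w) - x * bx - y * b_y"
  unfolding d v Sc_def T_def by (simp add: algebra_simps power2_eq_square)
 have "(x * bx + y * b_y)^2 <= (x^2 + y^2) * (bx^2 + b_y^2)"
  using zero_le_power2[of "x * b_y - y * bx"] by (simp add: power2_eq_square algebra_simps)
 also have "... <= T^2 * (q + q)"
 proof (intro mult_mono add_mono q)
  have "(3/4 * T)^2 <= (1 * T)^2" using T by (intro power_mono mult_right_mono) auto
  then show "x^2 + y^2 <= T^2" using r unfolding T_def by simp
 qed auto
 finally have xb: "(x * bx + y * b_y)^2 <= T^2 * (2 * q)" by simp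
 have s3: "(e + f + g)^2 <= 3 * (e^2 + f^2 + g^2)" for e f g :: real
  using zero_le_power2[of "e - f"] zero_le_power2[of "f - g"] zero_le_power2[of "e - g"]
  by (simp add: power2_eq_square algebra_simps)
 have "((T^2 - (x^2 + y^2)) * a)^2 = (T * S + - (T * w) + - (x * bx + y * b_y))^2"
  unfolding id by (simp add: algebra_simps)
 also have "... <= 3 * ((T * S)^2 + (- (T * w))^2 + (- (x * bx + y * b_y))^2)" by (rule s3)
 also have "... = 3 * (T^2 * S^2 + T^2 * w^2 + (x * bx + y * b_y)^2)"
  by (simp only: power2_minus power_mult_distrib[of T S] power_mult_distrib[of T w])
 also have "... <= 3 * (T^2 * q + T^2 * w^2 + T^2 * (2 * q))"
  using xb q(1) by (intro mult_left_mono add_mono) auto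
 finally have 1: "((T^2 - (x^2 + y^2)) * a)^2 <= T^2 * (9 * q + 3 * w^2)" by (simp add: algebra_simps)
 have "(3/4 * T)^2 = 9/16 * T^2" by (simp add: power_mult_distrib power_divide)
 then have "7/16 * T^2 <= T^2 - (x^2 + y^2)" using r unfolding T_def[symmetric] by linarith
 then have "(7/16 * T^2)^2 * a^2 <= (T^2 - (x^2 + y^2))^2 * a^2"
  by (intro mult_right_mono power_mono) auto
 then have "(7/16)^2 * (T^2 * (T^2 * a^2)) <= T^2 * (9 * q + 3 * w^2)"
  using 1 by (simp add: power_mult_distrib power2_eq_square algebra_simps)
 then have "T^2 * ((7/16)^2 * (T^2 * a^2)) <= T^2 * (9 * q + 3 * w^2)" by (simp add: mult_ac)
 then have "(7/16)^2 * (T^2 * a^2) <= 9 * q + 3 * w^2" using T by (simp add: mult_le_cancel_left_pos)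
 then have "49 * (T^2 * a^2) <= 2304 * q + 768 * w^2" by (simp add: power_divide)
 moreover have q0: "0 <= q" using q(1) zero_le_power2[of S] by linarith
 ultimately have Ta: "T^2 * a^2 <= 49 * q + 17 * w^2" using zero_le_power2[of w] by linarith
 have "(T * b)^2 <= 2 * bx^2 + 2 * (x * a)^2" "(T * c)^2 <= 2 * b_y^2 + 2 * (y * a)^2"
 proof -
  have "e^2 <= 2 * (f + e)^2 + 2 * f^2" for e f :: real
   using zero_le_power2[of "e + 2 * f"] by (simp add: power2_eq_square algebra_simps)
  then show "(T * b)^2 <= 2 * bx^2 + 2 * (x * a)^2" "(T * c)^2 <= 2 * b_y^2 + 2 * (y * a)^2"
   unfolding d by auto
 qed
 then have "T^2 * (b^2 + c^2) <= 4 * q + 2 * ((x^2 + y^2) * a^2)"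
  using q by (simp add: power_mult_distrib algebra_simps)
 also have "(x^2 + y^2) * a^2 <= T^2 * a^2"
 proof (rule mult_right_mono)
  have "(3/4 * T)^2 <= (1 * T)^2" using T by (intro power_mono mult_right_mono) auto
  then show "x^2 + y^2 <= T^2" using r unfolding T_def by simp
 qed auto
 finally have "T^2 * (b^2 + c^2) <= 4 * q + 2 * (49 * q + 17 * w^2)" using Ta by simp
 also have "4 * q + 2 * (49 * q + 17 * w^2) = 102 * q + 34 * w^2" by simp
 finally have "T^2 * (b^2 + c^2) <= 300 * q + 100 * w^2"
  using q0 zero_le_power2[of w] by linarith
 then show ?thesis unfolding v[symmetric] d(4,5)[symmetric] T_def[symmetric] .
qed

text \<open>Truncation at radius \<open>R\<close> provides the compact support for the Gagliardo
  inequality, and the finiteness of the integral that is absorbed later on.\<close>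

definition cutR where "cutR R x y = psq (1 - (x^2 + y^2) / R^2)"
definition vR where "vR R t x y = cutR R x y * u t x y"
definition vx where "vx R t x y = cutR R x y * ux t x y - 4 * max 0 (1 - (x^2 + y^2) / R^2) * x / R^2 * u t x y"
definition vy where "vy R t x y = cutR R x y * uy t x y - 4 * max 0 (1 - (x^2 + y^2) / R^2) * y / R^2 * u t x y"

lemma cutR_bounds: "0 <= cutR R x y" "cutR R x y <= 1"
 unfolding cutR_def psq_def by (auto intro!: power_le_one)

lemma cutR_zero: "0 < R ==> R^2 <= x^2 + y^2 ==> cutR R x y = 0"
 unfolding cutR_def psq_def by (simp add: le_divide_eq)

lemma vR_deriv:
 assumes R: "0 < R"
 shows "((%z. vR R t $$ z) has_derivative (%k. fst k * vx R t x y + snd k * vy R t x y)) (at (x,y))"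
proof -
 define m where "m = max 0 (1 - (x^2 + y^2) / R^2)"
 have 0: "((%z. 1 - ((fst z)^2 + (snd z)^2) / R^2) has_derivative (%k. - (2 * x * fst k + 2 * y * snd k) / R^2)) (at (x,y))"
  using R by (auto intro!: derivative_eq_intros simp: field_simps)
 have "(psq has_derivative (*) (2 * m)) (at ((%z. 1 - ((fst z)^2 + (snd z)^2) / R^2) (x,y)))"
  using psq_deriv by (simp add: has_field_derivative_def m_def)
 from has_derivative_compose[OF 0 this]
 have 1: "((%z. cutR R $$ z) has_derivative (%k. 2 * m * (- (2 * x * fst k + 2 * y * snd k) / R^2))) (at (x,y))"
  by (simp add: cutR_def)
 from has_derivative_mult[OF 1 dux_joint[of t x y]]
 show ?thesis unfolding vR_def
  by (rule has_derivative_eq_rhs)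
   (unfold vx_def vy_def m_def[symmetric], simp add: fun_eq_iff field_simps R[THEN less_imp_neq, symmetric])
qed

lemma vR_cont: "CO S (%z. vR R t $$ z)" "CO S (%z. vx R t $$ z)" "CO S (%z. vy R t $$ z)"
 unfolding vR_def vx_def vy_def cutR_def divide_inverse by (intro continuous_intros cont[THEN cont3_slice])+

lemma vR_abs: "<|vR R t x y|> <= <|u t x y|>"
 unfolding vR_def abs_mult using cutR_bounds[of R x y] by (simp add: mult_left_le_one_le)

text \<open>A radial cutoff commutes with rotations, so truncation costs nothing in the tangential
  derivative.\<close>

lemma vR_Om: "x * vy R t x y - y * vx R t x y = cutR R x y * (x * uy t x y - y * ux t x y)"
 unfolding vx_def vy_def by (simp add: algebra_simps)

lemma vR_grad:
 assumes R: "0 < R"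
 shows "(vx R t x y)^2 + (vy R t x y)^2 <= 2 * ((ux t x y)^2 + (uy t x y)^2) + 32 / R^2 * (u t x y)^2"
proof -
 define m where "m = max 0 (1 - (x^2 + y^2) / R^2)"
 define c where "c = cutR R x y"
 have m: "0 <= m" "m <= 1" by (auto simp: m_def)
 have c: "0 <= c" "c <= 1" using cutR_bounds by (auto simp: c_def)
 have c2: "c^2 <= 1" using c by (simp add: power_le_one)
 have m2: "m^2 * (x^2 + y^2) <= R^2"
 proof (cases "m = 0")
  case False
  then have "(x^2 + y^2) / R^2 <= 1" by (simp add: m_def max_def split: if_splits)
  then have "x^2 + y^2 <= R^2" using R by simp
  moreover have "m^2 <= 1" using m by (simp add: power_le_one)
  ultimately show ?thesis using mult_mono[of "m^2" 1 "x^2 + y^2" "R^2"] by simp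
 qed auto
 have s2: "(e - f)^2 <= 2 * e^2 + 2 * f^2" for e f :: real
  using zero_le_power2[of "e + f"] by (simp add: power2_eq_square algebra_simps)
 have "(vx R t x y)^2 + (vy R t x y)^2 <= (2 * (c * ux t x y)^2 + 2 * (4 * m * x / R^2 * u t x y)^2) + (2 * (c * uy t x y)^2 + 2 * (4 * m * y / R^2 * u t x y)^2)"
  unfolding vx_def vy_def c_def[symmetric] m_def[symmetric] by (intro add_mono s2)
 also have "... = 2 * (c^2 * ((ux t x y)^2 + (uy t x y)^2)) + 32 * (m^2 * (x^2 + y^2)) / (R^2 * R^2) * (u t x y)^2"
  by (simp add: power_mult_distrib power_divide algebra_simps add_divide_distrib power2_eq_square)
 also have "... <= 2 * (1 * ((ux t x y)^2 + (uy t x y)^2)) + 32 * R^2 / (R^2 * R^2) * (u t x y)^2"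
  using c2 m2 by (intro add_mono mult_left_mono mult_right_mono divide_right_mono) auto
 finally show ?thesis using R by (simp add: power2_eq_square)
qed

lemma cutR_tendsto: "(%n. cutR (T + real n) x y) ----> 1"
proof -
 have "filterlim (%n. T + real n) at_top sequentially"
  by (rule filterlim_tendsto_add_at_top[OF tendsto_const filterlim_real_sequentially])
 then have l: "(%n. inverse (T + real n)) ----> 0" by (rule tendsto_inverse_0_at_top)
 have "(%n. (max 0 (1 - (x^2 + y^2) * (inverse (T + real n) * inverse (T + real n))))^2) ----> (max 0 (1 - (x^2 + y^2) * (0 * 0)))^2"
  by (intro tendsto_intros l)
 then show ?thesis by (simp add: cutR_def psq_def divide_inverse power2_eq_square)
qed

context
 fixes D :: real
 assumes D0: "0 < D" and D: "(NN z. EE (dat $$ z)) <= EE D" and p35: "3 < p" "p < 5"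
begin

text \<open>\<open>K2\<close> is the constant of \<open>L2_growth\<close>; \<open>F1\<close>,
  \<open>F2\<close>, \<open>F3\<close> belong in this order to the three bounds of
  \<open>vR_grad_bounds\<close>. The numbers are \<open>188 = 4 * 47\<close>,
  \<open>676800 = 600 * 1128\<close> and \<open>232 = 200 + 32\<close>.\<close>

definition K2 where "K2 = (21 + 18048 / (5 - p)^2) * D"
definition F1 where "F1 = 188 * D + 32 * K2"
definition F2 where "F2 = 2 * K2 + 2 * (1128 * D)"
definition F3 where "F3 = 676800 * D + 232 * K2"

lemma K2_pos: "0 < K2" "0 < F1" "0 < F2" "0 < F3"
proof -
 show 1: "0 < K2" unfolding K2_def using D0 p35 by (intro mult_pos_pos add_pos_nonneg) auto
 show "0 < F1" "0 < F2" "0 < F3" unfolding F1_def F2_def F3_def using D0 1 by auto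
qed

lemma u_sq_bound: "0 <= t ==> (NN z. EE ((u t $$ z)^2)) <= EE (K2 * (1 + t) powr ((5 - p) / 2))"
 unfolding K2_def using D0 D p35 by (intro L2_growth) auto

lemma Qsum_meas[measurable]: "(%z. Qsum t $$ z) \<in> BB"
 unfolding Qsum_def by measurable

lemma T_pow:
 assumes "0 <= t" "1 + t <= R" and c: "0 <= c"
 shows "32 / R^2 * (c * (1 + t) powr ((5 - p) / 2)) <= 32 * c * (1 + t) powr ((5 - p) / 2 - 2)"
proof -
 have T: "0 < 1 + t" using assms by simp
 have "(1 + t)^2 <= R^2" using assms by (intro power_mono) auto
 then have "32 / R^2 * (c * (1 + t) powr ((5 - p) / 2)) <= 32 / (1 + t)^2 * (c * (1 + t) powr ((5 - p) / 2))"
  using T c assms by (intro mult_right_mono divide_left_mono) (auto intro!: mult_pos_pos)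
 also have "... = 32 * c * ((1 + t) powr ((5 - p) / 2) / (1 + t)^2)" by simp
 also have "(1 + t) powr ((5 - p) / 2) / (1 + t)^2 = (1 + t) powr ((5 - p) / 2 - 2)"
  using T by (simp add: powr_diff powr_numeral)
 finally show "32 / R^2 * (c * (1 + t) powr ((5 - p) / 2)) <= 32 * c * (1 + t) powr ((5 - p) / 2 - 2)" .
qed

text \<open>The full gradient is merely bounded, through the energy. The tangential part divided by
  \<open>1 + t\<close> and the gradient inside the cone are conformal derivatives over
  \<open>1 + t\<close>, so their square integrals gain the power
  \<open>(5 - p) / 2 - 2 = (1 - p) / 2\<close>. The condition \<open>1 + t <= R\<close> keeps the
  error of the truncation within these rates.\<close>

lemma vR_grad_bounds:
 assumes t: "0 <= t" and R: "1 + t <= R"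
 shows "(NN z. EE ((vx R t $$ z)^2 + (vy R t $$ z)^2)) <= EE F1"
  "(NN z. EE (((<|vR R t $$ z|> + <|fst z * vy R t $$ z - snd z * vx R t $$ z|>) / (1 + t))^2))
   <= EE (F2 * (1 + t) powr ((5 - p) / 2 - 2))"
  "(NN z. EE (if (fst z)^2 + (snd z)^2 < (3/4 * (1 + t))^2 then (vx R t $$ z)^2 + (vy R t $$ z)^2 else 0))
   <= EE (F3 * (1 + t) powr ((5 - p) / 2 - 2))"
proof -
 define T where "T = 1 + t"
 define e where "e = (5 - p) / 2"
 have T: "1 <= T" using t by (simp add: T_def)
 have R0: "0 < R" using R t by simp
 have le1: "T powr (e - 2) <= 1"
 proof -
  have "T powr (e - 2) <= T powr 0" using T p35 by (intro powr_mono) (auto simp: e_def)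
  then show ?thesis using T by simp
 qed
 have Rb: "32 / R^2 * (c * T powr e) <= 32 * c * T powr (e - 2)" if "0 <= c" for c
  using T_pow[OF t R that] le1 unfolding T_def e_def by simp
 have TT: "T powr e / T^2 = T powr (e - 2)" using T by (simp add: powr_diff powr_numeral)
 have uu: "(NN z. EE ((u t $$ z)^2)) <= EE (K2 * T powr e)"
  unfolding T_def e_def by (rule u_sq_bound[OF t])
 have QQ: "(NN z. EE (Qsum t $$ z)) <= EE (1128 * D * T powr e)"
  unfolding T_def e_def using D0 D t by (intro conformal_bound) auto
 have EE: "(NN z. EE (En t $$ z)) <= EE (47 * D)"
  using D0 D t by (intro energy_bound) auto
 have k: "0 <= K2 * T powr e" "0 <= 1128 * D * T powr e" using K2_pos D0 by auto
 have "(NN z. EE ((vx R t $$ z)^2 + (vy R t $$ z)^2)) <=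
  (NN z. EE (4 * En t $$ z + 32 / R^2 * (u t $$ z)^2))"
 proof (intro nn_integral_mono ennreal_leI)
  fix z
  have "2 * En t $$ z = (ut t $$ z)^2 + (ux t $$ z)^2 + (uy t $$ z)^2 + 2 * V t $$ z"
   by (simp add: En_def)
  then have "(ux t $$ z)^2 + (uy t $$ z)^2 <= 2 * En t $$ z"
   using V_nonneg[of t "fst z" "snd z"] zero_le_power2[of "ut t $$ z"] by linarith
  then have "2 * ((ux t $$ z)^2 + (uy t $$ z)^2) <= 4 * En t $$ z" by simp
  then show "(vx R t $$ z)^2 + (vy R t $$ z)^2 <= 4 * En t $$ z + 32 / R^2 * (u t $$ z)^2"
   using vR_grad[OF R0, of t "fst z" "snd z"] by linarith
 qed
 also have "... <= EE (4 * (47 * D) + 32 / R^2 * (K2 * T powr e))"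
  by (rule nn_integral_square_sum) (use EE uu En_nonneg D0 k in auto)
 also have "... <= EE F1"
 proof (rule ennreal_leI)
  have "32 * K2 * T powr (e - 2) <= 32 * K2 * 1" using le1 K2_pos by (intro mult_left_mono) auto
  then have "32 / R^2 * (K2 * T powr e) <= 32 * K2" using Rb[of K2] K2_pos by linarith
  then show "4 * (47 * D) + 32 / R^2 * (K2 * T powr e) <= F1" unfolding F1_def by linarith
 qed
 finally show "(NN z. EE ((vx R t $$ z)^2 + (vy R t $$ z)^2)) <= EE F1" .
 have "(NN z. EE (((<|vR R t $$ z|> + <|fst z * vy R t $$ z - snd z * vx R t $$ z|>) / T)^2))
  <= (NN z. EE (2 / T^2 * (u t $$ z)^2 + 2 / T^2 * Qsum t $$ z))"
 proof (intro nn_integral_mono ennreal_leI)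
  fix z :: "real \<times> real"
  define x y where "x = fst z" "y = snd z"
  have s2: "(f + g)^2 <= 2 * f^2 + 2 * g^2" for f g :: real
   using zero_le_power2[of "f - g"] by (simp add: power2_eq_square algebra_simps)
  have "<|vR R t x y|>^2 <= (u t x y)^2" using vR_abs[of R t x y] by (simp add: abs_le_square_iff)
  moreover have "<|x * vy R t x y - y * vx R t x y|>^2 <= Qsum t x y"
  proof -
   have "(cutR R x y)^2 * (x * uy t x y - y * ux t x y)^2 <= 1 * Qsum t x y"
    using cutR_bounds[of R x y] Om_sq by (intro mult_mono) (auto simp: power_le_one)
   then show ?thesis unfolding vR_Om power2_abs power_mult_distrib by simp
  qed
  ultimately have "(<|vR R t x y|> + <|x * vy R t x y - y * vx R t x y|>)^2 <= 2 * (u t x y)^2 + 2 * Qsum t x y"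
   using s2[of "<|vR R t x y|>" "<|x * vy R t x y - y * vx R t x y|>"] by linarith
  then have "(<|vR R t x y|> + <|x * vy R t x y - y * vx R t x y|>)^2 / T^2 <= (2 * (u t x y)^2 + 2 * Qsum t x y) / T^2"
   by (rule divide_right_mono) simp
  then show "((<|vR R t $$ z|> + <|fst z * vy R t $$ z - snd z * vx R t $$ z|>) / T)^2
    <= 2 / T^2 * (u t $$ z)^2 + 2 / T^2 * Qsum t $$ z"
   unfolding x_y_def power_divide by (simp add: add_divide_distrib)
 qed
 also have "... <= EE (2 / T^2 * (K2 * T powr e) + 2 / T^2 * (1128 * D * T powr e))"
  by (rule nn_integral_square_sum) (use uu QQ Qsum_nonneg k in auto)
 also have "2 / T^2 * (K2 * T powr e) + 2 / T^2 * (1128 * D * T powr e) = F2 * (T powr e / T^2)"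
  unfolding F2_def by (simp add: add_divide_distrib algebra_simps)
 finally show "(NN z. EE (((<|vR R t $$ z|> + <|fst z * vy R t $$ z - snd z * vx R t $$ z|>) / (1 + t))^2))
   <= EE (F2 * (1 + t) powr ((5 - p) / 2 - 2))" unfolding TT unfolding T_def e_def .
 have "(NN z. EE (if (fst z)^2 + (snd z)^2 < (3/4 * T)^2 then (vx R t $$ z)^2 + (vy R t $$ z)^2 else 0))
  <= (NN z. EE (600 / T^2 * Qsum t $$ z + (200 / T^2 + 32 / R^2) * (u t $$ z)^2))"
 proof (intro nn_integral_mono ennreal_leI)
  fix z :: "real \<times> real"
  define x y where "x = fst z" "y = snd z"
  have "(vx R t x y)^2 + (vy R t x y)^2 <= 600 / T^2 * Qsum t x y + (200 / T^2 + 32 / R^2) * (u t x y)^2" if "x^2 + y^2 < (3/4 * T)^2"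
  proof -
   have "(ux t x y)^2 + (uy t x y)^2 <= (300 * Qsum t x y + 100 * (u t x y)^2) / T^2"
    using interior_grad[OF t, of x y] that T unfolding T_def by (simp add: pos_le_divide_eq mult.commute)
   then have "2 * ((ux t x y)^2 + (uy t x y)^2) <= 2 * ((300 * Qsum t x y + 100 * (u t x y)^2) / T^2)" by (rule mult_left_mono) simp
   also have "... = 600 / T^2 * Qsum t x y + 200 / T^2 * (u t x y)^2" by (simp add: add_divide_distrib)
   finally show ?thesis using vR_grad[OF R0, of t x y] unfolding distrib_right by linarith
  qed
  moreover have "0 <= 600 / T^2 * Qsum t x y + (200 / T^2 + 32 / R^2) * (u t x y)^2"
   using Qsum_nonneg by (intro add_nonneg_nonneg mult_nonneg_nonneg) auto
  ultimately show "(if (fst z)^2 + (snd z)^2 < (3/4 * T)^2 then (vx R t $$ z)^2 + (vy R t $$ z)^2 else 0) <= 600 / T^2 * Qsum t $$ z + (200 / T^2 + 32 / R^2) * (u t $$ z)^2"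
   unfolding x_y_def by simp
 qed
 also have "... <= EE (600 / T^2 * (1128 * D * T powr e) + (200 / T^2 + 32 / R^2) * (K2 * T powr e))"
  by (rule nn_integral_square_sum) (use uu QQ Qsum_nonneg k in auto)
 also have "... <= EE (F3 * (T powr e / T^2))"
 proof (rule ennreal_leI)
  have "600 / T^2 * (1128 * D * T powr e) + (200 / T^2 + 32 / R^2) * (K2 * T powr e)
   = 676800 * D * (T powr e / T^2) + 200 * K2 * (T powr e / T^2) + 32 / R^2 * (K2 * T powr e)"
   by (simp add: algebra_simps)
  also have "... <= 676800 * D * (T powr e / T^2) + 200 * K2 * (T powr e / T^2) + 32 * K2 * (T powr e / T^2)"
   using Rb[of K2] K2_pos unfolding TT by simp
  also have "... = F3 * (T powr e / T^2)" by (simp add: F3_def algebra_simps)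
  finally show "600 / T^2 * (1128 * D * T powr e) + (200 / T^2 + 32 / R^2) * (K2 * T powr e) <= F3 * (T powr e / T^2)" .
 qed
 finally show "(NN z. EE (if (fst z)^2 + (snd z)^2 < (3/4 * (1 + t))^2 then (vx R t $$ z)^2 + (vy R t $$ z)^2 else 0))
   <= EE (F3 * (1 + t) powr ((5 - p) / 2 - 2))" unfolding TT unfolding T_def e_def .
qed

definition C0 where "C0 = 144 * p^2 * sqrt F1 * (sqrt F2 + sqrt F3)"

lemma C0_pos: "0 < C0"
 unfolding C0_def using p35 K2_pos by (intro mult_pos_pos add_pos_pos) auto

text \<open>The Gagliardo inequality for the power \<open>p\<close> of the truncated solution. Each
  derivative carries the power \<open>p - 1\<close>, whose square integral is at most
  \<open>Y\<close>; by Cauchy-Schwarz the product of the two factors is linear in \<open>Y\<close>,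
  and only one of them decays, which gives the square root of the rate in
  \<open>vR_grad_bounds\<close>.\<close>

lemma gn_step:
 assumes t: "0 <= t" and R: "1 + t <= R" and Y: "0 < Y"
  and vY: "(NN z. EE (<|vR R t $$ z|> powr (2 * p - 2))) <= EE Y"
 shows "(NN z. EE (<|vR R t $$ z|> powr (2 * p))) <= EE (C0 * (1 + t) powr ((5 - p) / 4 - 1) * Y)"
proof -
 define T where "T = 1 + t"
 define E where "E = T powr ((5 - p) / 2 - 2)"
 have T: "1 <= T" using t by (simp add: T_def)
 have E: "0 < E" using T by (simp add: E_def)
 have R0: "0 < R" using R t by simp
 define v where "v = (%x y. vR R t x y)"
 define h where "h = (%x y. <|v x y|> powr p)"
 define w where "w = (%x y. <|v x y|> powr (p - 1))"
 define \<phi>' where "\<phi>' = (%s::real. p * (<|s|> powr (p - 2) * s))"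
 define hx where "hx = (%x y. \<phi>' (v x y) * vx R t x y)"
 define hy where "hy = (%x y. \<phi>' (v x y) * vy R t x y)"
 have abs\<phi>: "<|\<phi>' s|> = p * <|s|> powr (p - 1)" for s
 proof (cases "s = 0")
  case False
  then show ?thesis using p35 powr_add[of "<|s|>" "p - 2" 1] by (simp add: \<phi>'_def abs_mult)
 qed (use p35 in \<open>simp add: \<phi>'_def\<close>)
 have c\<phi>: "CO S (%z. \<phi>' (f z))" if "CO S f" for S and f :: "'b::topological_space => real"
 proof -
  have "CO S (%z. <|f z|> powr (p - 2) * f z)"
   using continuous_on_powr_sgn[of "p - 1" S f] that p35 by simp
  from continuous_on_mult[OF continuous_on_const this] show ?thesis unfolding \<phi>'_def .
 qed
 have cv: "CO UNIV (%z. v $$ z)" unfolding v_def by (rule vR_cont)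
 have gag: "(NN z. EE ((h $$ z)^2))
  <= 144 * (NN z. EE (sqrt ((hx $$ z)^2 + (hy $$ z)^2)))
   * ((NN z. EE ((<|h $$ z|> + <|fst z * hy $$ z - snd z * hx $$ z|>) / T))
    + (NN z. EE (sqrt ((hx $$ z)^2 + (hy $$ z)^2)) * ind {z. (fst z)^2 + (snd z)^2 < (3/4 * T)^2} z))"
 proof (rule gagliardo_polar)
  fix x y
  show "((%z. h $$ z) has_derivative (%k. fst k * hx x y + snd k * hy x y)) (at (x, y))"
   unfolding h_def hx_def hy_def v_def
  proof (rule C1_has_derivative[OF vR_deriv[OF R0]])
   show "((%s. <|s|> powr p) hrd \<phi>' s) (at s)" for s
    unfolding \<phi>'_def by (rule abs_powr_deriv) (use p35 in simp)
  qed
  show "R^2 <= x^2 + y^2 ==> h x y = 0"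
   using cutR_zero[OF R0] p35 by (simp add: h_def v_def vR_def)
 next
  show "CO UNIV (%z. hx $$ z)" "CO UNIV (%z. hy $$ z)"
   unfolding hx_def hy_def by (intro continuous_intros c\<phi> cv vR_cont)+
 qed (use T in simp)
 have mv[measurable]: "(%z. v $$ z) \<in> BB" "(%z. vx R t $$ z) \<in> BB" "(%z. vy R t $$ z) \<in> BB"
  by (intro borel_measurable_continuous_onI cv vR_cont)+
 have mw[measurable]: "(%z. w $$ z) \<in> BB" unfolding w_def by measurable
 have mwl: "(%z. w $$ z) \<in> borel_measurable lborel" using mw by simp
 have w0: "0 <= w x y" for x y by (simp add: w_def)
 have w2: "(NN z. EE ((w $$ z)^2)) <= EE Y"
 proof -
  have "(w x y)^2 = <|vR R t x y|> powr (2 * p - 2)" for x y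
   unfolding w_def v_def power2_eq_square powr_add[symmetric] by (simp add: algebra_simps)
  then show ?thesis using vY by simp
 qed
 let ?g = "%z. sqrt ((vx R t $$ z)^2 + (vy R t $$ z)^2)"
 have gh: "sqrt ((hx x y)^2 + (hy x y)^2) = p * (w x y * sqrt ((vx R t x y)^2 + (vy R t x y)^2))" for x y
 proof -
  have "(hx x y)^2 + (hy x y)^2 = <|\<phi>' (v x y)|>^2 * ((vx R t x y)^2 + (vy R t x y)^2)"
   unfolding hx_def hy_def by (simp add: power_mult_distrib algebra_simps)
  then show ?thesis using p35 unfolding abs\<phi> w_def by (simp add: real_sqrt_mult)
 qed
 have I1: "(NN z. EE (sqrt ((hx $$ z)^2 + (hy $$ z)^2))) <= EE (p * (sqrt Y * sqrt F1))"
 proof -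
  have "(NN z. EE (w $$ z * ?g z)) <= EE (sqrt Y * sqrt F1)"
   by (rule nn_integral_cauchy[OF _ _ _ _ w2]) (use vR_grad_bounds(1)[OF t R] w0 Y K2_pos in auto)
  then have "EE p * (NN z. EE (w $$ z * ?g z)) <= EE p * EE (sqrt Y * sqrt F1)"
   by (rule mult_left_mono) simp
  moreover have "EE p * (NN z. EE (w $$ z * ?g z)) = (NN z. EE (p * (w $$ z * ?g z)))"
   using p35 w0 by (subst nn_integral_cmult[symmetric]) (auto intro!: nn_integral_cong simp: ennreal_mult)
  ultimately show ?thesis unfolding gh using p35 Y K2_pos by (simp add: ennreal_mult)
 qed
 have I2: "(NN z. EE ((<|h $$ z|> + <|fst z * hy $$ z - snd z * hx $$ z|>) / T)) <= EE (p * (sqrt Y * sqrt (F2 * E)))"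
 proof -
  let ?o = "%z. (<|v $$ z|> + <|fst z * vy R t $$ z - snd z * vx R t $$ z|>) / T"
  have mo[measurable]: "?o \<in> BB"
   unfolding divide_inverse by (intro borel_measurable_continuous_onI continuous_intros cv vR_cont)
  have "(NN z. EE (w $$ z * ?o z)) <= EE (sqrt Y * sqrt (F2 * E))"
  proof (rule nn_integral_cauchy[OF mwl _ _ _ w2])
   show "(NN z. EE ((?o z)^2)) <= EE (F2 * E)"
    using vR_grad_bounds(2)[OF t R] unfolding v_def T_def E_def .
  qed (use mo w0 Y K2_pos E T in auto)
  then have "EE p * (NN z. EE (w $$ z * ?o z)) <= EE p * EE (sqrt Y * sqrt (F2 * E))"
   by (rule mult_left_mono) simp
  moreover have "EE p * (NN z. EE (w $$ z * ?o z)) = (NN z. EE p * EE (w $$ z * ?o z))"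
   using borel_measurable_times[OF mw mo] by (intro nn_integral_cmult[symmetric]) simp
  moreover have "(NN z. EE p * EE (w $$ z * ?o z)) = (NN z. EE (p * (w $$ z * ?o z)))"
   using p35 w0 T by (intro nn_integral_cong ennreal_mult[symmetric] mult_nonneg_nonneg) auto
  moreover have "(<|h x y|> + <|x * hy x y - y * hx x y|>) / T <= p * (w x y * ((<|v x y|> + <|x * vy R t x y - y * vx R t x y|>) / T))" for x y
  proof -
   have 1: "<|x * hy x y - y * hx x y|> = p * w x y * <|x * vy R t x y - y * vx R t x y|>"
   proof -
    have "x * hy x y - y * hx x y = \<phi>' (v x y) * (x * vy R t x y - y * vx R t x y)" by (simp add: hx_def hy_def algebra_simps)
    then show ?thesis by (simp add: abs_mult abs\<phi> w_def)
   qed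
   have 2: "<|h x y|> <= p * w x y * <|v x y|>"
   proof -
    have "<|h x y|> = 1 * (w x y * <|v x y|>)"
     using p35 powr_add[of "<|v x y|>" "p - 1" 1] by (cases "v x y = 0") (auto simp: h_def w_def)
    also have "... <= p * (w x y * <|v x y|>)" using p35 w0 by (intro mult_right_mono) auto
    finally show ?thesis by (simp add: mult.assoc)
   qed
   have "<|h x y|> + <|x * hy x y - y * hx x y|> <= p * w x y * (<|v x y|> + <|x * vy R t x y - y * vx R t x y|>)"
    using 1 2 by (simp add: distrib_left)
   then have "(<|h x y|> + <|x * hy x y - y * hx x y|>) / T <= p * w x y * (<|v x y|> + <|x * vy R t x y - y * vx R t x y|>) / T"
    using T by (intro divide_right_mono) auto
   then show ?thesis by (simp add: mult.assoc)
  qed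
  then have "(NN z. EE ((<|h $$ z|> + <|fst z * hy $$ z - snd z * hx $$ z|>) / T)) <= (NN z. EE (p * (w $$ z * ?o z)))"
   by (intro nn_integral_mono ennreal_leI)
  ultimately show ?thesis using p35 Y K2_pos E by (simp add: ennreal_mult)
 qed
 have I3: "(NN z. EE (sqrt ((hx $$ z)^2 + (hy $$ z)^2)) * ind {z. (fst z)^2 + (snd z)^2 < (3/4 * T)^2} z) <= EE (p * (sqrt Y * sqrt (F3 * E)))"
 proof -
  define gi where "gi = (%z. if (fst z)^2 + (snd z)^2 < (3/4 * T)^2 then ?g z else 0)"
  have gi0: "0 <= gi z" for z by (simp add: gi_def)
  have mgi[measurable]: "gi \<in> BB"
  proof -
   have "{z::real\<times>real. (fst z)^2 + (snd z)^2 < (3/4*T)^2} \<in> sets borel"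
    by (intro borel_open open_Collect_less continuous_intros)
   then show ?thesis unfolding gi_def by (intro measurable_If) auto
  qed
  have "(NN z. EE (w $$ z * gi z)) <= EE (sqrt Y * sqrt (F3 * E))"
  proof (rule nn_integral_cauchy[OF mwl _ _ _ w2])
   have "(NN z. EE ((gi z)^2)) = (NN z. EE (if (fst z)^2 + (snd z)^2 < (3/4 * T)^2 then (vx R t $$ z)^2 + (vy R t $$ z)^2 else 0))"
    by (intro nn_integral_cong) (simp add: gi_def)
   then show "(NN z. EE ((gi z)^2)) <= EE (F3 * E)"
    using vR_grad_bounds(3)[OF t R] unfolding T_def E_def by simp
  qed (simp_all add: gi0 mgi w0 Y K2_pos E)
  then have "EE p * (NN z. EE (w $$ z * gi z)) <= EE p * EE (sqrt Y * sqrt (F3 * E))"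
   by (rule mult_left_mono) simp
  moreover have "EE p * (NN z. EE (w $$ z * gi z)) = (NN z. EE p * EE (w $$ z * gi z))"
   by (rule nn_integral_cmult[symmetric]) measurable
  moreover have "(NN z. EE p * EE (w $$ z * gi z)) = (NN z. EE (sqrt ((hx $$ z)^2 + (hy $$ z)^2)) * ind {z. (fst z)^2 + (snd z)^2 < (3/4 * T)^2} z)"
   unfolding gh gi_def using p35 w0 by (intro nn_integral_cong) (auto simp: indicator_def ennreal_mult)
  ultimately show ?thesis using p35 Y K2_pos E by (simp add: ennreal_mult)
 qed
 have "(NN z. EE (<|vR R t $$ z|> powr (2 * p))) = (NN z. EE ((h $$ z)^2))"
  by (intro nn_integral_cong) (simp add: h_def v_def power2_eq_square powr_add[symmetric])
 also note gag
 also have "144 * (NN z. EE (sqrt ((hx $$ z)^2 + (hy $$ z)^2)))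
   * ((NN z. EE ((<|h $$ z|> + <|fst z * hy $$ z - snd z * hx $$ z|>) / T))
    + (NN z. EE (sqrt ((hx $$ z)^2 + (hy $$ z)^2)) * ind {z. (fst z)^2 + (snd z)^2 < (3/4 * T)^2} z))
  <= EE 144 * EE (p * (sqrt Y * sqrt F1)) * (EE (p * (sqrt Y * sqrt (F2 * E))) + EE (p * (sqrt Y * sqrt (F3 * E))))"
  unfolding ennreal_numeral by (intro mult_mono add_mono I1 I2 I3) auto
 also have "... = EE (144 * (p * (sqrt Y * sqrt F1)) * (p * (sqrt Y * sqrt (F2 * E)) + p * (sqrt Y * sqrt (F3 * E))))"
  using p35 Y K2_pos E by (subst ennreal_plus[symmetric], simp, simp, subst ennreal_mult[symmetric], simp, simp, subst ennreal_mult[symmetric], auto)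
 also have "144 * (p * (sqrt Y * sqrt F1)) * (p * (sqrt Y * sqrt (F2 * E)) + p * (sqrt Y * sqrt (F3 * E))) = C0 * sqrt E * (sqrt Y * sqrt Y)"
 proof -
  have "144 * (p * (y * f1)) * (p * (y * (f2 * e)) + p * (y * (f3 * e))) = 144 * p^2 * f1 * (f2 + f3) * e * (y * y)"
   for y f1 f2 f3 e :: real by (simp add: algebra_simps power2_eq_square)
  then show ?thesis unfolding C0_def real_sqrt_mult .
 qed
 also have "sqrt Y * sqrt Y = Y" using Y by simp
 also have "sqrt E = (1 + t) powr ((5 - p) / 4 - 1)"
 proof -
  have "sqrt E = E powr (1/2)" using E by (simp add: powr_half_sqrt)
  also have "... = T powr (((5 - p) / 2 - 2) * (1/2))" unfolding E_def by (rule powr_powr)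
  also have "((5 - p) / 2 - 2) * (1/2) = (5 - p) / 4 - 1" by (simp add: field_simps)
  finally show ?thesis by (simp add: T_def)
 qed
 finally show ?thesis .
qed

text \<open>Because \<open>p > 3\<close>, the exponent \<open>2 * p - 2\<close> lies between
  \<open>p + 1\<close> and \<open>2 * p\<close>. The quantity \<open>Y\<close> in
  \<open>gn_step\<close> is therefore bounded by the decaying potential energy plus a small multiple
  of the left side \<open>X\<close> itself, which can be absorbed as truncation makes it
  finite.\<close>

lemma L2p_cut:
 assumes t: "0 <= t" and R: "1 + t <= R"
 shows "(NN z. EE (<|vR R t $$ z|> powr (2 * p)))
  <= EE ((2 * C0) powr ((p - 1) / 2) * (564 * D) * (1 + t) powr (- (p - 1) * (p + 3) / 8))"
proof -
 define T where "T = 1 + t"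
 have T: "1 <= T" using t by (simp add: T_def)
 have R0: "0 < R" using R t by simp
 define k where "k = C0 * T powr ((5 - p) / 4 - 1)"
 have k: "0 < k" unfolding k_def using C0_pos T by simp
 \<comment> \<open>The splitting height is chosen so that \<open>X\<close> reappears with
   coefficient \<open>k * M powr (-2) = 1/2\<close>.\<close>
 define M where "M = (2 * k) powr (1/2)"
 have M: "0 < M" "M^2 = 2 * k" unfolding M_def using k by (auto simp: powr_half_sqrt)
 define P0 where "P0 = 564 * D * T powr (- (p - 1) / 2)"
 have P0: "0 < P0" unfolding P0_def using D0 T by simp
 have vz: "vR R t $$ z = 0" if "z \<notin> sq_box R" for z
 proof -
  have "R^2 <= (fst z)^2 | R^2 <= (snd z)^2"
   using that R0 unfolding in_sq_box by (metis abs_le_square_iff abs_of_pos linear)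
  then have "R^2 <= (fst z)^2 + (snd z)^2" by (auto intro: order_trans add_increasing add_increasing2)
  then show ?thesis using cutR_zero[OF R0] by (simp add: vR_def)
 qed
 have ci: "integrable lborel (%z. <|vR R t $$ z|> powr e)" if "0 < e" for e
  by (rule integral_sq_box_lborel(1)[of R]) (use vz that in \<open>auto intro!: continuous_on_abs_powr vR_cont\<close>)
 define X where "X = (LL z. <|vR R t $$ z|> powr (2 * p))"
 have X: "(NN z. EE (<|vR R t $$ z|> powr (2 * p))) = EE X" "0 <= X"
  unfolding X_def using ci[of "2*p"] p35 by (auto intro!: nn_integral_eq_integral)
 define Y where "Y = M powr (p - 3) * P0 + M powr (-2) * X"
 have Y: "0 < Y" unfolding Y_def using M P0 X by (intro add_pos_nonneg) auto
 have mv[measurable]: "(%z. vR R t $$ z) \<in> BB" by (intro borel_measurable_continuous_onI vR_cont)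
 have "(NN z. EE (<|vR R t $$ z|> powr (2 * p - 2))) <=
  (NN z. EE (M powr (p - 3) * <|u t $$ z|> powr (p + 1) + M powr (-2) * <|vR R t $$ z|> powr (2 * p)))"
 proof (intro nn_integral_mono ennreal_leI)
  fix z :: "real \<times> real"
  define s where "s = <|vR R t $$ z|>"
  have s: "0 <= s" "s <= <|u t $$ z|>" using vR_abs by (auto simp: s_def)
  have "s powr (2 * p - 2) <= M powr (p - 3) * s powr (p + 1) + M powr (-2) * s powr (2 * p)"
  proof (cases "s <= M")
   case True
   have e: "2 * p - 2 = (p - 3) + (p + 1)" by simp
   have "s powr (2 * p - 2) = s powr (p - 3) * s powr (p + 1)" unfolding e powr_add ..
   also have "... <= M powr (p - 3) * s powr (p + 1)"
    using True s p35 by (intro mult_right_mono powr_mono2) auto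
   finally show ?thesis by (simp add: add_increasing2)
  next
   case False
   have e: "2 * p - 2 = (-2) + 2 * p" by simp
   have "s powr (2 * p - 2) = s powr (-2) * s powr (2 * p)" unfolding e powr_add ..
   also have "... <= M powr (-2) * s powr (2 * p)"
    using False M by (intro mult_right_mono powr_mono2') auto
   finally show ?thesis by (simp add: add_increasing)
  qed
  also have "M powr (p - 3) * s powr (p + 1) <= M powr (p - 3) * <|u t $$ z|> powr (p + 1)"
   using s p35 by (intro mult_left_mono powr_mono2) auto
  finally show "<|vR R t $$ z|> powr (2 * p - 2) <= M powr (p - 3) * <|u t $$ z|> powr (p + 1) + M powr (-2) * <|vR R t $$ z|> powr (2 * p)"
   unfolding s_def by simp
 qed
 also have "... <= EE (M powr (p - 3) * P0 + M powr (-2) * X)"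
 proof (rule nn_integral_square_sum)
  show "(NN z. EE (<|u t $$ z|> powr (p + 1))) <= EE P0"
   unfolding P0_def T_def using D0 D t by (intro potential_decay) auto
 qed (use X P0 in auto)
 finally have "(NN z. EE (<|vR R t $$ z|> powr (2 * p))) <= EE (C0 * (1 + t) powr ((5 - p) / 4 - 1) * Y)"
  unfolding Y_def[symmetric] by (rule gn_step[OF t R Y])
 then have "X <= k * Y" unfolding X(1) k_def T_def using k Y by (simp add: ennreal_le_iff C0_pos less_imp_le)
 also have "k * Y = k * M powr (p - 3) * P0 + k * M powr (-2) * X" by (simp add: Y_def algebra_simps)
 also have "k * M powr (-2) = 1/2"
  using M k by (simp add: powr_minus powr_numeral field_simps)
 finally have "X <= 2 * k * M powr (p - 3) * P0" by simp
 also have "2 * k * M powr (p - 3) = (2 * k) powr ((p - 1) / 2)"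
 proof -
  have "M powr (p - 3) = (2 * k) powr (1/2 * (p - 3))" unfolding M_def by (rule powr_powr)
  moreover have "(2 * k) powr 1 * (2 * k) powr (1/2 * (p - 3)) = (2 * k) powr ((p - 1) / 2)"
   unfolding powr_add[symmetric] by (rule arg_cong) (simp add: field_simps)
  ultimately show ?thesis using k by simp
 qed
 also have "(2 * k) powr ((p - 1) / 2) * P0 = (2 * C0) powr ((p - 1) / 2) * (564 * D) * T powr (- (p - 1) * (p + 3) / 8)"
 proof -
  have "(2 * k) powr ((p - 1) / 2) = (2 * C0) powr ((p - 1) / 2) * T powr (((5 - p) / 4 - 1) * ((p - 1) / 2))"
   unfolding k_def mult.assoc[symmetric] using C0_pos T by (simp add: powr_mult powr_powr)
  moreover have "T powr (((5 - p) / 4 - 1) * ((p - 1) / 2)) * T powr (- (p - 1) / 2) = T powr (- (p - 1) * (p + 3) / 8)"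
   unfolding powr_add[symmetric] by (rule arg_cong) (simp add: field_simps)
  ultimately show ?thesis unfolding P0_def by (simp add: mult_ac)
 qed
 finally show ?thesis unfolding X(1) T_def by (rule ennreal_leI)
qed

lemma L2p_bound:
 assumes t: "0 <= t"
 shows "(NN z. EE (<|u t $$ z|> powr (2 * p)))
  <= EE ((2 * C0) powr ((p - 1) / 2) * (564 * D) * (1 + t) powr (- (p - 1) * (p + 3) / 8))"
proof (rule nn_integral_le_of_tendsto[where f="%n z. EE (<|vR (1 + t + real n) t $$ z|> powr (2 * p))"])
 fix n
 have [measurable]: "(%z. vR (1 + t + real n) t $$ z) \<in> BB" by (intro borel_measurable_continuous_onI vR_cont)
 show "(%z. EE (<|vR (1 + t + real n) t $$ z|> powr (2 * p))) \<in> borel_measurable lborel" by measurable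
next
 fix z :: "real \<times> real"
 have "(%n. <|cutR (1 + t + real n) $$ z * u t $$ z|> powr (2 * p)) ----> <|1 * u t $$ z|> powr (2 * p)"
  by (intro tendsto_powr' tendsto_intros cutR_tendsto) (use p35 in auto)
 then show "(%n. EE (<|vR (1 + t + real n) t $$ z|> powr (2 * p))) ----> EE (<|u t $$ z|> powr (2 * p))"
  unfolding vR_def by (intro tendsto_ennrealI) simp
next
 show "eventually (%n. (NN z. EE (<|vR (1 + t + real n) t $$ z|> powr (2 * p)))
  <= (%_. EE ((2 * C0) powr ((p - 1) / 2) * (564 * D) * (1 + t) powr (- (p - 1) * (p + 3) / 8))) n) sequentially"
  by (rule always_eventually) (use L2p_cut[OF t] in simp)
qed auto

text \<open>Split at the height \<open>M\<close>, the power of \<open>1 + t\<close> for which the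
  two given bounds contribute equally. The resulting rate is affine in the exponent
  \<open>m\<close>.\<close>

lemma interpolate_decay:
 assumes m: "m1 <= m" "m <= m2" "m1 < m2" and K: "0 <= K" and t: "0 <= t"
  and 1: "(NN z. EE (<|u t $$ z|> powr m1)) <= EE (K * (1 + t) powr al1)"
  and 2: "(NN z. EE (<|u t $$ z|> powr m2)) <= EE (K * (1 + t) powr al2)"
 shows "(NN z. EE (<|u t $$ z|> powr m)) <= EE (2 * K * (1 + t) powr (al1 + (m - m1) * ((al2 - al1) / (m2 - m1))))"
proof -
 define T where "T = 1 + t"
 define ka where "ka = (al2 - al1) / (m2 - m1)"
 define M where "M = T powr ka"
 have T: "1 <= T" using t by (simp add: T_def)
 have M: "0 < M" using T by (simp add: M_def)
 have "(NN z. EE (<|u t $$ z|> powr m)) <=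
  (NN z. EE (M powr (m - m1) * <|u t $$ z|> powr m1 + M powr (m - m2) * <|u t $$ z|> powr m2))"
 proof (intro nn_integral_mono ennreal_leI)
  fix z :: "real \<times> real"
  define s where "s = <|u t $$ z|>"
  have s0: "0 <= s" by (simp add: s_def)
  have "s powr m <= M powr (m - m1) * s powr m1 + M powr (m - m2) * s powr m2"
  proof (cases "s <= M")
   case True
   have "s powr m = s powr (m - m1) * s powr m1" unfolding powr_add[symmetric] by simp
   also have "... <= M powr (m - m1) * s powr m1"
    using True s0 m by (intro mult_right_mono powr_mono2) auto
   finally show ?thesis by (simp add: add_increasing2)
  next
   case False
   have "s powr m = s powr (m - m2) * s powr m2" unfolding powr_add[symmetric] by simp
   also have "... <= M powr (m - m2) * s powr m2"
    using False M m by (intro mult_right_mono powr_mono2') auto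
   finally show ?thesis by (simp add: add_increasing)
  qed
  then show "<|u t $$ z|> powr m <= M powr (m - m1) * <|u t $$ z|> powr m1 + M powr (m - m2) * <|u t $$ z|> powr m2"
   by (simp add: s_def)
 qed
 also have "... <= EE (M powr (m - m1) * (K * T powr al1) + M powr (m - m2) * (K * T powr al2))"
  by (rule nn_integral_square_sum) (use 1 2 K in \<open>auto simp: T_def\<close>)
 also have "M powr (m - m1) * (K * T powr al1) = K * T powr (al1 + (m - m1) * ka)"
  unfolding M_def powr_powr by (simp add: powr_add mult_ac)
 also have "M powr (m - m2) * (K * T powr al2) = K * T powr (al1 + (m - m1) * ka)"
 proof -
  have "al1 + (m - m1) * ka = ka * (m - m2) + al2"
  proof -
   have "(m2 - m1) * ka = al2 - al1" using m by (simp add: ka_def)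
   then show ?thesis by (simp add: algebra_simps)
  qed
  then show ?thesis unfolding M_def powr_powr by (simp add: powr_add mult_ac)
 qed
 finally show ?thesis unfolding T_def ka_def by (simp add: mult.assoc)
qed

text \<open>The exponent condition is exactly \<open>(p + 1)((p - 1)\<^sup>2 - 8) > 0\<close>.\<close>
lemma nonlinearity_decay:
 assumes pp: "1 + sqrt 8 < p" and r: "2 * (p - 1) / (p + 1) <= r" "r <= 2"
 shows "\<exists>K eps. 0 < K & 0 < eps & (\<forall>t\<ge>0. (NN z. EE (<|N t $$ z|> powr r)) <= EE ((K * (1 + t) powr (- 1 - eps)) powr r))"
proof -
 define y where "y = p - 1"
 have y8: "8 < y^2"
 proof -
  have "sqrt 8 < y" using pp by (simp add: y_def)
  then have "(sqrt 8)^2 < y^2" by (intro power_strict_mono) auto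
  then show ?thesis by simp
 qed
 have y0: "2 < y" using p35 by (simp add: y_def)
 have r0: "0 < r"
 proof -
  have "0 < 2 * (p - 1) / (p + 1)" using p35 by simp
  then show ?thesis using r by linarith
 qed
 define m where "m = p * r"
 define K where "K = 1 + K2 + 564 * D + (2 * C0) powr ((p - 1) / 2) * (564 * D)"
 have K: "0 < K" "K2 <= K" "564 * D <= K" "(2 * C0) powr ((p - 1) / 2) * (564 * D) <= K"
 proof -
  define c where "c = (2 * C0) powr ((p - 1) / 2) * (564 * D)"
  have "0 <= c" using D0 by (simp add: c_def)
  then show "0 < K" "K2 <= K" "564 * D <= K" "(2 * C0) powr ((p - 1) / 2) * (564 * D) <= K"
   unfolding K_def c_def[symmetric] using K2_pos D0 by linarith+
 qed
 have b2: "(NN z. EE (<|u t $$ z|> powr 2)) <= EE (K * (1 + t) powr ((5 - p) / 2))" if t: "0 <= t" for t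
 proof -
  have "(NN z. EE (<|u t $$ z|> powr 2)) = (NN z. EE ((u t $$ z)^2))"
   by (simp add: powr_numeral)
  also note u_sq_bound[OF t]
  finally show ?thesis using K by (elim order_trans) (intro ennreal_leI mult_right_mono, auto)
 qed
 have bp: "(NN z. EE (<|u t $$ z|> powr (p + 1))) <= EE (K * (1 + t) powr (- (p - 1) / 2))" if t: "0 <= t" for t
 proof -
  have "(NN z. EE (<|u t $$ z|> powr (p + 1))) <= EE (564 * D * (1 + t) powr (- (p - 1) / 2))"
   using D0 D t by (intro potential_decay) auto
  then show ?thesis using K by (elim order_trans) (intro ennreal_leI mult_right_mono, auto)
 qed
 have b2p: "(NN z. EE (<|u t $$ z|> powr (2 * p))) <= EE (K * (1 + t) powr (- (p - 1) * (p + 3) / 8))" if t: "0 <= t" for t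
  by (rule order_trans[OF L2p_bound[OF t]]) (use K in \<open>intro ennreal_leI mult_right_mono, auto\<close>)
 have mr: "m <= 2 * p" using r p35 by (simp add: m_def)
 \<comment> \<open>As \<open>m = p * r\<close>, the inequality says \<open>al / r < - 1\<close>: the
   \<open>L^r\<close> norm of the nonlinearity then decays at an integrable rate.\<close>
 have "\<exists>al. p * al + m < 0 & (\<forall>t\<ge>0. (NN z. EE (<|u t $$ z|> powr m)) <= EE (2 * K * (1 + t) powr al))"
 proof (cases "m <= p + 1")
  case True
  have m2: "2 <= m"
  proof -
   have "2 <= p * (2 * (p - 1) / (p + 1))"
   proof -
    define q where "q = p * p"
    have "p * 3 <= q" unfolding q_def using p35 by (intro mult_left_mono) auto
    moreover have e: "p * (2 * (p - 1)) = 2 * q - 2 * p" by (simp add: q_def algebra_simps)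
    ultimately have "2 * (p + 1) <= p * (2 * (p - 1))" unfolding e using p35 by (simp add: distrib_left)
    then show ?thesis using p35 by (simp add: le_divide_eq)
   qed
   also have "... <= m" unfolding m_def using r p35 by (intro mult_left_mono) auto
   finally show ?thesis .
  qed
  define al where "al = (5 - p) / 2 + (m - 2) * ((- (p - 1) / 2 - (5 - p) / 2) / (p + 1 - 2))"
  have al: "al = (5 - p) / 2 - (m - 2) * 2 / (p - 1)" using p35 by (simp add: al_def field_simps)
  have "p * al + m < 0"
  proof -
   have m0: "2 * p * (p - 1) / (p + 1) <= m" unfolding m_def using mult_left_mono[OF r(1), of p] p35 by (simp add: mult_ac)
   have "p * al + m = p * (5 - p) / 2 + 4 * p / y - m * ((2 * p - y) / y)"
   proof -
    define i where "i = 1 / y"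
    have a1: "(2 * p - y) / y = 2 * p * i - 1" using y0 by (simp add: diff_divide_distrib i_def)
    have a2: "al = (5 - p) / 2 - (m - 2) * 2 * i" unfolding al y_def[symmetric] by (simp add: i_def)
    have a3: "4 * p / y = 4 * p * i" by (simp add: i_def)
    show ?thesis unfolding a1 a2 a3 by (simp add: algebra_simps)
   qed
   \<comment> \<open>The expression decreases in \<open>m\<close>, so the lower end of the range of
     \<open>r\<close> is the worst case; there it has the sign of \<open>8 - y^2\<close> with
     \<open>y = p - 1\<close>.\<close>
   also have "... <= p * (5 - p) / 2 + 4 * p / y - 2 * p * y / (p + 1) * ((2 * p - y) / y)"
    using mult_right_mono[OF m0, of "(2 * p - y) / y"] y0 unfolding y_def by simp
   also have "... = p * (- (y + 2) * (y^2 - 8)) / (2 * y * (y + 2))"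
   proof -
    have e: "p = y + 1" "p + 1 = y + 2" by (auto simp: y_def)
    show ?thesis unfolding e(1) using y0 by (simp add: divide_simps) (simp add: algebra_simps power2_eq_square)
   qed
   also have "... < 0"
    using y0 y8 p35 by (intro divide_neg_pos mult_pos_neg mult_neg_pos) auto
   finally show ?thesis .
  qed
  moreover have "(NN z. EE (<|u t $$ z|> powr m)) <= EE (2 * K * (1 + t) powr al)" if "0 <= t" for t
   unfolding al_def by (rule interpolate_decay[OF m2 True _ _ that b2[OF that] bp[OF that]]) (use p35 K in auto)
  ultimately show ?thesis by blast
 next
  case False
  define al where "al = - (p - 1) / 2 + (m - (p + 1)) * ((- (p - 1) * (p + 3) / 8 - - (p - 1) / 2) / (2 * p - (p + 1)))"
  have al: "al = - y / 2 - (m - (p + 1)) * (y / 8)"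
  proof -
   have e: "2 * p - (p + 1) = y" "p + 3 = y + 4" by (auto simp: y_def)
   show ?thesis unfolding al_def e y_def[symmetric] using y0 by (simp add: field_simps)
  qed
  have "p * al + m < 0"
  proof -
   have "p * al + m = - p * y / 2 + (p + 1) - (m - (p + 1)) * (p * y / 8 - 1)" unfolding al by (simp add: field_simps)
   \<comment> \<open>Above \<open>p + 1\<close> the worst case is \<open>m = p + 1\<close>, because
     \<open>p * y >= 8\<close>. What remains is negative by \<open>y^2 > 8\<close> and
     \<open>y < 4\<close>.\<close>
   also have "... <= - p * y / 2 + (p + 1)"
   proof -
    have "y * y <= p * y" using y0 by (intro mult_right_mono) (auto simp: y_def)
    then have "8 <= p * y" using y8 unfolding power2_eq_square by linarith
    then have "0 <= (m - (p + 1)) * (p * y / 8 - 1)" using False by (intro mult_nonneg_nonneg) auto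
    then show ?thesis by simp
   qed
   also have "... < 0"
   proof -
    define q where "q = y * y"
    have "- p * y / 2 + (p + 1) = - q / 2 - y / 2 + (y + 2)"
     by (simp add: q_def y_def algebra_simps diff_divide_distrib add_divide_distrib)
    moreover have "y < 4" using p35 by (simp add: y_def)
    moreover have "8 < q" using y8 by (simp add: q_def power2_eq_square)
    ultimately show ?thesis by linarith
   qed
   finally show ?thesis .
  qed
  moreover have "(NN z. EE (<|u t $$ z|> powr m)) <= EE (2 * K * (1 + t) powr al)" if "0 <= t" for t
   unfolding al_def by (rule interpolate_decay[OF _ mr _ _ that bp[OF that] b2p[OF that]]) (use False p35 K in auto)
  ultimately show ?thesis by blast
 qed
 then obtain al where al: "p * al + m < 0" "!!t. 0 <= t ==> (NN z. EE (<|u t $$ z|> powr m)) <= EE (2 * K * (1 + t) powr al)"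
  by blast
 define eps where "eps = - al / r - 1"
 have "0 < eps"
 proof -
  have "p * (al + r) < p * 0" using al(1) by (simp add: m_def algebra_simps)
  then have "al + r < 0" using p35 by (simp only: mult_less_cancel_left_pos)
  then show ?thesis unfolding eps_def using r0 by (simp add: field_simps)
 qed
 moreover have "(NN z. EE (<|N t $$ z|> powr r)) <= EE (((2 * K) powr (1/r) * (1 + t) powr (- 1 - eps)) powr r)" if t: "0 <= t" for t
 proof -
  have "<|N t x y|> powr r = <|u t x y|> powr m" for x y
  proof -
   have "<|N t x y|> = <|u t x y|> powr p"
    using p35 powr_add[of "<|u t x y|>" "p - 1" 1] by (cases "u t x y = 0") (auto simp: N_def abs_mult)
   then show ?thesis by (simp add: powr_powr m_def)
  qed
  moreover have "((2 * K) powr (1/r) * (1 + t) powr (- 1 - eps)) powr r = 2 * K * (1 + t) powr al"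
  proof -
   have "(- 1 - eps) * r = al" using r0 by (simp add: eps_def field_simps)
   then show ?thesis using K r0 t by (simp add: powr_mult powr_powr)
  qed
  ultimately show ?thesis using al(2)[OF t] by simp
 qed
 ultimately show ?thesis using K by (intro exI[of _ "(2 * K) powr (1/r)"] exI[of _ eps]) auto
qed

end

end

subsection \<open>Fourier integrals in the plane\<close>

definition vec2 :: "real \<times> real => real^2" where "vec2 z = (\<chi> i. if i = 1 then fst z else snd z)"

lemma vec2_nth[simp]: "vec2 z $ 1 = fst z" "vec2 z $ 2 = snd z" by (simp_all add: vec2_def)

lemma vec2_eta: "vec2 (x $ 1, x $ 2) = x" by (simp add: vec_eq_iff forall_2)

lemma inner_2: "x \<bullet> y = x $ 1 * y $ 1 + x $ 2 * y $ 2" for x y :: "real^2"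
 by (simp add: inner_vec_def sum_2)

lemma norm_2: "norm x = sqrt ((x $ 1)^2 + (x $ 2)^2)" for x :: "real^2"
 by (simp add: norm_eq_sqrt_inner inner_2 power2_eq_square)

lemma Basis_2: "(Basis :: (real^2) set) = {axis 1 1, axis 2 1}"
 by (auto simp: Basis_vec_def UNIV_2)

lemma axis_2_neq: "axis 1 (1::real) ~= (axis 2 1 :: real^2)" by (simp add: axis_eq_axis)

lemma vec2_cont: "CO S vec2"
 unfolding vec2_def
proof (rule continuous_on_vec_lambda)
 fix i :: 2
 show "CO S (%z. if i = 1 then fst z else snd z)" by (cases "i = 1") (auto intro!: continuous_intros)
qed

lemma vec2_meas[measurable]: "vec2 \<in> BB"
 by (rule borel_measurable_continuous_onI[OF vec2_cont])

lemma lborel_vec2: "distr lborel borel vec2 = lborel"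
proof (rule lborel_eqI[symmetric])
 fix l u :: "real^2" assume lu: "!!b. b \<in> Basis ==> l \<bullet> b <= u \<bullet> b"
 have i: "z \<bullet> axis k 1 = z $ k" for z :: "real^2" and k by (simp add: inner_axis)
 have lu': "l $ 1 <= u $ 1" "l $ 2 <= u $ 2" using lu[of "axis 1 1"] lu[of "axis 2 1"] by (auto simp: Basis_2 i)
 have "vec2 -` box l u = box (l $ 1, l $ 2) (u $ 1, u $ 2)"
  by (auto simp: mem_box_cart mem_box Basis_prod_def Basis_2 forall_2)
 then have "emeasure (distr lborel borel vec2) (box l u) = emeasure lborel (box (l $ 1, l $ 2) (u $ 1, u $ 2))"
  by (subst emeasure_distr) auto
 also have "... = EE (\<Prod>b\<in>Basis. ((u $ 1, u $ 2) - (l $ 1, l $ 2)) \<bullet> b)"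
  by (rule emeasure_lborel_box) (use lu' in \<open>auto simp: Basis_prod_def\<close>)
 also have "(\<Prod>b\<in>Basis. ((u $ 1, u $ 2) - (l $ 1, l $ 2)) \<bullet> b) = (u $ 1 - l $ 1) * (u $ 2 - l $ 2)"
  by (simp add: Basis_prod_def prod.union_disjoint)
 also have "... = (\<Prod>b\<in>Basis. (u - l) \<bullet> b)"
  using axis_2_neq by (simp add: Basis_2 i)
 finally show "emeasure (distr lborel borel vec2) (box l u) = EE (\<Prod>b\<in>Basis. (u - l) \<bullet> b)" .
qed simp

lemma nn_integral_vec2:
 assumes [measurable]: "f \<in> BB"
 shows "(NN x. f x) = (NN z. f (vec2 z))"
 using nn_integral_distr[of vec2 lborel borel f] by (simp add: lborel_vec2)

lemma integral_vec2:
 fixes f :: "real^2 => 'b::{banach, second_countable_topology}"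
 assumes [measurable]: "f \<in> BB"
 shows "(LL x. f x) = (LL z. f (vec2 z))" "integrable lborel f \<longleftrightarrow> integrable lborel (%z. f (vec2 z))"
 using integral_distr[of vec2 lborel borel f] integrable_distr_eq[of vec2 lborel borel f] by (simp_all add: lborel_vec2)

lemma nn_integral_vec2_product:
 assumes [measurable]: "f \<in> BB" "g \<in> BB"
 shows "(\<integral>\<^sup>+x. f (x $ 1) * g (x $ 2) \<partial>(lborel :: (real^2) measure)) = (NN s. f s) * (NN s. g s)"
proof -
 have [measurable]: "(%x::real^2. x $ i) \<in> BB" for i
  by (intro borel_measurable_continuous_onI continuous_intros)
 have m: "(%z. f (fst z) * g (snd z)) \<in> borel_measurable (lborel \<Otimes>\<^sub>M lborel)" by measurable
 have "(\<integral>\<^sup>+x. f (x $ 1) * g (x $ 2) \<partial>(lborel :: (real^2) measure)) = (NN z. f (fst z) * g (snd z))"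
  by (subst nn_integral_vec2) auto
 also have "... = (NN x. (NN y. f x * g y))"
  using lborel.nn_integral_fst[OF m] by (simp add: lborel_prod)
 also have "... = (NN s. f s) * (NN s. g s)"
  by (simp add: nn_integral_cmult nn_integral_multc)
 finally show ?thesis .
qed

lemma nn_integral_powr_near_0:
 fixes s :: real assumes s: "0 <= s" "s < 1" and l: "0 <= l"
 shows "(NN x. EE (<|x|> powr (- s)) * ind {-l..l} x) = EE (2 * l powr (1 - s) / (1 - s))"
proof -
 have h: "((%x. x powr (- s)) has_integral (l powr (- s + 1) / (- s + 1))) {0..l}"
  by (rule has_integral_powr_from_0) (use s l in auto)
 have e: "(%x. (ind {0..l} x *\<^sub>R x powr (- s))) = (%x. if x \<in> {0..l} then x powr (- s) else 0)" by (auto simp: indicator_def)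
 have "((%x. (ind {0..l} x *\<^sub>R x powr (- s))) has_integral (l powr (- s + 1) / (- s + 1))) UNIV"
  unfolding e has_integral_restrict_UNIV by (rule h)
 from nn_integral_has_integral_lborel[OF _ _ this]
 have 1: "(NN x. EE (ind {0..l} x *\<^sub>R x powr (- s))) = EE (l powr (1 - s) / (1 - s))" by simp
 have 2: "(NN x. EE (<|x|> powr (- s)) * ind {0..l} x) = EE (l powr (1 - s) / (1 - s))"
  unfolding 1[symmetric] by (intro nn_integral_cong) (auto simp: indicator_def)
 have 3: "(NN x. EE (<|x|> powr (- s)) * ind {-l..0} x) = EE (l powr (1 - s) / (1 - s))"
 proof -
  have "(NN x. EE (<|x|> powr (- s)) * ind {-l..0} x) = EE <|- 1|> * (NN x. EE (<|0 + - 1 * x|> powr (- s)) * ind {-l..0} (0 + - 1 * x))"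
   by (rule nn_integral_real_affine) auto
  also have "... = (NN x. EE (<|x|> powr (- s)) * ind {0..l} x)"
   by (simp, intro nn_integral_cong) (auto simp: indicator_def)
  finally show ?thesis using 2 by simp
 qed
 have "(NN x. EE (<|x|> powr (- s)) * ind {-l..l} x) = (NN x. EE (<|x|> powr (- s)) * ind {-l..0} x + EE (<|x|> powr (- s)) * ind {0..l} x)"
 proof (rule nn_integral_cong_AE)
  show "AE x in lborel. EE (<|x|> powr (- s)) * ind {-l..l} x = EE (<|x|> powr (- s)) * ind {-l..0} x + EE (<|x|> powr (- s)) * ind {0..l} x"
   using AE_lborel_singleton[of "0::real"] by eventually_elim (use l in \<open>auto simp: indicator_def\<close>)
 qed
 also have "... = EE (l powr (1 - s) / (1 - s)) + EE (l powr (1 - s) / (1 - s))"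
  by (subst nn_integral_add) (auto simp: 2 3)
 also have "... = EE (2 * l powr (1 - s) / (1 - s))"
  using s by (simp add: ennreal_plus[symmetric] del: ennreal_plus)
 finally show ?thesis .
qed

lemma AE_coord_nonzero: "AE x in (lborel :: (real^2) measure). x $ 1 ~= 0 & x $ 2 ~= 0"
proof -
 have "AE x in lborel. \<not> (x \<bullet> b = 0)" if "b ~= 0" for b :: "real^2"
 proof -
  have "negligible {x. b \<bullet> x = 0}" using negligible_hyperplane[of b 0] that by simp
  then have "{x. b \<bullet> x = 0} \<in> null_sets lebesgue" by (simp add: negligible_iff_null_sets)
  moreover have "{x. b \<bullet> x = 0} \<in> sets lborel" by (simp add: borel_closed closed_hyperplane)
  ultimately have "{x. b \<bullet> x = 0} \<in> null_sets lborel" by (simp add: null_sets_def)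
  then show ?thesis by (rule AE_I') (auto simp: inner_commute)
 qed
 from this[of "axis 1 1"] this[of "axis 2 1"] show ?thesis by (auto simp: inner_axis axis_eq_0_iff)
qed

text \<open>The product of the coordinates is at most the squared norm, so the radial singularity is
  dominated by a product of one-dimensional ones, each integrable for \<open>s < 1\<close>; the ball
  lies in a square.\<close>

lemma nn_integral_norm_powr_ball:
 fixes s :: real assumes s: "0 <= s" "s < 1" and l: "0 <= l"
 shows "(\<integral>\<^sup>+x. EE (norm x powr (- 2 * s)) * ind {x. norm x <= l} x \<partial>(lborel :: (real^2) measure))
  <= EE ((2 / (1 - s))^2 * l powr (2 - 2 * s))"
proof -
 let ?f = "%x. EE (<|x|> powr (- s)) * ind {-l..l} x"
 have "(\<integral>\<^sup>+x. EE (norm x powr (- 2 * s)) * ind {x. norm x <= l} x \<partial>(lborel :: (real^2) measure))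
  <= (\<integral>\<^sup>+x. ?f (x $ 1) * ?f (x $ 2) \<partial>(lborel :: (real^2) measure))"
 proof (rule nn_integral_mono_AE)
  show "AE x in lborel. EE (norm x powr (- 2 * s)) * ind {x. norm x <= l} x <= ?f (x $ 1) * ?f ((x::real^2) $ 2)"
   using AE_coord_nonzero
  proof eventually_elim
   case (elim x)
   show ?case
   proof (cases "norm x <= l")
    case True
    have c: "<|x $ i|> <= l" for i using component_le_norm_cart[of x i] True by linarith
    have "<|x $ 1|> * <|x $ 2|> <= (norm x)^2"
    proof -
     have "<|x $ 1|> * <|x $ 2|> <= norm x * norm x" by (intro mult_mono component_le_norm_cart) auto
     then show ?thesis by (simp add: power2_eq_square)
    qed
    then have "((norm x)^2) powr (- s) <= (<|x $ 1|> * <|x $ 2|>) powr (- s)"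
     using elim s by (intro powr_mono2') auto
    moreover have "((norm x)^2) powr (- s) = norm x powr (- 2 * s)"
     using elim powr_powr[of "norm x" 2 "- s"] by (auto simp: powr_numeral)
    ultimately have "norm x powr (- 2 * s) <= <|x $ 1|> powr (- s) * <|x $ 2|> powr (- s)"
     by (simp add: powr_mult)
    then have "EE (norm x powr (- 2 * s)) <= EE (<|x $ 1|> powr (- s)) * EE (<|x $ 2|> powr (- s))"
     by (simp add: ennreal_mult[symmetric] ennreal_leI)
    then show ?thesis using c[of 1] c[of 2] by (auto simp: indicator_def abs_le_iff)
   qed auto
  qed
 qed
 also have "... = (NN x. ?f x) * (NN x. ?f x)"
  by (rule nn_integral_vec2_product) auto
 also have "... = EE (2 * l powr (1 - s) / (1 - s) * (2 * l powr (1 - s) / (1 - s)))"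
  unfolding nn_integral_powr_near_0[OF s l] using s by (subst ennreal_mult[symmetric]) auto
 also have "2 * l powr (1 - s) / (1 - s) * (2 * l powr (1 - s) / (1 - s)) = (2 / (1 - s))^2 * l powr (2 - 2 * s)"
 proof -
  have "l powr (2 - 2 * s) = l powr (1 - s) * l powr (1 - s)" unfolding powr_add[symmetric] by simp
  then show ?thesis by (simp add: power2_eq_square)
 qed
 finally show ?thesis .
qed

text \<open>Again a product majorant: \<open>(1 + norm x)^2\<close> dominates the product of the two
  one-dimensional factors, each of which decays with exponent \<open>k / 2 > 1\<close>.\<close>

lemma nn_integral_decay_finite:
 fixes k :: real assumes k: "2 < k"
 shows "(\<integral>\<^sup>+x. EE ((1 + norm x) powr (- k)) \<partial>(lborel :: (real^2) measure)) < \<infinity>"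
proof -
 define e where "e = k / 2"
 have e: "1 < e" using k by (simp add: e_def)
 let ?f = "%x::real. EE ((1 + <|x|>) powr (- e))"
 have "(\<integral>\<^sup>+x. EE ((1 + norm x) powr (- k)) \<partial>(lborel :: (real^2) measure)) <= (\<integral>\<^sup>+x. ?f (x $ 1) * ?f (x $ 2) \<partial>(lborel :: (real^2) measure))"
 proof (intro nn_integral_mono)
  fix x :: "real^2"
  have "(1 + <|x $ 1|>) * (1 + <|x $ 2|>) <= (1 + norm x) * (1 + norm x)"
   using component_le_norm_cart[of x] by (intro mult_mono) auto
  then have "((1 + norm x) * (1 + norm x)) powr (- e) <= ((1 + <|x $ 1|>) * (1 + <|x $ 2|>)) powr (- e)"
   using e by (intro powr_mono2') (auto intro!: mult_pos_pos add_pos_nonneg)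
  moreover have "((1 + norm x) * (1 + norm x)) powr (- e) = (1 + norm x) powr (- k)"
   by (simp add: powr_mult powr_add[symmetric] e_def)
  ultimately show "EE ((1 + norm x) powr (- k)) <= ?f (x $ 1) * ?f (x $ 2)"
   by (simp add: powr_mult ennreal_mult[symmetric] ennreal_leI)
 qed
 also have "... = (NN x. ?f x) * (NN x. ?f x)"
  by (rule nn_integral_vec2_product) auto
 also have "... < \<infinity>"
 proof -
  have h: "((%x. x powr (- e)) has_integral (- (1 powr (- e + 1)) / (- e + 1))) {1..}"
   by (rule has_integral_powr_to_inf) (use e in auto)
  have "((%x. (ind {1..} x *\<^sub>R x powr (- e))) has_integral (- (1 powr (- e + 1)) / (- e + 1))) UNIV"
  proof -
   have "(%x. (ind {1..} x *\<^sub>R x powr (- e))) = (%x. if x \<in> {1..} then x powr (- e) else 0)" by (auto simp: indicator_def)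
   then show ?thesis using h by (simp only: has_integral_restrict_UNIV)
  qed
  from nn_integral_has_integral_lborel[OF _ _ this]
  have 1: "(NN x. EE (ind {1..} x *\<^sub>R x powr (- e))) < \<infinity>" by simp
  have half: "(NN x. ?f x * ind {0..} x) < \<infinity>"
  proof -
   have "(NN x. EE (ind {1..} x *\<^sub>R x powr (- e))) = EE <|1|> * (NN x. EE (ind {1..} (1 + 1 * x) *\<^sub>R (1 + 1 * x) powr (- e)))"
    by (rule nn_integral_real_affine) auto
   also have "... = (NN x. ?f x * ind {0..} x)"
    by (simp, intro nn_integral_cong) (auto simp: indicator_def)
   finally show ?thesis using 1 by simp
  qed
  have half': "(NN x. ?f x * ind {..0} x) = (NN x. ?f x * ind {0..} x)"
  proof -
   have "(NN x. ?f x * ind {..0} x) = EE <|- 1|> * (NN x. ?f (0 + - 1 * x) * ind {..0} (0 + - 1 * x))"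
    by (rule nn_integral_real_affine) auto
   also have "... = (NN x. ?f x * ind {0..} x)"
    by (simp, intro nn_integral_cong) (auto simp: indicator_def)
   finally show ?thesis .
  qed
  have "(NN x. ?f x) <= (NN x. ?f x * ind {..0} x + ?f x * ind {0..} x)"
   by (intro nn_integral_mono) (auto simp: indicator_def)
  also have "... = (NN x. ?f x * ind {..0} x) + (NN x. ?f x * ind {0..} x)"
   by (rule nn_integral_add) auto
  also have "... < \<infinity>" using half half' by simp
  finally show ?thesis by (simp add: ennreal_mult_less_top)
 qed
 finally show ?thesis .
qed

lemma lborel2_affine:
 fixes f :: "real^2 => 'b::{banach, second_countable_topology}"
 assumes [measurable]: "f \<in> BB" and c: "0 < c"
 shows "(LL x. f x) = (LL x. c^2 *\<^sub>R f (t + c *\<^sub>R x))"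
  "integrable lborel f \<longleftrightarrow> integrable lborel (%x. c^2 *\<^sub>R f (t + c *\<^sub>R x))"
proof -
 have l: "lborel = density (distr lborel borel (%x. t + c *\<^sub>R x)) (%_. EE (c^2))"
  using lborel_affine[of c t] c by (simp add: power2_eq_square)
 have "(LL x. f x) = (\<integral>x. f x \<partial>density (distr lborel borel (%x. t + c *\<^sub>R x)) (%_. EE (c^2)))"
  using l by simp
 also have "... = (LL x. c^2 *\<^sub>R f (t + c *\<^sub>R x))"
  by (subst integral_density) (auto simp: integral_distr)
 finally show "(LL x. f x) = (LL x. c^2 *\<^sub>R f (t + c *\<^sub>R x))" .
 have "integrable lborel f \<longleftrightarrow> integrable (density (distr lborel borel (%x. t + c *\<^sub>R x)) (%_. EE (c^2))) f"
  using l by simp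
 also have "... \<longleftrightarrow> integrable lborel (%x. c^2 *\<^sub>R f (t + c *\<^sub>R x))"
  by (subst integrable_density) (auto simp: integrable_distr_eq)
 finally show "integrable lborel f \<longleftrightarrow> integrable lborel (%x. c^2 *\<^sub>R f (t + c *\<^sub>R x))" .
qed

section \<open>Gaussian regularisation, Fourier inversion and Plancherel\<close>

lemma gauss_1d:
 "integrable lborel (%x::real. cis (t * x) * cr (exp (- (x^2) / 2)))"
 "(LL x. cis (t * x) * cr (exp (- (x^2) / 2))) = cr (sqrt (2 * pi) * exp (- (t^2) / 2))"
proof -
 have d: "std_normal_density x = exp (- (x^2) / 2) / sqrt (2 * pi)" for x by (simp add: std_normal_density_def)
 have i: "integrable lborel std_normal_density" using integrable_std_normal_moment[of 0] by simp
 have "integrable lborel (%x. sqrt (2 * pi) * std_normal_density x)" using i by simp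
 then have ie: "integrable lborel (%x::real. exp (- (x^2) / 2))" by (simp add: d)
 show 1: "integrable lborel (%x::real. cis (t * x) * cr (exp (- (x^2) / 2)))"
 proof (rule Bochner_Integration.integrable_bound[OF ie])
  show "(%x::real. cis (t * x) * cr (exp (- (x^2) / 2))) \<in> borel_measurable lborel"
   unfolding cis_conv_exp by measurable
 qed (simp add: norm_mult)
 have "char std_normal_distribution t = (LL x. std_normal_density x *\<^sub>R iexp (t * x))"
  unfolding char_def by (subst integral_density) (auto simp: normal_density_nonneg)
 also have "... = (LL x. cr (1 / sqrt (2 * pi)) * (cis (t * x) * cr (exp (- (x^2) / 2))))"
  by (intro Bochner_Integration.integral_cong) (simp_all add: d cis_conv_exp scaleR_conv_of_real mult_ac)
 also have "... = cr (1 / sqrt (2 * pi)) * (LL x. cis (t * x) * cr (exp (- (x^2) / 2)))"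
  by simp
 finally have "cr (1 / sqrt (2 * pi)) * (LL x. cis (t * x) * cr (exp (- (x^2) / 2))) = cr (exp (- (t^2) / 2))"
  by (simp add: char_std_normal_distribution)
 then have "cr (sqrt (2 * pi)) * (cr (1 / sqrt (2 * pi)) * (LL x. cis (t * x) * cr (exp (- (x^2) / 2)))) = cr (sqrt (2 * pi)) * cr (exp (- (t^2) / 2))"
  by simp
 then show "(LL x. cis (t * x) * cr (exp (- (x^2) / 2))) = cr (sqrt (2 * pi) * exp (- (t^2) / 2))"
  unfolding mult.assoc[symmetric] of_real_mult[symmetric] by simp
qed

definition gau :: "real^2 => real" where "gau x = exp (- ((norm x)^2) / 2)"

lemma gau_split: "gau (vec2 z) = exp (- ((fst z)^2) / 2) * exp (- ((snd z)^2) / 2)"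
proof -
 have "- ((norm (vec2 z))^2) / 2 = - ((fst z)^2) / 2 + - ((snd z)^2) / 2" by (simp add: norm_2 field_simps)
 then show ?thesis unfolding gau_def by (simp only: exp_add)
qed

lemma cis_meas[measurable]: "f \<in> borel_measurable M ==> (%x. cis (f x)) \<in> borel_measurable M"
 unfolding cis_conv_exp by measurable

lemma gau_meas[measurable]: "gau \<in> BB"
 unfolding gau_def by measurable

lemma gauss_2d:
 "integrable lborel (%x. cis (xi \<bullet> x) * cr (gau x))"
 "(LL x. cis (xi \<bullet> x) * cr (gau x)) = cr (2 * pi * gau xi)"
proof -
 define f where "f = (%t x::real. cis (t * x) * cr (exp (- (x^2) / 2)))"
 have s: "cis (xi \<bullet> vec2 z) * cr (gau (vec2 z)) = f (xi $ 1) (fst z) * f (xi $ 2) (snd z)" for z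
  unfolding gau_split inner_2 f_def by (simp add: cis_mult[symmetric] mult_ac)
 have fi: "integrable lborel (f t)" for t unfolding f_def by (rule gauss_1d)
 have [measurable]: "f t \<in> BB" for t unfolding f_def by measurable
 have ip: "integrable (lborel \<Otimes>\<^sub>M lborel) (%z. f (xi $ 1) (fst z) * f (xi $ 2) (snd z))"
 proof (rule lborel_pair.Fubini_integrable)
  show "integrable lborel (%x. (LL y. norm (f (xi $ 1) (fst (x, y)) * f (xi $ 2) (snd (x, y)))))"
   using integrable_norm[OF fi, of "xi $ 1"] by (simp add: norm_mult)
  show "AE x in lborel. integrable lborel (%y. f (xi $ 1) (fst (x, y)) * f (xi $ 2) (snd (x, y)))"
   using fi by simp
 qed measurable
 have m: "(%x. cis (xi \<bullet> x) * cr (gau x)) \<in> BB" by measurable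
 show "integrable lborel (%x. cis (xi \<bullet> x) * cr (gau x))"
  unfolding integral_vec2(2)[OF m] s using ip by (simp add: lborel_prod)
 have "(LL x. cis (xi \<bullet> x) * cr (gau x)) = (\<integral>z. f (xi $ 1) (fst z) * f (xi $ 2) (snd z) \<partial>(lborel \<Otimes>\<^sub>M lborel))"
  unfolding integral_vec2(1)[OF m] s by (simp add: lborel_prod)
 also have "... = (LL x. (LL y. f (xi $ 1) x * f (xi $ 2) y))"
  using lborel_pair.integral_fst'[OF ip] by simp
 also have "... = integral\<^sup>L lborel (f (xi $ 1)) * integral\<^sup>L lborel (f (xi $ 2))" by simp
 also have "... = cr (sqrt (2 * pi) * exp (- ((xi $ 1)^2) / 2)) * cr (sqrt (2 * pi) * exp (- ((xi $ 2)^2) / 2))"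
  unfolding f_def gauss_1d(2) ..
 also have "... = cr (2 * pi * gau xi)"
 proof -
  have sq: "sqrt (2 * pi) * A * (sqrt (2 * pi) * B) = 2 * pi * (A * B)" for A B
  proof -
   have "sqrt (2 * pi) * A * (sqrt (2 * pi) * B) = (sqrt (2 * pi) * sqrt (2 * pi)) * (A * B)" by (simp only: mult_ac)
   then show ?thesis by simp
  qed
  show ?thesis using gau_split[of "(xi $ 1, xi $ 2)"] unfolding vec2_eta of_real_mult[symmetric] sq by (simp del: of_real_mult)
 qed
 finally show "(LL x. cis (xi \<bullet> x) * cr (gau x)) = cr (2 * pi * gau xi)" .
qed

lemma gau_integrable: "integrable lborel gau" "(LL x. gau x) = 2 * pi"
proof -
 have "integrable lborel (%x. Re (cis (0 \<bullet> x) * cr (gau x)))" by (rule integrable_Re[OF gauss_2d(1)])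
 then show "integrable lborel gau" by simp
 have "(LL x. cr (gau x)) = cr (2 * pi)"
  using gauss_2d(2)[of 0] by (simp add: gau_def)
 then show "(LL x. gau x) = 2 * pi" by (metis integral_complex_of_real of_real_eq_iff)
qed

lemma gauss_scaled:
 assumes d: "0 < d"
 shows "integrable lborel (%x. cis (xi \<bullet> x) * cr (gau (d *\<^sub>R x)))"
 "(LL x. cis (xi \<bullet> x) * cr (gau (d *\<^sub>R x))) = cr (2 * pi / d^2 * gau (xi /\<^sub>R d))"
proof -
 define f where "f = (%x. cis ((xi /\<^sub>R d) \<bullet> x) * cr (gau x))"
 have [measurable]: "f \<in> BB" unfolding f_def by measurable
 have e: "f (0 + d *\<^sub>R x) = cis (xi \<bullet> x) * cr (gau (d *\<^sub>R x))" for x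
 proof -
  have "(xi /\<^sub>R d) \<bullet> (0 + d *\<^sub>R x) = xi \<bullet> x" using d by simp
  then show ?thesis unfolding f_def by (simp only: add_0)
 qed
 have "integrable lborel f" unfolding f_def by (rule gauss_2d)
 then have "integrable lborel (%x. d^2 *\<^sub>R f (0 + d *\<^sub>R x))"
  using lborel2_affine(2)[of f d 0] d by simp
 then have "integrable lborel (%x. (1/d^2) *\<^sub>R (d^2 *\<^sub>R f (0 + d *\<^sub>R x)))" by (rule integrable_scaleR_right)
 then show "integrable lborel (%x. cis (xi \<bullet> x) * cr (gau (d *\<^sub>R x)))" unfolding e using d by simp
 have "cr (2 * pi * gau (xi /\<^sub>R d)) = (LL x. d^2 *\<^sub>R f (0 + d *\<^sub>R x))"
  using lborel2_affine(1)[of f d 0] gauss_2d(2)[of "xi /\<^sub>R d"] d unfolding f_def by simp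
 also have "... = d^2 *\<^sub>R (LL x. cis (xi \<bullet> x) * cr (gau (d *\<^sub>R x)))" unfolding e by simp
 finally show "(LL x. cis (xi \<bullet> x) * cr (gau (d *\<^sub>R x))) = cr (2 * pi / d^2 * gau (xi /\<^sub>R d))"
  using d by (simp add: scaleR_conv_of_real field_simps)
qed

text \<open>The Fourier integral without normalisation. It is used in both directions: for
  amplitudes as inverse transform and, through \<open>ft_IF\<close>, as the transform
  itself.\<close>

definition IF :: "(real^2 => complex) => real^2 => complex" where
 "IF a x = (LL xi. cis (xi \<bullet> x) * a xi)"

lemma integrable_cis_mult:
 assumes "integrable lborel a" "f \<in> borel_measurable lborel"
 shows "integrable lborel (%xi. cis (f xi) * a xi)"
 by (rule Bochner_Integration.integrable_bound[OF assms(1)])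
  (use assms borel_measurable_integrable[OF assms(1)] in \<open>auto simp: norm_mult\<close>)

lemma IF_bound: "integrable lborel a ==> norm (IF a x) <= (LL xi. norm (a xi))"
 unfolding IF_def by (rule order_trans[OF integral_norm_bound]) (simp add: norm_mult)

lemma IF_meas[measurable]:
 assumes [measurable]: "a \<in> BB" "f \<in> borel_measurable M"
 shows "(%x. IF a (f x)) \<in> borel_measurable M"
proof (rule measurable_compose[OF assms(2)])
 have "(%x. (LL xi. cis (xi \<bullet> x) * a xi)) \<in> borel_measurable lborel"
  by (intro lborel.borel_measurable_lebesgue_integral) measurable
 then show "IF a \<in> BB" unfolding IF_def[abs_def] by simp
qed

lemma cnj_meas[measurable]: "f \<in> borel_measurable M ==> (%x. cnj (f x)) \<in> borel_measurable M"
 by (rule measurable_compose[OF _ borel_measurable_continuous_onI]) (auto intro!: continuous_intros)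

text \<open>The Gaussian makes the double integral absolutely convergent; by Fubini the inner
  integral is a Gaussian of width \<open>d\<close> about \<open>eta\<close>, of total mass
  \<open>(2 * pi)^2\<close>.\<close>

lemma gaussian_duality:
 assumes a: "integrable lborel a" and d: "0 < d"
 shows "(LL x. cis (- (eta \<bullet> x)) * cr (gau (d *\<^sub>R x)) * IF a x)
  = (LL xi. a xi * cr (2 * pi / d^2 * gau ((xi - eta) /\<^sub>R d)))"
proof -
 have [measurable]: "a \<in> BB" using a by auto
 define F where "F = (%x xi. cis (- (eta \<bullet> x)) * cr (gau (d *\<^sub>R x)) * (cis (xi \<bullet> x) * a xi))"
 have gi: "integrable lborel (%x. gau (d *\<^sub>R x))"
  using integrable_Re[OF gauss_scaled(1)[OF d, of 0]] by simp
 have g0: "0 <= gau x" for x by (simp add: gau_def)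
 have FI: "integrable (lborel \<Otimes>\<^sub>M lborel) (%(x,xi). F x xi)"
  unfolding F_def
 proof (rule lborel_pair.Fubini_integrable)
  show "integrable lborel (%x. (LL xi. norm (case (x, xi) of (x, xi) => cis (- (eta \<bullet> x)) * cr (gau (d *\<^sub>R x)) * (cis (xi \<bullet> x) * a xi))))"
   using gi by (simp add: norm_mult g0)
  show "AE x in lborel. integrable lborel (%xi. case (x, xi) of (x, xi) => cis (- (eta \<bullet> x)) * cr (gau (d *\<^sub>R x)) * (cis (xi \<bullet> x) * a xi))"
   using integrable_cis_mult[OF a] by auto
 qed measurable
 have "(LL x. cis (- (eta \<bullet> x)) * cr (gau (d *\<^sub>R x)) * IF a x) = (LL x. (LL xi. F x xi))"
  unfolding IF_def F_def by simp
 also have "... = (LL xi. (LL x. F x xi))" by (rule lborel_pair.Fubini_integral[OF FI, symmetric])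
 also have "... = (LL xi. a xi * cr (2 * pi / d^2 * gau ((xi - eta) /\<^sub>R d)))"
 proof (rule Bochner_Integration.integral_cong[OF refl])
  fix xi
  have "(LL x. F x xi) = (LL x. a xi * (cis ((xi - eta) \<bullet> x) * cr (gau (d *\<^sub>R x))))"
  proof (rule Bochner_Integration.integral_cong[OF refl])
   fix x
   have "cis ((xi - eta) \<bullet> x) = cis (xi \<bullet> x) * cis (- (eta \<bullet> x))" unfolding cis_mult by (simp add: inner_diff_left)
   then show "F x xi = a xi * (cis ((xi - eta) \<bullet> x) * cr (gau (d *\<^sub>R x)))" by (simp add: F_def mult_ac)
  qed
  also have "... = a xi * cr (2 * pi / d^2 * gau ((xi - eta) /\<^sub>R d))"
   using gauss_scaled(2)[OF d, of "xi - eta"] by simp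
  finally show "(LL x. F x xi) = a xi * cr (2 * pi / d^2 * gau ((xi - eta) /\<^sub>R d))" .
 qed
 finally show ?thesis .
qed

text \<open>Let \<open>d\<close> tend to 0 in \<open>gaussian_duality\<close>. The left side
  converges since \<open>IF a\<close> is integrable; the right side, rescaled about
  \<open>eta\<close>, since \<open>a\<close> is bounded and continuous at \<open>eta\<close>.
  Continuity is asked at one point only because the multipliers used later may jump at frequency
  0.\<close>

theorem IF_inversion:
 assumes a: "integrable lborel a" and b: "!!xi. norm (a xi) <= K" and c: "isCont a eta" and I: "integrable lborel (IF a)"
 shows "(LL x. cis (- (eta \<bullet> x)) * IF a x) = cr ((2 * pi)^2) * a eta"
proof -
 have [measurable]: "a \<in> BB" using a by auto
 let ?d = "%n. 1 / real (Suc n)"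
 have d: "0 < ?d n" for n by simp
 have dl: "?d ----> 0" using LIMSEQ_Suc[OF lim_1_over_n] by simp
 have gc: "isCont gau x" for x unfolding gau_def by (intro continuous_intros) auto
 have 1: "(%n. (LL x. cis (- (eta \<bullet> x)) * cr (gau (?d n *\<^sub>R x)) * IF a x)) ----> (LL x. cis (- (eta \<bullet> x)) * IF a x)"
 proof (rule integral_dominated_convergence[where w="%x. norm (IF a x)"])
  show "AE x in lborel. (%n. cis (- (eta \<bullet> x)) * cr (gau (?d n *\<^sub>R x)) * IF a x) ----> cis (- (eta \<bullet> x)) * IF a x"
  proof (rule AE_I2)
   fix x
   have "(%n. gau (?d n *\<^sub>R x)) ----> gau (0 *\<^sub>R x)"
    by (rule isCont_tendsto_compose[OF gc]) (intro tendsto_intros dl)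
   then have "(%n. cis (- (eta \<bullet> x)) * cr (gau (?d n *\<^sub>R x)) * IF a x) ----> cis (- (eta \<bullet> x)) * cr (gau (0 *\<^sub>R x)) * IF a x"
    by (intro tendsto_intros)
   then show "(%n. cis (- (eta \<bullet> x)) * cr (gau (?d n *\<^sub>R x)) * IF a x) ----> cis (- (eta \<bullet> x)) * IF a x" by (simp add: gau_def)
  qed
  show "AE x in lborel. norm (cis (- (eta \<bullet> x)) * cr (gau (?d n *\<^sub>R x)) * IF a x) <= norm (IF a x)" for n
   by (rule AE_I2) (simp add: norm_mult gau_def mult_left_le_one_le)
 qed (use I in auto)
 have 2: "(%n. (LL ze. a (eta + ?d n *\<^sub>R ze) * cr (2 * pi * gau ze))) ----> (LL ze. a eta * cr (2 * pi * gau ze))"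
 proof (rule integral_dominated_convergence[where w="%ze. K * (2 * pi * gau ze)"])
  show "AE ze in lborel. (%n. a (eta + ?d n *\<^sub>R ze) * cr (2 * pi * gau ze)) ----> a eta * cr (2 * pi * gau ze)"
  proof (rule AE_I2)
   fix ze
   have "(%n. eta + ?d n *\<^sub>R ze) ----> eta + 0 *\<^sub>R ze" by (intro tendsto_intros dl)
   then have "(%n. eta + ?d n *\<^sub>R ze) ----> eta" by simp
   from isCont_tendsto_compose[OF c this]
   show "(%n. a (eta + ?d n *\<^sub>R ze) * cr (2 * pi * gau ze)) ----> a eta * cr (2 * pi * gau ze)" by (intro tendsto_intros)
  qed
  show "AE ze in lborel. norm (a (eta + ?d n *\<^sub>R ze) * cr (2 * pi * gau ze)) <= K * (2 * pi * gau ze)" for n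
  proof (rule AE_I2)
   fix ze
   have "norm (cr (2 * pi * gau ze)) = 2 * pi * gau ze" unfolding norm_of_real by (simp add: gau_def)
   then show "norm (a (eta + ?d n *\<^sub>R ze) * cr (2 * pi * gau ze)) <= K * (2 * pi * gau ze)"
    unfolding norm_mult by (simp only:) (intro mult_right_mono b, simp add: gau_def)
  qed
 qed (use gau_integrable in auto)
 have 3: "(LL ze. a eta * cr (2 * pi * gau ze)) = cr ((2 * pi)^2) * a eta"
 proof -
  have "(LL ze. cr (2 * pi * gau ze)) = cr (2 * pi * (2 * pi))"
   unfolding integral_complex_of_real using gau_integrable by simp
  then show ?thesis by (simp add: power2_eq_square)
 qed
 have 4: "(LL x. cis (- (eta \<bullet> x)) * cr (gau (?d n *\<^sub>R x)) * IF a x) = (LL ze. a (eta + ?d n *\<^sub>R ze) * cr (2 * pi * gau ze))" for n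
 proof -
  have "(LL x. cis (- (eta \<bullet> x)) * cr (gau (?d n *\<^sub>R x)) * IF a x) = (LL xi. a xi * cr (2 * pi / (?d n)^2 * gau ((xi - eta) /\<^sub>R ?d n)))"
   by (rule gaussian_duality[OF a d])
  also have "... = (LL ze. (?d n)^2 *\<^sub>R (a (eta + ?d n *\<^sub>R ze) * cr (2 * pi / (?d n)^2 * gau ((eta + ?d n *\<^sub>R ze - eta) /\<^sub>R ?d n))))"
   by (rule lborel2_affine(1)[OF _ d]) measurable
  also have "... = (LL ze. a (eta + ?d n *\<^sub>R ze) * cr (2 * pi * gau ze))"
  proof (rule Bochner_Integration.integral_cong[OF refl])
   fix ze :: "real^2"
   have "(eta + ?d n *\<^sub>R ze - eta) /\<^sub>R ?d n = ze" using d[of n] by simp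
   then show "(?d n)^2 *\<^sub>R (a (eta + ?d n *\<^sub>R ze) * cr (2 * pi / (?d n)^2 * gau ((eta + ?d n *\<^sub>R ze - eta) /\<^sub>R ?d n))) = a (eta + ?d n *\<^sub>R ze) * cr (2 * pi * gau ze)"
   proof -
    have "cr (2 * pi / e^2 * g) = cr (2 * pi * g) / cr (e^2)" for e g by simp
    then show ?thesis using d[of n] \<open>_ /\<^sub>R ?d n = ze\<close> by (simp add: scaleR_conv_of_real del: of_nat_Suc of_real_mult of_real_divide)
   qed
  qed
  finally show ?thesis .
 qed
 show ?thesis using LIMSEQ_unique[OF 1] 2 unfolding 4 3 by blast
qed

text \<open>Valid also without integrability, since the Bochner integral is then 0 by
  convention.\<close>

lemma norm_integral_le_nn_integral:
 fixes f :: "'a => 'b::{banach, second_countable_topology}"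
 shows "EE (norm (integral\<^sup>L M f)) <= (\<integral>\<^sup>+x. EE (norm (f x)) \<partial>M)"
 using integral_norm_bound_ennreal[of M f] by (cases "integrable M f") (auto simp: not_integrable_integral_eq)

text \<open>Only the upper bound is needed, so \<open>a\<close> may be rough. With a Gaussian
  inserted, \<open>gaussian_duality\<close> turns the square into a quadratic form of
  \<open>a\<close> with a symmetric positive kernel \<open>G\<close> of mass
  \<open>(2 * pi)^2\<close>; Fatou then removes the Gaussian.\<close>

theorem IF_plancherel:
 assumes a: "integrable lborel a" and A: "(NN xi. EE ((norm (a xi))^2)) <= EE A" "0 <= A"
 shows "(NN x. EE ((norm (IF a x))^2)) <= EE ((2 * pi)^2 * A)"
proof -
 have [measurable]: "a \<in> BB" using a by auto
 have g0: "0 <= gau x" for x by (simp add: gau_def)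
 define M where "M = (LL xi. norm (a xi))"
 have M: "norm (IF a x) <= M" for x unfolding M_def by (rule IF_bound[OF a])
 have key: "(NN x. EE (gau (d *\<^sub>R x) * (norm (IF a x))^2)) <= EE ((2 * pi)^2 * A)" if d: "0 < d" for d
 proof -
  define G where "G = (%xi eta. 2 * pi / d^2 * gau ((xi - eta) /\<^sub>R d))"
  have G0: "0 <= G xi eta" for xi eta using g0 by (simp add: G_def)
  have Gsym: "G xi eta = G eta xi" for xi eta by (simp add: G_def gau_def norm_minus_commute)
  have [measurable]: "(%z. G $$ z) \<in> borel_measurable (borel \<Otimes>\<^sub>M borel)" unfolding G_def by measurable
  have mG: "(%eta. G xi eta) \<in> BB" "(%xi. G xi eta) \<in> BB" for xi eta unfolding G_def by measurable
  note [measurable] = mG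
  have GI: "(NN xi. EE (G xi eta)) = EE ((2 * pi)^2)" for eta
  proof -
   have f: "(%xi. G xi eta) \<in> BB" by measurable
   have e: "d^2 *\<^sub>R G (eta + d *\<^sub>R x) eta = 2 * pi * gau x" for x using d by (simp add: G_def)
   have "integrable lborel (%xi. G xi eta)" unfolding lborel2_affine(2)[OF f d, of eta] e using gau_integrable by simp
   moreover have "(LL xi. G xi eta) = (2 * pi)^2"
    unfolding lborel2_affine(1)[OF f d, of eta] e using gau_integrable by (simp add: power2_eq_square)
   ultimately show ?thesis using G0 by (simp add: nn_integral_eq_integral)
  qed
  have gi: "integrable lborel (%x. gau (d *\<^sub>R x))"
   using integrable_Re[OF gauss_scaled(1)[OF d, of 0]] by simp
  define F where "F = (%x eta. cnj (a eta) * (cis (- (eta \<bullet> x)) * cr (gau (d *\<^sub>R x)) * IF a x))"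
  have FI: "integrable (lborel \<Otimes>\<^sub>M lborel) (%(x,eta). F x eta)"
   unfolding F_def
  proof (rule lborel_pair.Fubini_integrable)
   have "integrable lborel (%x. gau (d *\<^sub>R x) * norm (IF a x) * M)"
    by (rule Bochner_Integration.integrable_bound[OF integrable_mult_left[OF gi, of "M * M"]])
     (use M g0 order_trans[OF norm_ge_zero M] in \<open>auto simp: abs_mult mult.assoc intro!: mult_left_mono mult_right_mono\<close>)
   then show "integrable lborel (%x. (LL eta. norm (case (x, eta) of (x, eta) => cnj (a eta) * (cis (- (eta \<bullet> x)) * cr (gau (d *\<^sub>R x)) * IF a x))))"
    by (simp add: norm_mult g0 M_def mult_ac)
   show "AE x in lborel. integrable lborel (%eta. case (x, eta) of (x, eta) => cnj (a eta) * (cis (- (eta \<bullet> x)) * cr (gau (d *\<^sub>R x)) * IF a x))"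
   proof (rule AE_I2)
    fix x
    have "integrable lborel (%eta. cis (- (eta \<bullet> x)) * cnj (a eta))"
     by (rule integrable_cis_mult) (use a in auto)
    from integrable_mult_left[OF this, of "cr (gau (d *\<^sub>R x)) * IF a x"]
    show "integrable lborel (%eta. case (x, eta) of (x, eta) => cnj (a eta) * (cis (- (eta \<bullet> x)) * cr (gau (d *\<^sub>R x)) * IF a x))"
     by (simp add: mult_ac)
   qed
  qed measurable
  have cnjIF: "cnj (IF a x) = (LL eta. cnj (a eta) * cis (- (eta \<bullet> x)))" for x
   unfolding IF_def Bochner_Integration.integral_cnj[symmetric] by (simp add: cis_cnj mult.commute)
  have igi: "integrable lborel (%x. gau (d *\<^sub>R x) * (norm (IF a x))^2)"
   by (rule Bochner_Integration.integrable_bound[OF integrable_mult_left[OF gi, of "M^2"]])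
    (use M g0 in \<open>auto simp: abs_mult intro!: mult_left_mono power_mono\<close>)
  have "cr (LL x. gau (d *\<^sub>R x) * (norm (IF a x))^2) = (LL x. cr (gau (d *\<^sub>R x) * (norm (IF a x))^2))"
   by (rule integral_complex_of_real[symmetric])
  also have "... = (LL x. (LL eta. F x eta))"
  proof (rule Bochner_Integration.integral_cong[OF refl])
   fix x
   have "(LL eta. F x eta) = (LL eta. cnj (a eta) * cis (- (eta \<bullet> x)) * (cr (gau (d *\<^sub>R x)) * IF a x))"
    by (simp add: F_def mult_ac)
   also have "... = cnj (IF a x) * (cr (gau (d *\<^sub>R x)) * IF a x)" unfolding cnjIF by simp
   also have "... = cr (gau (d *\<^sub>R x) * (norm (IF a x))^2)"
    using complex_norm_square[of "IF a x"] by (simp add: mult_ac)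
   finally show "cr (gau (d *\<^sub>R x) * (norm (IF a x))^2) = (LL eta. F x eta)" by simp
  qed
  also have "... = (LL eta. (LL x. F x eta))" by (rule lborel_pair.Fubini_integral[OF FI, symmetric])
  also have "... = (LL eta. cnj (a eta) * (LL xi. a xi * cr (G xi eta)))"
   unfolding F_def G_def using gaussian_duality[OF a d] by simp
  finally have e1: "cr (LL x. gau (d *\<^sub>R x) * (norm (IF a x))^2) = (LL eta. cnj (a eta) * (LL xi. a xi * cr (G xi eta)))" .
  have "EE (LL x. gau (d *\<^sub>R x) * (norm (IF a x))^2) <= EE (norm (LL eta. cnj (a eta) * (LL xi. a xi * cr (G xi eta))))"
   unfolding e1[symmetric] norm_of_real by (intro ennreal_leI) simp
  also have "... <= (NN eta. EE (norm (cnj (a eta) * (LL xi. a xi * cr (G xi eta)))))"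
   by (rule norm_integral_le_nn_integral)
  also have "... <= (NN eta. (NN xi. EE (norm (a eta) * norm (a xi) * G xi eta)))"
  proof (rule nn_integral_mono)
   fix eta
   have "EE (norm (LL xi. a xi * cr (G xi eta))) <= (NN xi. EE (norm (a xi * cr (G xi eta))))"
    by (rule norm_integral_le_nn_integral)
   then have "EE (norm (a eta)) * EE (norm (LL xi. a xi * cr (G xi eta))) <= EE (norm (a eta)) * (NN xi. EE (norm (a xi * cr (G xi eta))))"
    by (rule mult_left_mono) simp
   also have "... = (NN xi. EE (norm (a eta) * norm (a xi) * G xi eta))"
    by (subst nn_integral_cmult[symmetric], measurable) (intro nn_integral_cong, simp add: norm_mult G0 ennreal_mult mult.assoc)
   finally show "EE (norm (cnj (a eta) * (LL xi. a xi * cr (G xi eta)))) <= (NN xi. EE (norm (a eta) * norm (a xi) * G xi eta))"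
    by (simp add: norm_mult ennreal_mult)
  qed
  \<comment> \<open>Schur's test for a symmetric kernel: the arithmetic-geometric inequality under
    the double integral gives two equal halves.\<close>
  also have "... <= (NN eta. (NN xi. EE ((norm (a eta))^2 / 2) * EE (G xi eta) + EE ((norm (a xi))^2 / 2) * EE (G xi eta)))"
  proof (intro nn_integral_mono)
   fix eta xi
   have "norm (a eta) * norm (a xi) <= (norm (a eta))^2 / 2 + (norm (a xi))^2 / 2"
    using zero_le_power2[of "norm (a eta) - norm (a xi)"] by (simp add: power2_diff)
   then have "norm (a eta) * norm (a xi) * G xi eta <= (norm (a eta))^2 / 2 * G xi eta + (norm (a xi))^2 / 2 * G xi eta"
    unfolding distrib_right[symmetric] by (intro mult_right_mono G0)
   then show "EE (norm (a eta) * norm (a xi) * G xi eta) <= EE ((norm (a eta))^2 / 2) * EE (G xi eta) + EE ((norm (a xi))^2 / 2) * EE (G xi eta)"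
    using G0 by (simp only: ennreal_mult[symmetric] ennreal_plus[symmetric] zero_le_power2 divide_nonneg_nonneg mult_nonneg_nonneg zero_le_numeral ennreal_leI)
  qed
  also have "... = (NN eta. (NN xi. EE ((norm (a eta))^2 / 2) * EE (G xi eta))) + (NN eta. (NN xi. EE ((norm (a xi))^2 / 2) * EE (G xi eta)))"
   unfolding G_def by (subst nn_integral_add[symmetric]) (auto intro!: nn_integral_cong nn_integral_add)
  also have "(NN eta. (NN xi. EE ((norm (a xi))^2 / 2) * EE (G xi eta))) = (NN xi. (NN eta. EE ((norm (a xi))^2 / 2) * EE (G xi eta)))"
   unfolding G_def by (rule lborel_pair.Fubini') measurable
  also have "... = (NN eta. (NN xi. EE ((norm (a eta))^2 / 2) * EE (G xi eta)))"
   by (intro nn_integral_cong arg_cong2[where f="(*)"] refl arg_cong[where f=ennreal] Gsym)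
  also have "(NN eta. (NN xi. EE ((norm (a eta))^2 / 2) * EE (G xi eta))) = (NN eta. EE ((norm (a eta))^2 / 2) * EE ((2 * pi)^2))"
   by (intro nn_integral_cong) (simp add: nn_integral_cmult GI)
  also have "(NN eta. EE ((norm (a eta))^2 / 2) * EE ((2 * pi)^2)) + (NN eta. EE ((norm (a eta))^2 / 2) * EE ((2 * pi)^2))
   = (NN eta. EE ((norm (a eta))^2) * EE ((2 * pi)^2))"
   by (subst nn_integral_add[symmetric], measurable) (intro nn_integral_cong, simp add: distrib_right[symmetric] ennreal_plus[symmetric] del: ennreal_plus)
  also have "... = (NN eta. EE ((norm (a eta))^2)) * EE ((2 * pi)^2)" by (rule nn_integral_multc) measurable
  also have "... <= EE A * EE ((2 * pi)^2)" by (intro mult_right_mono A) auto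
  also have "... = EE ((2 * pi)^2 * A)" using A by (simp add: ennreal_mult mult.commute)
  finally have "EE (LL x. gau (d *\<^sub>R x) * (norm (IF a x))^2) <= EE ((2 * pi)^2 * A)" .
  then show ?thesis using igi g0 by (simp add: nn_integral_eq_integral)
 qed
 let ?d = "%n. 1 / real (Suc n)"
 have dl: "?d ----> 0" using LIMSEQ_Suc[OF lim_1_over_n] by simp
 have gc: "isCont gau x" for x unfolding gau_def by (intro continuous_intros) auto
 show ?thesis
 proof (rule nn_integral_le_of_tendsto[where f="%n x. EE (gau (?d n *\<^sub>R x) * (norm (IF a x))^2)"])
  fix x
  have "(%n. gau (?d n *\<^sub>R x)) ----> gau (0 *\<^sub>R x)"
   by (rule isCont_tendsto_compose[OF gc]) (intro tendsto_intros dl)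
  then have "(%n. gau (?d n *\<^sub>R x) * (norm (IF a x))^2) ----> gau (0 *\<^sub>R x) * (norm (IF a x))^2" by (intro tendsto_intros)
  then show "(%n. EE (gau (?d n *\<^sub>R x) * (norm (IF a x))^2)) ----> EE ((norm (IF a x))^2)"
   by (intro tendsto_ennrealI) (simp add: gau_def)
  show "eventually (%n. (NN x. EE (gau (?d n *\<^sub>R x) * (norm (IF a x))^2)) <= (%_. EE ((2 * pi)^2 * A)) n) sequentially"
   by (rule always_eventually) (use key in simp)
 qed auto
qed

section \<open>Sobolev embedding through superlevel sets, and Hoelder's inequality\<close>

lemma nn_integral_powr_Ioo:
 fixes k M :: real assumes k: "0 < k" and M: "0 <= M"
 shows "(NN s. EE (k * s powr (k - 1)) * ind {0<..<M} s) = EE (M powr k)"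
proof -
 have "((%s. s powr (k - 1)) has_integral (M powr (k - 1 + 1) / (k - 1 + 1))) {0..M}"
  by (rule has_integral_powr_from_0) (use k M in auto)
 from has_integral_mult_right[OF this, of k] have h: "((%s. k * s powr (k - 1)) has_integral M powr k) {0..M}" using k by simp
 have e: "(%s. ind {0..M} s *\<^sub>R (k * s powr (k - 1))) = (%s. if s \<in> {0..M} then k * s powr (k - 1) else 0)" by (auto simp: indicator_def)
 have "((%s. ind {0..M} s *\<^sub>R (k * s powr (k - 1))) has_integral M powr k) UNIV"
  unfolding e has_integral_restrict_UNIV by (rule h)
 from nn_integral_has_integral_lborel[OF _ _ this]
 have "(NN s. EE (ind {0..M} s *\<^sub>R (k * s powr (k - 1)))) = EE (M powr k)" using k by simp
 moreover have "(NN s. EE (k * s powr (k - 1)) * ind {0<..<M} s) = (NN s. EE (ind {0..M} s *\<^sub>R (k * s powr (k - 1))))"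
 proof (rule nn_integral_cong_AE)
  show "AE s in lborel. EE (k * s powr (k - 1)) * ind {0<..<M} s = EE (ind {0..M} s *\<^sub>R (k * s powr (k - 1)))"
   using AE_lborel_singleton[of "0::real"] AE_lborel_singleton[of M] by eventually_elim (auto simp: indicator_def)
 qed
 ultimately show ?thesis by simp
qed

text \<open>Cauchy-Schwarz against the power \<open>- sg\<close> of the frequency, which is square
  integrable on balls of the plane for \<open>sg < 1\<close>.\<close>

lemma integral_norm_low_frequencies:
 fixes a :: "real^2 => complex"
 assumes a: "integrable lborel a" and sg: "0 <= sg" "sg < 1" and A: "0 < A" and l: "0 < l"
  and H: "(NN xi. EE (norm xi powr (2 * sg) * (cmod (a xi))^2)) <= EE A"
 shows "(NN xi. EE (cmod (a xi)) * ind {xi. norm xi <= l} xi) <= EE (2 / (1 - sg) * l powr (1 - sg) * sqrt A)"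
proof -
 have [measurable]: "a \<in> BB" using a by auto
 define f g where "f = (%xi::real^2. norm xi powr (- sg) * ind {xi. norm xi <= l} xi)" and "g = (%xi. norm xi powr sg * cmod (a xi))"
 have [measurable]: "f \<in> BB" "g \<in> BB" unfolding f_def g_def by measurable
 have e: "(norm xi powr r)^2 = norm xi powr (2 * r)" for xi :: "real^2" and r
  by (simp add: powr_powr power2_eq_square powr_add[symmetric])
 have "(NN xi. EE ((f xi)^2)) = (NN xi. EE (norm xi powr (- 2 * sg)) * ind {xi. norm xi <= l} (xi::real^2))"
  by (intro nn_integral_cong) (auto simp: f_def indicator_def power_mult_distrib e)
 also have "... <= EE ((2 / (1 - sg))^2 * l powr (2 - 2 * sg))" by (rule nn_integral_norm_powr_ball) (use sg l in auto)
 also have "(2 / (1 - sg))^2 * l powr (2 - 2 * sg) = (2 / (1 - sg) * l powr (1 - sg))^2"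
  by (simp add: power_divide power_mult_distrib power2_eq_square[of "l powr _"] powr_add[symmetric])
 finally have 1: "(NN xi. EE ((f xi)^2)) <= EE ((2 / (1 - sg) * l powr (1 - sg))^2)" .
 have 2: "(NN xi. EE ((g xi)^2)) <= EE A" using H by (simp add: g_def power_mult_distrib e)
 have "(NN xi. EE (cmod (a xi)) * ind {xi. norm xi <= l} xi) = (NN xi. EE (f xi * g xi))"
 proof (rule nn_integral_cong_AE)
  show "AE xi in lborel. EE (cmod (a xi)) * ind {xi. norm xi <= l} xi = EE (f xi * g xi)"
   using AE_lborel_singleton[of "0::real^2"]
   by eventually_elim (auto simp: f_def g_def indicator_def mult.assoc[symmetric] powr_add[symmetric])
 qed
 also have "... <= EE (sqrt ((2 / (1 - sg) * l powr (1 - sg))^2) * sqrt A)"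
  by (rule nn_integral_cauchy[OF _ _ _ _ 1 2]) (use sg l A in \<open>auto simp: f_def g_def\<close>)
 also have "sqrt ((2 / (1 - sg) * l powr (1 - sg))^2) = 2 / (1 - sg) * l powr (1 - sg)" using sg by (simp add: real_sqrt_mult)
 finally show ?thesis .
qed

lemma integrable_restrict:
 fixes a :: "'a => 'b::{banach, second_countable_topology}"
 assumes a: "integrable M a" and [measurable]: "Measurable.pred M P"
 shows "integrable M (%x. if P x then a x else 0)"
 by (rule Bochner_Integration.integrable_bound[OF a]) (use borel_measurable_integrable[OF a] in auto)

lemma IF_add: "integrable lborel a ==> integrable lborel b ==> IF (%xi. a xi + b xi) x = IF a x + IF b x"
 unfolding IF_def distrib_left by (intro Bochner_Integration.integral_add integrable_cis_mult) auto

text \<open>Chebyshev for the high frequencies, at a threshold where the low frequencies contribute at most \<open>mu / 2\<close>.\<close>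
lemma IF_superlevel:
 assumes a: "integrable lborel a" and sg: "0 <= sg" "sg < 1" and A: "0 < A" and mu: "0 < mu"
  and H: "(NN xi. EE (norm xi powr (2 * sg) * (cmod (a xi))^2)) <= EE A"
 defines "c \<equiv> 4 * sqrt A / (1 - sg)"
 shows "(NN x. ind {x. mu < cmod (IF a x)} x) <= EE (4 * (2 * pi)^2 / mu^2) * (NN xi. EE ((cmod (a xi))^2) * ind {xi. mu < c * norm xi powr (1 - sg)} xi)"
proof -
 have [measurable]: "a \<in> BB" using a by auto
 define l where "l = (mu / c) powr (1 / (1 - sg))"
 have c: "0 < c" and l: "0 < l" using A sg mu by (auto simp: c_def l_def)
 have lp: "l powr (1 - sg) = mu / c" using mu c sg by (simp add: l_def powr_powr)
 let ?P = "%xi::real^2. mu < c * norm xi powr (1 - sg)"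
 have lowl: "norm xi <= l" if "\<not> ?P xi" for xi
 proof (rule ccontr)
  assume "\<not> norm xi <= l"
  then have "l powr (1 - sg) < norm xi powr (1 - sg)" using l sg by (intro powr_less_mono2) auto
  then show False using that c unfolding lp by (simp add: field_simps)
 qed
 define b1 b2 where "b1 = (%xi. if \<not> ?P xi then a xi else 0)" and "b2 = (%xi. if ?P xi then a xi else 0)"
 have bi: "integrable lborel b1" "integrable lborel b2" unfolding b1_def b2_def by (intro integrable_restrict a, measurable)+
 have s: "IF a x = IF b1 x + IF b2 x" for x
  unfolding IF_add[OF bi, symmetric] by (rule arg_cong[where f="%a. IF a x"]) (auto simp: b1_def b2_def)
 have low: "cmod (IF b1 x) <= mu / 2" for x
 proof -
  have "EE (cmod (IF b1 x)) <= (NN xi. EE (norm (cis (xi \<bullet> x) * b1 xi)))"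
   unfolding IF_def by (rule norm_integral_le_nn_integral)
  also have "... <= (NN xi. EE (cmod (a xi)) * ind {xi. norm xi <= l} xi)"
   by (intro nn_integral_mono) (use lowl in \<open>auto simp: b1_def norm_mult indicator_def not_less\<close>)
  also have "... <= EE (2 / (1 - sg) * l powr (1 - sg) * sqrt A)"
   by (rule integral_norm_low_frequencies[OF a sg A l H])
  also have "2 / (1 - sg) * l powr (1 - sg) * sqrt A = mu / 2" unfolding lp c_def using A sg by (simp add: field_simps)
  finally show ?thesis using mu by simp
 qed
 let ?R = "(NN xi. EE ((cmod (a xi))^2) * ind {xi. ?P xi} xi)"
 have Rb: "?R = (NN xi. EE ((cmod (b2 xi))^2))" by (intro nn_integral_cong) (auto simp: b2_def indicator_def)
 show ?thesis
 proof (cases ?R)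
  case (real r)
  have "(NN x. ind {x. mu < cmod (IF a x)} x) <= (NN x. EE (4 / mu^2) * EE ((cmod (IF b2 x))^2))"
  proof (intro nn_integral_mono)
   fix x
   show "ind {x. mu < cmod (IF a x)} x <= EE (4 / mu^2) * EE ((cmod (IF b2 x))^2)"
   proof (cases "mu < cmod (IF a x)")
    case True
    have "mu / 2 <= cmod (IF b2 x)" using True low[of x] norm_triangle_ineq[of "IF b1 x" "IF b2 x"] unfolding s by linarith
    then have "(mu / 2)^2 <= (cmod (IF b2 x))^2" using mu by (intro power_mono) auto
    then have "1 <= 4 / mu^2 * (cmod (IF b2 x))^2" using mu by (simp add: field_simps)
    then show ?thesis using True by (simp add: ennreal_mult[symmetric])
   qed simp
  qed
  also have "... = EE (4 / mu^2) * (NN x. EE ((cmod (IF b2 x))^2))" unfolding b2_def by (rule nn_integral_cmult) measurable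
  also have "... <= EE (4 / mu^2) * EE ((2 * pi)^2 * r)"
   by (intro mult_left_mono IF_plancherel bi) (use real Rb in auto)
  also have "... = EE (4 * (2 * pi)^2 / mu^2) * ?R" unfolding real(2) using real(1) mu by (simp add: ennreal_mult[symmetric] field_simps)
  finally show ?thesis .
 next
  case top
  then show ?thesis using mu by (simp add: ennreal_mult_top)
 qed
qed

text \<open>Integrate the superlevel bound over all heights \<open>mu\<close> and exchange the
  integrals. For fixed \<open>xi\<close> the heights run up to a multiple of
  \<open>norm xi powr (1 - sg)\<close>, and \<open>(1 - sg) * (q - 2) = 2 * sg\<close> restores the
  homogeneous norm. Convergence at small heights uses \<open>q > 2\<close>, that is
  \<open>0 < sg\<close>.\<close>

lemma sobolev_pos:
 assumes sg: "0 < sg" "sg < 1"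
 obtains C where "0 < C" "!!a A. integrable lborel a ==> 0 < A ==> (NN xi. EE (norm xi powr (2 * sg) * (cmod (a xi))^2)) <= EE A ==>
  (NN x. EE (cmod (IF a x) powr (2 / (1 - sg)))) <= EE ((C * sqrt A) powr (2 / (1 - sg)))"
proof -
 define q where "q = 2 / (1 - sg)"
 have q: "2 < q" using sg by (simp add: q_def field_simps)
 define M where "M = q * 4 * (2 * pi)^2 / (q - 2) * (4 / (1 - sg)) powr (q - 2)"
 have M: "0 < M" using q sg by (simp add: M_def)
 have "(NN x. EE (cmod (IF a x) powr q)) <= EE ((M powr (1/q) * sqrt A) powr q)"
  if a: "integrable lborel a" and A: "0 < A" and H: "(NN xi. EE (norm xi powr (2 * sg) * (cmod (a xi))^2)) <= EE A" for a A
 proof -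
  have [measurable]: "a \<in> BB" using a by auto
  define c where "c = 4 * sqrt A / (1 - sg)"
  have c: "0 < c" using A sg by (simp add: c_def)
  let ?I = "%x mu. EE (q * mu powr (q - 1)) * ind {z. 0 < snd z & snd z < cmod (IF a (fst z))} (x, mu)"
  let ?J = "%xi mu. EE ((cmod (a xi))^2 * (q * 4 * (2 * pi)^2) * mu powr (q - 3)) * ind {z. 0 < snd z & snd z < c * norm (fst z) powr (1 - sg)} (xi, mu)"
  have "{z \<in> space (borel \<Otimes>\<^sub>M borel). 0 < snd z & snd z < cmod (IF a (fst z))} \<in> sets (borel \<Otimes>\<^sub>M borel)" "{z \<in> space (borel \<Otimes>\<^sub>M borel). 0 < snd z & snd z < c * norm (fst z :: real^2) powr (1 - sg)} \<in> sets (borel \<Otimes>\<^sub>M borel)"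
   by measurable
  note [measurable] = this[unfolded space_pair_measure space_borel UNIV_Times_UNIV, simplified]
  have "(NN x. EE (cmod (IF a x) powr q)) = (NN x. (NN mu. ?I x mu))"
   by (intro nn_integral_cong, subst nn_integral_powr_Ioo[symmetric]) (use q in \<open>auto intro!: nn_integral_cong simp: indicator_def\<close>)
  also have "... = (NN mu. (NN x. ?I x mu))" by (rule lborel_pair.Fubini') measurable
  also have "... <= (NN mu. (NN xi. ?J xi mu))"
  proof (rule nn_integral_mono)
   fix mu :: real
   show "(NN x. ?I x mu) <= (NN xi. ?J xi mu)"
   proof (cases "0 < mu")
    case True
    have "(NN x. ?I x mu) = (NN x. EE (q * mu powr (q - 1)) * ind {x. mu < cmod (IF a x)} x)"
     using True by (intro nn_integral_cong) (auto simp: indicator_def)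
    also have "... = EE (q * mu powr (q - 1)) * (NN x. ind {x. mu < cmod (IF a x)} x)" by (rule nn_integral_cmult) measurable
    also have "... <= EE (q * mu powr (q - 1)) * (EE (4 * (2 * pi)^2 / mu^2) * (NN xi. EE ((cmod (a xi))^2) * ind {xi. mu < c * norm xi powr (1 - sg)} xi))"
     unfolding c_def by (intro mult_left_mono IF_superlevel[OF a _ _ A True H]) (use sg in auto)
    also have "... = (NN xi. EE (q * mu powr (q - 1) * (4 * (2 * pi)^2 / mu^2)) * (EE ((cmod (a xi))^2) * ind {xi. mu < c * norm xi powr (1 - sg)} xi))"
     by (subst nn_integral_cmult, measurable) (subst ennreal_mult[of "q * mu powr (q - 1)"], use q in \<open>simp_all only: mult.assoc\<close>, simp_all)
    also have "... = (NN xi. ?J xi mu)"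
    proof -
     have pw: "mu powr (q - 1) / mu^2 = mu powr (q - 3)" using True powr_diff[of mu "q - 1" 2] by (simp add: powr_numeral)
     have "q * mu powr (q - 1) * (4 * (2 * pi)^2 / mu^2) * (cmod (a xi))^2 = (cmod (a xi))^2 * (q * 4 * (2 * pi)^2) * mu powr (q - 3)" for xi
      unfolding pw[symmetric] by simp
     then show ?thesis
      using True q by (intro nn_integral_cong) (auto simp: indicator_def ennreal_mult''[symmetric])
    qed
    finally show ?thesis .
   qed simp
  qed
  also have "... = (NN xi. (NN mu. ?J xi mu))" by (rule lborel_pair.Fubini'[symmetric]) measurable
  also have "... = (NN xi. EE (M * A powr ((q - 2)/2)) * EE (norm xi powr (2 * sg) * (cmod (a xi))^2))"
  proof (intro nn_integral_cong)
   fix xi :: "real^2"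
   have "(NN mu. ?J xi mu) = (NN mu. EE ((cmod (a xi))^2 * (q * 4 * (2 * pi)^2) / (q - 2)) * (EE ((q - 2) * mu powr (q - 2 - 1)) * ind {0<..<c * norm xi powr (1 - sg)} mu))"
    using q by (intro nn_integral_cong) (auto simp: indicator_def ennreal_mult''[symmetric])
   also have "... = EE ((cmod (a xi))^2 * (q * 4 * (2 * pi)^2) / (q - 2)) * EE ((c * norm xi powr (1 - sg)) powr (q - 2))"
    using q c by (subst nn_integral_cmult, measurable) (subst nn_integral_powr_Ioo, auto)
   also have "(c * norm xi powr (1 - sg)) powr (q - 2) = (4 / (1 - sg)) powr (q - 2) * A powr ((q - 2)/2) * norm xi powr (2 * sg)"
   proof -
    have "(1 - sg) * (q - 2) = 2 * sg" using sg by (simp add: q_def field_simps)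
    moreover have "sqrt A powr (q - 2) = A powr ((q - 2)/2)" using A by (simp add: powr_half_sqrt[symmetric] powr_powr)
    moreover have "c = 4 / (1 - sg) * sqrt A" by (simp add: c_def)
    moreover have "(4 / (1 - sg) * sqrt A * norm xi powr (1 - sg)) powr (q - 2) = (4 / (1 - sg)) powr (q - 2) * sqrt A powr (q - 2) * norm xi powr ((1 - sg) * (q - 2))"
     using powr_mult[of "4 / (1 - sg) * sqrt A" "norm xi powr (1 - sg)" "q - 2"] powr_mult[of "4 / (1 - sg)" "sqrt A" "q - 2"] sg A by (simp add: powr_powr)
    ultimately show ?thesis by simp
   qed
   also have "EE ((cmod (a xi))^2 * (q * 4 * (2 * pi)^2) / (q - 2)) * EE ((4 / (1 - sg)) powr (q - 2) * A powr ((q - 2)/2) * norm xi powr (2 * sg)) = EE (M * A powr ((q - 2)/2)) * EE (norm xi powr (2 * sg) * (cmod (a xi))^2)"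
    using q M by (subst (1 2) ennreal_mult[symmetric]) (auto simp: M_def mult_ac)
   finally show "(NN mu. ?J xi mu) = EE (M * A powr ((q - 2)/2)) * EE (norm xi powr (2 * sg) * (cmod (a xi))^2)" .
  qed
  also have "... = EE (M * A powr ((q - 2)/2)) * (NN xi. EE (norm xi powr (2 * sg) * (cmod (a xi))^2))" by (rule nn_integral_cmult) measurable
  also have "... <= EE (M * A powr ((q - 2)/2)) * EE A" by (intro mult_left_mono H) auto
  also have "... = EE (M * (A powr ((q - 2)/2) * A powr 1))" using M A by (simp add: ennreal_mult[symmetric] mult.assoc)
  also have "M * (A powr ((q - 2)/2) * A powr 1) = (M powr (1/q) * sqrt A) powr q"
   using M A q unfolding powr_add[symmetric] by (simp add: powr_mult powr_powr powr_half_sqrt[symmetric] diff_divide_distrib)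
  finally show ?thesis .
 qed
 then show thesis using that[of "M powr (1/q)"] M unfolding q_def by auto
qed

lemma sobolev:
 assumes sg: "0 <= sg" "sg < 1"
 obtains C where "0 < C" "!!a A. integrable lborel a ==> 0 < A ==> (NN xi. EE (norm xi powr (2 * sg) * (cmod (a xi))^2)) <= EE A ==>
  (NN x. EE (cmod (IF a x) powr (2 / (1 - sg)))) <= EE ((C * sqrt A) powr (2 / (1 - sg)))"
proof (cases "sg = 0")
 case True
 have "(NN x. EE (cmod (IF a x) powr 2)) <= EE ((2 * pi * sqrt A) powr 2)"
  if a: "integrable lborel a" and A: "0 < A" and H: "(NN xi. EE (norm xi powr 0 * (cmod (a xi))^2)) <= EE A" for a A
 proof -
  have "(NN xi. EE ((cmod (a xi))^2)) = (NN xi. EE (norm xi powr 0 * (cmod (a xi))^2))"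
  \<comment> \<open>\<open>0 powr 0\<close> is 0, so the two integrands differ at the origin and
    agree only almost everywhere.\<close>
  proof (rule nn_integral_cong_AE)
   show "AE xi in lborel. EE ((cmod (a xi))^2) = EE (norm xi powr 0 * (cmod (a xi))^2)"
    using AE_lborel_singleton[of "0::real^2"] by eventually_elim simp
  qed
  from IF_plancherel[OF a order_trans[OF eq_refl[OF this] H]] show ?thesis
   using A by (simp add: power_mult_distrib)
 qed
 then show thesis using that[of "2 * pi"] True by auto
next
 case False
 then have "0 < sg" using sg by simp
 from sobolev_pos[OF this sg(2)] show thesis using that by blast
qed

lemma young_conj:
 fixes x y r q :: real assumes "0 <= x" "0 <= y" "1 < r" "1 / r + 1 / q = 1"
 shows "x * y <= x powr r + y powr q"
proof -
 have "q ~= 0" using assms by auto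
 then have qr: "q + r = q * r" using assms by (simp add: field_simps)
 then have "q = r / (r - 1)" using assms by (simp add: field_simps)
 then have q: "1 < q" using assms by simp
 show ?thesis
 proof (cases "x = 0 | y = 0")
  case False
  then have p: "0 < x" "0 < y" using assms by auto
  show ?thesis
  proof (cases "x <= y powr (q - 1)")
   case True
   then have "x * y <= y powr (q - 1) * y powr 1" using p by (intro mult_mono) auto
   also have "... = y powr q" unfolding powr_add[symmetric] by simp
   finally show ?thesis by (simp add: add_increasing)
  next
   case False
   then have "(y powr (q - 1)) powr (r - 1) <= x powr (r - 1)" using assms by (intro powr_mono2) auto
   moreover have "(q - 1) * (r - 1) = 1" using qr by (simp add: algebra_simps)
   ultimately have "y <= x powr (r - 1)" using p by (simp add: powr_powr)
   then have "x * y <= x powr 1 * x powr (r - 1)" using p by (intro mult_mono) auto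
   also have "... = x powr r" unfolding powr_add[symmetric] by simp
   finally show ?thesis by (simp add: add_increasing2)
  qed
 qed auto
qed

text \<open>Both functions are normalised first; the factor 2 comes from \<open>young_conj\<close>,
  which omits the weights \<open>1 / r\<close> and \<open>1 / q\<close>.\<close>

lemma hoelder:
 fixes F h :: "'a => real"
 assumes [measurable]: "F \<in> borel_measurable M" "h \<in> borel_measurable M"
  and r: "1 < r" "1 / r + 1 / q = 1" and B: "0 < B" "0 < H"
  and F: "(\<integral>\<^sup>+x. EE (<|F x|> powr r) \<partial>M) <= EE (B powr r)"
  and h: "(\<integral>\<^sup>+x. EE (<|h x|> powr q) \<partial>M) <= EE (H powr q)"
 shows "(\<integral>\<^sup>+x. EE <|F x * h x|> \<partial>M) <= EE (2 * B * H)"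
proof -
 have "(\<integral>\<^sup>+x. EE <|F x * h x|> \<partial>M) <= (\<integral>\<^sup>+x. EE (B * H / B powr r) * EE (<|F x|> powr r) + EE (B * H / H powr q) * EE (<|h x|> powr q) \<partial>M)"
 proof (intro nn_integral_mono)
  fix x
  have "<|F x * h x|> = B * H * (<|F x|> / B * (<|h x|> / H))" using B by (simp add: abs_mult)
  also have "... <= B * H * ((<|F x|> / B) powr r + (<|h x|> / H) powr q)" using B r by (intro mult_left_mono young_conj) auto
  also have "... = B * H / B powr r * <|F x|> powr r + B * H / H powr q * <|h x|> powr q" using B by (simp add: powr_divide field_simps)
  finally show "EE <|F x * h x|> <= EE (B * H / B powr r) * EE (<|F x|> powr r) + EE (B * H / H powr q) * EE (<|h x|> powr q)"
   using B by (simp only: ennreal_mult[symmetric] ennreal_plus[symmetric] mult_nonneg_nonneg divide_nonneg_nonneg powr_ge_zero less_imp_le ennreal_leI)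
 qed
 also have "... = EE (B * H / B powr r) * (\<integral>\<^sup>+x. EE (<|F x|> powr r) \<partial>M) + EE (B * H / H powr q) * (\<integral>\<^sup>+x. EE (<|h x|> powr q) \<partial>M)"
  by (simp add: nn_integral_add nn_integral_cmult)
 also have "... <= EE (B * H / B powr r) * EE (B powr r) + EE (B * H / H powr q) * EE (H powr q)"
  by (intro add_mono mult_left_mono F h) auto
 also have "... = EE (2 * B * H)" using B by (simp add: ennreal_mult[symmetric] ennreal_plus[symmetric] del: ennreal_plus)
 finally show ?thesis .
qed

subsection \<open>Free waves\<close>

text \<open>Amplitudes with all moments integrable: exactly what allows differentiating under the
  integral any number of times.\<close>

definition amp :: "(real^2 => complex) => bool" where
 "amp a \<longleftrightarrow> a \<in> BB & (\<forall>k. integrable lborel (%xi. norm xi ^ k * cmod (a xi)))"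

lemma amp_meas: "amp a ==> a \<in> BB" by (simp add: amp_def)

lemma amp_integrable: "amp a ==> integrable lborel a"
proof -
 assume a: "amp a"
 then have "integrable lborel (%xi. norm xi ^ 0 * cmod (a xi))" unfolding amp_def by blast
 then have "integrable lborel (%xi. cmod (a xi))" by simp
 then show "integrable lborel a" by (rule integrable_norm_cancel) (use amp_meas[OF a] in simp)
qed

lemma amp_bound:
 assumes "amp a" and [measurable]: "b \<in> BB" and "!!xi. cmod (b xi) <= K * norm xi ^ m * cmod (a xi)"
 shows "amp b"
 unfolding amp_def
proof (intro conjI allI)
 fix k
 have i: "integrable lborel (%xi. K * (norm xi ^ (k + m) * cmod (a xi)))" using assms(1) unfolding amp_def by (intro integrable_mult_right) blast
 show "integrable lborel (%xi. norm xi ^ k * cmod (b xi))"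
 proof (rule Bochner_Integration.integrable_bound[OF i])
  show "AE xi in lborel. norm (norm xi ^ k * cmod (b xi)) <= norm (K * (norm xi ^ (k + m) * cmod (a xi)))"
  proof (rule AE_I2)
   fix xi :: "real^2"
   have "norm xi ^ k * cmod (b xi) <= norm xi ^ k * (K * norm xi ^ m * cmod (a xi))" by (intro mult_left_mono assms) auto
   then show "norm (norm xi ^ k * cmod (b xi)) <= norm (K * (norm xi ^ (k + m) * cmod (a xi)))"
    by (simp add: power_add mult_ac)
  qed
 qed simp
qed fact

lemma amp_mult:
 assumes a: "amp a" and [measurable]: "l \<in> BB" and l: "!!xi. cmod (l xi) <= norm xi ^ m"
 shows "amp (%xi. l xi * a xi)"
 using amp_meas[OF a] l by (intro amp_bound[OF a, of _ 1 m]) (auto simp: norm_mult intro!: mult_right_mono)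

text \<open>The real part of a half wave. Multiplying a Hermitian amplitude by a suitable power of
  the imaginary unit selects its cosine or its sine part, so one amplitude encodes both initial
  data.\<close>

definition W :: "(real^2 => complex) => real => real => real => real" where
 "W a t x y = Re (LL xi. cis (xi $ 1 * x + xi $ 2 * y + t * norm xi) * a xi)"

lemma nth_meas[measurable]: "(%x::real^2. x $ i) \<in> BB"
 by (intro borel_measurable_continuous_onI continuous_intros)

lemma cis_taylor: "cmod (cis (u + h) - cis u - h *\<^sub>R (\<i> * cis u)) <= h^2"
proof -
 have "cis (u + h) - cis u - h *\<^sub>R (\<i> * cis u) = cis u * (iexp h - (\<Sum>k\<le>1. (\<i> * h)^k / fact k))"
 proof -
  have "iexp h - (\<Sum>k\<le>1. (\<i> * h)^k / fact k) = cis h - 1 - \<i> * h" by (simp add: cis_conv_exp)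
  then show ?thesis by (simp add: cis_mult[symmetric] scaleR_conv_of_real algebra_simps del: cis_mult)
 qed
 also have "cmod ... <= <|h|>^2 / 2" unfolding norm_mult using iexp_approx1[of h 1] by (simp add: numeral_2_eq_2)
 finally show ?thesis using zero_le_power2[of h] unfolding power2_abs by linarith
qed

text \<open>The remainder of \<open>cis\<close> is quadratic, and the second moment of
  \<open>a\<close> is integrable. The phase is affine in the variable of differentiation, so time
  and both space directions are covered at once.\<close>

lemma phase_deriv:
 assumes a: "amp a" and [measurable]: "\<psi> \<in> BB" "l \<in> BB" and l: "!!xi. <|l xi|> <= norm xi"
 shows "((%s. Re (LL xi. cis (\<psi> xi + s * l xi) * a xi)) hrd
  Re (LL xi. cis (\<psi> xi + t * l xi) * (\<i> * cr (l xi) * a xi))) (at t)"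
proof -
 let ?F = "%s xi. cis (\<psi> xi + s * l xi) * a xi" and ?f = "%xi. cis (\<psi> xi + t * l xi) * (\<i> * cr (l xi) * a xi)"
 have [measurable]: "a \<in> BB" by (rule amp_meas[OF a])
 have F: "integrable lborel (?F s)" for s by (rule integrable_cis_mult[OF amp_integrable[OF a]]) measurable
 have "amp (%xi. \<i> * cr (l xi) * a xi)" using l by (intro amp_mult[OF a, of _ 1]) (auto simp: norm_mult)
 then have f: "integrable lborel ?f" by (intro integrable_cis_mult[OF amp_integrable]) measurable
 define K where "K = (LL xi. norm xi ^ 2 * cmod (a xi))"
 have Ki: "integrable lborel (%xi. norm xi ^ 2 * cmod (a xi))" using a by (auto simp: amp_def)
 have key: "norm (integral\<^sup>L lborel (?F s) - integral\<^sup>L lborel (?F t) - (s - t) *\<^sub>R integral\<^sup>L lborel ?f) <= (s - t)^2 * K" for s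
 proof -
  have "integral\<^sup>L lborel (?F s) - integral\<^sup>L lborel (?F t) - (s - t) *\<^sub>R integral\<^sup>L lborel ?f = (LL xi. ?F s xi - ?F t xi - (s - t) *\<^sub>R ?f xi)"
   using F f by (simp del: scaleR_conv_of_real)
  also have "norm ... <= (LL xi. (s - t)^2 * (norm xi ^ 2 * cmod (a xi)))"
  proof (rule Bochner_Integration.integral_norm_bound_integral)
   fix xi
   have "?F s xi - ?F t xi - (s - t) *\<^sub>R ?f xi = (cis (\<psi> xi + t * l xi + (s - t) * l xi) - cis (\<psi> xi + t * l xi) - ((s - t) * l xi) *\<^sub>R (\<i> * cis (\<psi> xi + t * l xi))) * a xi"
    by (simp add: algebra_simps scaleR_conv_of_real)
   also have "norm ... <= ((s - t) * l xi)^2 * cmod (a xi)" unfolding norm_mult by (intro mult_right_mono cis_taylor) auto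
   also have "... <= ((s - t)^2 * (norm xi)^2) * cmod (a xi)"
    unfolding power_mult_distrib using l[of xi] power_mono[OF l[of xi], of 2] by (intro mult_right_mono mult_left_mono) auto
   finally show "norm (?F s xi - ?F t xi - (s - t) *\<^sub>R ?f xi) <= (s - t)^2 * (norm xi ^ 2 * cmod (a xi))" by (simp add: mult.assoc)
  qed (use F f Ki in auto)
  finally show ?thesis by (simp add: K_def)
 qed
 have "((%s. integral\<^sup>L lborel (?F s)) has_vector_derivative integral\<^sup>L lborel ?f) (at t)"
  unfolding has_vector_derivative_def has_derivative_iff_norm
 proof
  show "((%s. norm (integral\<^sup>L lborel (?F s) - integral\<^sup>L lborel (?F t) - (s - t) *\<^sub>R integral\<^sup>L lborel ?f) / norm (s - t)) \<longlongrightarrow> 0) (at t)"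
  proof (rule tendsto_sandwich[OF _ _ tendsto_const])
   have "((%s. <|s - t|> * K) \<longlongrightarrow> <|t - t|> * K) (at t)" by (intro tendsto_intros)
   then show "((%s. <|s - t|> * K) \<longlongrightarrow> 0) (at t)" by simp
   show "\<forall>\<^sub>F s in at t. norm (integral\<^sup>L lborel (?F s) - integral\<^sup>L lborel (?F t) - (s - t) *\<^sub>R integral\<^sup>L lborel ?f) / norm (s - t) <= <|s - t|> * K"
   proof (rule always_eventually, rule allI)
    fix s
    show "norm (integral\<^sup>L lborel (?F s) - integral\<^sup>L lborel (?F t) - (s - t) *\<^sub>R integral\<^sup>L lborel ?f) / norm (s - t) <= <|s - t|> * K"
    proof (cases "s = t")
     case False
     then show ?thesis using key[of s] by (subst pos_divide_le_eq) (auto simp: power2_eq_square abs_mult_self_eq mult_ac)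
    qed simp
   qed
  qed (auto intro!: always_eventually)
 qed (rule bounded_linear_scaleR_left)
 from bounded_linear.has_vector_derivative[OF bounded_linear_Re this]
 show ?thesis by (simp add: has_real_derivative_iff_has_vector_derivative)
qed

lemma W_derivs:
 assumes a: "amp a"
 shows "((%s. W a s x y) hrd W (%xi. \<i> * cr (norm xi) * a xi) t x y) (at t)"
  "((%s. W a t s y) hrd W (%xi. \<i> * cr (xi $ 1) * a xi) t x y) (at x)"
  "((%s. W a t x s) hrd W (%xi. \<i> * cr (xi $ 2) * a xi) t x y) (at y)"
proof -
 show "((%s. W a s x y) hrd W (%xi. \<i> * cr (norm xi) * a xi) t x y) (at t)"
  unfolding W_def by (rule phase_deriv[OF a]) auto
 have e: "xi $ 1 * x + xi $ 2 * y + t * norm xi = (xi $ 2 * y + t * norm xi) + x * xi $ 1" for xi :: "real^2" and x by simp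
 show "((%s. W a t s y) hrd W (%xi. \<i> * cr (xi $ 1) * a xi) t x y) (at x)"
  unfolding W_def e by (rule phase_deriv[OF a]) (auto intro: component_le_norm_cart)
 have e: "xi $ 1 * x + xi $ 2 * y + t * norm xi = (xi $ 1 * x + t * norm xi) + y * xi $ 2" for xi :: "real^2" and y by simp
 show "((%s. W a t x s) hrd W (%xi. \<i> * cr (xi $ 2) * a xi) t x y) (at y)"
  unfolding W_def e by (rule phase_deriv[OF a]) (auto intro: component_le_norm_cart)
qed

lemma cont_W: "amp a ==> cont3 (W a)"
proof -
 assume a: "amp a"
 have [measurable]: "a \<in> BB" by (rule amp_meas[OF a])
 have "isCont (%z. W a (fst z) (fst (snd z)) (snd (snd z))) z" for z
  unfolding continuous_at_sequentially W_def
 proof (intro allI impI)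
  fix f :: "nat => real \<times> real \<times> real" assume f: "f ----> z"
  show "((%z. Re (LL xi. cis (xi $ 1 * fst (snd z) + xi $ 2 * snd (snd z) + fst z * norm xi) * a xi)) \<circ> f) ----> Re (LL xi. cis (xi $ 1 * fst (snd z) + xi $ 2 * snd (snd z) + fst z * norm xi) * a xi)"
   unfolding o_def
  proof (intro tendsto_Re integral_dominated_convergence[where w="%xi. norm (a xi)"])
   show "AE xi in lborel. (%n. cis (xi $ 1 * fst (snd (f n)) + xi $ 2 * snd (snd (f n)) + fst (f n) * norm xi) * a xi) ----> cis (xi $ 1 * fst (snd z) + xi $ 2 * snd (snd z) + fst z * norm xi) * a xi"
    by (rule AE_I2) (auto simp: cis_conv_exp intro!: tendsto_intros f)
  qed (use amp_integrable[OF a] in \<open>auto simp: norm_mult\<close>)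
 qed
 then show "cont3 (W a)" unfolding cont3_def by (simp add: continuous_at_imp_continuous_on)
qed

definition dT :: "(real^2 => complex) => real^2 => complex" where "dT a xi = \<i> * cr (norm xi) * a xi"
definition dX :: "2 => (real^2 => complex) => real^2 => complex" where "dX i a xi = \<i> * cr (xi $ i) * a xi"

lemma amp_d: "amp a ==> amp (dT a)" "amp a ==> amp (dX i a)"
 unfolding dT_def[abs_def] dX_def[abs_def] by (intro amp_mult[of _ _ 1]; auto simp: norm_mult intro: component_le_norm_cart)+

lemma DERIV_W:
 assumes "amp a"
 shows "((%s. W a s x y) hrd W (dT a) t x y) (at t)"
  "((%s. W a t s y) hrd W (dX 1 a) t x y) (at x)"
  "((%s. W a t x s) hrd W (dX 2 a) t x y) (at y)"
 using W_derivs[OF assms] unfolding dT_def[abs_def] dX_def[abs_def] by auto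

lemma W_wave: "amp a ==> W (dT (dT a)) t x y = W (dX 1 (dX 1 a)) t x y + W (dX 2 (dX 2 a)) t x y"
proof -
 assume a: "amp a"
 have n: "cr (norm xi) * cr (norm xi) = cr (xi $ 1) * cr (xi $ 1) + cr (xi $ 2) * cr (xi $ 2)" for xi :: "real^2"
  unfolding of_real_mult[symmetric] of_real_add[symmetric] norm_2 by (simp add: power2_eq_square)
 have e: "cis r * dT (dT a) xi = cis r * dX 1 (dX 1 a) xi + cis r * dX 2 (dX 2 a) xi" for r xi
  using arg_cong[OF n, of "%z. - cis r * (z * a xi)"] by (simp add: dT_def dX_def algebra_simps)
 have i: "integrable lborel (%xi. cis (xi $ 1 * x + xi $ 2 * y + t * norm xi) * dX i (dX i a) xi)" for i
  by (rule integrable_cis_mult[OF amp_integrable[OF amp_d(2)[OF amp_d(2)[OF a]]]]) measurable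
 show ?thesis unfolding W_def e by (simp add: i)
qed

lemma dX_comm: "dX i (dT a) = dT (dX i a)" by (simp add: fun_eq_iff dX_def dT_def)

text \<open>Energy in a backward cone: the spatial derivatives vanish at time 0 together with
  \<open>W a 0\<close>, and the time derivative vanishes outside the ball. Thus the cut energy is 0
  at time 0, hence at time \<open>t\<close>, and continuity makes it vanish pointwise.\<close>

lemma W_finite_speed:
 assumes a: "amp a" and t: "0 <= t" and R: "0 <= R"
  and z: "!!x y. W a 0 x y = 0" and s: "!!x y. R < sqrt (x^2 + y^2) ==> W (dT a) 0 x y = 0"
  and xy: "R + t < sqrt (x^2 + y^2)"
 shows "W (dT a) t x y = 0"
proof -
 note A = amp_d[OF a]
 let ?wt = "W (dT a)" and ?wx = "W (dX 1 a)" and ?wy = "W (dX 2 a)"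
 define e where "e = (%t x y. (?wt t x y * ?wt t x y + ?wx t x y * ?wx t x y + ?wy t x y * ?wy t x y) / 2)"
 have c: "cont3 ?wt" "cont3 ?wx" "cont3 ?wy" "cont3 (W (dT (dT a)))" "cont3 (W (dT (dX i a)))" "cont3 (W (dX j (dX i a)))" for i j
  by (intro cont_W A amp_d)+
 have cur: "is_current e (%t x y. - (?wt t x y * ?wx t x y)) (%t x y. - (?wt t x y * ?wy t x y)) (%_ _ _. 0)"
  unfolding e_def
 proof (rule is_currentI)
  note d = DERIV_W[OF A(1)] DERIV_W[OF A(2)]
  fix t x y
  show "((%s. (?wt s x y * ?wt s x y + ?wx s x y * ?wx s x y + ?wy s x y * ?wy s x y) / 2) hrd
   ?wt t x y * W (dT (dT a)) t x y + ?wx t x y * W (dT (dX 1 a)) t x y + ?wy t x y * W (dT (dX 2 a)) t x y) (at t)"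
   by (rule DERIV_cong, (rule derivative_intros d)+, simp, algebra)
  show "((%s. - (?wt t s y * ?wx t s y)) hrd - (W (dT (dX 1 a)) t x y * ?wx t x y + ?wt t x y * W (dX 1 (dX 1 a)) t x y)) (at x)"
   by (rule DERIV_cong, (rule derivative_intros d[unfolded dX_comm])+, simp add: dX_comm)
  show "((%s. - (?wt t x s * ?wy t x s)) hrd - (W (dT (dX 2 a)) t x y * ?wy t x y + ?wt t x y * W (dX 2 (dX 2 a)) t x y)) (at y)"
   by (rule DERIV_cong, (rule derivative_intros d[unfolded dX_comm])+, simp add: dX_comm)
  show "?wt t x y * W (dT (dT a)) t x y + ?wx t x y * W (dT (dX 1 a)) t x y + ?wy t x y * W (dT (dX 2 a)) t x y
   + - (W (dT (dX 1 a)) t x y * ?wx t x y + ?wt t x y * W (dX 1 (dX 1 a)) t x y) + - (W (dT (dX 2 a)) t x y * ?wy t x y + ?wt t x y * W (dX 2 (dX 2 a)) t x y) = 0"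
   unfolding W_wave[OF a] by algebra
 qed (auto simp: cont3_def intro!: continuous_intros c[unfolded cont3_def])
 have ce: "cont3 e" using is_current_cont[OF cur] by auto
 have causal: "v * - (?wt t x y * ?wx t x y) + w * - (?wt t x y * ?wy t x y) <= e t x y" if "v^2 + w^2 <= 1" for t x y v w
 proof -
  have "(v * ?wx t x y + w * ?wy t x y)^2 <= (v^2 + w^2) * ((?wx t x y)^2 + (?wy t x y)^2)"
   using zero_le_power2[of "v * ?wy t x y - w * ?wx t x y"] by (simp add: power2_eq_square algebra_simps)
  also have "... <= 1 * ((?wx t x y)^2 + (?wy t x y)^2)" by (intro mult_right_mono that) auto
  finally show ?thesis using zero_le_power2[of "?wt t x y + (v * ?wx t x y + w * ?wy t x y)"]
   unfolding e_def by (simp add: power2_eq_square algebra_simps)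
 qed
 have z0: "?wx 0 x y = 0" "?wy 0 x y = 0" for x y
 proof -
  have "((%s. 0) hrd W (dX 1 a) 0 x y) (at x)" "((%s. 0) hrd W (dX 2 a) 0 x y) (at y)"
   using DERIV_W(2,3)[OF a, where t=0] unfolding z by auto
  from this[THEN DERIV_unique, OF DERIV_const] show "?wx 0 x y = 0" "?wy 0 x y = 0" by auto
 qed
 define de where "de = sqrt (x^2 + y^2) - R - t"
 have de: "0 < de" using xy by (simp add: de_def)
 \<comment> \<open>With apex height \<open>t + de / 2\<close> and smoothing \<open>de / 4\<close>
   the cutoff is positive at \<open>(t, x, y)\<close>, where its argument is \<open>de / 4\<close>,
   but zero at time 0 above the ball of radius \<open>R\<close>.\<close>
 let ?k = "cone_cut (de / 4) x y (t + de / 2)"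
 have "(LL z. ?k t $$ z * e t $$ z) <= (LL z. ?k 0 $$ z * e 0 $$ z) + ((%_. 0) t - (%_. 0) 0)"
  by (rule current_cut_bound[OF cur _ t causal, where B'="%_. 0"]) (use de in auto)
 moreover have z1: "?k 0 x' y' * e 0 x' y' = 0" for x' y'
 proof (cases "R < sqrt (x'^2 + y'^2)")
  case True then show ?thesis using s z0 by (simp add: e_def)
 next
  case False
  have "sqrt (x^2 + y^2) <= sqrt ((x' - x)^2 + (y' - y)^2) + sqrt (x'^2 + y'^2)"
   using norm_triangle_ineq[of "(x - x', y - y')" "(x', y')"] by (simp add: norm_Pair power2_commute)
  moreover have "sqrt ((x' - x)^2 + (y' - y)^2) <= jap (de / 4) (x' - x) (y' - y)" unfolding jap_def by simp
  ultimately have "t + de / 2 - 0 - jap (de / 4) (x' - x) (y' - y) <= 0" using False de unfolding de_def by argo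
  then show ?thesis unfolding cone_cut_def psq_def by simp
 qed
 ultimately have le: "(LL z. ?k t $$ z * e t $$ z) <= 0" by simp
 let ?S = "<|x|> + <|y|> + <|t + de / 2|>"
 have cc: "CO S (%z. ?k t $$ z * e t $$ z)" for S
  by (rule cont3_slice, rule cont3_mult, rule cont_cone_cut, use de in simp, rule ce)
 have nn: "0 <= ?k t $$ z * e t $$ z" for z
  by (intro mult_nonneg_nonneg cone_cut_nonneg) (auto simp: e_def)
 have "integral (sq_box ?S) (%z. ?k t $$ z * e t $$ z) = (LL z. ?k t $$ z * e t $$ z)"
  by (rule integral_sq_box_lborel(2)[symmetric, OF cc]) (use cone_cut_box_zero[of "de / 4" t x y "t + de/2" ?S] de t in auto)
 then have "integral (sq_box ?S) (%z. ?k t $$ z * e t $$ z) = 0"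
  using le nn by (intro antisym) (auto intro!: integral_nonneg integrable_continuous cc)
 moreover have "0 < ?S" using de t by auto
 then have "box (- ?S, - ?S) (?S, ?S) ~= {}" by (auto simp: box_ne_empty Basis_prod_def)
 ultimately have "\<forall>z\<in>sq_box ?S. ?k t $$ z * e t $$ z = 0"
  using integral_cbox_eq_0_iff[OF cc] nn by blast
 moreover have "(x, y) \<in> sq_box ?S" unfolding in_sq_box by auto
 ultimately have "?k t x y * e t x y = 0" by force
 moreover have "?k t x y ~= 0" using de by (simp add: cone_cut_def psq_def jap_def)
 ultimately have "?wt t x y * ?wt t x y + ?wx t x y * ?wx t x y + ?wy t x y * ?wy t x y = 0" by (simp add: e_def)
 then have "?wt t x y * ?wt t x y = 0" using zero_le_square[of "?wt t x y"] zero_le_square[of "?wx t x y"] zero_le_square[of "?wy t x y"] by linarith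
 then show ?thesis by simp
qed

lemma W_finite_speed':
 assumes a: "amp a" and t: "0 <= t" and R: "0 <= R"
  and z: "!!x y. W a 0 x y = 0" and s: "!!x y. R < sqrt (x^2 + y^2) ==> W (dT a) 0 x y = 0"
  and xy: "R + t < sqrt (x^2 + y^2)"
 shows "W a t x y = 0"
proof (cases "t = 0")
 case False
 have "W a t x y = W a 0 x y"
 proof (rule DERIV_isconst2[of 0 t "%s. W a s x y"])
  show "CO {0..t} (%s. W a s x y)" using DERIV_W(1)[OF a] by (meson DERIV_atLeastAtMost_imp_continuous_on)
  show "((%s. W a s x y) hrd 0) (at s)" if "0 < s" "s < t" for s
   using DERIV_W(1)[OF a, of x y s] W_finite_speed[OF a _ R z s, of s x y] that xy by simp
 qed (use t False in auto)
 then show ?thesis by (simp add: z)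
qed (simp add: z)

section \<open>Fourier multipliers on compactly supported functions\<close>

lemma lborel_reflect:
 fixes f :: "real^2 => 'b::{banach, second_countable_topology}"
 assumes [measurable]: "f \<in> BB"
 shows "(LL x. f (- x)) = (LL x. f x)" "integrable lborel (%x. f (- x)) \<longleftrightarrow> integrable lborel f"
proof -
 have l: "distr lborel borel uminus = (lborel :: (real^2) measure)"
  using lborel_affine[of "-1" "0::real^2"] by (simp add: density_1)
 show "(LL x. f (- x)) = (LL x. f x)" "integrable lborel (%x. f (- x)) \<longleftrightarrow> integrable lborel f"
  using integral_distr[of uminus lborel borel f] integrable_distr_eq[of uminus lborel borel f] by (simp_all add: l)
qed

lemma cc_integrable:
 fixes f :: "real^2 => 'b::euclidean_space"
 assumes c: "CO UNIV f" and b: "bounded {x. f x ~= 0}"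
 shows "integrable lborel f"
proof -
 obtain r where r: "{x. f x ~= 0} \<subseteq> cball 0 r" using bounded_subset_ballD[OF b, of 0] ball_subset_cball by blast
 have "set_integrable lborel (cball 0 r) f" unfolding set_integrable_def
  by (rule borel_integrable_compact) (use continuous_on_subset[OF c] in auto)
 moreover have "(%x. ind (cball 0 r) x *\<^sub>R f x) = f" using r by (auto simp: fun_eq_iff indicator_def subset_iff)
 ultimately show ?thesis by (simp add: set_integrable_def)
qed

lemma isCont_IF:
 assumes a: "integrable lborel a"
 shows "isCont (IF a) x"
 unfolding continuous_at_sequentially IF_def
proof (intro allI impI)
 fix f :: "nat => real^2" assume f: "f ----> x"
 have [measurable]: "a \<in> BB" using a by auto
 show "((%x. (LL xi. cis (xi \<bullet> x) * a xi)) \<circ> f) ----> (LL xi. cis (xi \<bullet> x) * a xi)"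
  unfolding o_def
 proof (intro integral_dominated_convergence[where w="%xi. norm (a xi)"])
  show "AE xi in lborel. (%n. cis (xi \<bullet> f n) * a xi) ----> cis (xi \<bullet> x) * a xi"
   by (rule AE_I2) (auto simp: cis_conv_exp intro!: tendsto_intros f)
 qed (use a in \<open>auto simp: norm_mult\<close>)
qed

lemma IF_real:
 assumes [measurable]: "a \<in> BB" and h: "!!xi. a (- xi) = cnj (a xi)"
 shows "Im (IF a x) = 0"
proof -
 have "cnj (IF a x) = (LL xi. cis ((- xi) \<bullet> x) * a (- xi))"
  unfolding IF_def Bochner_Integration.integral_cnj[symmetric] h by (simp add: cis_cnj)
 also have "... = IF a x" unfolding IF_def by (rule lborel_reflect(1)) measurable
 finally show ?thesis by (simp add: complex_eq_iff)
qed

text \<open>The origin is a null set. This permits the convention that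
  \<open>sin (t * norm xi) / norm xi\<close> is 0 there, where the limit would be
  \<open>t\<close>.\<close>

lemma IF_cong_off_0:
 assumes [measurable]: "a \<in> BB" "b \<in> BB" and ab: "!!xi. xi ~= 0 ==> a xi = b xi"
 shows "IF a x = IF b x"
 unfolding IF_def
proof (rule Bochner_Integration.integral_cong_AE)
 show "AE xi in lborel. cis (xi \<bullet> x) * a xi = cis (xi \<bullet> x) * b xi"
  using AE_lborel_singleton[of "0::real^2"] by eventually_elim (simp add: ab)
qed measurable

text \<open>Pointwise decay and not only integrable moments: boundedness near the origin is what
  makes the quotient by \<open>norm xi\<close> in the sine propagator integrable in the
  plane.\<close>

definition rapid :: "(real^2 => complex) => bool" where
 "rapid a \<longleftrightarrow> a \<in> BB & (\<forall>k. \<exists>K. \<forall>xi. norm xi ^ k * cmod (a xi) <= K)"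

lemma rapid_amp: "rapid a ==> amp a"
 unfolding amp_def
proof (intro conjI allI)
 assume a: "rapid a"
 then show [measurable]: "a \<in> BB" by (simp add: rapid_def)
 fix k
 obtain K L where K: "!!xi. norm xi ^ k * cmod (a xi) <= K" and L: "!!xi. norm xi ^ (k + 3) * cmod (a xi) <= L"
  using a unfolding rapid_def by metis
 have i: "integrable lborel (%xi::real^2. (4 * K + 4 * L) * (1 + norm xi) powr (- 3))"
  by (intro integrable_mult_right integrableI_nonneg) (use nn_integral_decay_finite[of 3] in auto)
 show "integrable lborel (%xi. norm xi ^ k * cmod (a xi))"
 proof (rule Bochner_Integration.integrable_bound[OF i])
  show "AE xi in lborel. norm (norm xi ^ k * cmod (a xi)) <= norm ((4 * K + 4 * L) * (1 + norm xi) powr (- 3))"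
  proof (rule AE_I2)
   fix xi :: "real^2"
   have "(1 + norm xi)^3 <= 4 + 4 * norm xi ^ 3"
   proof -
    have "0 <= 3 * (1 + norm xi) * (norm xi - 1)^2" by simp
    then show ?thesis by (simp add: power2_eq_square power3_eq_cube algebra_simps)
   qed
   then have "(norm xi ^ k * cmod (a xi)) * (1 + norm xi)^3 <= (norm xi ^ k * cmod (a xi)) * (4 + 4 * norm xi ^ 3)" by (intro mult_left_mono) auto
   also have "... = 4 * (norm xi ^ k * cmod (a xi)) + 4 * (norm xi ^ (k + 3) * cmod (a xi))" by (simp add: algebra_simps power_add)
   also have "... <= 4 * K + 4 * L" by (intro add_mono mult_left_mono K L) auto
   finally have m: "(norm xi ^ k * cmod (a xi)) * (1 + norm xi)^3 <= 4 * K + 4 * L" .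
   have p: "0 < (1 + norm xi)^3" by (intro zero_less_power add_pos_nonneg) auto
   then have "norm xi ^ k * cmod (a xi) <= (4 * K + 4 * L) / (1 + norm xi)^3" using m by (simp add: pos_le_divide_eq)
   also have "... = (4 * K + 4 * L) * (1 + norm xi) powr (- 3)" by (simp add: powr_minus_divide add_nonneg_pos)
   finally show "norm (norm xi ^ k * cmod (a xi)) <= norm ((4 * K + 4 * L) * (1 + norm xi) powr (- 3))" by simp
  qed
 qed simp
qed

lemma rapid_amp_div:
 assumes r: "rapid a"
 shows "amp (%xi. a xi / cr (norm xi))"
 unfolding amp_def
proof (intro conjI allI)
 have am: "amp a" by (rule rapid_amp[OF r])
 have [measurable]: "a \<in> BB" by (rule amp_meas[OF am])
 show "(%xi. a xi / cr (norm xi)) \<in> BB" by measurable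
 obtain K where K: "!!xi. cmod (a xi) <= K" using r unfolding rapid_def by (metis mult_1 power_0)
 let ?i = "%xi::real^2. norm xi powr (- 1) * ind {xi. norm xi <= 1} xi"
 have "(NN xi. EE (?i xi)) = (NN xi. EE (norm xi powr (- 2 * (1/2))) * ind {xi. norm xi <= 1} (xi::real^2))"
  by (intro nn_integral_cong) (auto simp: indicator_def)
 also have "... < \<infinity>" by (rule le_less_trans[OF nn_integral_norm_powr_ball]) auto
 finally have i: "integrable lborel ?i" by (intro integrableI_nonneg) auto
 fix k
 have j: "integrable lborel (%xi. K * ?i xi + norm xi ^ k * cmod (a xi) + norm xi ^ (k - 1) * cmod (a xi))"
  using am unfolding amp_def by (intro Bochner_Integration.integrable_add integrable_mult_right i) auto
 show "integrable lborel (%xi. norm xi ^ k * cmod (a xi / cr (norm xi)))"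
 proof (rule Bochner_Integration.integrable_bound[OF j])
  show "AE xi in lborel. norm (norm xi ^ k * cmod (a xi / cr (norm xi))) <= norm (K * ?i xi + norm xi ^ k * cmod (a xi) + norm xi ^ (k - 1) * cmod (a xi))"
  proof (rule AE_I2)
   fix xi :: "real^2"
   have K0: "0 <= K" using K[of 0] norm_ge_zero[of "a 0"] by linarith
   have nn: "0 <= K * ?i xi" "0 <= norm xi ^ k * cmod (a xi)" "0 <= norm xi ^ (k - 1) * cmod (a xi)" using K0 by auto
   have "norm xi ^ k * cmod (a xi) / norm xi <= K * ?i xi + norm xi ^ k * cmod (a xi) + norm xi ^ (k - 1) * cmod (a xi)"
   proof (cases "xi = 0")
    case False
    show ?thesis
    proof (cases k)
     case (Suc m) then show ?thesis using nn False by simp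
    next
     case 0
     show ?thesis
     proof (cases "norm xi <= 1")
      case True
      have "cmod (a xi) / norm xi <= K * ?i xi" using True False K[of xi] by (simp add: powr_minus_divide divide_right_mono)
      then show ?thesis using 0 nn norm_ge_zero[of "a xi"] by (simp, linarith)
     next
      case n: False
      then have "cmod (a xi) / norm xi <= cmod (a xi) / 1" by (intro divide_left_mono) auto
      then show ?thesis using 0 nn norm_ge_zero[of "a xi"] by (simp, linarith)
     qed
    qed
   qed (use nn in simp)
   then show "norm (norm xi ^ k * cmod (a xi / cr (norm xi))) <= norm (K * ?i xi + norm xi ^ k * cmod (a xi) + norm xi ^ (k - 1) * cmod (a xi))"
    by (simp add: norm_divide)
  qed
 qed simp
qed

lemma rapid_bound:
 assumes r: "rapid a" and [measurable]: "b \<in> BB" and b: "!!xi. cmod (b xi) <= K * (1 + norm xi) * cmod (a xi)" "0 <= K"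
 shows "rapid b"
 unfolding rapid_def
proof (intro conjI allI)
 fix k
 obtain A B where A: "!!xi. norm xi ^ k * cmod (a xi) <= A" and B: "!!xi. norm xi ^ Suc k * cmod (a xi) <= B"
  using r unfolding rapid_def by metis
 have "norm xi ^ k * cmod (b xi) <= K * (A + B)" for xi
 proof -
  have "norm xi ^ k * cmod (b xi) <= norm xi ^ k * (K * (1 + norm xi) * cmod (a xi))" by (intro mult_left_mono b) auto
  also have "... = K * (norm xi ^ k * cmod (a xi) + norm xi ^ Suc k * cmod (a xi))" by (simp add: algebra_simps)
  also have "... <= K * (A + B)" by (intro mult_left_mono add_mono A B b)
  finally show ?thesis .
 qed
 then show "\<exists>K. \<forall>xi. norm xi ^ k * cmod (b xi) <= K" by blast
qed fact

text \<open>Contains every \<open>test_fun\<close>. Smoothness is replaced by rapid decay of the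
  transform, which a multiplier of linear growth preserves without any computation of
  derivatives.\<close>

definition adm :: "(real^2 => real) => bool" where
 "adm h \<longleftrightarrow> CO UNIV h & bounded {x. h x ~= 0} & rapid (ft h)"

lemma ft_IF: "ft h xi = IF (%x. cr (h x)) (- xi)"
 unfolding ft_def IF_def by (simp add: inner_commute)

lemma ft_meas[measurable]:
 assumes [measurable]: "h \<in> BB" "f \<in> borel_measurable M"
 shows "(%x. ft h (f x)) \<in> borel_measurable M"
 unfolding ft_IF by measurable

lemma ft_cnj: "ft h (- xi) = cnj (ft h xi)"
 unfolding ft_def Bochner_Integration.integral_cnj[symmetric] by (simp add: cis_cnj)

lemma cc_of_real:
 assumes "CO UNIV h" "bounded {x. h x ~= 0}"
 shows "integrable lborel (%x::real^2. cr (h x))"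
 by (rule cc_integrable) (use assms in \<open>auto intro!: continuous_intros\<close>)

lemma admD:
 assumes "adm h"
 shows "h \<in> BB" "CO UNIV h" "bounded {x. h x ~= 0}" "rapid (ft h)" "amp (ft h)" "integrable lborel (ft h)"
  "isCont (ft h) xi" "integrable lborel h"
proof -
 show 1: "CO UNIV h" "bounded {x. h x ~= 0}" "rapid (ft h)" using assms by (auto simp: adm_def)
 then show "h \<in> BB" "amp (ft h)" "integrable lborel (ft h)" "integrable lborel h"
  by (auto intro: rapid_amp amp_integrable cc_integrable borel_measurable_continuous_onI)
 have "isCont (%xi. IF (%x. cr (h x)) (- xi)) xi"
  by (rule isCont_o2[OF _ isCont_IF[OF cc_of_real[OF 1(1,2)]]]) (intro continuous_intros)
 then show "isCont (ft h) xi" unfolding ft_IF[abs_def] .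
qed

lemma adm_inversion:
 assumes h: "adm h"
 shows "IF (ft h) x = cr ((2 * pi)^2) * cr (h x)"
proof -
 note [measurable] = admD(1)[OF h]
 have b: "\<exists>K. \<forall>x. norm (cr (h x)) <= K"
 proof -
  obtain r where r: "{x. h x ~= 0} \<subseteq> cball 0 r" using bounded_subset_ballD[OF admD(3)[OF h], of 0] ball_subset_cball by blast
  have "bounded (h ` cball 0 r)" by (intro compact_imp_bounded compact_continuous_image continuous_on_subset[OF admD(2)[OF h]]) auto
  then obtain K where K: "!!x. x \<in> cball 0 r ==> <|h x|> <= K" unfolding bounded_iff by (metis imageI real_norm_def)
  have "<|h x|> <= max K 0" for x using K[of x] r by (cases "h x = 0") (auto simp: subset_iff)
  then show ?thesis by (auto intro!: exI[of _ "max K 0"])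
 qed
 then obtain K where K: "!!x. norm (cr (h x)) <= K" by blast
 have I: "IF (%x. cr (h x)) xi = ft h (- xi)" for xi by (simp add: ft_IF)
 have "(LL xi. cis (- (x \<bullet> xi)) * IF (%x. cr (h x)) xi) = cr ((2 * pi)^2) * cr (h x)"
 proof (rule IF_inversion[OF cc_of_real[OF admD(2,3)[OF h]] K])
  show "isCont (%x. cr (h x)) x"
   using admD(2)[OF h] by (auto simp: continuous_on_eq_continuous_at intro!: continuous_intros)
  have "integrable lborel (%xi. ft h (- xi))" using admD(6)[OF h] by (subst lborel_reflect(2)) auto
  then show "integrable lborel (IF (%x. cr (h x)))" unfolding I[abs_def] .
 qed
 moreover have "(LL xi. cis (- (x \<bullet> xi)) * ft h (- xi)) = IF (ft h) x"
  unfolding IF_def by (subst lborel_reflect(1)[of "%xi. cis (xi \<bullet> x) * ft h xi", symmetric]) (auto simp: inner_commute)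
 ultimately show ?thesis unfolding I by simp
qed

lemma fmult_IF: "fmult m g x = Re (IF (%xi. cr (m xi / (2 * pi)^2) * ft g xi) x)"
proof -
 have "cr (1 / (2 * pi)^2) * (LL xi. cis (xi \<bullet> x) * cr (m xi) * ft g xi) = (LL xi. cr (1 / (2 * pi)^2) * (cis (xi \<bullet> x) * cr (m xi) * ft g xi))"
  by simp
 also have "... = IF (%xi. cr (m xi / (2 * pi)^2) * ft g xi) x" unfolding IF_def by (intro Bochner_Integration.integral_cong) auto
 finally show ?thesis unfolding fmult_def by simp
qed

text \<open>Evenness of \<open>m\<close> makes the output real. Its transform is found by inversion,
  which needs integrability and hence the support hypothesis \<open>s\<close>; for the propagators
  that is finite speed. At frequency 0 the multiplier may have a wrong value by the division
  convention, so the formula is claimed elsewhere only.\<close>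

lemma adm_fmult:
 assumes g: "adm g" and [measurable]: "m \<in> BB" and ev: "!!xi. m (- xi) = m xi"
  and b: "!!xi. <|m xi|> <= K * (1 + norm xi)" and c: "!!xi. xi ~= 0 ==> isCont m xi" and s: "bounded {x. fmult m g x ~= 0}"
 shows "adm (fmult m g)" "!!xi. xi ~= 0 ==> ft (fmult m g) xi = cr (m xi) * ft g xi"
proof -
 note [measurable] = admD(1)[OF g]
 define a where "a = (%xi. cr (m xi / (2 * pi)^2) * ft g xi)"
 have K0: "0 <= K" using b[of 0] by simp
 have ra: "rapid a"
 proof (rule rapid_bound[OF admD(4)[OF g], of _ "K / (2 * pi)^2"])
  show "cmod (a xi) <= K / (2 * pi)^2 * (1 + norm xi) * cmod (ft g xi)" for xi
   using divide_right_mono[OF b[of xi], of "(2 * pi)^2"] unfolding a_def norm_mult norm_of_real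
   by (intro mult_right_mono) (auto simp: abs_divide)
 qed (use K0 in \<open>auto simp: a_def\<close>)
 have ai: "integrable lborel a" by (intro amp_integrable rapid_amp ra)
 obtain B where B: "!!xi. cmod (a xi) <= B" using ra unfolding rapid_def by (metis mult_1 power_0)
 have re: "IF a x = cr (fmult m g x)" for x
  using IF_real[of a x] by (simp add: fmult_IF a_def complex_eq_iff ev ft_cnj)
 have "isCont (%x. Re (IF a x)) x" for x by (rule isCont_Re[OF isCont_IF[OF ai]])
 then have cont: "CO UNIV (fmult m g)" by (simp add: re continuous_at_imp_continuous_on)
 have f: "ft (fmult m g) xi = cr ((2 * pi)^2) * a xi" if "xi ~= 0" for xi
 proof -
  have "(LL x. cis (- (xi \<bullet> x)) * IF a x) = cr ((2 * pi)^2) * a xi"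
  proof (rule IF_inversion[OF ai B])
   show "isCont a xi" unfolding a_def by (intro continuous_intros c that admD(7)[OF g]) auto
   show "integrable lborel (IF a)" unfolding re[abs_def] by (rule cc_of_real[OF cont s])
  qed
  then show ?thesis by (simp add: ft_def re)
 qed
 then show f': "xi ~= 0 ==> ft (fmult m g) xi = cr (m xi) * ft g xi" for xi by (simp add: a_def)
 have "rapid (ft (fmult m g))" unfolding rapid_def
 proof (intro conjI allI)
  show "ft (fmult m g) \<in> BB" using borel_measurable_continuous_onI[OF cont] by measurable
  fix k
  obtain K where K: "!!xi. norm xi ^ k * cmod (a xi) <= K" using ra unfolding rapid_def by blast
  have "norm xi ^ k * cmod (ft (fmult m g) xi) <= (2 * pi)^2 * K + cmod (ft (fmult m g) 0)" for xi
  proof (cases "xi = 0")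
   case True
   have "0 <= K" using K[of 0] by (rule order_trans[rotated]) simp
   then show ?thesis using True by (cases k) auto
  next
   case False
   have "norm xi ^ k * cmod (ft (fmult m g) xi) = (2 * pi)^2 * (norm xi ^ k * cmod (a xi))"
    unfolding f[OF False] norm_mult norm_of_real by simp
   also have "... <= (2 * pi)^2 * K" by (intro mult_left_mono K) auto
   finally show ?thesis by (simp add: add_increasing2)
  qed
  then show "\<exists>K. \<forall>xi. norm xi ^ k * cmod (ft (fmult m g) xi) <= K" by blast
 qed
 then show "adm (fmult m g)" unfolding adm_def using cont s by blast
qed

lemma fmult_add:
 assumes g: "adm g" and m[measurable]: "m \<in> BB" "m' \<in> BB"
  and b: "!!xi. <|m xi|> <= K * (1 + norm xi)" "!!xi. <|m' xi|> <= K * (1 + norm xi)"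
 shows "fmult (%xi. m xi + m' xi) g x = fmult m g x + fmult m' g x"
proof -
 note [measurable] = admD(1)[OF g]
 have K0: "0 <= K" using b(1)[of 0] by simp
 have r: "integrable lborel (%xi. cr (m xi / (2 * pi)^2) * ft g xi)"
  if [measurable]: "m \<in> BB" and b: "!!xi. <|m xi|> <= K * (1 + norm xi)" for m :: "real^2 => real"
 proof (intro amp_integrable rapid_amp rapid_bound[OF admD(4)[OF g], of _ "K / (2 * pi)^2"])
  show "cmod (cr (m xi / (2 * pi)^2) * ft g xi) <= K / (2 * pi)^2 * (1 + norm xi) * cmod (ft g xi)" for xi
   using divide_right_mono[OF b[of xi], of "(2 * pi)^2"] unfolding norm_mult norm_of_real
   by (intro mult_right_mono) (auto simp: abs_divide)
 qed (use K0 in auto)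
 show ?thesis unfolding fmult_IF plus_complex.simps(1)[symmetric] IF_add[OF r[OF m(1) b(1)] r[OF m(2) b(2)], symmetric]
  by (simp add: add_divide_distrib distrib_right)
qed

lemma fmult_comp:
 assumes g: "adm g" "adm h" and [measurable]: "m \<in> BB" "m' \<in> BB"
  and h: "!!xi. xi ~= 0 ==> ft h xi = cr (m' xi) * ft g xi"
 shows "fmult m h x = fmult (%xi. m xi * m' xi) g x"
proof -
 note [measurable] = admD(1)[OF g(1)] admD(1)[OF g(2)]
 show ?thesis unfolding fmult_IF by (rule arg_cong[where f=Re], rule IF_cong_off_0) (auto simp: h)
qed

lemma fmult_cong_off_0:
 assumes g: "adm g" and [measurable]: "m \<in> BB" "m' \<in> BB"
  and h: "!!xi. xi ~= 0 ==> m xi = m' xi"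
 shows "fmult m g x = fmult m' g x"
proof -
 note [measurable] = admD(1)[OF g(1)]
 show ?thesis unfolding fmult_IF by (rule arg_cong[where f=Re], rule IF_cong_off_0) (auto simp: h)
qed

lemma IF_cmult: "IF (%xi. c * a xi) x = c * IF a x"
 unfolding IF_def by (simp add: mult.left_commute)

lemma W_IF: "W a t x y = Re (IF (%xi. cis (t * norm xi) * a xi) (vec2 (x, y)))"
 unfolding W_def IF_def by (simp add: inner_2 cis_mult[symmetric] mult_ac)

lemma W_herm:
 assumes a: "amp a" and h: "!!xi. a (- xi) = cnj (a xi)"
 shows "W a t x y = Re (IF (%xi. cr (cos (t * norm xi)) * a xi) (vec2 (x, y)))"
  "W (%xi. - \<i> * a xi) t x y = Re (IF (%xi. cr (sin (t * norm xi)) * a xi) (vec2 (x, y)))"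
  "W (%xi. \<i> * a xi) t x y = - Re (IF (%xi. cr (sin (t * norm xi)) * a xi) (vec2 (x, y)))"
proof -
 have [measurable]: "a \<in> BB" by (rule amp_meas[OF a])
 let ?C = "%xi. cr (cos (t * norm xi)) * a xi" and ?S = "%xi. cr (sin (t * norm xi)) * a xi"
 have i: "integrable lborel ?C" "integrable lborel ?S"
  by (intro amp_integrable amp_mult[OF a, of _ 0]; simp)+
 have "cis (t * norm xi) * a xi = ?C xi + \<i> * ?S xi" for xi by (simp add: complex_eq_iff algebra_simps)
 then have s: "IF (%xi. cis (t * norm xi) * a xi) z = IF ?C z + \<i> * IF ?S z" for z
  using IF_add[OF i(1) integrable_mult_right[OF i(2), of \<i>]] by (simp add: IF_cmult)
 have r: "Im (IF ?C z) = 0" "Im (IF ?S z) = 0" for z by (rule IF_real; simp add: h)+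
 have c: "cis (t * norm xi) * (k * a xi) = k * (cis (t * norm xi) * a xi)" for k xi by simp
 show "W a t x y = Re (IF ?C (vec2 (x, y)))" "W (%xi. - \<i> * a xi) t x y = Re (IF ?S (vec2 (x, y)))" "W (%xi. \<i> * a xi) t x y = - Re (IF ?S (vec2 (x, y)))"
  unfolding W_IF c IF_cmult s by (simp_all add: r)
qed

lemma fmult_minus: "fmult (%xi. - m xi) g x = - fmult m g x"
 using IF_cmult[of "-1"] by (simp add: fmult_IF)

lemma wave_parity: "Cw (- t) g x = Cw t g x" "Sw (- t) g x = - Sw t g x" "Dw (- t) g x = - Dw t g x"
 unfolding Cw_def Sw_def Dw_def fmult_minus[symmetric] by simp_all

lemma Cw_0: "adm g ==> Cw 0 g x = g x"
 using adm_inversion[of g x] IF_cmult[of "cr (1 / (2 * pi)^2)" "ft g" x] by (simp add: Cw_def fmult_IF)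

lemma Sw_0: "Sw 0 g x = 0"
 using IF_cmult[of 0] by (simp add: Sw_def fmult_IF)

text \<open>One amplitude \<open>b\<close> produces \<open>Sw\<close>, \<open>Cw\<close> and
  \<open>Dw\<close> as successive time derivatives. Its wave vanishes at time 0 and has velocity
  \<open>g\<close>, so finite speed applies to the first two; \<open>Dw\<close> vanishes as the time
  derivative of a function that is zero on an open set of times. Negative times follow by
  parity.\<close>

lemma adm_waves:
 assumes g: "adm g"
 obtains b R where "amp b" "0 <= R" "!!t x y. Sw t g (vec2 (x, y)) = W b t x y" "!!t x y. Cw t g (vec2 (x, y)) = W (dT b) t x y"
  "!!t x y. Dw t g (vec2 (x, y)) = W (dT (dT b)) t x y"
  "!!t x. R + <|t|> < norm x ==> Sw t g x = 0" "!!t x. R + <|t|> < norm x ==> Cw t g x = 0" "!!t x. R + <|t|> < norm x ==> Dw t g x = 0"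
proof -
 note [measurable] = admD(1)[OF g]
 define a where "a = (%xi. cr (1 / (2 * pi)^2) * (ft g xi / cr (norm xi)))"
 define b where "b = (%xi. - \<i> * a xi)"
 have a: "amp a" unfolding a_def by (rule amp_bound[OF rapid_amp_div[OF admD(4)[OF g]], of _ "1 / (2 * pi)^2" 0]) (auto simp: norm_mult norm_divide norm_power)
 have b: "amp b" unfolding b_def by (rule amp_mult[OF a, of _ 0]) auto
 have h: "a (- xi) = cnj (a xi)" for xi by (simp add: a_def ft_cnj)
 have db: "dT b = (%xi. cr (norm xi) * a xi)" by (simp add: fun_eq_iff b_def dT_def complex_eq_iff)
 have adb: "amp (%xi. cr (norm xi) * a xi)" using amp_d(1)[OF b] unfolding db .
 have ddb: "dT (dT b) = (%xi. \<i> * (cr (norm xi) * (cr (norm xi) * a xi)))" unfolding db by (simp add: dT_def[abs_def] mult.assoc)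
 have addb: "amp (%xi. cr (norm xi) * (cr (norm xi) * a xi))" by (rule amp_mult[OF adb, of _ 1]) auto
 have [measurable]: "a \<in> BB" by (rule amp_meas[OF a])
 have S: "Sw t g (vec2 (x, y)) = W b t x y" for t x y
  unfolding b_def W_herm(2)[OF a h] Sw_def fmult_IF by (rule arg_cong[where f=Re], rule IF_cong_off_0) (auto simp: a_def)
 have C: "Cw t g (vec2 (x, y)) = W (dT b) t x y" for t x y
  unfolding db by (subst W_herm(1)[OF adb], simp add: h, unfold Cw_def fmult_IF, rule arg_cong[where f=Re], rule IF_cong_off_0) (auto simp: a_def)
 have D: "Dw t g (vec2 (x, y)) = W (dT (dT b)) t x y" for t x y
  unfolding ddb by (subst W_herm(3)[OF addb], simp add: h, unfold Dw_def mult_minus_left fmult_minus fmult_IF, rule arg_cong[where f="%z. - Re z"], rule IF_cong_off_0) (auto simp: a_def)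
 obtain r where r: "{x. g x ~= 0} \<subseteq> ball 0 r" using bounded_subset_ballD[OF admD(3)[OF g]] by blast
 define R where "R = max 0 r"
 have g0: "g x = 0" if "R < norm x" for x using r that by (force simp: R_def)
 have v: "norm (vec2 (x, y)) = sqrt (x^2 + y^2)" for x y by (simp add: norm_2)
 have z: "W b 0 x y = 0" for x y unfolding S[symmetric] by (rule Sw_0)
 have s: "W (dT b) 0 x y = 0" if "R < sqrt (x^2 + y^2)" for x y
  unfolding C[symmetric] Cw_0[OF g] using that by (intro g0) (simp add: v)
 have pos: "Sw t g x = 0" "Cw t g x = 0" if "0 <= t" "R + t < norm x" for t x
 proof -
  have xx: "R + t < sqrt ((x $ 1)^2 + (x $ 2)^2)" using that by (simp add: norm_2)
  have R0: "0 <= R" by (simp add: R_def)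
  show "Sw t g x = 0" "Cw t g x = 0"
   using W_finite_speed'[OF b that(1) R0 z s xx] W_finite_speed[OF b that(1) R0 z s xx] S[of t "x $ 1" "x $ 2"] C[of t "x $ 1" "x $ 2"] by (simp_all add: vec2_eta)
 qed
 have SC: "Sw t g x = 0" "Cw t g x = 0" if "R + <|t|> < norm x" for t x
  using pos[of "<|t|>" x] that wave_parity(1,2)[of t g x] by (auto simp: abs_if split: if_splits)
 have DD: "Dw t g x = 0" if "R + <|t|> < norm x" for t x
 proof -
  have e: "Cw s g x = W (dT b) s (x $ 1) (x $ 2)" for s using C[of s "x $ 1" "x $ 2"] by (simp add: vec2_eta)
  have d: "((%s. Cw s g x) hrd W (dT (dT b)) t (x $ 1) (x $ 2)) (at t)"
   unfolding e by (rule DERIV_W(1)[OF amp_d(1)[OF b]])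
  have "((%s. 0) hrd W (dT (dT b)) t (x $ 1) (x $ 2)) (at t)"
  proof (rule has_field_derivative_transform_within_open[OF d])
   show "open {s. R + <|s|> < norm x}" by (intro open_Collect_less continuous_intros)
  qed (use that SC in auto)
  then have "W (dT (dT b)) t (x $ 1) (x $ 2) = 0" using DERIV_unique DERIV_const by blast
  then show ?thesis using D[of t "x $ 1" "x $ 2"] by (simp add: vec2_eta)
 qed
 show thesis by (rule that[OF b _ S C D SC DD]) (auto simp: R_def)
qed

lemma abs_sin_div: "<|sin (t * norm xi) / norm xi|> <= <|t|>"
proof (cases "xi = 0")
 case False
 have "<|sin (t * norm xi)|> <= <|t|> * norm xi" using abs_sin_x_le_abs_x[of "t * norm xi"] by (simp add: abs_mult)
 then show ?thesis using False by (simp add: field_simps abs_divide)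
qed simp

lemma abs_norm_sin: "<|- norm xi * sin (t * norm xi)|> <= norm xi"
 using mult_left_mono[OF abs_sin_le_one[of "t * norm xi"], of "norm xi"] by (simp add: abs_mult)

lemma adm_propagators:
 assumes g: "adm g"
 shows "adm (Cw t g)" "adm (Sw t g)" "adm (Dw t g)"
  "!!xi. xi ~= 0 ==> ft (Cw t g) xi = cr (cos (t * norm xi)) * ft g xi"
  "!!xi. xi ~= 0 ==> ft (Sw t g) xi = cr (sin (t * norm xi) / norm xi) * ft g xi"
  "!!xi. xi ~= 0 ==> ft (Dw t g) xi = cr (- norm xi * sin (t * norm xi)) * ft g xi"
proof -
 obtain b R where R: "!!t x. R + <|t|> < norm x ==> Sw t g x = 0" "!!t x. R + <|t|> < norm x ==> Cw t g x = 0" "!!t x. R + <|t|> < norm x ==> Dw t g x = 0"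
  using adm_waves[OF g] by metis
 have bd: "bounded {x. Sw t g x ~= 0}" "bounded {x. Cw t g x ~= 0}" "bounded {x. Dw t g x ~= 0}"
  using R[of t] by (auto intro!: bounded_subset[OF bounded_cball[of 0 "R + <|t|>"]] simp: not_less[symmetric])
 have 1: "<|cos (t * norm xi)|> <= 1 * (1 + norm xi)" for xi :: "real^2" using abs_cos_le_one[of "t * norm xi"] norm_ge_zero[of xi] by (simp, linarith)
 have 2: "<|sin (t * norm xi) / norm xi|> <= <|t|> * (1 + norm xi)" for xi :: "real^2"
  using abs_sin_div[of t xi] mult_nonneg_nonneg[OF abs_ge_zero norm_ge_zero, of t xi] unfolding distrib_left mult_1_right by linarith
 have 3: "<|- norm xi * sin (t * norm xi)|> <= 1 * (1 + norm xi)" for xi :: "real^2" using abs_norm_sin[of xi t] by simp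
 show "adm (Cw t g)" "!!xi. xi ~= 0 ==> ft (Cw t g) xi = cr (cos (t * norm xi)) * ft g xi"
  unfolding Cw_def by (rule adm_fmult[OF g _ _ 1]; use bd in \<open>auto simp: Cw_def intro!: continuous_intros\<close>)+
 show "adm (Sw t g)" "!!xi. xi ~= 0 ==> ft (Sw t g) xi = cr (sin (t * norm xi) / norm xi) * ft g xi"
  unfolding Sw_def by (rule adm_fmult[OF g _ _ 2]; use bd in \<open>auto simp: Sw_def intro!: continuous_intros\<close>)+
 show "adm (Dw t g)" "!!xi. xi ~= 0 ==> ft (Dw t g) xi = cr (- norm xi * sin (t * norm xi)) * ft g xi"
  unfolding Dw_def by (rule adm_fmult[OF g _ _ 3]; use bd in \<open>auto simp: Dw_def intro!: continuous_intros\<close>)+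
qed

lemma fmult_add_comp:
 assumes g: "adm g" "adm h" "adm h'" and [measurable]: "m \<in> BB" "m1 \<in> BB" "m2 \<in> BB" "m1' \<in> BB" "m2' \<in> BB"
  and h: "!!xi. xi ~= 0 ==> ft h xi = cr (m1' xi) * ft g xi" "!!xi. xi ~= 0 ==> ft h' xi = cr (m2' xi) * ft g xi"
  and m: "!!xi. xi ~= 0 ==> m xi = m1 xi * m1' xi + m2 xi * m2' xi"
  and b: "!!xi. <|m1 xi * m1' xi|> <= K * (1 + norm xi)" "!!xi. <|m2 xi * m2' xi|> <= K * (1 + norm xi)"
 shows "fmult m g x = fmult m1 h x + fmult m2 h' x"
proof -
 have "fmult m g x = fmult (%xi. m1 xi * m1' xi + m2 xi * m2' xi) g x" by (rule fmult_cong_off_0[OF g(1)]) (auto simp: m)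
 also have "... = fmult (%xi. m1 xi * m1' xi) g x + fmult (%xi. m2 xi * m2' xi) g x" by (rule fmult_add[OF g(1) _ _ b]) auto
 also have "fmult (%xi. m1 xi * m1' xi) g x = fmult m1 h x" by (rule fmult_comp[OF g(1,2) _ _ h(1), symmetric]) auto
 also have "fmult (%xi. m2 xi * m2' xi) g x = fmult m2 h' x" by (rule fmult_comp[OF g(1,3) _ _ h(2), symmetric]) auto
 finally show ?thesis .
qed

lemma mult_le_one_plus_norm:
 assumes "<|a|> <= A" "<|b|> <= B" "A * B <= K * (1 + norm xi)"
 shows "<|a * b|> <= K * (1 + norm (xi :: real^2))"
proof -
 have "0 <= A" using assms(1) by linarith
 then have "<|a|> * <|b|> <= A * B" by (intro mult_mono assms) auto
 then show ?thesis using assms(3) by (simp add: abs_mult)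
qed

text \<open>The addition formulas for sine and cosine on the Fourier side. The two versions for
  \<open>Cw\<close> differ in which factor carries the division by the frequency; each pair in
  \<open>Pw_group\<close> needs its own.\<close>

lemma group_law:
 assumes g: "adm g"
 shows "Cw (t - T) g x = Cw (- T) (Cw t g) x + Dw (- T) (Sw t g) x"
  "Sw (t - T) g x = Sw (- T) (Cw t g) x + Cw (- T) (Sw t g) x"
  "Dw (t - T) g x = Cw (- T) (Dw t g) x + Dw (- T) (Cw t g) x"
  "Cw (t - T) g x = Sw (- T) (Dw t g) x + Cw (- T) (Cw t g) x"
proof -
 note p = adm_propagators[OF g, where t=t]
 let ?K = "1 + <|T|> + <|t|>"
 have k: "0 <= norm xi * (<|T|> + <|t|>)" "1 <= ?K * (1 + norm xi)" "norm xi <= ?K * (1 + norm xi)" "<|T|> <= ?K * (1 + norm xi)" "<|t|> <= ?K * (1 + norm xi)" for xi :: "real^2"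
 proof -
  show 1: "0 <= norm xi * (<|T|> + <|t|>)" by simp
  have "?K * (1 + norm xi) = 1 + <|T|> + <|t|> + norm xi + norm xi * (<|T|> + <|t|>)" by (simp add: algebra_simps)
  then show "1 <= ?K * (1 + norm xi)" "norm xi <= ?K * (1 + norm xi)" "<|T|> <= ?K * (1 + norm xi)" "<|t|> <= ?K * (1 + norm xi)"
   using 1 norm_ge_zero[of xi] by linarith+
 qed
 note c = abs_cos_le_one abs_sin_le_one abs_norm_sin abs_sin_div
 have ss: "<|- norm xi * sin (r * norm xi) * (sin (q * norm xi) / norm xi)|> <= ?K * (1 + norm xi)" for xi :: "real^2" and r q
 proof -
  have "<|sin (r * norm xi)|> * <|sin (q * norm xi)|> <= 1 * 1" by (intro mult_mono abs_sin_le_one) auto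
  then have "<|- norm xi * sin (r * norm xi) * (sin (q * norm xi) / norm xi)|> <= 1" by (cases "xi = 0") (auto simp: abs_mult)
  with k(2)[of xi] show ?thesis by linarith
 qed
 have ss': "<|sin (q * norm xi) / norm xi * (- norm xi * sin (r * norm xi))|> <= ?K * (1 + norm xi)" for xi :: "real^2" and r q
  using ss[of xi r q] by (simp only: mult.commute)
 have cc: "<|cos (r * norm xi) * cos (q * norm xi)|> <= ?K * (1 + norm xi)" for xi :: "real^2" and r q
  by (rule mult_le_one_plus_norm[OF c(1) c(1)]) (use k in simp)
 have sc: "<|sin (- T * norm xi) / norm xi * cos (q * norm xi)|> <= ?K * (1 + norm xi)" "<|cos (q * norm xi) * (sin (t * norm xi) / norm xi)|> <= ?K * (1 + norm xi)" for xi :: "real^2" and q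
  by (rule mult_le_one_plus_norm[OF c(4) c(1)], use k in simp) (rule mult_le_one_plus_norm[OF c(1) c(4)], use k in simp)
 have cs: "<|cos (r * norm xi) * (- norm xi * sin (q * norm xi))|> <= ?K * (1 + norm xi)" "<|- norm xi * sin (q * norm xi) * cos (r * norm xi)|> <= ?K * (1 + norm xi)" for xi :: "real^2" and r q
  by (rule mult_le_one_plus_norm[OF c(1) c(3)], use k in simp) (rule mult_le_one_plus_norm[OF c(3) c(1)], use k in simp)
 have tr: "cos ((t - T) * norm xi) = cos (T * norm xi) * cos (t * norm xi) + sin (T * norm xi) * sin (t * norm xi)"
  "sin ((t - T) * norm xi) = sin (t * norm xi) * cos (T * norm xi) - cos (t * norm xi) * sin (T * norm xi)" for xi :: "real^2"
  by (simp_all add: left_diff_distrib cos_diff sin_diff)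
 show "Cw (t - T) g x = Cw (- T) (Cw t g) x + Dw (- T) (Sw t g) x" unfolding Cw_def[of "t - T"] Cw_def[of "- T"] Dw_def[of "- T"]
  by (rule fmult_add_comp[OF g p(1,2) _ _ _ _ _ p(4,5) _ cc ss]) (auto simp: tr)
 show "Sw (t - T) g x = Sw (- T) (Cw t g) x + Cw (- T) (Sw t g) x" unfolding Sw_def[of "t - T"] Cw_def[of "- T"] Sw_def[of "- T"]
  by (rule fmult_add_comp[OF g p(1,2) _ _ _ _ _ p(4,5) _ sc]) (auto simp: tr diff_divide_distrib, simp add: mult.commute)
 show "Dw (t - T) g x = Cw (- T) (Dw t g) x + Dw (- T) (Cw t g) x" unfolding Dw_def[of "t - T"] Cw_def[of "- T"] Dw_def[of "- T"]
  by (rule fmult_add_comp[OF g p(3,1) _ _ _ _ _ p(6,4) _ cs]) (auto simp: tr right_diff_distrib)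
 show "Cw (t - T) g x = Sw (- T) (Dw t g) x + Cw (- T) (Cw t g) x" unfolding Cw_def[of "t - T"] Cw_def[of "- T"] Sw_def[of "- T"]
  by (rule fmult_add_comp[OF g p(3,1) _ _ _ _ _ p(6,4) _ ss' cc]) (auto simp: tr)
qed

text \<open>Sine and cosine are bounded by 1, so the bounds are uniform in \<open>t\<close>; the
  division by \<open>norm xi\<close> in \<open>Sw\<close> accounts for the one derivative
  gained.\<close>

lemma Nsq_propagators:
 assumes g: "adm g"
 shows "Nsq (1 - s) (Sw t g) <= Nsq (- s) g" "Nsq sg (Cw t g) <= Nsq sg g"
proof -
 note p = adm_propagators[OF g, where t=t]
 show "Nsq (1 - s) (Sw t g) <= Nsq (- s) g" unfolding Nsq_def
 proof (rule nn_integral_mono_AE)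
  show "AE xi in lborel. EE (norm xi powr (2 * (1 - s)) * (cmod (ft (Sw t g) xi))^2) <= EE (norm xi powr (2 * - s) * (cmod (ft g xi))^2)"
   using AE_lborel_singleton[of "0::real^2"]
  proof eventually_elim
   case (elim xi)
   have "norm xi powr (2 * (1 - s)) = norm xi powr (2 * - s) * (norm xi)^2"
    using elim powr_add[of "norm xi" "2 * - s" 2] by (simp add: powr_numeral algebra_simps)
   then have "norm xi powr (2 * (1 - s)) * (cmod (ft (Sw t g) xi))^2 = norm xi powr (2 * - s) * (<|sin (t * norm xi)|>^2 * (cmod (ft g xi))^2)"
    using elim by (simp add: p(5) norm_mult norm_divide power_mult_distrib power_divide)
   also have "... <= norm xi powr (2 * - s) * (1 * (cmod (ft g xi))^2)"
    by (intro mult_left_mono mult_right_mono power_le_one) auto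
   finally show ?case by (simp add: ennreal_leI)
  qed
 qed
 show "Nsq sg (Cw t g) <= Nsq sg g" unfolding Nsq_def
 proof (rule nn_integral_mono_AE)
  show "AE xi in lborel. EE (norm xi powr (2 * sg) * (cmod (ft (Cw t g) xi))^2) <= EE (norm xi powr (2 * sg) * (cmod (ft g xi))^2)"
   using AE_lborel_singleton[of "0::real^2"]
  proof eventually_elim
   case (elim xi)
   have "(cmod (ft (Cw t g) xi))^2 = <|cos (t * norm xi)|>^2 * (cmod (ft g xi))^2" using elim by (simp add: p(4) norm_mult power_mult_distrib)
   also have "... <= 1 * (cmod (ft g xi))^2" by (intro mult_right_mono power_le_one) auto
   finally show ?case by (intro ennreal_leI mult_left_mono) auto
  qed
 qed
qed

lemma ft_plancherel:
 assumes "adm h" "(NN x. EE ((h x)^2)) <= EE A" "0 <= A"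
 shows "(NN xi. EE ((cmod (ft h xi))^2)) <= EE ((2 * pi)^2 * A)"
proof -
 have [measurable]: "(%x. cr (h x)) \<in> BB" using admD(1)[OF assms(1)] by simp
 have "(NN xi. EE ((cmod (ft h xi))^2)) = (NN xi. EE ((cmod (IF (%x. cr (h x)) xi))^2))"
  unfolding ft_IF[symmetric, of h "- _", simplified] by (simp add: ft_cnj)
 also have "... <= EE ((2 * pi)^2 * A)"
  by (rule IF_plancherel) (use assms cc_of_real admD(2,3)[OF assms(1)] in auto)
 finally show ?thesis .
qed

text \<open>Sobolev with \<open>sg = 1 - s\<close> places \<open>h\<close> in
  \<open>L^(2/s)\<close>, whose conjugate exponent is \<open>2 / (2 - s)\<close>.\<close>

lemma dual_estimate:
 assumes s: "0 < s" "s <= 1"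
 obtains C where "0 < C" "!!F h B A. F \<in> BB ==> (NN x. EE (<|F x|> powr (2 / (2 - s)))) <= EE (B powr (2 / (2 - s))) ==> 0 < B ==>
  adm h ==> Nsq (1 - s) h <= EE A ==> 0 < A ==> (NN x. EE <|F x * h x|>) <= EE (C * B * sqrt A)"
proof -
 obtain C where C: "0 < C" "!!a A. integrable lborel a ==> 0 < A ==> (NN xi. EE (norm xi powr (2 * (1 - s)) * (cmod (a xi))^2)) <= EE A ==>
  (NN x. EE (cmod (IF a x) powr (2 / (1 - (1 - s))))) <= EE ((C * sqrt A) powr (2 / (1 - (1 - s))))"
  using sobolev[of "1 - s"] s by auto
 have "(NN x. EE <|F x * h x|>) <= EE (2 * C * B * sqrt A)"
  if F: "F \<in> BB" "(NN x. EE (<|F x|> powr (2 / (2 - s)))) <= EE (B powr (2 / (2 - s)))" "0 < B"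
   and h: "adm h" "Nsq (1 - s) h <= EE A" "0 < A" for F h B A
 proof -
  have "(NN x. EE (<|h x|> powr (2 / s))) <= (NN x. EE (cmod (IF (ft h) x) powr (2 / s)))"
  proof (intro nn_integral_mono ennreal_leI powr_mono2)
   fix x
   have "1 * 1 <= (2 * pi) * (2 * pi)" using pi_ge_two by (intro mult_mono) auto
   then have "1 * <|h x|> <= (2 * pi)^2 * <|h x|>" by (intro mult_right_mono) (auto simp: power2_eq_square)
   then show "<|h x|> <= cmod (IF (ft h) x)" unfolding adm_inversion[OF h(1)] norm_mult norm_of_real by simp
  qed (use s in auto)
  also have "... <= EE ((C * sqrt A) powr (2 / s))"
   using C(2)[OF admD(6)[OF h(1)] h(3)] h(2) by (simp add: Nsq_def)
  finally have "(NN x. EE <|F x * h x|>) <= EE (2 * B * (C * sqrt A))"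
   by (intro hoelder[where r="2 / (2 - s)" and q="2 / s"] F) (use s C h admD(1)[OF h(1)] F in \<open>auto simp: field_simps\<close>)
  then show ?thesis by (simp add: mult_ac)
 qed
 then show thesis using that[of "2 * C"] C(1) by auto
qed

subsection \<open>Riesz representation of bounded functionals\<close>

text \<open>The witnesses in \<open>Ck\<close> could a priori change with the order; naming the
  partials through \<open>frechet_derivative\<close> shows that all orders share them.\<close>

lemma test_partial:
 assumes g: "test_fun g" and b: "b \<in> Basis"
 shows "test_fun (%x. frechet_derivative g (at x) b)" "(g has_derivative frechet_derivative g (at x)) (at x)"
proof -
 have D: "\<exists>D. (\<forall>x. (g has_derivative frechet_derivative g (at x)) (at x)) & Ck k (D b) & (\<forall>x. frechet_derivative g (at x) b = D b x)" for k
 proof -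
  have "Ck (Suc k) g" using g unfolding test_fun_def smooth_fun_def by blast
  then obtain D where d: "!!x. (g has_derivative (%h. \<Sum>b\<in>Basis. (h \<bullet> b) * D b x)) (at x)" and C: "!!b. b \<in> Basis ==> Ck k (D b)" by auto
  have f: "frechet_derivative g (at x) = (%h. \<Sum>b\<in>Basis. (h \<bullet> b) * D b x)" for x using frechet_derivative_at[OF d[of x]] by simp
  have "frechet_derivative g (at x) b = D b x" for x
  proof -
   have "(\<Sum>c\<in>Basis. (b \<bullet> c) * D c x) = (\<Sum>c\<in>Basis. if c = b then D c x else 0)" by (intro sum.cong) (auto simp: inner_Basis b)
   then show ?thesis unfolding f using b by simp
  qed
  then show ?thesis using d C[OF b] f by metis
 qed
 show d: "(g has_derivative frechet_derivative g (at x)) (at x)" for x using D[of 0] by blast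
 have "Ck k (%x. frechet_derivative g (at x) b)" for k using D[of k] by (auto simp: fun_eq_iff[symmetric])
 moreover have "{x. frechet_derivative g (at x) b ~= 0} \<subseteq> closure {x. g x ~= 0}"
 proof (rule ccontr)
  assume "\<not> ?thesis"
  then obtain x where x: "frechet_derivative g (at x) b ~= 0" "x \<in> - closure {x. g x ~= 0}" by blast
  have "((%_. 0) has_derivative (%_. 0)) (at x)" by (rule has_derivative_const)
  then have "(g has_derivative (%_. 0)) (at x)"
  proof (rule has_derivative_transform_within_open[OF _ _ x(2)])
   show "0 = g y" if "y \<in> - closure {x. g x ~= 0}" for y using that closure_subset[of "{x. g x ~= 0}"] by (metis (mono_tags, lifting) Compl_iff mem_Collect_eq subsetD)
  qed (simp add: open_Compl)
  then have "frechet_derivative g (at x) = (%_. 0)" using frechet_derivative_at by metis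
  then show False using x by simp
 qed
 ultimately show "test_fun (%x. frechet_derivative g (at x) b)"
  using g bounded_subset[OF bounded_closure] unfolding test_fun_def smooth_fun_def by blast
qed

lemma test_cc: "test_fun g ==> CO UNIV g" "test_fun g ==> bounded {x. g x ~= 0}"
 unfolding test_fun_def smooth_fun_def by (metis Ck.simps(1)) simp

lemma vec2_shift: "vec2 (s, y) = vec2 (0, y) + s *\<^sub>R axis 1 1" "vec2 (x, s) = vec2 (x, 0) + s *\<^sub>R axis 2 1"
 by (auto simp: vec_eq_iff forall_2 axis_def)

lemma vec2_DERIV:
 assumes d: "!!x. (g has_derivative g' x) (at x)"
 shows "((%s. g (vec2 (s, y))) hrd g' (vec2 (x, y)) (axis 1 1)) (at x)"
  "((%s. g (vec2 (x, s))) hrd g' (vec2 (x, y)) (axis 2 1)) (at y)"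
proof -
 have l: "g' z (h *\<^sub>R v) = g' z v * h" for z h v
  using linear_scale[OF has_derivative_linear[OF d[of z]]] by simp
 have "((%s. vec2 (0, y) + s *\<^sub>R axis 1 1) has_derivative (%h. h *\<^sub>R axis 1 1)) (at x)"
  "((%s. vec2 (x, 0) + s *\<^sub>R axis 2 1) has_derivative (%h. h *\<^sub>R axis 2 1)) (at y)"
  by (auto intro!: derivative_eq_intros)
 from has_derivative_compose[OF this(1) d] has_derivative_compose[OF this(2) d]
 show "((%s. g (vec2 (s, y))) hrd g' (vec2 (x, y)) (axis 1 1)) (at x)"
  "((%s. g (vec2 (x, s))) hrd g' (vec2 (x, y)) (axis 2 1)) (at y)"
  unfolding has_field_derivative_def by (simp_all only: l vec2_shift[symmetric])
qed

lemma integral_box_real2: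
 fixes f :: "real^2 => real"
 assumes f: "CO UNIV f" and R: "!!x. R < norm x ==> f x = 0"
 shows "(LL x. f x) = integral (sq_box R) (%z. f (vec2 (fst z, snd z)))"
proof -
 have "norm (vec2 z) > R" if "z \<notin> sq_box R" for z
  using that component_le_norm_cart[of "vec2 z" 1] component_le_norm_cart[of "vec2 z" 2] unfolding in_sq_box by auto
 moreover have "CO S (%z. f (vec2 z))" for S by (rule continuous_on_compose2[OF f vec2_cont]) auto
 ultimately show ?thesis
  using integral_vec2(1)[OF borel_measurable_continuous_onI[OF f]] integral_sq_box_lborel(2)[of R "%z. f (vec2 z)"] R by simp
qed

lemma ft_partial:
 assumes g: "test_fun g"
 shows "cmod (ft (%x. frechet_derivative g (at x) (axis i 1)) xi) = <|xi $ i|> * cmod (ft g xi)"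
proof -
 define gi where "gi = (%x. frechet_derivative g (at x) (axis i 1))"
 have b: "axis i (1::real) \<in> Basis" by (auto simp: Basis_vec_def)
 note tg = test_cc[OF g]
 have ti: "CO UNIV gi" "bounded {x. gi x ~= 0}" unfolding gi_def by (fact test_cc[OF test_partial(1)[OF g b]])+
 obtain r1 r2 where r: "{x. g x ~= 0} \<subseteq> ball 0 r1" "{x. gi x ~= 0} \<subseteq> ball 0 r2"
  using bounded_subset_ballD[OF tg(2), of 0] bounded_subset_ballD[OF ti(2), of 0] by blast
 define R where "R = max 1 (max r1 r2)"
 have z: "g x = 0" "gi x = 0" if "R <= norm x" for x using r that by (force simp: R_def)+
 \<comment> \<open>Integration by parts on a box beyond the support. The free phase \<open>c\<close>
   handles both components of the transform: \<open>c = 0\<close> and \<open>c = pi/2\<close> give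
   the cosine and the sine part.\<close>
 have key: "(LL x. cos (xi \<bullet> x + c) * gi x) = xi $ i * (LL x. sin (xi \<bullet> x + c) * g x)" for c
 proof -
  have ct: "CO UNIV (%x. cos (xi \<bullet> x + c) * gi x)" "CO UNIV (%x. sin (xi \<bullet> x + c) * g x)"
   by (intro continuous_intros tg ti)+
  let ?q = "%x y. cos (xi \<bullet> vec2 (x, y) + c) * g (vec2 (x, y))"
  let ?q' = "%x y. cos (xi \<bullet> vec2 (x, y) + c) * gi (vec2 (x, y)) - xi $ i * (sin (xi \<bullet> vec2 (x, y) + c) * g (vec2 (x, y)))"
  note d = vec2_DERIV[OF test_partial(2)[OF g b]]
  have cv: "CO S (%z. f (vec2 (fst z, snd z)))" if "CO UNIV f" for S and f :: "real^2 => real"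
   using continuous_on_compose2[OF that vec2_cont, of S] by simp
  have c': "CO UNIV (%z. ?q' $$ z)" by (intro continuous_on_diff cv[OF ct(1)] continuous_on_mult[OF continuous_on_const cv[OF ct(2)]])
  have R0: "0 <= R" by (simp add: R_def)
  have nv: "R <= norm (vec2 (a, b))" if "<|a|> = R | <|b|> = R" for a b
   using that component_le_norm_cart[of "vec2 (a, b)" 1] component_le_norm_cart[of "vec2 (a, b)" 2] by auto
  have "integral (sq_box R) (%z. ?q' $$ z) = 0"
  proof (cases "i = 1")
   case True
   have dq: "((%s. ?q s y) hrd ?q' x y) (at x)" for x y
    by (rule DERIV_cong, (rule derivative_intros d(1))+, simp add: inner_2, (rule derivative_intros d(1))+) (simp add: True gi_def inner_2)
   show ?thesis by (rule integral_dx_zero[where q="?q"]) (use dq c' R0 z nv in auto)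
  next
   case False
   then have i: "i = 2" using exhaust_2 by blast
   have dq: "((%s. ?q x s) hrd ?q' x y) (at y)" for x y
    by (rule DERIV_cong, (rule derivative_intros d(2))+, simp add: inner_2, (rule derivative_intros d(2))+) (simp add: i gi_def inner_2)
   show ?thesis by (rule integral_dy_zero[where q="?q"]) (use dq c' R0 z nv in auto)
  qed
  also have "integral (sq_box R) (%z. ?q' $$ z) = integral (sq_box R) (%z. cos (xi \<bullet> vec2 (fst z, snd z) + c) * gi (vec2 (fst z, snd z)))
   - xi $ i * integral (sq_box R) (%z. sin (xi \<bullet> vec2 (fst z, snd z) + c) * g (vec2 (fst z, snd z)))"
   by (subst integral_diff[OF integrable_continuous[OF cv[OF ct(1)]] integrable_continuous[OF continuous_on_mult[OF continuous_on_const cv[OF ct(2)]]]]) simp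
  also have "... = (LL x. cos (xi \<bullet> x + c) * gi x) - xi $ i * (LL x. sin (xi \<bullet> x + c) * g x)"
   by (subst (1 2) integral_box_real2[of _ R, symmetric]) (use ct z in auto)
  finally show ?thesis by simp
 qed
 have c: "integrable lborel (%x. cr (g x))" "integrable lborel (%x. cr (gi x))" by (intro cc_of_real tg ti)+
 have ri: "ft f xi = Complex (LL x. cos (xi \<bullet> x) * f x) (- (LL x. sin (xi \<bullet> x) * f x))" if f: "integrable lborel (%x. cr (f x))" for f
 proof -
  have i: "integrable lborel (%x. cis (- (xi \<bullet> x)) * cr (f x))" by (rule integrable_cis_mult[OF f]) measurable
  show ?thesis unfolding ft_def complex_eq_iff using integral_Re[OF i] integral_Im[OF i] by simp
 qed
 have "ft gi xi = \<i> * cr (xi $ i) * ft g xi"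
  unfolding ri[OF c(1)] ri[OF c(2)] using key[of 0] key[of "pi/2"] by (simp add: complex_eq_iff cos_add sin_add)
 then show ?thesis unfolding gi_def[symmetric] by (simp add: norm_mult)
qed

text \<open>Each partial derivative of \<open>g\<close> trades for one factor \<open>xi $ i\<close>,
  and the transform of any test function is bounded by its \<open>L^1\<close> norm; induction gives
  every power of decay.\<close>

lemma test_adm:
 assumes g: "test_fun g"
 shows "adm g"
proof -
 have ib: "cmod (ft g xi) <= (LL x. <|g x|>)" if "test_fun g" for g xi
  unfolding ft_IF using IF_bound[OF cc_of_real[OF test_cc[OF that]]] by simp
 have k: "\<exists>K. \<forall>xi. <|xi $ i|> ^ k * cmod (ft g xi) <= K" if "test_fun g" for g k i
  using that
 proof (induction k arbitrary: g)
  case (Suc k)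
  have b: "axis i (1::real) \<in> Basis" by (auto simp: Basis_vec_def)
  from Suc.IH[OF test_partial(1)[OF Suc.prems b]] show ?case unfolding ft_partial[OF Suc.prems] by (simp add: mult_ac)
 qed (use ib in auto)
 have "\<exists>K. \<forall>xi. norm xi ^ k * cmod (ft g xi) <= K" for k
 proof -
  obtain K1 K2 where K: "!!xi. <|xi $ 1|> ^ k * cmod (ft g xi) <= K1" "!!xi. <|xi $ 2|> ^ k * cmod (ft g xi) <= K2" using k[OF g, of 1 k] k[OF g, of 2 k] by blast
  have "norm xi ^ k * cmod (ft g xi) <= 2 ^ k * (K1 + K2)" for xi
  proof -
   have "norm xi <= 2 * max <|xi $ 1|> <|xi $ 2|>" using norm_le_l1_cart[of xi] by (simp add: sum_2)
   then have "norm xi ^ k <= 2 ^ k * max <|xi $ 1|> <|xi $ 2|> ^ k" unfolding power_mult_distrib[symmetric] by (rule power_mono) simp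
   also have "... <= 2 ^ k * (<|xi $ 1|> ^ k + <|xi $ 2|> ^ k)" by (intro mult_left_mono) (auto simp: max_def)
   finally have "norm xi ^ k * cmod (ft g xi) <= 2 ^ k * (<|xi $ 1|> ^ k + <|xi $ 2|> ^ k) * cmod (ft g xi)" by (rule mult_right_mono) simp
   also have "... = 2 ^ k * (<|xi $ 1|> ^ k * cmod (ft g xi) + <|xi $ 2|> ^ k * cmod (ft g xi))" by (simp add: algebra_simps)
   also have "... <= 2 ^ k * (K1 + K2)" by (intro mult_left_mono add_mono K) auto
   finally show ?thesis .
  qed
  then show ?thesis by blast
 qed
 moreover have "ft g \<in> BB" using borel_measurable_continuous_onI[OF test_cc(1)[OF g]] by measurable
 ultimately show ?thesis unfolding adm_def rapid_def using test_cc[OF g] by blast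
qed

lemma adm_lin:
 assumes h: "adm h" "adm k"
 shows "adm (%x. h x + c * k x)"
proof -
 note [measurable] = admD(1)[OF h(1)] admD(1)[OF h(2)]
 have i: "integrable lborel (%x. cr (h x))" "integrable lborel (%x. cr (k x))" using cc_of_real admD(2,3) h by blast+
 have f: "ft (%x. h x + c * k x) = (%xi. ft h xi + cr c * ft k xi)"
  unfolding ft_IF[abs_def] of_real_add of_real_mult using IF_add[OF i(1) integrable_mult_right[OF i(2)]] IF_cmult by auto
 have "rapid (ft (%x. h x + c * k x))" unfolding rapid_def f
 proof (intro conjI allI)
  fix n
  obtain A B where A: "!!xi. norm xi ^ n * cmod (ft h xi) <= A" and B: "!!xi. norm xi ^ n * cmod (ft k xi) <= B"
   using admD(4)[OF h(1)] admD(4)[OF h(2)] unfolding rapid_def by metis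
  have "norm xi ^ n * cmod (ft h xi + cr c * ft k xi) <= A + <|c|> * B" for xi
  proof -
   have "norm xi ^ n * cmod (ft h xi + cr c * ft k xi) <= norm xi ^ n * (cmod (ft h xi) + <|c|> * cmod (ft k xi))"
    by (intro mult_left_mono norm_triangle_le) (auto simp: norm_mult)
   also have "... = norm xi ^ n * cmod (ft h xi) + <|c|> * (norm xi ^ n * cmod (ft k xi))" by (simp add: algebra_simps)
   also have "... <= A + <|c|> * B" by (intro add_mono mult_left_mono A B) auto
   finally show ?thesis .
  qed
  then show "\<exists>K. \<forall>xi. norm xi ^ n * cmod (ft h xi + cr c * ft k xi) <= K" by blast
 qed measurable
 moreover have "bounded {x. h x + c * k x ~= 0}"
  by (rule bounded_subset[OF bounded_Un[THEN iffD2, OF conjI[OF admD(3)[OF h(1)] admD(3)[OF h(2)]]]]) auto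
 moreover have "CO UNIV (%x. h x + c * k x)" by (intro continuous_intros admD(2) h)
 ultimately show ?thesis unfolding adm_def by blast
qed

lemma powr_neg_exp_lim: "(%n. (1/2)^n * C) ----> (0::real)"
 using tendsto_mult_left_zero[OF LIMSEQ_power_zero[of "1/2::real"], of C] by simp

text \<open>Riesz representation in \<open>L\<^sup>2(w)\<close>: a minimising sequence of \<open>\<integral>g\<^sup>2w/2 - \<Lambda> g\<close> converges almost everywhere.\<close>
lemma riesz_adm:
 fixes \<Lambda> :: "(real^2 => real) => real"
 assumes w: "CO UNIV w" "!!x. 0 < w x"
  and lin: "!!h k c. adm h ==> adm k ==> \<Lambda> (%x. h x + c * k x) = \<Lambda> h + c * \<Lambda> k"
  and bd: "!!h. adm h ==> (\<Lambda> h)^2 <= C * (LL x. (h x)^2 * w x)" and C: "0 < C"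
 obtains f where "f \<in> BB" "integrable lborel (%x. (f x)^2 * w x)" "!!h. adm h ==> \<Lambda> h = (LL x. f x * h x * w x)"
proof -
 have [measurable]: "w \<in> BB" by (rule borel_measurable_continuous_onI[OF w(1)])
 note am = admD(1)
 define B where "B = (%h k. (LL x. h x * k x * w x))"
 have Bi: "integrable lborel (%x. h x * k x * w x)" if "adm h" "adm k" for h k
 proof (rule cc_integrable)
  show "CO UNIV (%x. h x * k x * w x)" by (intro continuous_on_mult admD(2)[OF that(1)] admD(2)[OF that(2)] w(1))
 qed (auto intro!: bounded_subset[OF admD(3)[OF that(1)]])
 have Bn: "0 <= B h h" for h unfolding B_def using less_imp_le[OF w(2)] by (intro Bochner_Integration.integral_nonneg) auto
 have Blin: "B (%x. h x + c * k x) (%x. h x + c * k x) = B h h + 2 * c * B h k + c^2 * B k k" if "adm h" "adm k" for h k c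
 proof -
  have "(%x. (h x + c * k x) * (h x + c * k x) * w x) = (%x. h x * h x * w x + 2 * c * (h x * k x * w x) + c^2 * (k x * k x * w x))" by (simp add: fun_eq_iff power2_eq_square algebra_simps)
  then show ?thesis unfolding B_def using Bi that by simp
 qed
 define J where "J = (%h. B h h / 2 - \<Lambda> h)"
 have bdB: "(\<Lambda> h)^2 <= C * B h h" if "adm h" for h using bd[OF that] by (simp add: B_def power2_eq_square)
 have J0: "- C / 2 <= J h" if "adm h" for h
 proof -
  have "(2 * \<Lambda> h)^2 <= (C + B h h)^2" using bdB[OF that] zero_le_power2[of "C - B h h"] by (simp add: power2_eq_square algebra_simps)
  then have "2 * \<Lambda> h <= C + B h h" by (rule power2_le_imp_le) (use C Bn in simp)
  then show ?thesis by (simp add: J_def field_simps)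
 qed
 have ne: "adm (%_. 0)" unfolding adm_def rapid_def ft_def by auto
 define m where "m = (INF h\<in>{h. adm h}. J h)"
 have bb: "bdd_below (J ` {h. adm h})" using J0 by (auto intro!: bdd_belowI[of _ "- C / 2"])
 have mJ: "m <= J h" if "adm h" for h unfolding m_def using that bb by (intro cINF_lower) auto
 have "\<exists>h. adm h & J h < m + (1/4)^n" for n :: nat
  using cINF_less_iff[OF _ bb, of "m + (1/4)^n"] ne unfolding m_def by auto
 then obtain g where g: "!!n. adm (g n)" "!!n. J (g n) < m + (1/4)^n" by metis
 note [measurable] = am[OF g(1)]
 have mono4: "(1/4::real)^k <= (1/4)^n" if "n <= k" for n k :: nat using that by (intro power_decreasing) auto
 have cauchy: "B (%x. g k x - g n x) (%x. g k x - g n x) <= 8 * (1/4)^n" if nk: "n <= k" for n k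
 proof -
  \<comment> \<open>The parallelogram law: the value of \<open>J\<close> at the midpoint of
    \<open>g n\<close> and \<open>g k\<close> is at least \<open>m\<close>, while both endpoints
    exceed \<open>m\<close> by less than \<open>(1/4)^n\<close>, so a quarter of
    \<open>B a a\<close> is at most \<open>2 * (1/4)^n\<close>.\<close>
  define a where "a = (%x. g n x + (-1) * g k x)"
  have a: "adm a" "adm (%x. g n x + (-1/2) * a x)" unfolding a_def by (intro adm_lin g)+
  have e: "g k = (%x. g n x + (-1) * a x)" "(%x. g k x - g n x) = (%x. 0 + (-1) * a x)" by (auto simp: a_def)
  have "J (g k) = B (g n) (g n) / 2 - B (g n) a + B a a / 2 - \<Lambda> (g n) + \<Lambda> a"
   unfolding J_def e(1) lin[OF g(1) a(1)] Blin[OF g(1) a(1)] by simp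
  moreover have "J (%x. g n x + (-1/2) * a x) = B (g n) (g n) / 2 - B (g n) a / 2 + B a a / 8 - \<Lambda> (g n) + \<Lambda> a / 2"
   unfolding J_def lin[OF g(1) a(1)] Blin[OF g(1) a(1)] by (simp add: power2_eq_square)
  moreover have "J (g n) = B (g n) (g n) / 2 - \<Lambda> (g n)" by (simp add: J_def)
  ultimately have "B a a <= 8 * (1/4)^n" using mJ[OF a(2)] g(2)[of n] g(2)[of k] mono4[OF nk] by linarith
  then show ?thesis unfolding e(2) using Blin[OF ne a(1), of "-1"] by (simp add: B_def)
 qed
 have nnB: "(NN x. EE ((g k x - g n x)^2 * w x)) <= EE (8 * (1/4)^n)" if "n <= k" for n k
 proof -
  have d: "adm (%x. g k x - g n x)" using adm_lin[OF g(1) g(1), of k "-1" n] by simp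
  have "(NN x. EE ((g k x - g n x)^2 * w x)) = EE (B (%x. g k x - g n x) (%x. g k x - g n x))"
   unfolding B_def using Bi[OF d d] less_imp_le[OF w(2)] by (subst nn_integral_eq_integral[symmetric]) (auto simp: power2_eq_square)
  then show ?thesis using cauchy[OF that] by (simp add: ennreal_leI)
 qed
 \<comment> \<open>The rate \<open>(1/4)^n\<close> is fast enough to insert the weight
   \<open>2^n\<close> and sum. Almost everywhere the increments are then dominated by a geometric
   series with ratio \<open>sqrt (1/2)\<close>.\<close>
 have AE: "AE x in lborel. convergent (%n. g n x)"
 proof -
  have "(NN x. (\<Sum>n. EE (2^n * ((g (Suc n) x - g n x)^2 * w x)))) = (\<Sum>n. (NN x. EE (2^n * ((g (Suc n) x - g n x)^2 * w x))))"
   by (rule nn_integral_suminf) measurable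
  also have "... <= (\<Sum>n. EE (8 * (1/2)^n))"
  proof (intro suminf_le summableI)
   fix n
   have "(NN x. EE (2^n * ((g (Suc n) x - g n x)^2 * w x))) = EE (2^n) * (NN x. EE ((g (Suc n) x - g n x)^2 * w x))"
    using less_imp_le[OF w(2)] by (subst nn_integral_cmult[symmetric]) (auto simp: ennreal_mult intro!: nn_integral_cong)
   also have "... <= EE (2^n) * EE (8 * (1/4)^n)" by (intro mult_left_mono nnB) auto
   also have "... = EE (8 * (1/2)^n)" by (simp add: ennreal_mult[symmetric] power_divide power_mult_distrib[symmetric] field_simps)
   finally show "(NN x. EE (2^n * ((g (Suc n) x - g n x)^2 * w x))) <= EE (8 * (1/2)^n)" .
  qed
  also have "... < \<infinity>" by (subst suminf_ennreal2) (auto intro!: summable_mult summable_geometric)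
  finally have "AE x in lborel. (\<Sum>n. EE (2^n * ((g (Suc n) x - g n x)^2 * w x))) ~= \<infinity>"
   by (intro nn_integral_noteq_infinite) auto
  then show ?thesis
  proof eventually_elim
   case (elim x)
   then obtain S where S: "0 <= S" "(\<Sum>n. EE (2^n * ((g (Suc n) x - g n x)^2 * w x))) = EE S" by (cases "\<Sum>n. EE (2^n * ((g (Suc n) x - g n x)^2 * w x))") auto
   have "norm (g (Suc n) x - g n x) <= sqrt (S / w x) * (sqrt (1/2))^n" for n
   proof -
    have "EE (2^n * ((g (Suc n) x - g n x)^2 * w x)) <= EE S"
     unfolding S(2)[symmetric] using sum_le_suminf[of "%n. EE (2^n * ((g (Suc n) x - g n x)^2 * w x))" "{n}"] by simp
    then have "2^n * ((g (Suc n) x - g n x)^2 * w x) <= S" using S by simp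
    then have "(g (Suc n) x - g n x)^2 <= S / w x * (1/2)^n" using w(2)[of x] by (simp add: field_simps power_divide)
    then have "sqrt ((g (Suc n) x - g n x)^2) <= sqrt (S / w x * (1/2)^n)" by (rule real_sqrt_le_mono)
    then show ?thesis unfolding real_sqrt_abs real_sqrt_mult real_sqrt_power[of "1/2"] by simp
   qed
   moreover have "summable (%n. sqrt (S / w x) * (sqrt (1/2))^n)" by (intro summable_mult summable_geometric) (simp add: real_sqrt_divide)
   ultimately have "summable (%n. g (Suc n) x - g n x)" by (rule summable_comparison_test'[rotated])
   then have "convergent (%n. \<Sum>i<n. g (Suc i) x - g i x)" by (simp add: summable_iff_convergent)
   then have "convergent (%n. g n x - g 0 x)" unfolding sum_lessThan_telescope[of "%i. g i x"] .
   from convergent_add[OF this convergent_const[of "g 0 x"]] show ?case by simp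
  qed
 qed
 define f where "f = (%x. lim (%n. g n x))"
 have [measurable]: "f \<in> BB" unfolding f_def by (rule borel_measurable_lim_metric) measurable
 have fat: "(NN x. EE ((f x - g n x)^2 * w x)) <= EE (8 * (1/4)^n)" for n
 proof -
  have "(NN x. EE ((f x - g n x)^2 * w x)) = (NN x. liminf (%k. EE ((g k x - g n x)^2 * w x)))"
  proof (rule nn_integral_cong_AE)
   show "AE x in lborel. EE ((f x - g n x)^2 * w x) = liminf (%k. EE ((g k x - g n x)^2 * w x))"
    using AE
   proof eventually_elim
    case (elim x)
    then have "(%k. g k x) ----> f x" unfolding f_def by (simp add: convergent_LIMSEQ_iff)
    then have "(%k. EE ((g k x - g n x)^2 * w x)) ----> EE ((f x - g n x)^2 * w x)" by (intro tendsto_intros)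
    then show ?case by (metis lim_imp_Liminf sequentially_bot)
   qed
  qed
  also have "... <= liminf (%k. (NN x. EE ((g k x - g n x)^2 * w x)))" by (rule nn_integral_liminf) measurable
  also have "... <= liminf (%k. EE (8 * (1/4)^n))"
   by (rule Liminf_mono) (auto simp: eventually_sequentially intro!: exI[of _ n] nnB)
  finally show ?thesis by (simp add: Liminf_const)
 qed
 have fgi: "integrable lborel (%x. (f x - g n x)^2 * w x)" "(LL x. (f x - g n x)^2 * w x) <= 8 * (1/4)^n" for n
  by (rule nn_integral_le_integrable[OF _ _ fat]; use less_imp_le[OF w(2)] in simp)+
 have f2: "integrable lborel (%x. (f x)^2 * w x)"
 proof (rule Bochner_Integration.integrable_bound)
  show "integrable lborel (%x. 2 * ((f x - g 0 x)^2 * w x) + 2 * (g 0 x * g 0 x * w x))" using fgi Bi[OF g(1) g(1)] by (intro Bochner_Integration.integrable_add integrable_mult_right) auto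
  show "AE x in lborel. norm ((f x)^2 * w x) <= norm (2 * ((f x - g 0 x)^2 * w x) + 2 * (g 0 x * g 0 x * w x))"
  proof (rule AE_I2)
   fix x
   have "(f x)^2 <= 2 * (f x - g 0 x)^2 + 2 * (g 0 x)^2" using zero_le_power2[of "f x - 2 * g 0 x"] by (simp add: power2_eq_square algebra_simps)
   then have "(f x)^2 * w x <= (2 * (f x - g 0 x)^2 + 2 * (g 0 x)^2) * w x" using w(2)[of x] by (intro mult_right_mono) auto
   also have "... = 2 * ((f x - g 0 x)^2 * w x) + 2 * (g 0 x * g 0 x * w x)" by (simp add: power2_eq_square distrib_right mult.assoc)
   finally show "norm ((f x)^2 * w x) <= norm (2 * ((f x - g 0 x)^2 * w x) + 2 * (g 0 x * g 0 x * w x))" using w(2)[of x] by simp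
  qed
 qed simp
 have rep: "\<Lambda> h = (LL x. f x * h x * w x)" if h: "adm h" for h
 proof -
  note [measurable] = am[OF h]
  let ?e = "%n. (1/2::real)^n"
  \<comment> \<open>The Euler-Lagrange equation holds approximately: \<open>g n\<close> is within
    \<open>(1/4)^n\<close> of the infimum, and variations by \<open>h\<close> with coefficients
    \<open>(1/2)^n\<close> and \<open>- (1/2)^n\<close> leave an error of order
    \<open>(1/2)^n\<close>.\<close>
  have v: "<|B (g n) h - \<Lambda> h|> <= ?e n * (1 + B h h / 2)" for n
  proof -
   have "m <= J (g n) + c * (B (g n) h - \<Lambda> h) + c^2 * B h h / 2" for c
    using mJ[OF adm_lin[OF g(1) h], of n c] unfolding J_def lin[OF g(1) h] Blin[OF g(1) h] by (simp add: algebra_simps)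
   then have p: "- (c * (B (g n) h - \<Lambda> h)) <= (1/4)^n + c^2 * B h h / 2" for c using g(2)[of n] by (smt (verit))
   have q: "(1/4::real)^n = ?e n * ?e n" by (simp add: power_mult_distrib[symmetric])
   have "?e n * <|B (g n) h - \<Lambda> h|> <= ?e n * (?e n * (1 + B h h / 2))"
    using p[of "?e n"] p[of "- ?e n"] unfolding q by (simp add: abs_if power2_eq_square algebra_simps)
   then show ?thesis by simp
  qed
  have i: "integrable lborel (%x. (f x - g n x) * h x * w x)" and b: "<|(LL x. (f x - g n x) * h x * w x)|> <= ?e n * (4 + B h h / 2)" for n
  proof -
   let ?k = "%x. 2^n / 2 * ((f x - g n x)^2 * w x) + ?e n / 2 * (h x * h x * w x)"
   have ki: "integrable lborel ?k" using fgi Bi[OF h h] by (intro Bochner_Integration.integrable_add integrable_mult_right) auto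
   have kb: "norm ((f x - g n x) * h x * w x) <= ?k x" for x
   proof -
    define r where "r = f x - g n x"
    have "2 * (<|r|> * <|h x|>) <= 2^n * r^2 + ?e n * (h x)^2"
    proof -
     have "0 <= (2^n * <|r|> - <|h x|>)^2 * ?e n" by simp
     also have "(2^n * <|r|> - <|h x|>)^2 * ?e n = (2^n * ?e n) * (2^n * r^2) - 2 * (2^n * ?e n) * (<|r|> * <|h x|>) + ?e n * (h x)^2"
      by (simp add: power2_diff power_mult_distrib algebra_simps) (simp add: power2_eq_square)
     also have "2^n * ?e n = 1" by (simp add: power_mult_distrib[symmetric])
     finally show ?thesis by simp
    qed
    then have "(<|r|> * <|h x|>) * w x <= (2^n / 2 * r^2 + ?e n / 2 * (h x)^2) * w x" using w(2)[of x] by (intro mult_right_mono) auto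
    then show ?thesis unfolding r_def[symmetric] using w(2)[of x] by (simp add: abs_mult power2_eq_square algebra_simps)
   qed
   show i: "integrable lborel (%x. (f x - g n x) * h x * w x)"
    by (rule Bochner_Integration.integrable_bound[OF ki]) (use kb in \<open>auto intro!: AE_I2 order_trans[OF _ abs_ge_self]\<close>)
   have "<|(LL x. (f x - g n x) * h x * w x)|> <= integral\<^sup>L lborel ?k"
    using Bochner_Integration.integral_norm_bound_integral[OF i ki kb] by simp
   also have "... = 2^n / 2 * (LL x. (f x - g n x)^2 * w x) + ?e n / 2 * B h h" using fgi Bi[OF h h] by (simp add: B_def)
   also have "... <= 2^n / 2 * (8 * (1/4)^n) + ?e n / 2 * B h h" by (intro add_mono mult_left_mono fgi) auto
   also have "2^n / 2 * (8 * (1/4)^n) = 4 * ?e n" by (simp add: power_mult_distrib[symmetric] power_divide field_simps)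
   finally show "<|(LL x. (f x - g n x) * h x * w x)|> <= ?e n * (4 + B h h / 2)" by (simp add: algebra_simps)
  qed
  have s: "(LL x. f x * h x * w x) - \<Lambda> h = (LL x. (f x - g n x) * h x * w x) + (B (g n) h - \<Lambda> h)" for n
  proof -
   have "(LL x. f x * h x * w x) = (LL x. (f x - g n x) * h x * w x + g n x * h x * w x)" by (intro Bochner_Integration.integral_cong) (auto simp: algebra_simps)
   then show ?thesis using i[of n] Bi[OF g(1) h, of n] by (simp add: B_def)
  qed
  have "<|(LL x. f x * h x * w x) - \<Lambda> h|> <= ?e n * (5 + B h h)" for n
   using v[of n] b[of n] s[of n] by (simp add: distrib_left)
  then have "<|(LL x. f x * h x * w x) - \<Lambda> h|> <= 0"
   by (intro LIMSEQ_le_const[OF powr_neg_exp_lim]) auto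
  then show ?thesis by simp
 qed
 show thesis by (rule that[OF _ f2 rep]) auto
qed

subsection \<open>Duhamel pairing and scattering\<close>

lemma cont3_real2: "cont3 f ==> CO S (%x::real^2. f t (x $ 1) (x $ 2))"
 by (erule cont3_comp) (intro continuous_intros)+

lemma W_dX_zero:
 assumes a: "amp a" and z: "!!x y. rh < sqrt (x^2 + y^2) ==> W a t x y = 0" and xy: "rh < sqrt (x^2 + y^2)"
 shows "W (dX 1 a) t x y = 0" "W (dX 2 a) t x y = 0"
proof -
 have "((%_. 0) hrd W (dX 1 a) t x y) (at x)"
  by (rule has_field_derivative_transform_within_open[OF DERIV_W(2)[OF a], of "{s. rh < sqrt (s^2 + y^2)}"])
   (use z xy in \<open>auto intro!: open_Collect_less continuous_intros\<close>)
 moreover have "((%_. 0) hrd W (dX 2 a) t x y) (at y)"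
  by (rule has_field_derivative_transform_within_open[OF DERIV_W(3)[OF a], of "{s. rh < sqrt (x^2 + s^2)}"])
   (use z xy in \<open>auto intro!: open_Collect_less continuous_intros\<close>)
 ultimately show "W (dX 1 a) t x y = 0" "W (dX 2 a) t x y = 0" using DERIV_unique DERIV_const by blast+
qed

lemma W_plancherel:
 assumes a: "amp a" and A: "(NN xi. EE ((cmod (a xi))^2)) <= EE A" "0 <= A"
 shows "(NN z. EE ((W a 0 $$ z)^2)) <= EE ((2 * pi)^2 * A)"
proof -
 note [measurable] = amp_meas[OF a]
 have "(NN z. EE ((W a 0 $$ z)^2)) <= (NN z. EE ((cmod (IF a (vec2 z)))^2))"
 proof (intro nn_integral_mono ennreal_leI)
  fix z
  have "W a 0 $$ z = Re (IF a (vec2 z))" by (simp add: W_IF)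
  then show "(W a 0 $$ z)^2 <= (cmod (IF a (vec2 z)))^2" using power_mono[OF abs_Re_le_cmod[of "IF a (vec2 z)"], of 2] by simp
 qed
 also have "... = (NN x. EE ((cmod (IF a x))^2))" by (rule nn_integral_vec2[symmetric]) measurable
 also have "... <= EE ((2 * pi)^2 * A)" by (rule IF_plancherel[OF amp_integrable[OF a] A])
 finally show ?thesis .
qed

text \<open>The weight puts \<open>h\<close> in \<open>L^1\<close>, since
  \<open>(1 + norm x) powr (- 3)\<close> is integrable in the plane, so the transform is bounded and
  low frequencies are harmless for \<open>s < 1\<close>; high frequencies are left to Plancherel.
  This is what allows \<open>L0\<close> to be represented by a function.\<close>

lemma Nsq_weighted:
 assumes s: "0 <= s" "s < 1"
 obtains C where "0 < C" "!!h A. adm h ==> (NN x. EE ((h x)^2 * (1 + norm x)^3)) <= EE A ==> 0 < A ==> Nsq (- s) h <= EE (C * A)"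
proof -
 obtain c where c: "0 <= c" "(\<integral>\<^sup>+x. EE ((1 + norm x) powr (- 3)) \<partial>(lborel :: (real^2) measure)) = EE c"
  using nn_integral_decay_finite[of 3] by (cases "(\<integral>\<^sup>+x. EE ((1 + norm x) powr (- 3)) \<partial>(lborel :: (real^2) measure))") auto
 define K where "K = (c + 1) * (2 / (1 - s))^2 + (2 * pi)^2"
 have "Nsq (- s) h <= EE (K * A)" if h: "adm h" and A: "(NN x. EE ((h x)^2 * (1 + norm x)^3)) <= EE A" "0 < A" for h A
 proof -
  note [measurable] = admD(1)[OF h]
  have "(NN x. EE ((1 + norm x) powr (- 3/2) * (<|h x|> * (1 + norm x) powr (3/2)))) <= EE (sqrt (c + 1) * sqrt A)"
  proof (rule nn_integral_cauchy)
   have "((1 + norm x) powr (- 3/2))^2 = (1 + norm x) powr (- 3)" "(<|h x|> * (1 + norm x) powr (3/2))^2 = (h x)^2 * (1 + norm x)^3" for x :: "real^2"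
    by (simp_all add: power_mult_distrib powr_power[symmetric] power2_eq_square[of "_ powr _"] powr_add[symmetric] powr_numeral add_pos_nonneg)
   then show "(NN x. EE (((1 + norm (x::real^2)) powr (- 3/2))^2)) <= EE (c + 1)" "(NN x. EE ((<|h x|> * (1 + norm x) powr (3/2))^2)) <= EE A"
    using A c by (simp_all add: ennreal_leI)
  qed (use c A in auto)
  moreover have "(1 + norm x) powr (- 3/2) * (<|h x|> * (1 + norm x) powr (3/2)) = <|h x|>" for x
  proof -
   have "0 < 1 + norm x" by (simp add: add_pos_nonneg)
   then have "(1 + norm x) powr (- 3/2) * (1 + norm x) powr (3/2) = 1" unfolding powr_add[symmetric] by simp
   then show ?thesis by (simp add: mult.left_commute)
  qed
  ultimately have l1: "(NN x. EE <|h x|>) <= EE (sqrt (c + 1) * sqrt A)" by (simp only:)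
  have fb: "(cmod (ft h xi))^2 <= (c + 1) * A" for xi
  proof -
   have "EE (cmod (ft h xi)) <= (NN x. EE (norm (cis (- (xi \<bullet> x)) * cr (h x))))"
    unfolding ft_def by (rule norm_integral_le_nn_integral)
   also have "... <= EE (sqrt (c + 1) * sqrt A)" using l1 by (simp add: norm_mult)
   finally have "cmod (ft h xi) <= sqrt (c + 1) * sqrt A" using c A by simp
   then have "(cmod (ft h xi))^2 <= (sqrt (c + 1) * sqrt A)^2" by (intro power_mono) auto
   then show ?thesis using c A by (simp add: power_mult_distrib)
  qed
  have "(NN x. EE ((h x)^2)) <= (NN x. EE ((h x)^2 * (1 + norm x)^3))"
  proof (intro nn_integral_mono ennreal_leI)
   fix x :: "real^2"
   have "(h x)^2 * 1 <= (h x)^2 * (1 + norm x)^3" by (intro mult_left_mono one_le_power) auto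
   then show "(h x)^2 <= (h x)^2 * (1 + norm x)^3" by simp
  qed
  with A have "(NN x. EE ((h x)^2)) <= EE A" by simp
  from ft_plancherel[OF h this] A have pl: "(NN xi. EE ((cmod (ft h xi))^2)) <= EE ((2 * pi)^2 * A)" by simp
  have "Nsq (- s) h <= (NN xi. EE ((c + 1) * A) * (EE (norm xi powr (- 2 * s)) * ind {xi. norm xi <= 1} xi) + EE ((cmod (ft h xi))^2))"
   unfolding Nsq_def
  proof (intro nn_integral_mono)
   fix xi :: "real^2"
   show "EE (norm xi powr (2 * - s) * (cmod (ft h xi))^2) <= EE ((c + 1) * A) * (EE (norm xi powr (- 2 * s)) * ind {xi. norm xi <= 1} xi) + EE ((cmod (ft h xi))^2)"
   proof (cases "norm xi <= 1")
    case True
    have "norm xi powr (2 * - s) * (cmod (ft h xi))^2 <= norm xi powr (2 * - s) * ((c + 1) * A)" by (intro mult_left_mono fb) auto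
    then have "EE (norm xi powr (2 * - s) * (cmod (ft h xi))^2) <= EE ((c + 1) * A) * EE (norm xi powr (- 2 * s))"
     using c A by (simp add: ennreal_mult[symmetric] mult.commute ennreal_leI)
    then show ?thesis using True by (simp add: add_increasing2)
   next
    case False
    then have "norm xi powr (2 * - s) * (cmod (ft h xi))^2 <= norm xi powr 0 * (cmod (ft h xi))^2" using s by (intro mult_right_mono powr_mono) auto
    moreover have "xi ~= 0" using False by auto
    ultimately show ?thesis using False by (auto intro!: ennreal_leI)
   qed
  qed
  also have "... = EE ((c + 1) * A) * (NN xi. EE (norm xi powr (- 2 * s)) * ind {xi. norm xi <= 1} (xi::real^2)) + (NN xi. EE ((cmod (ft h xi))^2))"
   by (subst nn_integral_add) (auto intro!: arg_cong2[where f="(+)"] nn_integral_cmult)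
  also have "... <= EE ((c + 1) * A) * EE ((2 / (1 - s))^2 * 1 powr (2 - 2 * s)) + EE ((2 * pi)^2 * A)"
   by (intro add_mono mult_left_mono nn_integral_norm_powr_ball s pl) auto
  also have "... = EE (K * A)" using c A by (simp add: K_def ennreal_mult[symmetric] ennreal_plus[symmetric] algebra_simps del: ennreal_plus)
  finally show ?thesis .
 qed
 moreover have "0 < K" unfolding K_def using c by (intro add_nonneg_pos) auto
 ultimately show thesis using that by blast
qed

lemma Nsq_0_finite: "adm h ==> 0 <= sg ==> sg <= 1 ==> Nsq sg h < \<infinity>"
proof -
 assume h: "adm h" and sg: "0 <= sg" "sg <= 1"
 note [measurable] = admD(1)[OF h]
 obtain K where K: "!!xi. cmod (ft h xi) <= K" using admD(4)[OF h] unfolding rapid_def by (metis mult_1 power_0)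
 have i: "integrable lborel (%xi. K * (norm xi ^ 0 * cmod (ft h xi) + norm xi ^ 2 * cmod (ft h xi)))"
  using admD(5)[OF h] unfolding amp_def by (intro integrable_mult_right Bochner_Integration.integrable_add) blast+
 have b: "norm xi powr (2 * sg) * (cmod (ft h xi))^2 <= K * (norm xi ^ 0 * cmod (ft h xi) + norm xi ^ 2 * cmod (ft h xi))" for xi
 proof -
  have "norm xi powr (2 * sg) <= 1 + norm xi ^ 2"
  proof (cases "norm xi <= 1")
   case True
   then have "norm xi powr (2 * sg) <= 1 powr (2 * sg)" using sg by (intro powr_mono2) auto
   then show ?thesis using zero_le_power2[of "norm xi"] by (simp add: add_increasing2)
  next
   case False
   then have "norm xi powr (2 * sg) <= norm xi powr 2" using sg by (intro powr_mono) auto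
   then show ?thesis using False by (simp add: powr_numeral)
  qed
  moreover have "(cmod (ft h xi))^2 <= K * cmod (ft h xi)" unfolding power2_eq_square by (intro mult_right_mono K) auto
  ultimately have "norm xi powr (2 * sg) * (cmod (ft h xi))^2 <= (1 + norm xi ^ 2) * (K * cmod (ft h xi))" by (intro mult_mono) auto
  then show ?thesis by (simp add: algebra_simps)
 qed
 have "integrable lborel (%xi. norm xi powr (2 * sg) * (cmod (ft h xi))^2)"
  by (rule Bochner_Integration.integrable_bound[OF i]) (use b in \<open>auto intro!: AE_I2 order_trans[OF _ abs_ge_self]\<close>)
 then show ?thesis unfolding Nsq_def by (simp add: integrable_iff_bounded)
qed

lemma fmult_lin:
 assumes g: "adm g" "adm k" and [measurable]: "m \<in> BB" and b: "!!xi. <|m xi|> <= K * (1 + norm xi)"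
 shows "fmult m (%x. g x + c * k x) x = fmult m g x + c * fmult m k x"
proof -
 note [measurable] = admD(1)[OF g(1)] admD(1)[OF g(2)]
 have K0: "0 <= K" using b[of 0] by simp
 have i: "integrable lborel (%x. cr (g x))" "integrable lborel (%x. cr (k x))" using cc_of_real admD(2,3) g by blast+
 have f: "ft (%x. g x + c * k x) xi = ft g xi + cr c * ft k xi" for xi
  unfolding ft_IF of_real_add of_real_mult using IF_add[OF i(1) integrable_mult_right[OF i(2)]] IF_cmult by auto
 have r: "integrable lborel (%xi. cr (m xi / (2 * pi)^2) * ft h xi)" if h: "adm h" for h
 proof (intro amp_integrable rapid_amp rapid_bound[OF admD(4)[OF h], of _ "K / (2 * pi)^2"])
  note [measurable] = admD(1)[OF h]
  show "(%xi. cr (m xi / (2 * pi)^2) * ft h xi) \<in> BB" by measurable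
  show "cmod (cr (m xi / (2 * pi)^2) * ft h xi) <= K / (2 * pi)^2 * (1 + norm xi) * cmod (ft h xi)" for xi
   using divide_right_mono[OF b[of xi], of "(2 * pi)^2"] unfolding norm_mult norm_of_real
   by (intro mult_right_mono) (auto simp: abs_divide)
 qed (use K0 in auto)
 have e: "cr (m xi / (2 * pi)^2) * ft (%x. g x + c * k x) xi = cr (m xi / (2 * pi)^2) * ft g xi + cr c * (cr (m xi / (2 * pi)^2) * ft k xi)" for xi
  unfolding f distrib_left by (simp only: mult.left_commute[of _ "cr c"])
 show ?thesis unfolding fmult_IF e using IF_add[OF r[OF g(1)] integrable_mult_right[OF r[OF g(2)], of "cr c"], of x] unfolding IF_cmult
  by (simp only: plus_complex.sel times_complex.sel Re_complex_of_real Im_complex_of_real mult_zero_left diff_zero)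
qed

lemma propagators_lin:
 assumes g: "adm g" "adm k"
 shows "Cw t (%x. g x + c * k x) x = Cw t g x + c * Cw t k x" "Sw t (%x. g x + c * k x) x = Sw t g x + c * Sw t k x" "Dw t (%x. g x + c * k x) x = Dw t g x + c * Dw t k x"
proof -
 have 1: "<|cos (t * norm xi)|> <= 1 * (1 + norm xi)" "<|- norm xi * sin (t * norm xi)|> <= 1 * (1 + norm xi)" for xi :: "real^2"
  using abs_cos_le_one[of "t * norm xi"] norm_ge_zero[of xi] abs_norm_sin[of xi t] by (simp_all, linarith)
 have 2: "<|sin (t * norm xi) / norm xi|> <= <|t|> * (1 + norm xi)" for xi :: "real^2"
  using abs_sin_div[of t xi] mult_nonneg_nonneg[OF abs_ge_zero norm_ge_zero, of t xi] unfolding distrib_left mult_1_right by linarith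
 show "Cw t (%x. g x + c * k x) x = Cw t g x + c * Cw t k x" unfolding Cw_def by (rule fmult_lin[OF g _ 1(1)]) simp
 show "Sw t (%x. g x + c * k x) x = Sw t g x + c * Sw t k x" unfolding Sw_def by (rule fmult_lin[OF g _ 2]) simp
 show "Dw t (%x. g x + c * k x) x = Dw t g x + c * Dw t k x" unfolding Dw_def by (rule fmult_lin[OF g _ 1(2)]) simp
qed

lemma hdot_sq_le:
 assumes "!!g A. test_fun g ==> 0 < A ==> Nsq (- s) g <= EE A ==> <|\<Lambda> g|> <= M * sqrt A" and M: "0 <= M"
 shows "hdot_sq s \<Lambda> <= EE (M^2)"
 unfolding hdot_sq_def
proof (rule SUP_least)
 fix g assume g: "g \<in> {g. test_fun g & 0 < Nsq (- s) g & Nsq (- s) g < \<infinity>}"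
 then obtain A where A: "0 <= A" "Nsq (- s) g = EE A" by (cases "Nsq (- s) g") auto
 with g have A0: "0 < A" by simp
 then have "<|\<Lambda> g|>^2 <= (M * sqrt A)^2" using assms(1)[of g A] g A by (intro power_mono) auto
 then have "(\<Lambda> g)^2 <= M^2 * A" using A0 by (simp add: power_mult_distrib)
 then have "(\<Lambda> g)^2 / A <= M^2" using A0 by (simp add: pos_divide_le_eq)
 then show "EE ((\<Lambda> g)^2) / Nsq (- s) g <= EE (M^2)" unfolding A(2) using A0 by (simp add: divide_ennreal ennreal_leI)
qed

section \<open>The solution paired with free waves\<close>

context nlw begin

definition ph where "ph t x = u t (x $ 1) (x $ 2)" for x :: "real^2"
definition pt where "pt t x = ut t (x $ 1) (x $ 2)" for x :: "real^2"
definition pN where "pN t x = N t (x $ 1) (x $ 2)" for x :: "real^2"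

lemma cont_N: "cont3 N"
proof -
 have "N = (%t x y. uxx t x y + uyy t x y - utt t x y)" using eq by (simp add: fun_eq_iff N_def)
 then show ?thesis using cont unfolding cont3_def by (auto intro!: continuous_intros)
qed

lemma ph_cont: "CO S (ph t)" "CO S (pt t)" "CO S (pN t)"
 unfolding ph_def[abs_def] pt_def[abs_def] pN_def[abs_def] by (intro cont3_real2 cont cont_N)+

lemma ph_meas[measurable]: "ph t \<in> BB" "pt t \<in> BB" "pN t \<in> BB"
 by (intro borel_measurable_continuous_onI ph_cont)+

lemma dt_ph: "dt ph t x = pt t x"
 unfolding dt_def ph_def pt_def by (rule DERIV_imp_deriv) (rule du)

lemma pairing_integrable:
 assumes "CO UNIV f" "adm h"
 shows "integrable lborel (%x. f x * h x)"
 by (rule cc_integrable[OF continuous_on_mult[OF assms(1) admD(2)[OF assms(2)]]]) (auto intro!: bounded_subset[OF admD(3)[OF assms(2)]])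

text \<open>The solution at time \<open>tau\<close> paired with a free wave \<open>w\<close>, of
  time derivative \<open>w'\<close>, run backwards from time \<open>t\<close>. For a solution of the
  linear equation this would not depend on \<open>tau\<close>; here its derivative is minus the
  pairing with the nonlinearity.\<close>

definition Pw where "Pw w w' t tau = pairing (pt tau) (w (t - tau)) + pairing (ph tau) (w' (t - tau))"

lemma duhamel_deriv:
 assumes b: "amp b" and R: "0 <= R"
  and w: "!!t x y. w t (vec2 (x, y)) = W b t x y" "!!t x y. w' t (vec2 (x, y)) = W (dT b) t x y"
  and z: "!!t x. R + <|t|> < norm x ==> w t x = 0" "!!t x. R + <|t|> < norm x ==> w' t x = 0"
  and tau: "tau \<in> {T0..T1}"
 shows "(Pw w w' t hrd - pairing (pN tau) (w (t - tau))) (at tau within {T0..T1})"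
proof -
 \<comment> \<open>One box holding the supports for all \<open>tau\<close> in
   \<open>{T0..T1}\<close>; the added 1 keeps the inclusion strict.\<close>
 define S where "S = R + <|t|> + <|T0|> + <|T1|> + 1"
 have S: "R + <|t - s|> < S" if "s \<in> {T0..T1}" for s using that unfolding S_def by auto
 have S0: "0 <= S" using R by (simp add: S_def)
 have v: "norm (vec2 (x, y)) = sqrt (x^2 + y^2)" for x y by (simp add: norm_2)
 have Wz: "W b s x y = 0" "W (dT b) s x y = 0" if "R + <|s|> < sqrt (x^2 + y^2)" for s x y
  using z[of s "vec2 (x, y)"] that by (simp_all add: w v)
 have A: "amp (dT b)" "amp (dX i b)" "amp (dT (dT b))" "amp (dX j (dX i b))" for i j by (intro amp_d b)+
 have cw: "cont3 (%s x y. W a (t - s) x y)" if "amp a" for a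
  unfolding cont3_def by (rule cont3_comp[OF cont_W[OF that]]) (intro continuous_intros)+
 have dw: "((%s. W a (t - s) x y) hrd - W (dT a) (t - s) x y) (at s)" if "amp a" for a s x y
 proof -
  have "((%s. t - s) hrd - 1) (at s)" by (auto intro!: derivative_eq_intros)
  from DERIV_chain2[OF DERIV_W(1)[OF that] this] show ?thesis by simp
 qed
 define e where "e = (%s x y. ut s x y * W b (t - s) x y + u s x y * W (dT b) (t - s) x y)"
 define q1 where "q1 = (%s x y. u s x y * W (dX 1 b) (t - s) x y - ux s x y * W b (t - s) x y)"
 define q2 where "q2 = (%s x y. u s x y * W (dX 2 b) (t - s) x y - uy s x y * W b (t - s) x y)"
 have cur: "is_current e q1 q2 (%s x y. - (N s x y * W b (t - s) x y))"
  unfolding e_def q1_def q2_def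
 proof (rule is_currentI)
  fix s x y
  show "((%s. ut s x y * W b (t - s) x y + u s x y * W (dT b) (t - s) x y) hrd
   utt s x y * W b (t - s) x y - u s x y * W (dT (dT b)) (t - s) x y) (at s)"
   by (rule DERIV_cong, (rule derivative_intros dut(1) du(1) dw b A)+, simp)
  show "((%r. u s r y * W (dX 1 b) (t - s) r y - ux s r y * W b (t - s) r y) hrd
   u s x y * W (dX 1 (dX 1 b)) (t - s) x y - uxx s x y * W b (t - s) x y) (at x)"
   by (rule DERIV_cong, (rule derivative_intros du(2) dux(2) DERIV_W(2) b A)+, simp)
  show "((%r. u s x r * W (dX 2 b) (t - s) x r - uy s x r * W b (t - s) x r) hrd
   u s x y * W (dX 2 (dX 2 b)) (t - s) x y - uyy s x y * W b (t - s) x y) (at y)"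
   by (rule DERIV_cong, (rule derivative_intros du(3) duy(3) DERIV_W(3) b A)+, simp)
  show "utt s x y * W b (t - s) x y - u s x y * W (dT (dT b)) (t - s) x y + (u s x y * W (dX 1 (dX 1 b)) (t - s) x y - uxx s x y * W b (t - s) x y)
   + (u s x y * W (dX 2 (dX 2 b)) (t - s) x y - uyy s x y * W b (t - s) x y) = - (N s x y * W b (t - s) x y)"
   unfolding W_wave[OF b] eq N_def by algebra
 qed (use cont cw[OF b] cw[OF A(1)] cw[OF A(2)] cw[OF A(3)] cw[OF A(4)] in \<open>auto simp: cont3_def intro!: continuous_intros\<close>)
 have out: "R + <|t - s|> < sqrt (x^2 + y^2)" if "s \<in> {T0..T1}" "S <= <|x|> | S <= <|y|>" for s x y
 proof -
  have "<|x|> <= sqrt (x^2 + y^2)" "<|y|> <= sqrt (x^2 + y^2)" by (auto intro: real_le_rsqrt)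
  then show ?thesis using S[OF that(1)] that(2) by linarith
 qed
 have q0: "q1 s x y = 0 & q2 s x y = 0" if "s \<in> {T0..T1}" "S <= <|x|> | S <= <|y|>" for s x y
  using W_dX_zero[OF b Wz(1) out[OF that]] Wz(1)[OF out[OF that]] by (simp add: q1_def q2_def)
 have D: "((%s. integral (sq_box S) (%z. e s $$ z)) hrd integral (sq_box S) (%z. - (N tau $$ z * W b (t - tau) $$ z))) (at tau within {T0..T1})"
  by (rule current_integral_deriv[OF cur S0 q0]) (use tau in auto)
 have pi: "pairing (%x. f s (x $ 1) (x $ 2)) k = integral (sq_box S) (%z. f s $$ z * W a (t - s) $$ z)"
  if f: "cont3 f" and a: "amp a" "!!x y. k (vec2 (x, y)) = W a (t - s) x y" "!!x. R + <|t - s|> < norm x ==> k x = 0" and s: "s \<in> {T0..T1}" for f k a s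
 proof -
  have ke: "k x = W a (t - s) (x $ 1) (x $ 2)" for x using a(2)[of "x $ 1" "x $ 2"] by (simp add: vec2_eta)
  show ?thesis unfolding pairing_def
   by (subst integral_box_real2[of _ S]) (use a(3) S[OF s] continuous_on_mult[OF cont3_real2[OF f] cont3_real2[OF cont_W[OF a(1)]]] in \<open>auto simp: ke\<close>)
 qed
 have ci: "(%z. f s $$ z * W a (t - s) $$ z) integrable_on sq_box S" if "cont3 f" "amp a" for f a s
  by (intro integrable_continuous continuous_on_mult cont3_slice that cont_W)
 have P: "integral (sq_box S) (%z. e s $$ z) = Pw w w' t s" if s: "s \<in> {T0..T1}" for s
  using Henstock_Kurzweil_Integration.integral_add[OF ci[OF cont(2) b] ci[OF cont(1) A(1)], of s s]
   pi[OF cont(2) b w(1) z(1) s] pi[OF cont(1) A(1) w(2) z(2) s] by (simp add: Pw_def e_def pt_def[abs_def] ph_def[abs_def])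
 have "integral (sq_box S) (%z. - (N tau $$ z * W b (t - tau) $$ z)) = - pairing (pN tau) (w (t - tau))"
  unfolding pN_def[abs_def] by (subst pi[OF cont_N b w(1) z(1) tau]) auto
 with has_field_derivative_transform_within[OF D zero_less_one tau P] show ?thesis by simp
qed

end

definition wave :: "(real => real^2 => real) => (real => real^2 => real) => bool" where
 "wave w w' \<longleftrightarrow> (\<forall>t. adm (w t) & adm (w' t)) & (\<exists>b R. amp b & 0 <= R & (\<forall>t x y. w t (vec2 (x, y)) = W b t x y) & (\<forall>t x y. w' t (vec2 (x, y)) = W (dT b) t x y)
  & (\<forall>t x. R + <|t|> < norm x --> w t x = 0 & w' t x = 0))"

lemma wave_propagators:
 assumes "adm g"
 shows "wave (%t. Sw t g) (%t. Cw t g)" "wave (%t. Cw t g) (%t. Dw t g)"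
proof -
 obtain b R where b: "amp b" "0 <= R" "!!t x y. Sw t g (vec2 (x, y)) = W b t x y" "!!t x y. Cw t g (vec2 (x, y)) = W (dT b) t x y"
  "!!t x y. Dw t g (vec2 (x, y)) = W (dT (dT b)) t x y"
  "!!t x. R + <|t|> < norm x ==> Sw t g x = 0" "!!t x. R + <|t|> < norm x ==> Cw t g x = 0" "!!t x. R + <|t|> < norm x ==> Dw t g x = 0"
  by (rule adm_waves[OF assms]) blast
 show "wave (%t. Sw t g) (%t. Cw t g)" "wave (%t. Cw t g) (%t. Dw t g)"
  unfolding wave_def using adm_propagators(1-3)[OF assms] b amp_d(1)[OF b(1)] by blast+
qed

lemma integral_mult_bound:
 fixes f g :: "real \<times> real => real"
 assumes "CO UNIV f" "CO UNIV g" "!!z. z \<notin> sq_box R ==> f z = 0"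
  and F: "(NN z. EE ((f z)^2)) <= EE F" and G: "(NN z. EE ((g z)^2)) <= EE G" and pos: "0 < F" "0 < G"
 shows "<|integral (sq_box R) (%z. f z * g z)|> <= sqrt F * sqrt G"
proof -
 have [measurable]: "f \<in> BB" "g \<in> BB" using assms(1,2) by (auto intro: borel_measurable_continuous_onI)
 have "integral (sq_box R) (%z. f z * g z) = (LL z. f z * g z)"
  by (rule integral_sq_box_lborel(2)[symmetric]) (use assms in \<open>auto intro!: continuous_on_mult intro: continuous_on_subset\<close>)
 then have "EE <|integral (sq_box R) (%z. f z * g z)|> <= (NN z. EE (<|f z|> * <|g z|>))"
  using norm_integral_le_nn_integral[of lborel "%z. f z * g z"] by (simp add: abs_mult)
 also have "... <= EE (sqrt F * sqrt G)" by (rule nn_integral_cauchy) (use F G pos in auto)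
 finally show ?thesis using pos by simp
qed

lemma C1_partials:
 assumes d: "((%z. f $$ z) has_derivative (%k. fst k * a + snd k * b)) (at (x, y))"
 shows "((%s. f s y) hrd a) (at x)" "((%s. f x s) hrd b) (at y)"
proof -
 have "((%s. (s, y)) has_derivative (%h. (h, 0))) (at x)" "((%s. (x, s)) has_derivative (%h. (0, h))) (at y)" by (auto intro!: derivative_eq_intros)
 from has_derivative_compose[OF this(1) d] has_derivative_compose[OF this(2) d]
 show "((%s. f s y) hrd a) (at x)" "((%s. f x s) hrd b) (at y)"
  by (simp_all add: has_field_derivative_def mult_commute_abs)
qed

context nlw begin

lemma pairing_add:
 assumes f: "CO UNIV f" and h: "adm h" "adm k"
 shows "pairing f (%x. h x + c * k x) = pairing f h + c * pairing f k"
 unfolding pairing_def using pairing_integrable[OF f h(1)] pairing_integrable[OF f h(2)] by (simp add: distrib_left mult.left_commute)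

text \<open>The group law moves \<open>t\<close> from the base time into the test functions. In this
  way limits taken at base time 0 determine the comparison wave at every \<open>t\<close>.\<close>

lemma Pw_group:
 assumes g: "adm g"
 shows "Pw (%t. Sw t g) (%t. Cw t g) t tau = Pw (%s. Sw s (Cw t g)) (%s. Cw s (Cw t g)) 0 tau + Pw (%s. Cw s (Sw t g)) (%s. Dw s (Sw t g)) 0 tau"
  "Pw (%t. Cw t g) (%t. Dw t g) t tau = Pw (%s. Sw s (Dw t g)) (%s. Cw s (Dw t g)) 0 tau + Pw (%s. Cw s (Cw t g)) (%s. Dw s (Cw t g)) 0 tau"
proof -
 note p = adm_propagators(1-3)[OF g, of t]
 note q = adm_propagators(1-3)[OF p(1), of "- tau"] adm_propagators(1-3)[OF p(2), of "- tau"] adm_propagators(1-3)[OF p(3), of "- tau"]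
 note e = group_law[OF g, of t tau]
 have a: "pairing f (%x. h x + k x) = pairing f h + pairing f k" if "CO UNIV f" "adm h" "adm k" for f h k
  using pairing_add[OF that, of 1] by simp
 have s: "Cw (t - tau) g = (%x. Cw (- tau) (Cw t g) x + Dw (- tau) (Sw t g) x)" "Sw (t - tau) g = (%x. Sw (- tau) (Cw t g) x + Cw (- tau) (Sw t g) x)"
  "Dw (t - tau) g = (%x. Cw (- tau) (Dw t g) x + Dw (- tau) (Cw t g) x)" using e by auto
 have s': "Cw (t - tau) g = (%x. Sw (- tau) (Dw t g) x + Cw (- tau) (Cw t g) x)" using e by auto
 show "Pw (%t. Sw t g) (%t. Cw t g) t tau = Pw (%s. Sw s (Cw t g)) (%s. Cw s (Cw t g)) 0 tau + Pw (%s. Cw s (Sw t g)) (%s. Dw s (Sw t g)) 0 tau"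
  unfolding Pw_def s by (simp add: a ph_cont q)
 show "Pw (%t. Cw t g) (%t. Dw t g) t tau = Pw (%s. Sw s (Dw t g)) (%s. Cw s (Dw t g)) 0 tau + Pw (%s. Cw s (Cw t g)) (%s. Dw s (Cw t g)) 0 tau"
  unfolding Pw_def s(3) s' by (simp add: a ph_cont q)
qed

lemma Pw_diag: "adm g ==> Pw (%t. Sw t g) (%t. Cw t g) t t = pairing (ph t) g" "adm g ==> Pw (%t. Cw t g) (%t. Dw t g) t t = pairing (pt t) g"
proof -
 have "Dw 0 g = (%x. 0)" "Sw 0 g = (%x. 0)" using wave_parity(3)[of 0 g] Sw_0 by auto
 moreover assume "adm g" then have "Cw 0 g = g" using Cw_0 by auto
 ultimately show "Pw (%t. Sw t g) (%t. Cw t g) t t = pairing (ph t) g" "Pw (%t. Cw t g) (%t. Dw t g) t t = pairing (pt t) g"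
  by (simp_all add: Pw_def pairing_def)
qed

text \<open>As \<open>tau\<close> tends to infinity, \<open>L0 h\<close> and \<open>L1 h\<close>
  become the pairings of \<open>h\<close> with the position and the velocity of the scattering state
  at time 0. They do not depend on \<open>s\<close>, so one state serves the whole range of
  norms.\<close>

definition Lim where "Lim w w' t = lim (%n. Pw w w' t (real n))"
definition L0 where "L0 h = Lim (%t. Sw t h) (%t. Cw t h) 0"
definition L1 where "L1 h = Lim (%t. Cw t h) (%t. Dw t h) 0"

context
 fixes D :: real
 assumes D0: "0 < D" and D: "(NN z. EE (dat $$ z)) <= EE D" and pp: "1 + sqrt 8 < p" and plt: "p < 5"
begin

lemma p3: "3 < p"
proof -
 have "2 < sqrt 8" by (rule real_less_rsqrt) simp
 then show ?thesis using pp by simp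
qed

lemma s_crit_pos: "0 < s_crit p" "s_crit p < 1" using p3 by (auto simp: s_crit_def field_simps)

text \<open>Under \<open>r = 2 / (2 - s)\<close> the range from \<open>s_crit p\<close> to 1 is the
  range of \<open>r\<close> in \<open>nonlinearity_decay\<close>. Integrating the rate
  \<open>- 1 - eps\<close> in time gives \<open>- eps\<close>, and \<open>Nsq (1 - s)\<close> of the
  wave does not grow.\<close>

lemma duhamel_decay:
 assumes s: "s_crit p <= s" "s <= 1"
 obtains M eps where "0 < M" "0 < eps" "!!w w' A t T0 T1. wave w w' ==> (!!tau. Nsq (1 - s) (w tau) <= EE A) ==> 0 < A ==> 0 <= T0 ==> T0 <= T1 ==>
  <|Pw w w' t T1 - Pw w w' t T0|> <= M * sqrt A * (1 + T0) powr (- eps)"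
proof -
 have s0: "0 < s" using s s_crit_pos by simp
 have r: "2 * (p - 1) / (p + 1) <= 2 / (2 - s)" "2 / (2 - s) <= 2"
 proof -
  have "2 - s <= (p + 1) / (p - 1)" using s(1) p3 by (simp add: s_crit_def field_simps)
  then have "2 / ((p + 1) / (p - 1)) <= 2 / (2 - s)" using s p3 by (intro divide_left_mono) auto
  then show "2 * (p - 1) / (p + 1) <= 2 / (2 - s)" by simp
  show "2 / (2 - s) <= 2" using s by (simp add: pos_divide_le_eq)
 qed
 obtain K eps where K: "0 < K" "0 < eps" "!!t. 0 <= t ==> (NN z. EE (<|N t $$ z|> powr (2 / (2 - s)))) <= EE ((K * (1 + t) powr (- 1 - eps)) powr (2 / (2 - s)))"
  using nonlinearity_decay[OF D0 D p3 plt pp r] by blast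
 obtain C where C: "0 < C" "!!F h B A. F \<in> BB ==> (NN x. EE (<|F x|> powr (2 / (2 - s)))) <= EE (B powr (2 / (2 - s))) ==> 0 < B ==>
  adm h ==> Nsq (1 - s) h <= EE A ==> 0 < A ==> (NN x. EE <|F x * h x|>) <= EE (C * B * sqrt A)"
  by (rule dual_estimate[OF s0 s(2)]) blast
 define M where "M = C * K / eps"
 have M: "0 < M" using C K by (simp add: M_def)
 have "<|Pw w w' t T1 - Pw w w' t T0|> <= M * sqrt A * (1 + T0) powr (- eps)"
  if w: "wave w w'" and N: "!!tau. Nsq (1 - s) (w tau) <= EE A" and A: "0 < A" and T: "0 <= T0" "T0 <= T1" for w w' A t T0 T1
 proof -
  obtain b R where b: "amp b" "0 <= R" "!!t x y. w t (vec2 (x, y)) = W b t x y" "!!t x y. w' t (vec2 (x, y)) = W (dT b) t x y"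
   "!!t x. R + <|t|> < norm x ==> w t x = 0" "!!t x. R + <|t|> < norm x ==> w' t x = 0" using w unfolding wave_def by blast
  have aw: "adm (w tau)" for tau using w unfolding wave_def by blast
  note d = duhamel_deriv[OF b]
  let ?B = "%tau. - (M * sqrt A) * (1 + tau) powr (- eps)" and ?B' = "%tau. C * (K * (1 + tau) powr (- 1 - eps)) * sqrt A"
  have dB: "(?B hrd ?B' tau) (at tau within {T0..T1})" if "tau \<in> {T0..T1}" for tau
  proof -
   have "0 < 1 + tau" using that T by auto
   then have "((%tau. (1 + tau) powr (- eps)) hrd (- eps) * (1 + tau) powr (- eps - 1) * 1) (at tau within {T0..T1})"
    by (intro DERIV_cong[OF DERIV_chain2[OF has_real_derivative_powr]]) (auto intro!: derivative_eq_intros)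
   moreover have "- eps - 1 = - 1 - eps" by simp
   ultimately have "((%tau. (1 + tau) powr (- eps)) hrd (- eps) * (1 + tau) powr (- 1 - eps)) (at tau within {T0..T1})" by simp
   from DERIV_cmult[OF this, of "- (M * sqrt A)"] show ?thesis
    by (rule DERIV_cong) (use K in \<open>simp add: M_def\<close>)
  qed
  have bd: "<|pairing (pN tau) (w (t - tau))|> <= ?B' tau" if "tau \<in> {T0..T1}" for tau
  proof -
   have t0: "0 <= tau" using that T by auto
   have "(NN x. EE (<|pN tau x|> powr (2 / (2 - s)))) = (NN z. EE (<|N tau $$ z|> powr (2 / (2 - s))))"
    by (subst nn_integral_vec2, measurable) (simp add: pN_def)
   also note K(3)[OF t0]
   finally have "(NN x. EE <|pN tau x * w (t - tau) x|>) <= EE (?B' tau)"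
    by (intro C(2) aw N A) (use K t0 in auto)
   then have "EE <|pairing (pN tau) (w (t - tau))|> <= EE (?B' tau)"
    unfolding pairing_def using norm_integral_le_nn_integral[of lborel "%x. pN tau x * w (t - tau) x"] by simp
   then show ?thesis using C K A t0 by (subst (asm) ennreal_le_iff) auto
  qed
  have "Pw w w' t T1 - Pw w w' t T0 <= ?B T1 - ?B T0"
   by (rule DERIV_le_mono_diff[OF T(2) d dB]) (use bd in \<open>auto simp: abs_le_iff\<close>)
  moreover have "- Pw w w' t T1 - - Pw w w' t T0 <= ?B T1 - ?B T0"
   by (rule DERIV_le_mono_diff[OF T(2) DERIV_minus[OF d] dB]) (use bd in \<open>auto simp: abs_le_iff\<close>)
  moreover have "0 <= M * sqrt A * (1 + T1) powr (- eps)" using M A by auto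
  ultimately show ?thesis by (simp add: abs_le_iff)
 qed
 then show thesis using that[OF M K(2)] by blast
qed

text \<open>\<open>Lim\<close> is taken along integer times; letting the later time run to infinity
  in \<open>duhamel_decay\<close> gives the rate for every real \<open>T\<close>.\<close>

lemma Pw_limit:
 assumes s: "s_crit p <= s" "s <= 1"
 obtains M eps where "0 < M" "0 < eps" "!!w w' A t. wave w w' ==> (!!tau. Nsq (1 - s) (w tau) <= EE A) ==> 0 < A ==>
  (%n. Pw w w' t (real n)) ----> Lim w w' t & (\<forall>T\<ge>0. <|Pw w w' t T - Lim w w' t|> <= M * sqrt A * (1 + T) powr (- eps))"
proof -
 obtain M eps where M: "0 < M" "0 < eps" "!!w w' A t T0 T1. wave w w' ==> (!!tau. Nsq (1 - s) (w tau) <= EE A) ==> 0 < A ==> 0 <= T0 ==> T0 <= T1 ==>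
  <|Pw w w' t T1 - Pw w w' t T0|> <= M * sqrt A * (1 + T0) powr (- eps)"
  by (rule duhamel_decay[OF s]) blast
 have "(%n. Pw w w' t (real n)) ----> Lim w w' t & (\<forall>T\<ge>0. <|Pw w w' t T - Lim w w' t|> <= M * sqrt A * (1 + T) powr (- eps))"
  if w: "wave w w'" "!!tau. Nsq (1 - s) (w tau) <= EE A" "0 < A" for w w' A t
 proof -
  note c = M(3)[OF w, of _ _ t]
  have z: "(%n. M * sqrt A * (1 + real n) powr (- eps)) ----> 0"
   using M(2) by real_asymp
  have "Cauchy (%n. Pw w w' t (real n))"
  proof (rule metric_CauchyI)
   fix e :: real assume "0 < e"
   then obtain n where n: "M * sqrt A * (1 + real n) powr (- eps) < e / 2"
    using order_tendstoD(2)[OF z, of "e / 2"] unfolding eventually_sequentially by auto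
   show "\<exists>n. \<forall>k\<ge>n. \<forall>l\<ge>n. dist (Pw w w' t (real k)) (Pw w w' t (real l)) < e"
   proof (intro exI allI impI)
    fix k l assume "n <= k" "n <= l"
    then have "<|Pw w w' t (real k) - Pw w w' t (real n)|> < e / 2" "<|Pw w w' t (real l) - Pw w w' t (real n)|> < e / 2"
     using c[of "real n" "real k"] c[of "real n" "real l"] n by simp_all
    then show "dist (Pw w w' t (real k)) (Pw w w' t (real l)) < e" unfolding dist_real_def by linarith
   qed
  qed
  then have l: "(%n. Pw w w' t (real n)) ----> Lim w w' t" unfolding Lim_def by (simp add: Cauchy_convergent convergent_LIMSEQ_iff[symmetric])
  have "<|Pw w w' t T - Lim w w' t|> <= M * sqrt A * (1 + T) powr (- eps)" if T: "0 <= T" for T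
  proof (rule LIMSEQ_le_const2)
   show "(%n. <|Pw w w' t T - Pw w w' t (real n)|>) ----> <|Pw w w' t T - Lim w w' t|>" by (intro tendsto_intros l)
   obtain n0 where "T <= real n0" using real_arch_simple by blast
   then show "\<exists>n0. \<forall>n\<ge>n0. <|Pw w w' t T - Pw w w' t (real n)|> <= M * sqrt A * (1 + T) powr (- eps)"
    using c[OF T] by (intro exI[of _ n0]) (metis abs_minus_commute of_nat_mono order_trans)
  qed
  then show ?thesis using l by blast
 qed
 then show thesis using that[OF M(1,2)] by blast
qed

text \<open>Mere existence of the limits: every admissible \<open>h\<close> has finite norms of the
  orders required, the negative order by \<open>Nsq_weighted\<close>.\<close>

lemma Lim_conv:
 assumes h: "adm h"
 shows "(%n. Pw (%t. Sw t h) (%t. Cw t h) t (real n)) ----> Lim (%t. Sw t h) (%t. Cw t h) t"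
  "(%n. Pw (%t. Cw t h) (%t. Dw t h) t (real n)) ----> Lim (%t. Cw t h) (%t. Dw t h) t"
proof -
 let ?s = "s_crit p"
 obtain M eps where M: "!!w w' A t. wave w w' ==> (!!tau. Nsq (1 - ?s) (w tau) <= EE A) ==> 0 < A ==> (%n. Pw w w' t (real n)) ----> Lim w w' t"
  using Pw_limit[of ?s] s_crit_pos by (metis less_imp_le order_refl)
 have f: "\<exists>A>0. N <= EE A" if "N < \<infinity>" for N
  using that by (cases N) (auto intro!: exI[of _ "enn2real N + 1"] ennreal_leI)
 obtain C where C: "!!h A. adm h ==> (NN x. EE ((h x)^2 * (1 + norm x)^3)) <= EE A ==> 0 < A ==> Nsq (- ?s) h <= EE (C * A)"
  by (rule Nsq_weighted[of ?s]) (use s_crit_pos in auto)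
 have "integrable lborel (%x. ((h x)^2 * (1 + norm x)^3))"
  by (rule cc_integrable) (auto intro!: continuous_intros admD(2)[OF h] bounded_subset[OF admD(3)[OF h]])
 then have "(NN x. EE ((h x)^2 * (1 + norm x)^3)) < \<infinity>" by (simp add: integrable_iff_bounded)
 from f[OF this] obtain A where "0 < A" "(NN x. EE ((h x)^2 * (1 + norm x)^3)) <= EE A" by blast
 then have "Nsq (- ?s) h < \<infinity>" using C[OF h, of A] by (simp add: le_less_trans)
 from f[OF this] obtain A1 where A1: "0 < A1" "Nsq (- ?s) h <= EE A1" by blast
 from f[OF Nsq_0_finite[OF h, of "1 - ?s"]] s_crit_pos obtain A2 where A2: "0 < A2" "Nsq (1 - ?s) h <= EE A2" by auto
 note q = Nsq_propagators[OF h]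
 show "(%n. Pw (%t. Sw t h) (%t. Cw t h) t (real n)) ----> Lim (%t. Sw t h) (%t. Cw t h) t"
  by (rule M[OF wave_propagators(1)[OF h] order_trans[OF q(1) A1(2)] A1(1)])
 show "(%n. Pw (%t. Cw t h) (%t. Dw t h) t (real n)) ----> Lim (%t. Cw t h) (%t. Dw t h) t"
  by (rule M[OF wave_propagators(2)[OF h] order_trans[OF q(2) A2(2)] A2(1)])
qed

lemma Lim_group:
 assumes g: "adm g"
 shows "Lim (%t. Sw t g) (%t. Cw t g) t = L0 (Cw t g) + L1 (Sw t g)" "Lim (%t. Cw t g) (%t. Dw t g) t = L0 (Dw t g) + L1 (Cw t g)"
proof -
 note p = adm_propagators(1-3)[OF g, of t]
 show "Lim (%t. Sw t g) (%t. Cw t g) t = L0 (Cw t g) + L1 (Sw t g)"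
  using LIMSEQ_unique[OF Lim_conv(1)[OF g, of t, unfolded Pw_group(1)[OF g]] tendsto_add[OF Lim_conv(1)[OF p(1), of 0] Lim_conv(2)[OF p(2), of 0]]]
  by (simp add: L0_def L1_def)
 show "Lim (%t. Cw t g) (%t. Dw t g) t = L0 (Dw t g) + L1 (Cw t g)"
  using LIMSEQ_unique[OF Lim_conv(2)[OF g, of t, unfolded Pw_group(2)[OF g]] tendsto_add[OF Lim_conv(1)[OF p(3), of 0] Lim_conv(2)[OF p(1), of 0]]]
  by (simp add: L0_def L1_def)
qed

lemma L_lin:
 assumes g: "adm g" "adm k"
 shows "L0 (%x. g x + c * k x) = L0 g + c * L0 k" "L1 (%x. g x + c * k x) = L1 g + c * L1 k"
proof -
 note l = propagators_lin[OF g]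
 note p = adm_propagators(1-3)[OF g(1)] adm_propagators(1-3)[OF g(2)]
 have P: "Pw (%t. Sw t (%x. g x + c * k x)) (%t. Cw t (%x. g x + c * k x)) 0 tau = Pw (%t. Sw t g) (%t. Cw t g) 0 tau + c * Pw (%t. Sw t k) (%t. Cw t k) 0 tau"
  "Pw (%t. Cw t (%x. g x + c * k x)) (%t. Dw t (%x. g x + c * k x)) 0 tau = Pw (%t. Cw t g) (%t. Dw t g) 0 tau + c * Pw (%t. Cw t k) (%t. Dw t k) 0 tau" for tau
  unfolding Pw_def l[abs_def] by (simp_all add: pairing_add ph_cont p algebra_simps)
 note L = Lim_conv[OF adm_lin[OF g, of c], of 0, unfolded P]
 show "L0 (%x. g x + c * k x) = L0 g + c * L0 k" unfolding L0_def
  by (rule LIMSEQ_unique[OF L(1)]) (intro tendsto_intros Lim_conv g)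
 show "L1 (%x. g x + c * k x) = L1 g + c * L1 k" unfolding L1_def
  by (rule LIMSEQ_unique[OF L(2)]) (intro tendsto_intros Lim_conv g)
qed

text \<open>The initial position and its gradient are square integrable, by Hardy and energy. So
  \<open>h\<close> is split into a low frequency part and a divergence, each with \<open>L^2\<close>
  size controlled by the norm of order \<open>- s\<close>, and the divergence is integrated by
  parts. Three terms of size \<open>2 * pi\<close> give \<open>6 * pi\<close>.\<close>

lemma phi0_dual:
 assumes s: "0 <= s" "s <= 1" and h: "adm h" and N: "Nsq (- s) h <= EE E" and E: "0 < E"
 shows "<|pairing (ph 0) h|> <= 6 * pi * sqrt (F1 D + 21 * D) * sqrt E"
proof -
 define M where "M = F1 D + 21 * D"
 have F0: "0 < F1 D" by (rule K2_pos(2)[OF D0 D p3 plt])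
 have M: "0 < M" "F1 D <= M" "21 * D <= M" using F0 D0 by (auto simp: M_def)
 note [measurable] = admD(1)[OF h]
 define c where "c = 1 / (2 * pi)^2"
 have c: "0 < c" "c <= 1"
 proof -
  have "1 * 1 <= (2 * pi) * (2 * pi)" using pi_ge_two by (intro mult_mono) auto
  then show "0 < c" "c <= 1" by (auto simp: c_def power2_eq_square)
 qed
 \<comment> \<open>\<open>c\<close> is the normalisation of the inversion formula, decomposed as
   \<open>m0 + m 1 xi * xi $ 1 + m 2 xi * xi $ 2\<close>. Below frequency 1 only \<open>m0\<close>
   acts, above it only the quotient by \<open>(norm xi)^2\<close>; both are at most
   \<open>norm xi powr (- s)\<close> for \<open>0 <= s <= 1\<close>.\<close>
 define m0 where "m0 = (%xi::real^2. if norm xi <= 1 then c else 0)"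
 define m where "m = (%i (xi::real^2). if norm xi <= 1 then 0 else c * xi $ i / (norm xi)^2)"
 define a0 where "a0 = (%xi. cr (m0 xi) * ft h xi)"
 define a where "a = (%i xi. - \<i> * cr (m i xi) * ft h xi)"
 have [measurable]: "m0 \<in> BB" "m i \<in> BB" for i unfolding m0_def m_def by measurable
 have ml: "<|m i xi|> * norm xi <= 1" for i xi
 proof (cases "norm xi <= 1")
  case False
  have "c * <|xi $ i|> <= 1 * norm xi" using c component_le_norm_cart[of xi i] by (intro mult_mono) auto
  then show ?thesis using False c by (simp add: m_def abs_mult abs_divide power2_eq_square field_simps)
 qed (simp add: m_def)
 have m1: "<|m i xi|> <= 1" for i xi
 proof (cases "norm xi <= 1")
  case False
  have "<|m i xi|> * 1 <= <|m i xi|> * norm xi" using False by (intro mult_left_mono) auto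
  then show ?thesis using ml[of i xi] by simp
 qed (simp add: m_def)
 have am: "amp a0" "amp (a i)" for i unfolding a0_def a_def
  by (rule amp_mult[OF admD(5)[OF h], of _ 0]; use c m1 in \<open>auto simp: norm_mult m0_def\<close>)+
 have nb: "(NN xi. EE ((cmod (f xi))^2)) <= EE E" if f: "!!xi. xi ~= 0 ==> cmod (f xi) <= norm xi powr (- s) * cmod (ft h xi)" for f
 proof -
  have "(NN xi. EE ((cmod (f xi))^2)) <= Nsq (- s) h" unfolding Nsq_def
  proof (rule nn_integral_mono_AE)
   show "AE xi in lborel. EE ((cmod (f xi))^2) <= EE (norm xi powr (2 * - s) * (cmod (ft h xi))^2)"
    using AE_lborel_singleton[of "0::real^2"]
   proof eventually_elim
    case (elim xi)
    have "(norm xi powr (- s))^2 = norm xi powr (2 * - s)" by (simp add: power2_eq_square powr_add[symmetric])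
    then show ?case using power_mono[OF f[of xi], of 2] elim by (intro ennreal_leI) (simp add: power_mult_distrib)
   qed
  qed
  with N show ?thesis by simp
 qed
 have n0: "(NN xi. EE ((cmod (a0 xi))^2)) <= EE E"
 proof (rule nb)
  fix xi :: "real^2" assume "xi ~= 0"
  then have "m0 xi <= norm xi powr (- s)" using c s powr_mono'[of "- s" 0 "norm xi"] by (auto simp: m0_def)
  then show "cmod (a0 xi) <= norm xi powr (- s) * cmod (ft h xi)" using c unfolding a0_def norm_mult norm_of_real by (intro mult_right_mono) (auto simp: m0_def)
 qed
 have n1: "(NN xi. EE ((cmod (a i xi))^2)) <= EE E" for i
 proof (rule nb)
  fix xi :: "real^2" assume z: "xi ~= 0"
  have "<|m i xi|> <= norm xi powr (- s)"
  proof (cases "norm xi <= 1")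
   case False
   have "<|m i xi|> <= norm xi powr (- 1)" using ml[of i xi] z by (simp add: powr_minus_divide field_simps)
   also have "... <= norm xi powr (- s)" using False s by (intro powr_mono) auto
   finally show ?thesis .
  qed (simp add: m_def)
  then show "cmod (a i xi) <= norm xi powr (- s) * cmod (ft h xi)" unfolding a_def norm_mult norm_of_real by (intro mult_right_mono) auto
 qed
 have hs: "h (vec2 z) = W a0 0 $$ z + W (dX 1 (a 1)) 0 $$ z + W (dX 2 (a 2)) 0 $$ z" for z
 proof -
  have i: "integrable lborel a0" "integrable lborel (dX 1 (a 1))" "integrable lborel (dX 2 (a 2))" by (intro amp_integrable amp_d am)+
  have e: "a0 xi + (dX 1 (a 1) xi + dX 2 (a 2) xi) = cr c * ft h xi" for xi
  proof (cases "norm xi <= 1")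
   case False
   then have "(xi $ 1)^2 + (xi $ 2)^2 = (norm xi)^2" "norm xi ~= 0" by (auto simp: norm_2)
   then have "m 1 xi * xi $ 1 + m 2 xi * xi $ 2 = c" using False by (simp add: m_def power2_eq_square add_divide_distrib[symmetric] distrib_left[symmetric] mult.assoc)
   then have "cr (m 1 xi) * cr (xi $ 1) + cr (m 2 xi) * cr (xi $ 2) = cr c" by (metis of_real_add of_real_mult)
   then show ?thesis using False by (simp add: a0_def a_def dX_def m0_def algebra_simps) (metis (no_types, opaque_lifting) distrib_left mult.assoc mult.commute)
  qed (simp add: a0_def a_def dX_def m0_def m_def)
  have "W a0 0 $$ z + W (dX 1 (a 1)) 0 $$ z + W (dX 2 (a 2)) 0 $$ z = Re (IF a0 (vec2 z) + (IF (dX 1 (a 1)) (vec2 z) + IF (dX 2 (a 2)) (vec2 z)))"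
   by (simp add: W_IF)
  also have "... = Re (cr c * IF (ft h) (vec2 z))"
   unfolding IF_add[OF i(2,3), symmetric] IF_add[OF i(1) Bochner_Integration.integrable_add[OF i(2,3)], symmetric] e IF_cmult ..
  also have "... = h (vec2 z)" unfolding adm_inversion[OF h] by (simp add: c_def)
  finally show ?thesis by simp
 qed
 have cW: "CO S (%z. W b 0 $$ z)" if "amp b" for b S by (rule cont3_slice[OF cont_W[OF that]])
 \<comment> \<open>The radius is at least 1 as \<open>vR_grad_bounds\<close> requires at time 0. The
   bound is uniform in \<open>R\<close>, so the truncation can be removed by dominated
   convergence.\<close>
 have bound: "<|(LL z. vR R 0 $$ z * h (vec2 z))|> <= 6 * pi * sqrt M * sqrt E" if R: "1 <= R" for R
 proof -
  have R0: "0 < R" "0 <= R" using R by auto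
  have z: "vR R 0 $$ z = 0" "vx R 0 $$ z = 0" "vy R 0 $$ z = 0" if o: "R <= <|fst z|> | R <= <|snd z|>" for z
  proof -
   have "R^2 <= (fst z)^2 + (snd z)^2" using o
   proof
    assume "R <= <|fst z|>" then have "R^2 <= (fst z)^2" using R0 by (simp add: abs_le_square_iff[symmetric])
    then show ?thesis by (simp add: add_increasing2)
   next
    assume "R <= <|snd z|>" then have "R^2 <= (snd z)^2" using R0 by (simp add: abs_le_square_iff[symmetric])
    then show ?thesis by (simp add: add_increasing)
   qed
   then have "cutR R $$ z = 0" "max 0 (1 - ((fst z)^2 + (snd z)^2) / R^2) = 0" using cutR_zero[OF R0(1)] R0 by (auto simp: le_divide_eq)
   then show "vR R 0 $$ z = 0" "vx R 0 $$ z = 0" "vy R 0 $$ z = 0" unfolding vR_def vx_def vy_def by auto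
  qed
  have zb: "z \<notin> sq_box R ==> R <= <|fst z|> | R <= <|snd z|>" for z by (auto simp: in_sq_box)
  note vc = vR_cont[of UNIV R 0]
  have g: "(NN z. EE ((vx R 0 $$ z)^2 + (vy R 0 $$ z)^2)) <= EE (F1 D)"
   using vR_grad_bounds(1)[OF D0 D p3 plt, of 0 R] R by simp
  have b2: "(NN z. EE ((vx R 0 $$ z)^2)) <= EE M" "(NN z. EE ((vy R 0 $$ z)^2)) <= EE M"
   by (rule order_trans[OF nn_integral_mono[OF ennreal_leI] order_trans[OF g ennreal_leI[OF M(2)]]], simp)+
  have b1: "(NN z. EE ((vR R 0 $$ z)^2)) <= EE M"
   by (rule order_trans[OF nn_integral_mono[OF ennreal_leI] order_trans[OF data_L2[OF less_imp_le[OF D0] D] ennreal_leI[OF M(3)]]]) (use vR_abs in \<open>simp add: abs_le_square_iff[symmetric]\<close>)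
  have Ab: "0 < (2 * pi)^2 * E" using E by simp
  have w0: "(NN z. EE ((W a0 0 $$ z)^2)) <= EE ((2 * pi)^2 * E)" "(NN z. EE ((W (a i) 0 $$ z)^2)) <= EE ((2 * pi)^2 * E)" for i
   using E by (intro W_plancherel am n0 n1; simp)+
  define I where "I = (%f b. integral (sq_box R) (%z. f $$ z * W b 0 $$ z))"
  have Ii: "(%z. f $$ z * W b 0 $$ z) integrable_on sq_box R" if "CO UNIV (%z. f $$ z)" "amp b" for f b
   by (intro integrable_continuous continuous_on_mult cW that continuous_on_subset[OF that(1)]) auto
  have bI: "<|I (vR R 0) a0|> <= sqrt M * sqrt ((2 * pi)^2 * E)" "<|I (vx R 0) (a 1)|> <= sqrt M * sqrt ((2 * pi)^2 * E)" "<|I (vy R 0) (a 2)|> <= sqrt M * sqrt ((2 * pi)^2 * E)"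
   unfolding I_def by (rule integral_mult_bound[OF _ cW _ _ w0(1) M(1) Ab] integral_mult_bound[OF _ cW _ _ w0(2) M(1) Ab]; use vc am z zb b1 b2 in auto)+
  have dv: "((%s. vR R 0 s y) hrd vx R 0 x y) (at x)" "((%s. vR R 0 x s) hrd vy R 0 x y) (at y)" for x y
   by (rule C1_partials[OF vR_deriv[OF R0(1)]])+
  have "integral (sq_box R) (%z. vx R 0 $$ z * W (a 1) 0 $$ z + vR R 0 $$ z * W (dX 1 (a 1)) 0 $$ z) = 0"
   by (rule integral_dx_zero[where q="%x y. vR R 0 x y * W (a 1) 0 x y" and qx="%x y. vx R 0 x y * W (a 1) 0 x y + vR R 0 x y * W (dX 1 (a 1)) 0 x y"])
    (use dv DERIV_W(2)[OF am(2)] z[of "(- R, _)"] z[of "(R, _)"] R0 in \<open>auto intro!: DERIV_cong[OF DERIV_mult] continuous_on_add continuous_on_mult vc cW am amp_d\<close>)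
  then have i1: "I (vR R 0) (dX 1 (a 1)) = - I (vx R 0) (a 1)"
   unfolding I_def by (subst (asm) Henstock_Kurzweil_Integration.integral_add) (auto intro!: Ii vc am amp_d)
  have "integral (sq_box R) (%z. vy R 0 $$ z * W (a 2) 0 $$ z + vR R 0 $$ z * W (dX 2 (a 2)) 0 $$ z) = 0"
   by (rule integral_dy_zero[where q="%x y. vR R 0 x y * W (a 2) 0 x y" and qy="%x y. vy R 0 x y * W (a 2) 0 x y + vR R 0 x y * W (dX 2 (a 2)) 0 x y"])
    (use dv DERIV_W(3)[OF am(2)] z[of "(_, - R)"] z[of "(_, R)"] R0 in \<open>auto intro!: DERIV_cong[OF DERIV_mult] continuous_on_add continuous_on_mult vc cW am amp_d\<close>)
  then have i2: "I (vR R 0) (dX 2 (a 2)) = - I (vy R 0) (a 2)"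
   unfolding I_def by (subst (asm) Henstock_Kurzweil_Integration.integral_add) (auto intro!: Ii vc am amp_d)
  have "(LL z. vR R 0 $$ z * h (vec2 z)) = integral (sq_box R) (%z. vR R 0 $$ z * h (vec2 z))"
   by (rule integral_sq_box_lborel(2)) (use z zb in \<open>auto intro!: continuous_on_mult vR_cont continuous_on_compose2[OF admD(2)[OF h] vec2_cont]\<close>)
  also have "... = I (vR R 0) a0 + I (vR R 0) (dX 1 (a 1)) + I (vR R 0) (dX 2 (a 2))"
   unfolding hs distrib_left I_def by (subst Henstock_Kurzweil_Integration.integral_add, intro integrable_add Ii vc am amp_d, intro Ii vc am amp_d)
    (subst Henstock_Kurzweil_Integration.integral_add, (intro Ii vc am amp_d)+, simp)
  finally have "<|(LL z. vR R 0 $$ z * h (vec2 z))|> <= 3 * (sqrt M * sqrt ((2 * pi)^2 * E))" using bI unfolding i1 i2 by linarith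
  then show ?thesis by (simp add: real_sqrt_mult mult_ac)
 qed
 have "(%n. (LL z. vR (1 + real n) 0 $$ z * h (vec2 z))) ----> (LL z. u 0 $$ z * h (vec2 z))"
 proof (rule integral_dominated_convergence[where w="%z. <|u 0 $$ z * h (vec2 z)|>"])
  have "integrable lborel (%z. ph 0 (vec2 z) * h (vec2 z))"
   using pairing_integrable[OF ph_cont(1) h, of 0] integral_vec2(2)[of "%x. ph 0 x * h x"] by simp
  then show "integrable lborel (%z. <|u 0 $$ z * h (vec2 z)|>)" by (simp add: ph_def)
  show "AE z in lborel. (%n. vR (1 + real n) 0 $$ z * h (vec2 z)) ----> u 0 $$ z * h (vec2 z)"
   unfolding vR_def using tendsto_mult[OF tendsto_mult[OF cutR_tendsto tendsto_const] tendsto_const] by (intro AE_I2) fastforce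
  show "AE z in lborel. norm (vR (1 + real n) 0 $$ z * h (vec2 z)) <= <|u 0 $$ z * h (vec2 z)|>" for n
   using vR_abs by (auto simp: abs_mult intro!: AE_I2 mult_right_mono)
  show "(%z. vR (1 + real n) 0 $$ z * h (vec2 z)) \<in> borel_measurable lborel" for n
   using borel_measurable_continuous_onI[OF vR_cont(1)] by measurable
 qed measurable
 then have "<|(LL z. u 0 $$ z * h (vec2 z))|> <= 6 * pi * sqrt M * sqrt E"
  by (intro LIMSEQ_le_const2[OF tendsto_rabs]) (auto intro!: bound)
 moreover have "pairing (ph 0) h = (LL z. u 0 $$ z * h (vec2 z))"
  unfolding pairing_def by (subst integral_vec2(1), measurable) (simp add: ph_def)
 ultimately show ?thesis by (simp add: M_def)
qed

end

end

lemma loc_integrable_weight: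
 assumes F[measurable]: "F \<in> BB" and i: "integrable lborel (%x. (F x)^2 * w x)" and w: "CO UNIV w" "!!x. 0 < w x"
 shows "loc_integrable (%x. F x * w x)"
 unfolding loc_integrable_def
proof (intro conjI allI impI)
 have [measurable]: "w \<in> BB" by (rule borel_measurable_continuous_onI[OF w(1)])
 show "(%x. F x * w x) \<in> borel_measurable lborel" by measurable
 fix K :: "(real^2) set" assume K: "compact K"
 then have [measurable]: "K \<in> sets borel" by (simp add: borel_compact)
 have j: "integrable lborel (%x. ind K x *\<^sub>R ((F x)^2 * w x) + ind K x *\<^sub>R w x)"
  by (intro Bochner_Integration.integrable_add integrable_mult_indicator i borel_integrable_compact[OF K] continuous_on_subset[OF w(1)]) auto
 show "set_integrable lborel K (%x. F x * w x)" unfolding set_integrable_def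
 proof (rule Bochner_Integration.integrable_bound[OF j])
  show "AE x in lborel. norm (ind K x *\<^sub>R (F x * w x)) <= norm (ind K x *\<^sub>R ((F x)^2 * w x) + ind K x *\<^sub>R w x)"
  proof (rule AE_I2)
   fix x
   have "<|F x|> <= (F x)^2 + 1" using zero_le_power2[of "<|F x|> - 1"] by (simp add: power2_diff)
   then have "<|F x|> * w x <= ((F x)^2 + 1) * w x" using w(2)[of x] by (intro mult_right_mono) auto
   then show "norm (ind K x *\<^sub>R (F x * w x)) <= norm (ind K x *\<^sub>R ((F x)^2 * w x) + ind K x *\<^sub>R w x)"
    using w(2)[of x] by (auto simp: indicator_def abs_mult distrib_right)
  qed
 qed measurable
qed

context nlw begin

context
 fixes D :: real
 assumes D0: "0 < D" and D: "(NN z. EE (dat $$ z)) <= EE D" and pp: "1 + sqrt 8 < p" and plt: "p < 5"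
begin

lemmas ctx = D0 D pp plt

text \<open>A pointwise form of Hoelder's inequality: with \<open>c = 1 + norm x\<close>, values
  above the height \<open>c powr (- b)\<close> are paid for by the weighted square, values below it
  by an integrable power of \<open>c\<close>.\<close>

lemma phi1_Lr:
 assumes r: "1 < r" "r <= 2"
 shows "\<exists>K>0. (NN x. EE (<|pt 0 x|> powr r)) <= EE (K powr r)"
proof -
 have "(NN x. EE ((1 + norm x)^2 * (pt 0 x)^2)) = (NN z. EE ((1 + sqrt ((fst z)^2 + (snd z)^2))^2 * (ut 0 $$ z)^2))"
  by (subst nn_integral_vec2, measurable) (simp add: pt_def norm_2)
 also have "... <= (NN z. EE (dat $$ z))"
  by (intro nn_integral_mono ennreal_leI) (auto simp: dat_def distrib_left)
 finally have w: "(NN x. EE ((1 + norm x)^2 * (pt 0 x)^2)) < \<infinity>" using D by (simp add: le_less_trans)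
 \<comment> \<open>\<open>k > 2\<close> is integrability in the plane and amounts to
   \<open>r > 1\<close>; for \<open>r = 2\<close> any number above 2 can stand there.\<close>
 define k where "k = (if r < 2 then 2 * r / (2 - r) else 3)"
 have k: "2 < k" using r by (auto simp: k_def field_simps)
 have pt: "<|a|> powr r <= c^2 * a^2 + c powr (- k)" if c: "1 <= c" for a c :: real
 proof (cases "r = 2")
  case True
  have "a^2 * 1 <= a^2 * c^2" using c by (intro mult_left_mono one_le_power) auto
  then have "<|a|> powr r <= c^2 * a^2" using True by (cases "a = 0") (simp_all add: powr_numeral mult.commute)
  then show ?thesis by (simp add: add_increasing2)
 next
  case False
  with r have r2: "r < 2" by simp
  define b where "b = 2 / (2 - r)"
  have b: "b * (2 - r) = 2" "b * r = k" "0 < b"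
  proof -
   have "2 - r ~= 0" using r2 by simp
   then show "b * (2 - r) = 2" using nonzero_divide_eq_eq[of "2 - r" 2 b] by (metis b_def)
   show "0 < b" using r2 by (simp add: b_def)
   show "b * r = k" using r2 by (simp add: b_def k_def)
  qed
  show ?thesis
  proof (cases "<|a|> <= c powr (- b)")
   case True
   then have "<|a|> powr r <= (c powr (- b)) powr r" using r by (intro powr_mono2) auto
   also have "... = c powr (- k)" using b by (simp add: powr_powr)
   finally show ?thesis by (simp add: add_increasing)
  next
   case False
   have p: "0 < c powr (- b)" using c by simp
   with False have a0: "0 < <|a|>" by linarith
   have "<|a|> powr (r - 2) <= (c powr (- b)) powr (r - 2)" using False p r2 by (intro powr_mono2') auto
   also have "(c powr (- b)) powr (r - 2) = c powr 2" unfolding powr_powr using b by (simp add: algebra_simps)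
   finally have "<|a|> powr 2 * <|a|> powr (r - 2) <= <|a|> powr 2 * c powr 2" by (intro mult_left_mono) auto
   then have "<|a|> powr r <= c^2 * a^2" unfolding powr_add[symmetric] using a0 c by (simp add: powr_numeral mult.commute)
   then show ?thesis by (simp add: add_increasing2)
  qed
 qed
 have "(NN x. EE (<|pt 0 x|> powr r)) <= (NN x. EE ((1 + norm x)^2 * (pt 0 x)^2) + EE ((1 + norm x) powr (- k)))"
 proof (intro nn_integral_mono)
  fix x :: "real^2"
  show "EE (<|pt 0 x|> powr r) <= EE ((1 + norm x)^2 * (pt 0 x)^2) + EE ((1 + norm x) powr (- k))"
   using pt[of "1 + norm x" "pt 0 x"] by (simp add: ennreal_plus[symmetric] ennreal_leI del: ennreal_plus)
 qed
 also have "... = (NN x. EE ((1 + norm x)^2 * (pt 0 x)^2)) + (\<integral>\<^sup>+x. EE ((1 + norm x) powr (- k)) \<partial>(lborel :: (real^2) measure))"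
  by (rule nn_integral_add) auto
 also have "... < \<infinity>" using w nn_integral_decay_finite[OF k] by simp
 finally obtain T where T: "0 <= T" "(NN x. EE (<|pt 0 x|> powr r)) = EE T" by (cases "(NN x. EE (<|pt 0 x|> powr r))") auto
 have "((T + 1) powr (1 / r)) powr r = T + 1" using T r by (simp add: powr_powr)
 then show ?thesis using T by (intro exI[of _ "(T + 1) powr (1 / r)"]) (auto intro!: ennreal_leI)
qed

text \<open>Compare the limit with the value at \<open>tau = 0\<close>: the difference is the
  Duhamel bound with \<open>T = 0\<close>, and the initial pairings are bounded by
  \<open>phi0_dual\<close> and by \<open>phi1_Lr\<close> with Sobolev duality.\<close>

lemma L_bounds:
 assumes s: "s_crit p <= s" "s <= 1"
 obtains C where "0 < C" "!!h E. adm h ==> Nsq (- s) h <= EE E ==> 0 < E ==> <|L0 h|> <= C * sqrt E"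
  "!!h E. adm h ==> Nsq (1 - s) h <= EE E ==> 0 < E ==> <|L1 h|> <= C * sqrt E"
proof -
 have s0: "0 < s" using s s_crit_pos[OF ctx] by simp
 obtain M eps where M: "0 < M" "!!w w' A t. wave w w' ==> (!!tau. Nsq (1 - s) (w tau) <= EE A) ==> 0 < A ==>
  (%n. Pw w w' t (real n)) ----> Lim w w' t & (\<forall>T\<ge>0. <|Pw w w' t T - Lim w w' t|> <= M * sqrt A * (1 + T) powr (- eps))"
  by (rule Pw_limit[OF ctx s]) blast
 obtain C where C: "0 < C" "!!F h B A. F \<in> BB ==> (NN x. EE (<|F x|> powr (2 / (2 - s)))) <= EE (B powr (2 / (2 - s))) ==> 0 < B ==>
  adm h ==> Nsq (1 - s) h <= EE A ==> 0 < A ==> (NN x. EE <|F x * h x|>) <= EE (C * B * sqrt A)"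
  by (rule dual_estimate[OF s0 s(2)]) blast
 obtain K where K: "0 < K" "(NN x. EE (<|pt 0 x|> powr (2 / (2 - s)))) <= EE (K powr (2 / (2 - s)))"
  using phi1_Lr[of "2 / (2 - s)"] s s0 by (auto simp: pos_divide_le_eq pos_less_divide_eq)
 define K0 where "K0 = 6 * pi * sqrt (F1 D + 21 * D)"
 define Z where "Z = M + K0 + C * K"
 have F0: "0 < F1 D" by (rule K2_pos(2)[OF D0 D p3[OF ctx] plt])
 have K0: "0 <= K0" unfolding K0_def using F0 D0 by (intro mult_nonneg_nonneg) auto
 have CK: "0 < C * K" using C K by simp
 show thesis
 proof (rule that[of Z])
  show "0 < Z" using M K0 CK by (simp add: Z_def)
  fix h and E :: real assume h: "adm h" and E: "0 < E"
  have sE: "0 <= sqrt E" using E by simp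
  { assume N: "Nsq (- s) h <= EE E"
   have "<|Pw (%t. Sw t h) (%t. Cw t h) 0 0 - Lim (%t. Sw t h) (%t. Cw t h) 0|> <= M * sqrt E"
    using M(2)[OF wave_propagators(1)[OF h] order_trans[OF Nsq_propagators(1)[OF h] N] E, of 0] by (auto dest: spec[of _ 0])
   then have "<|pairing (ph 0) h - L0 h|> <= M * sqrt E" by (simp add: Pw_diag h L0_def)
   moreover have "<|pairing (ph 0) h|> <= K0 * sqrt E" unfolding K0_def by (rule phi0_dual[OF ctx _ s(2) h N E]) (use s0 in simp)
   moreover have "0 <= (C * K) * sqrt E" using CK sE by simp
   ultimately show "<|L0 h|> <= Z * sqrt E" unfolding Z_def distrib_right by linarith }
  { assume N: "Nsq (1 - s) h <= EE E"
   have "<|Pw (%t. Cw t h) (%t. Dw t h) 0 0 - Lim (%t. Cw t h) (%t. Dw t h) 0|> <= M * sqrt E"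
    using M(2)[OF wave_propagators(2)[OF h] order_trans[OF Nsq_propagators(2)[OF h] N] E, of 0] by (auto dest: spec[of _ 0])
   then have "<|pairing (pt 0) h - L1 h|> <= M * sqrt E" by (simp add: Pw_diag h L1_def)
   moreover have "EE <|pairing (pt 0) h|> <= EE (C * K * sqrt E)"
    unfolding pairing_def
    by (rule order_trans[OF norm_integral_le_nn_integral[of lborel "%x. pt 0 x * h x", unfolded real_norm_def] C(2)[OF _ K(2,1) h N E]]) simp
   then have "<|pairing (pt 0) h|> <= C * K * sqrt E" using CK sE by simp
   moreover have "0 <= K0 * sqrt E" using K0 sE by simp
   ultimately show "<|L1 h|> <= Z * sqrt E" unfolding Z_def distrib_right by linarith }
 qed
qed

text \<open>The bound at \<open>s_crit p\<close>, weakened to a weighted \<open>L^2\<close> bound,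
  gives the position as a locally integrable function; the bound at \<open>s = 1\<close> gives the
  velocity in \<open>L^2\<close>. The convergence rate then comes from \<open>Pw_limit\<close> at
  base time \<open>t\<close> and final time \<open>T = t\<close>.\<close>

lemma scattering:
 "\<exists>f0 f1. scat_data p f0 f1 & (\<forall>s. s_crit p <= s & s <= 1 --> (scat_dist s ph f0 f1 \<longlongrightarrow> 0) at_top)"
proof -
 let ?s = "s_crit p"
 note sc = s_crit_pos[OF ctx]
 \<comment> \<open>The functional bounds are stated for positive upper bounds \<open>E\<close> of
   the norm. Letting \<open>E\<close> decrease to the norm also covers functions of norm 0.\<close>
 have le_eps: "a <= k * Q" if "!!E. Q < E ==> 0 < E ==> a <= k * E" "0 <= Q" "0 < k" for a k Q :: real
 proof (rule field_le_epsilon)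
  fix e :: real assume "0 < e"
  then show "a <= k * Q + e" using that(1)[of "Q + e / k"] that(2,3) by (simp add: distrib_left add_nonneg_pos)
 qed
 let ?w = "%x::real^2. (1 + norm x)^3"
 have wc: "CO UNIV ?w" and wp: "0 < ?w x" for x by (auto intro!: continuous_intros zero_less_power add_pos_nonneg)
 have cont2: "CO UNIV (%x. (h x)^2 * w x)" "bounded {x. (h x)^2 * w x ~= 0}" if "adm h" "CO UNIV w" for h and w :: "real^2 => real"
  by (intro continuous_on_mult continuous_on_power admD(2)[OF that(1)] that(2)) (auto intro!: bounded_subset[OF admD(3)[OF that(1)]])
 have nni: "(NN x. EE ((h x)^2 * w x)) = EE (LL x. (h x)^2 * w x)" if "adm h" "CO UNIV w" "!!x. 0 < w x" for h and w :: "real^2 => real"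
  using that(3) by (intro nn_integral_eq_integral cc_integrable cont2 that) (auto intro!: AE_I2 simp: less_imp_le)
 have iw: "0 <= (LL x. (h x)^2 * w x)" if "!!x. 0 < w x" for h and w :: "real^2 => real"
  using that by (intro Bochner_Integration.integral_nonneg) (simp add: less_imp_le)
 obtain C where C: "0 < C" "!!h E. adm h ==> Nsq (- ?s) h <= EE E ==> 0 < E ==> <|L0 h|> <= C * sqrt E"
  using L_bounds[of ?s] sc by (metis less_imp_le order_refl)
 obtain C1 where C1: "0 < C1" "!!h E. adm h ==> Nsq 0 h <= EE E ==> 0 < E ==> <|L1 h|> <= C1 * sqrt E"
  using L_bounds[of 1] sc by (metis less_imp_le order_refl diff_self)
 obtain K where K: "0 < K" "!!h A. adm h ==> (NN x. EE ((h x)^2 * (1 + norm x)^3)) <= EE A ==> 0 < A ==> Nsq (- ?s) h <= EE (K * A)"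
  by (rule Nsq_weighted[of ?s]) (use sc in auto)
 have sq: "x^2 <= c^2 * k * E" if "<|x|> <= c * sqrt (k * E)" "0 <= k * E" for x c k E :: real
  using power_mono[OF that(1), of 2] that(2) by (simp add: power_mult_distrib mult.assoc)
 have b0: "(L0 h)^2 <= (C^2 * K) * (LL x. (h x)^2 * ?w x)" if h: "adm h" for h
 proof (rule le_eps)
  fix E assume E: "(LL x. (h x)^2 * ?w x) < E" "0 < E"
  have "Nsq (- ?s) h <= EE (K * E)" using E by (intro K(2) h) (auto simp: nni[OF h wc wp] intro!: ennreal_leI)
  from C(2)[OF h this] show "(L0 h)^2 <= C^2 * K * E" using E K by (intro sq) auto
 qed (use iw wp C K in auto)
 obtain F0 where F0: "F0 \<in> BB" "integrable lborel (%x. (F0 x)^2 * ?w x)" "!!h. adm h ==> L0 h = (LL x. F0 x * h x * ?w x)"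
  by (rule riesz_adm[OF wc wp L_lin(1)[OF ctx] b0]) (use C K in auto)
 have b1: "(L1 h)^2 <= (C1^2 * (2 * pi)^2) * (LL x. (h x)^2 * 1)" if h: "adm h" for h
 proof (rule le_eps)
  fix E assume E: "(LL x. (h x)^2 * 1) < E" "0 < E"
  have "Nsq 0 h <= (NN xi. EE ((cmod (ft h xi))^2))" unfolding Nsq_def by (intro nn_integral_mono ennreal_leI) (auto simp: powr_def)
  also have "... <= EE ((2 * pi)^2 * E)"
   by (rule ft_plancherel[OF h]) (use E nni[OF h, of "%_. 1"] in \<open>auto intro!: ennreal_leI\<close>)
  finally show "(L1 h)^2 <= C1^2 * (2 * pi)^2 * E" using C1(2)[OF h, of "(2 * pi)^2 * E"] E by (intro sq) auto
 qed (use iw[of "%_. 1"] C1 in auto)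
 obtain f1 where f1: "f1 \<in> BB" "integrable lborel (%x. (f1 x)^2 * 1)" "!!h. adm h ==> L1 h = (LL x. f1 x * h x * 1)"
  by (rule riesz_adm[OF continuous_on_const _ L_lin(2)[OF ctx] b1]) (use C1 in auto)
 define f0 where "f0 = (%x. F0 x * ?w x)"
 have p: "pairing f0 h = L0 h" "pairing f1 h = L1 h" if "adm h" for h
  using F0(3)[OF that] f1(3)[OF that] by (simp_all add: pairing_def f0_def mult_ac)
 have hd: "hdot_sq s (pairing f0) < \<infinity>" "hdot_sq (s - 1) (pairing f1) < \<infinity>" if s: "?s <= s" "s <= 1" for s
 proof -
  obtain C where C: "0 < C" "!!h E. adm h ==> Nsq (- s) h <= EE E ==> 0 < E ==> <|L0 h|> <= C * sqrt E"
   "!!h E. adm h ==> Nsq (1 - s) h <= EE E ==> 0 < E ==> <|L1 h|> <= C * sqrt E" by (rule L_bounds[OF s]) blast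
  have "hdot_sq s (pairing f0) <= EE (C^2)" "hdot_sq (s - 1) (pairing f1) <= EE (C^2)"
   by (rule hdot_sq_le; use C test_adm in \<open>auto simp: p\<close>)+
  then show "hdot_sq s (pairing f0) < \<infinity>" "hdot_sq (s - 1) (pairing f1) < \<infinity>" by (auto simp: le_less_trans)
 qed
 have "scat_data p f0 f1" unfolding scat_data_def
  using hd[of ?s] hd[of 1] sc loc_integrable_weight[OF F0(1,2) wc wp] loc_integrable_weight[OF f1(1,2)] f1(2) by (auto simp: f0_def)
 moreover have "(scat_dist s ph f0 f1 \<longlongrightarrow> 0) at_top" if s: "?s <= s" "s <= 1" for s
 proof -
  obtain M eps where M: "0 < M" "0 < eps" "!!w w' A t. wave w w' ==> (!!tau. Nsq (1 - s) (w tau) <= EE A) ==> 0 < A ==>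
   (%n. Pw w w' t (real n)) ----> Lim w w' t & (\<forall>T\<ge>0. <|Pw w w' t T - Lim w w' t|> <= M * sqrt A * (1 + T) powr (- eps))"
   by (rule Pw_limit[OF ctx s]) blast
  have bd: "scat_dist s ph f0 f1 t <= EE ((M * (1 + t) powr (- eps))^2) + EE ((M * (1 + t) powr (- eps))^2)" if t: "0 <= t" for t
   unfolding scat_dist_def
  proof (intro add_mono hdot_sq_le)
   fix g and E :: real assume "test_fun g" and E: "0 < E"
   then have g: "adm g" by (simp add: test_adm)
   note q = adm_propagators(1-3)[OF g, of t]
   { assume N: "Nsq (- s) g <= EE E"
    have "<|pairing (ph t) g - Lim (%t. Sw t g) (%t. Cw t g) t|> <= M * sqrt E * (1 + t) powr (- eps)"
     using M(3)[OF wave_propagators(1)[OF g] order_trans[OF Nsq_propagators(1)[OF g] N] E, of t] t by (auto simp: Pw_diag[OF g, symmetric])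
    then show "<|pairing (ph t) g - pairing f0 (Cw t g) - pairing f1 (Sw t g)|> <= M * (1 + t) powr (- eps) * sqrt E"
     unfolding Lim_group[OF ctx g] by (simp add: p q mult_ac diff_diff_eq) }
   { assume "Nsq (- (s - 1)) g <= EE E"
    then have N: "Nsq (1 - s) g <= EE E" by simp
    have "<|pairing (pt t) g - Lim (%t. Cw t g) (%t. Dw t g) t|> <= M * sqrt E * (1 + t) powr (- eps)"
     using M(3)[OF wave_propagators(2)[OF g] order_trans[OF Nsq_propagators(2)[OF g] N] E, of t] t by (auto simp: Pw_diag[OF g, symmetric])
    moreover have "dt ph t = pt t" using dt_ph by auto
    ultimately show "<|pairing (dt ph t) g - pairing f0 (Dw t g) - pairing f1 (Cw t g)|> <= M * (1 + t) powr (- eps) * sqrt E"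
     unfolding Lim_group[OF ctx g] by (simp add: p q mult_ac diff_diff_eq) }
  qed (use M in auto)
  have l: "((%t. (M * (1 + t) powr (- eps))^2) \<longlongrightarrow> 0) at_top"
  proof -
   have "((%t. (1 + t) powr (- eps)) \<longlongrightarrow> 0) at_top" using M(2) by real_asymp
   from tendsto_power[OF tendsto_mult_right_zero[OF this, of M], of 2] show ?thesis by simp
  qed
  have "((%t. EE ((M * (1 + t) powr (- eps))^2) + EE ((M * (1 + t) powr (- eps))^2)) \<longlongrightarrow> 0 + 0) at_top"
   using tendsto_ennrealI[OF l] by (intro tendsto_add) simp_all
  then have lim: "((%t. EE ((M * (1 + t) powr (- eps))^2) + EE ((M * (1 + t) powr (- eps))^2)) \<longlongrightarrow> 0) at_top" by simp
  show ?thesis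
   by (rule tendsto_sandwich[OF _ _ tendsto_const lim]) (use bd in \<open>auto intro: eventually_mono[OF eventually_ge_at_top[of 0]]\<close>)
 qed
 ultimately show ?thesis by blast
qed

end

lemma nlw_reverse:
 "nlw p (%t. u (- t)) (%t x y. - ut (- t) x y) (%t. ux (- t)) (%t. uy (- t)) (%t. utt (- t)) (%t x y. - utx (- t) x y) (%t x y. - uty (- t) x y) (%t. uxx (- t)) (%t. uxy (- t)) (%t. uyy (- t))"
proof -
 have d: "((%s. f (- s)) hrd - f' (- t)) (at t)" if "!!s. (f hrd f' s) (at s)" for f f' and t :: real
  using DERIV_chain2[where f=f and g=uminus and x=t and Db="- 1" and Da="f' (- t)" and s=UNIV, OF that DERIV_minus[OF DERIV_ident]] by simp
 have c: "cont3 (%t. f (- t))" if "cont3 f" for f unfolding cont3_def by (rule cont3_comp[OF that]) (intro continuous_intros)+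
 have c': "cont3 (%t x y. - f (- t) x y)" if "cont3 f" for f using c[OF that] unfolding cont3_def by (rule continuous_on_minus)
 have m: "((%s. - f (- s)) hrd f' (- t)) (at t)" if "!!s. (f hrd f' s) (at s)" for f f' and t :: real
  using DERIV_minus[OF d[OF that]] by simp
 show ?thesis
 proof unfold_locales
  fix t x y
  show "((%s. u (- s) x y) hrd - ut (- t) x y) (at t)" by (rule d[OF du(1)])
  show "((%s. - ut (- s) x y) hrd utt (- t) x y) (at t)" by (rule m[OF dut(1)])
  show "((%s. ux (- s) x y) hrd - utx (- t) x y) (at t)" by (rule d[OF dux(1)])
  show "((%s. uy (- s) x y) hrd - uty (- t) x y) (at t)" by (rule d[OF duy(1)])
 qed (intro p1 p5 du dut dux duy dux_joint c c' cont eq DERIV_minus)+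
qed

text \<open>Reversing time changes the sign of the velocity and of the odd propagators
  \<open>Sw\<close> and \<open>Dw\<close>. With \<open>f1\<close> replaced by its negative,
  \<open>scat_dist\<close> is therefore unchanged.\<close>

lemma scattering_past:
 assumes ctx: "0 < D" "(NN z. EE (dat $$ z)) <= EE D" "1 + sqrt 8 < p" "p < 5"
 shows "\<exists>f0 f1. scat_data p f0 f1 & (\<forall>s. s_crit p <= s & s <= 1 --> (scat_dist s ph f0 f1 \<longlongrightarrow> 0) at_bot)"
proof -
 let ?ph = "%t. ph (- t)"
 note n = nlw_reverse
 have e: "nlw.ph (%t. u (- t)) = ?ph" using nlw.ph_def[OF n] by (auto simp: ph_def[abs_def])
 have d: "nlw.dat p (%t. u (- t)) (%t x y. - ut (- t) x y) (%t. ux (- t)) (%t. uy (- t)) = dat"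
  by (simp add: fun_eq_iff nlw.dat_def[OF n] dat_def)
 obtain f0 f1 where f: "scat_data p f0 f1" "!!s. s_crit p <= s ==> s <= 1 ==> (scat_dist s ?ph f0 f1 \<longlongrightarrow> 0) at_top"
  using nlw.scattering[OF n ctx(1) _ ctx(3,4)] ctx(2) unfolding e d by blast
 have h: "hdot_sq s (%g. - L g) = hdot_sq s L" for s L unfolding hdot_sq_def by simp
 have pm: "pairing (%x. - f x) g = - pairing f g" "pairing f (%x. - g x) = - pairing f g" for f g unfolding pairing_def by simp_all
 have pe: "Cw (- t) g = Cw t g" "Sw (- t) g = (%x. - Sw t g x)" "Dw (- t) g = (%x. - Dw t g x)" for t g using wave_parity by auto
 have dd: "dt ?ph t = (%x. - pt (- t) x)" "dt ph t = pt t" for t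
 proof -
  have "dt ?ph t x = - pt (- t) x" for x
   unfolding dt_def ph_def pt_def by (rule DERIV_imp_deriv) (rule nlw.du(1)[OF n])
  then show "dt ?ph t = (%x. - pt (- t) x)" "dt ph t = pt t" using dt_ph by auto
 qed
 have sd: "scat_dist s ph f0 (%x. - f1 x) (- t) = scat_dist s ?ph f0 f1 t" for s t
 proof -
  have "(%g. - pairing (pt (- t)) g - pairing f0 (Dw t g) - pairing f1 (Cw t g)) = (%g. - (pairing (pt (- t)) g + pairing f0 (Dw t g) + pairing f1 (Cw t g)))" by simp
  then show ?thesis unfolding scat_dist_def dd pe pm by (simp only: h) simp
 qed
 have "scat_data p f0 (%x. - f1 x)" using f(1) h[of _ "pairing f1"] unfolding scat_data_def loc_integrable_def set_integrable_def pm[abs_def] by auto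
 moreover have "(scat_dist s ph f0 (%x. - f1 x) \<longlongrightarrow> 0) at_bot" if "s_crit p <= s" "s <= 1" for s
  unfolding filterlim_at_bot_mirror sd using f(2)[OF that] by simp
 ultimately show ?thesis by blast
qed

end

subsection \<open>Solutions in coordinates\<close>

text \<open>The second difference over a small square is evaluated by the mean value theorem in both
  orders; continuity finishes as the square shrinks. It is needed because \<open>Ck 2\<close>
  provides separate witnesses for the two orders, while the locale has one name for both.\<close>

lemma symmetric_mixed_partials:
 fixes g :: "real => real => real"
 assumes d: "!!x y. ((%s. g s y) hrd gx x y) (at x)" "!!x y. ((%s. g x s) hrd gy x y) (at y)"
  "!!x y. ((%s. gx x s) hrd gxy x y) (at y)" "!!x y. ((%s. gy s y) hrd gyx x y) (at x)"
  and c: "CO UNIV (%z. gxy $$ z)" "CO UNIV (%z. gyx $$ z)"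
 shows "gxy a b = gyx a b"
proof -
 have key: "\<exists>x y x' y'. a < x & x < a + h & b < y & y < b + h & a < x' & x' < a + h & b < y' & y' < b + h & gxy x y = gyx x' y'" if h: "0 < h" for h
 proof -
  have dx: "((%s. g s (b + h) - g s b) hrd gx x (b + h) - gx x b) (at x)" for x by (intro DERIV_diff d)
  have dy: "((%s. g (a + h) s - g a s) hrd gy (a + h) y - gy a y) (at y)" for y by (intro DERIV_diff d)
  obtain x where x: "a < x" "x < a + h" "g (a + h) (b + h) - g (a + h) b - (g a (b + h) - g a b) = h * (gx x (b + h) - gx x b)"
   using MVT2[of a "a + h", OF _ dx] h by auto
  obtain y where y: "b < y" "y < b + h" "gx x (b + h) - gx x b = h * gxy x y" using MVT2[of b "b + h" "gx x", OF _ d(3)] h by auto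
  obtain y' where y': "b < y'" "y' < b + h" "g (a + h) (b + h) - g a (b + h) - (g (a + h) b - g a b) = h * (gy (a + h) y' - gy a y')"
   using MVT2[of b "b + h", OF _ dy] h by auto
  obtain x' where x': "a < x'" "x' < a + h" "gy (a + h) y' - gy a y' = h * gyx x' y'" using MVT2[of a "a + h" "%s. gy s y'", OF _ d(4)] h by auto
  have "h * (h * gxy x y) = h * (h * gyx x' y')" using x(3) y'(3) unfolding y(3) x'(3) by linarith
  then show ?thesis using x y x' y' h by auto
 qed
 define h where "h = (%n. 1 / real (Suc n))"
 have hp: "0 < h n" for n by (simp add: h_def)
 have h0: "h ----> 0" unfolding h_def using LIMSEQ_Suc[OF lim_1_over_n] by simp
 obtain x y x' y' where q: "!!n. a < x n & x n < a + h n & b < y n & y n < b + h n & a < x' n & x' n < a + h n & b < y' n & y' n < b + h n & gxy (x n) (y n) = gyx (x' n) (y' n)"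
  using key[OF hp] by metis
 have l: "z ----> e" if "!!n. e < z n & z n < e + h n" for z and e :: real
 proof (rule tendsto_sandwich[OF _ _ tendsto_const])
  show "(%n. e + h n) ----> e" using tendsto_add[OF tendsto_const h0, of e] by simp
 qed (use that in \<open>auto intro!: always_eventually less_imp_le\<close>)
 have lm: "(%n. f (x n) (y n)) ----> f a b" if "CO UNIV (%z. f $$ z)" "x ----> a" "y ----> b" for f :: "real => real => real" and x y
  using isCont_tendsto_compose[OF _ tendsto_Pair[OF that(2,3)], of "%z. f $$ z"] that(1) by (simp add: continuous_on_eq_continuous_at)
 have "x ----> a" "y ----> b" "x' ----> a" "y' ----> b" by (rule l, use q in simp)+
 then have "(%n. gxy (x n) (y n)) ----> gxy a b" "(%n. gyx (x' n) (y' n)) ----> gyx a b" using lm[OF c(1)] lm[OF c(2)] by blast+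
 moreover have "gxy (x n) (y n) = gyx (x' n) (y' n)" for n using q by blast
 ultimately show ?thesis using LIMSEQ_unique[of "%n. gyx (x' n) (y' n)"] by simp
qed

abbreviation e0 :: "real \<times> (real^2)" where "e0 \<equiv> (1, 0)"
abbreviation e1 :: "real \<times> (real^2)" where "e1 \<equiv> (0, axis 1 1)"
abbreviation e2 :: "real \<times> (real^2)" where "e2 \<equiv> (0, axis 2 1)"

lemma Basis_012: "(Basis :: (real \<times> (real^2)) set) = {e0, e1, e2}"
 by (auto simp: Basis_prod_def Basis_2)

lemma sum_Basis_012: "(\<Sum>b\<in>(Basis :: (real \<times> (real^2)) set). f b) = f e0 + f e1 + (f e2 :: real)"
 unfolding Basis_012 by (simp add: axis_2_neq add.assoc)

lemma grad_partials:
 fixes f :: "real \<times> (real^2) => real"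
 assumes f: "!!z. (f has_derivative (%h. \<Sum>b\<in>Basis. (h \<bullet> b) * g b z)) (at z)"
 shows "((%s. f (s, vec2 (x, y))) hrd g e0 (t, vec2 (x, y))) (at t)"
  "((%s. f (t, vec2 (s, y))) hrd g e1 (t, vec2 (x, y))) (at x)"
  "((%s. f (t, vec2 (x, s))) hrd g e2 (t, vec2 (x, y))) (at y)"
  "((%w. f (t, vec2 (fst w, snd w))) has_derivative (%h. fst h * g e1 (t, vec2 (x, y)) + snd h * g e2 (t, vec2 (x, y)))) (at (x, y))"
  "pdir f e0 z = g e0 z" "pdir f e1 z = g e1 z" "pdir f e2 z = g e2 z"
proof -
 have v: "vec2 (s, r) = s *\<^sub>R axis 1 1 + r *\<^sub>R axis 2 1" for s r by (auto simp: vec_eq_iff forall_2 axis_def)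
 have ip: "axis 1 1 \<bullet> (axis 2 1 :: real^2) = 0" "axis 2 1 \<bullet> (axis 1 1 :: real^2) = 0" "axis i 1 \<bullet> (axis i 1 :: real^2) = 1" for i by (simp_all add: inner_axis_axis)
 have f': "(f has_derivative (%h. (h \<bullet> e0) * g e0 z + (h \<bullet> e1) * g e1 z + (h \<bullet> e2) * g e2 z)) (at z)" for z
  using f[of z] unfolding sum_Basis_012 .
 have D: "((%s. f (p s)) hrd g v (p t)) (at t)" if "(p has_derivative (%h. h *\<^sub>R v)) (at t)" "v \<in> {e0, e1, e2}" for p v t
  using has_derivative_compose[OF that(1) f'] that(2)
  by (auto simp: has_field_derivative_def ip mult_commute_abs inner_axis_axis)
 show "((%s. f (s, vec2 (x, y))) hrd g e0 (t, vec2 (x, y))) (at t)" by (rule D) (auto intro!: derivative_eq_intros)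
 show "((%s. f (t, vec2 (s, y))) hrd g e1 (t, vec2 (x, y))) (at x)" by (rule D) (auto simp: v intro!: derivative_eq_intros)
 show "((%s. f (t, vec2 (x, s))) hrd g e2 (t, vec2 (x, y))) (at y)" by (rule D) (auto simp: v intro!: derivative_eq_intros)
 have "((%w. (t, vec2 (fst w, snd w))) has_derivative (%h. (0, fst h *\<^sub>R axis 1 1 + snd h *\<^sub>R axis 2 1))) (at (x, y))"
  unfolding v by (auto intro!: derivative_eq_intros)
 from has_derivative_compose[OF this f']
 show "((%w. f (t, vec2 (fst w, snd w))) has_derivative (%h. fst h * g e1 (t, vec2 (x, y)) + snd h * g e2 (t, vec2 (x, y)))) (at (x, y))"
  by (simp add: inner_add_left ip)
 have P: "pdir f v z = g v z" if "v \<in> {e0, e1, e2}" for v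
 proof -
  have "((%s. z + s *\<^sub>R v) has_derivative (%h. h *\<^sub>R v)) (at 0)" by (auto intro!: derivative_eq_intros)
  from DERIV_imp_deriv[OF D[OF this that]] show ?thesis by (simp add: pdir_def)
 qed
 show "pdir f e0 z = g e0 z" "pdir f e1 z = g e1 z" "pdir f e2 z = g e2 z" by (rule P, simp)+
qed

lemma cont3_vec2: "CO UNIV f ==> cont3 (%t x y. f (t, vec2 (x, y)))"
 unfolding cont3_def by (rule continuous_on_compose2[of UNIV f]) (auto intro!: continuous_intros continuous_on_compose2[OF vec2_cont])

lemma nlw_solution_locale:
 assumes sol: "nlw_solution p \<phi>0 \<phi>1 \<phi>" and p: "1 < p" "p <= 5"
 obtains ut ux uy utt utx uty uxx uxy uyy where "nlw p (%t x y. \<phi> t (vec2 (x, y))) ut ux uy utt utx uty uxx uxy uyy"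
  "E02 p \<phi>0 \<phi>1 = (NN z. EE (nlw.dat p (%t x y. \<phi> t (vec2 (x, y))) ut ux uy $$ z))"
proof -
 define \<Phi> where "\<Phi> = (%z::real \<times> (real^2). \<phi> $$ z)"
 have C: "Ck 2 \<Phi>" and E: "!!z. - pdir (pdir \<Phi> e0) e0 z + (\<Sum>i\<in>UNIV. pdir (pdir \<Phi> (0, axis i 1)) (0, axis i 1) z) = <|\<Phi> z|> powr (p - 1) * \<Phi> z"
  and i0: "!!x. \<phi> 0 x = \<phi>0 x" and i1: "!!x. dt \<phi> 0 x = \<phi>1 x"
  using sol unfolding nlw_solution_def \<Phi>_def Let_def by auto
 obtain g where g: "!!z. (\<Phi> has_derivative (%h. \<Sum>b\<in>Basis. (h \<bullet> b) * g b z)) (at z)" "!!b. b \<in> Basis ==> Ck (Suc 0) (g b)"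
  using C unfolding numeral_2_eq_2 Ck.simps(2)[of "Suc 0"] by blast
 have "\<forall>b\<in>Basis. \<exists>D. (\<forall>z. (g b has_derivative (%h. \<Sum>c\<in>Basis. (h \<bullet> c) * D c z)) (at z)) & (\<forall>c\<in>Basis. CO UNIV (D c))"
  using g(2) by simp
 from bchoice[OF this] obtain G where G: "!!b z. b \<in> Basis ==> (g b has_derivative (%h. \<Sum>c\<in>Basis. (h \<bullet> c) * G b c z)) (at z)" "!!b c. b \<in> Basis ==> c \<in> Basis ==> CO UNIV (G b c)"
  by blast
 have B: "e0 \<in> Basis" "e1 \<in> Basis" "e2 \<in> Basis" by (auto simp: Basis_012)
 note d = grad_partials[OF g(1)] and d0 = grad_partials[OF G(1)[OF B(1)]] and d1 = grad_partials[OF G(1)[OF B(2)]] and d2 = grad_partials[OF G(1)[OF B(3)]]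
 have c0: "CO UNIV \<Phi>" "b \<in> Basis ==> CO UNIV (g b)" for b
  using has_derivative_continuous[OF g(1)] has_derivative_continuous[OF G(1)] by (auto simp: continuous_on_eq_continuous_at)
 let ?f = "%f t x y. f (t, vec2 (x, y))"
 have c2: "cont3 (?f (G b c))" if "b \<in> Basis" "c \<in> Basis" for b c by (rule cont3_vec2[OF G(2)[OF that]])
 have cc: "CO S (%z. G b c (h z, vec2 (k z, l z)))" if "b \<in> Basis" "c \<in> Basis" "CO S h" "CO S k" "CO S l" for b c h k l and S :: "(real \<times> real) set"
  using cont3_comp[OF c2[OF that(1,2)] that(3-5)] .
 have s1: "G e0 e1 (t, vec2 (x, y)) = G e1 e0 (t, vec2 (x, y))" for t x y
  by (rule symmetric_mixed_partials[where g="%t x. \<Phi> (t, vec2 (x, y))" and gx="%t x. g e0 (t, vec2 (x, y))" and gy="%t x. g e1 (t, vec2 (x, y))"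
   and gxy="%t x. G e0 e1 (t, vec2 (x, y))" and gyx="%t x. G e1 e0 (t, vec2 (x, y))"]) (intro d d0 d1 cc B continuous_intros)+
 have s2: "G e0 e2 (t, vec2 (x, y)) = G e2 e0 (t, vec2 (x, y))" for t x y
  by (rule symmetric_mixed_partials[where g="%t y. \<Phi> (t, vec2 (x, y))" and gx="%t y. g e0 (t, vec2 (x, y))" and gy="%t y. g e2 (t, vec2 (x, y))"
   and gxy="%t y. G e0 e2 (t, vec2 (x, y))" and gyx="%t y. G e2 e0 (t, vec2 (x, y))"]) (intro d d0 d2 cc B continuous_intros)+
 have s3: "G e1 e2 (t, vec2 (x, y)) = G e2 e1 (t, vec2 (x, y))" for t x y
  by (rule symmetric_mixed_partials[where g="%x y. \<Phi> (t, vec2 (x, y))" and gx="%x y. g e1 (t, vec2 (x, y))" and gy="%x y. g e2 (t, vec2 (x, y))"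
   and gxy="%x y. G e1 e2 (t, vec2 (x, y))" and gyx="%x y. G e2 e1 (t, vec2 (x, y))"]) (intro d d1 d2 cc B continuous_intros)+
 have pe: "pdir \<Phi> e0 = g e0" "pdir \<Phi> e1 = g e1" "pdir \<Phi> e2 = g e2" using d(5-7) by auto
 have eq: "G e0 e0 z = G e1 e1 z + G e2 e2 z - <|\<Phi> z|> powr (p - 1) * \<Phi> z" for z
  using E[of z] unfolding sum_2 pe d0(5) d1(6) d2(7) by linarith
 have ph: "\<phi> t v = \<Phi> (t, v)" for t v by (simp add: \<Phi>_def)
 have n: "nlw p (%t x y. \<phi> t (vec2 (x, y))) (?f (g e0)) (?f (g e1)) (?f (g e2)) (?f (G e0 e0)) (?f (G e0 e1)) (?f (G e0 e2)) (?f (G e1 e1)) (?f (G e1 e2)) (?f (G e2 e2))"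
  unfolding ph
 proof unfold_locales
  fix t x y
  show "((%s. g e1 (s, vec2 (x, y))) hrd G e0 e1 (t, vec2 (x, y))) (at t)" unfolding s1 by (rule d1)
  show "((%s. g e2 (s, vec2 (x, y))) hrd G e0 e2 (t, vec2 (x, y))) (at t)" unfolding s2 by (rule d2)
  show "((%s. g e2 (t, vec2 (s, y))) hrd G e1 e2 (t, vec2 (x, y))) (at x)" unfolding s3 by (rule d2)
  show "((%z. \<Phi> (t, vec2 (fst z, snd z))) has_derivative (%h. fst h * g e1 (t, vec2 (x, y)) + snd h * g e2 (t, vec2 (x, y)))) (at (x, y))" by (rule d)
 qed (intro p d d0 d1 d2 cont3_vec2 c0 G(2) B eq)+
 have gs: "grad_sq \<phi>0 v = (g e1 (0, v))^2 + (g e2 (0, v))^2" for v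
 proof -
  have "pdir \<phi>0 (axis i 1) v = pdir \<Phi> (0, axis i 1) (0, v)" for i by (simp add: pdir_def \<Phi>_def i0)
  then show ?thesis by (simp add: grad_sq_def sum_2 pe)
 qed
 have ph1: "\<phi>1 v = g e0 (0, v)" for v
 proof -
  have "((%s. \<phi> s v) hrd g e0 (0, v)) (at 0)" using d(1)[of "v $ 1" "v $ 2" 0] by (simp add: vec2_eta ph)
  from DERIV_imp_deriv[OF this] show ?thesis unfolding i1[symmetric] dt_def .
 qed
 let ?dat = "nlw.dat p (%t x y. \<phi> t (vec2 (x, y))) (?f (g e0)) (?f (g e1)) (?f (g e2))"
 have "CO UNIV (%z. ?dat $$ z)" by (rule nlw.contdat[OF n])
 from continuous_on_compose2[OF this, of UNIV "%x::real^2. (x $ 1, x $ 2)"]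
 have cd: "CO UNIV (%x::real^2. ?dat (x $ 1) (x $ 2))" by (simp add: continuous_on_Pair continuous_on_component)
 have "E02 p \<phi>0 \<phi>1 = (NN x. EE (?dat (x $ 1) ((x::real^2) $ 2)))"
  unfolding E02_def
 proof (intro nn_integral_cong)
  fix x :: "real^2"
  have "(1 + norm x) powr 2 = (1 + norm x)^2" by (simp add: powr_numeral add_nonneg_pos)
  then show "EE ((1 + norm x) powr 2 * (grad_sq \<phi>0 x + (\<phi>1 x)^2) + (1 + norm x) powr 2 * <|\<phi>0 x|> powr (p + 1)) = EE (?dat (x $ 1) (x $ 2))"
   by (simp add: nlw.dat_def[OF n] gs ph1 i0 norm_2 vec2_eta)
 qed
 also have "... = (NN z. EE (?dat $$ z))"
  by (subst nn_integral_vec2) (use borel_measurable_continuous_onI[OF cd] in auto)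
 finally show thesis using that[OF n] by blast
qed

theorem theorem1:
  fixes p :: real
  assumes "1 < p" and "p \<le> 5"
  shows "(\<exists>C::real. \<forall>\<phi>0 \<phi>1 \<phi>. nlw_solution p \<phi>0 \<phi>1 \<phi> \<longrightarrow> E02 p \<phi>0 \<phi>1 < \<infinity> \<longrightarrow>
            (\<forall>t\<ge>0. (\<integral>\<^sup>+ x. ennreal (\<bar>\<phi> t x\<bar> powr (p + 1)) \<partial>lborel)
                     \<le> ennreal C * E02 p \<phi>0 \<phi>1 * ennreal ((1 + t) powr (- (p - 1) / 2))))
       \<and> (1 + sqrt 8 < p \<and> p < 5 \<longrightarrow>
          (\<forall>\<phi>0 \<phi>1 \<phi>. nlw_solution p \<phi>0 \<phi>1 \<phi> \<longrightarrow> E02 p \<phi>0 \<phi>1 < \<infinity> \<longrightarrow>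
             (\<exists>f0 f1. scat_data p f0 f1 \<and>
                (\<forall>s. s_crit p \<le> s \<and> s \<le> 1 \<longrightarrow> (scat_dist s \<phi> f0 f1 \<longlongrightarrow> 0) at_top)) \<and>
             (\<exists>f0 f1. scat_data p f0 f1 \<and>
                (\<forall>s. s_crit p \<le> s \<and> s \<le> 1 \<longrightarrow> (scat_dist s \<phi> f0 f1 \<longlongrightarrow> 0) at_bot))))"
proof (intro conjI impI allI)
 \<comment> \<open>The constant 564 serves for every admissible \<open>p\<close>.\<close>
 have "(NN x. EE (<|\<phi> t x|> powr (p + 1))) <= EE 564 * E02 p \<phi>0 \<phi>1 * EE ((1 + t) powr (- (p - 1) / 2))"
  if sol: "nlw_solution p \<phi>0 \<phi>1 \<phi>" and E: "E02 p \<phi>0 \<phi>1 < \<infinity>" and t: "0 <= t" for \<phi>0 \<phi>1 \<phi> t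
 proof -
  obtain ut ux uy utt utx uty uxx uxy uyy where n: "nlw p (%t x y. \<phi> t (vec2 (x, y))) ut ux uy utt utx uty uxx uxy uyy"
   "E02 p \<phi>0 \<phi>1 = (NN z. EE (nlw.dat p (%t x y. \<phi> t (vec2 (x, y))) ut ux uy $$ z))"
   by (rule nlw_solution_locale[OF sol assms]) blast
  interpret nlw p "%t x y. \<phi> t (vec2 (x, y))" ut ux uy utt utx uty uxx uxy uyy by (rule n)
  have e: "ph t x = \<phi> t x" for x by (simp add: ph_def vec2_eta)
  obtain D where D: "0 <= D" "E02 p \<phi>0 \<phi>1 = EE D" using E by (cases "E02 p \<phi>0 \<phi>1") auto
  have "(NN x. EE (<|\<phi> t x|> powr (p + 1))) = (NN z. EE (<|\<phi> t (vec2 (fst z, snd z))|> powr (p + 1)))"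
   unfolding e[symmetric] by (subst nn_integral_vec2) simp_all
  also have "... <= EE (564 * D * (1 + t) powr (- (p - 1) / 2))"
   by (rule potential_decay[OF D(1) _ t]) (use n(2) D(2) in simp)
  also have "... = EE 564 * E02 p \<phi>0 \<phi>1 * EE ((1 + t) powr (- (p - 1) / 2))"
   unfolding D(2) using D(1) by (simp add: ennreal_mult)
  finally show ?thesis .
 qed
 then show "\<exists>C::real. \<forall>\<phi>0 \<phi>1 \<phi>. nlw_solution p \<phi>0 \<phi>1 \<phi> --> E02 p \<phi>0 \<phi>1 < \<infinity> -->
  (\<forall>t\<ge>0. (NN x. EE (<|\<phi> t x|> powr (p + 1))) <= EE C * E02 p \<phi>0 \<phi>1 * EE ((1 + t) powr (- (p - 1) / 2)))" by blast
next
 fix \<phi>0 \<phi>1 \<phi>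
 assume pp: "1 + sqrt 8 < p & p < 5" and sol: "nlw_solution p \<phi>0 \<phi>1 \<phi>" and E: "E02 p \<phi>0 \<phi>1 < \<infinity>"
 obtain ut ux uy utt utx uty uxx uxy uyy where n: "nlw p (%t x y. \<phi> t (vec2 (x, y))) ut ux uy utt utx uty uxx uxy uyy"
  "E02 p \<phi>0 \<phi>1 = (NN z. EE (nlw.dat p (%t x y. \<phi> t (vec2 (x, y))) ut ux uy $$ z))"
  by (rule nlw_solution_locale[OF sol assms]) blast
 interpret nlw p "%t x y. \<phi> t (vec2 (x, y))" ut ux uy utt utx uty uxx uxy uyy by (rule n)
 have e: "ph = \<phi>" by (auto simp: ph_def vec2_eta fun_eq_iff)
 obtain D where D: "0 <= D" "E02 p \<phi>0 \<phi>1 = EE D" using E by (cases "E02 p \<phi>0 \<phi>1") auto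
 \<comment> \<open>The scattering estimates divide by the size of the data or take it as strictly
   positive; enlarging the bound by 1 includes vanishing data.\<close>
 have D': "0 < D + 1" "(NN z. EE (dat $$ z)) <= EE (D + 1)"
  using D n(2) by (auto intro!: ennreal_leI)
 show "\<exists>f0 f1. scat_data p f0 f1 & (\<forall>s. s_crit p <= s & s <= 1 --> (scat_dist s \<phi> f0 f1 \<longlongrightarrow> 0) at_top)"
  using scattering[OF D'] pp unfolding e by blast
 show "\<exists>f0 f1. scat_data p f0 f1 & (\<forall>s. s_crit p <= s & s <= 1 --> (scat_dist s \<phi> f0 f1 \<longlongrightarrow> 0) at_bot)"
  using scattering_past[OF D'] pp unfolding e by blast
qed

end
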